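(* Let $E/\mathbb{Q}$ be an elliptic curve, let $K$ be an imaginary quadratic field, let $[\alpha:\beta]\in\mathbb{P}^1(\mathbb{Z}_3)$ be a slope, and put $L=L_{\alpha,\beta}$. Then $$E(L)[2^\infty]=E(L\cap K(E[2]))[2^\infty].$$ The intersection $L\cap K(E[2])$ equals $K$ unless one of the following holds: (i) $\mathbb{Q}(E[2])=\mathbb{Q}(\zeta_9)^+$ and $\beta\equiv 0\pmod 3$; the intersection is then $K_{\mathrm{cyc}}^{(1)}$. (ii) $K(E[2])=K_{\mathrm{anti}}^{(1)}$ and $\alpha\equiv0\pmod 3$; the intersection is then $K_{\mathrm{anti}}^{(1)}$. The displayed equality also holds with $L$ replaced by $\widetilde K_3$.
   Context: All fields lie in a fixed algebraic closure $\overline{\mathbb{Q}}$. $\widetilde K_3$ is the compositum of all $\mathbb{Z}_3$-extensions of the imaginary quadratic field $K$; $\mathrm{Gal}(\widetilde K_3/K)\simeq\mathbb{Z}_3^2$ is the direct sum of the rank-one $(+1)$- and $(-1)$-eigenspaces of complex conjugation, with fixed generators $\gamma_c$ and $\gamma_a$ (as $\mathbb{Z}_3$-modules) respectively. $K_{\mathrm{cyc}}$ is the cyclotomic $\mathbb{Z}_3$-extension of $K$ (fixed field of $\mathbb{Z}_3\gamma_a$), $K_{\mathrm{anti}}$ the anticyclotomic $\mathbb{Z}_3$-extension (fixed field of $\mathbb{Z}_3\gamma_c$), and $K_{\mathrm{cyc}}^{(1)},K_{\mathrm{anti}}^{(1)}$ their layers of degree $3$ over $K$. A slope $[\alpha:\beta]\in\mathbb{P}^1(\mathbb{Z}_3)$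 is represented by $\alpha,\beta\in\mathbb{Z}_3$, at least one a unit; it defines the surjection $\varphi_{\alpha,\beta}:\mathrm{Gal}(\widetilde K_3/K)\to\mathbb{Z}_3$, $\gamma_c\mapsto\alpha$, $\gamma_a\mapsto\beta$, and $L_{\alpha,\beta}$ is the fixed field of $\ker\varphi_{\alpha,\beta}$. $A[2^\infty]$ is the $2$-primary torsion subgroup. $\mathbb{Q}(\zeta_9)^+$ is the maximal real subfield of the field of $9$th roots of unity; $\mathbb{Q}(E[2])$, $K(E[2])$ are the $2$-division fields over $\mathbb{Q}$, $K$. *)

theory Defs
  imports
    "HOL-Analysis.Analysis"
    "HOL-Algebra.Algebra"
    "HOL-Computational_Algebra.Computational_Algebra"
begin

section \<open>Subfields of the algebraic closure of the rationals\<close>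

text \<open>All fields are subsets of the field of algebraic complex numbers, so that complex
  conjugation is the library function \<^const>\<open>cnj\<close>.\<close>

definition Qbar :: "complex ring" where
  "Qbar = \<lparr>carrier = {z. algebraic z}, mult = (*), one = 1, ring.zero = 0, add = (+)\<rparr>"

definition imaginary_quadratic :: "complex set \<Rightarrow> bool" where
  "imaginary_quadratic K \<longleftrightarrow>
     subfield K Qbar \<and> ring.dimension Qbar 2 \<rat> K \<and> \<not> K \<subseteq> \<real>"

definition Gal :: "complex set \<Rightarrow> complex set \<Rightarrow> (complex \<Rightarrow> complex) monoid" where
  "Gal L K = (BijGroup L)\<lparr>carrier :=
     {\<sigma> \<in> Bij L. \<sigma> \<in> ring_hom (Qbar\<lparr>carrier := L\<rparr>) (Qbar\<lparr>carrier := L\<rparr>) \<and> (\<forall>x\<in>K. \<sigma> x = x)}\<rparr>"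

text \<open>The Krull topology is the topology of pointwise convergence for the discrete topology
  on the field.\<close>

definition krull_topology :: "complex set \<Rightarrow> complex set \<Rightarrow> (complex \<Rightarrow> complex) topology" where
  "krull_topology L K =
     subtopology (product_topology (\<lambda>_. discrete_topology L) L) (carrier (Gal L K))"

definition fixed_field :: "complex set \<Rightarrow> (complex \<Rightarrow> complex) set \<Rightarrow> complex set" where
  "fixed_field L H = {x \<in> L. \<forall>\<sigma>\<in>H. \<sigma> x = x}"

text \<open>Every extension inside \<^const>\<open>Qbar\<close> is algebraic, so the fixed field condition says
  that the extension is normal and separable.\<close>

definition galois_extension :: "complex set \<Rightarrow> complex set \<Rightarrow> bool" where
  "galois_extension L K \<longleftrightarrow> subfield K Qbar \<and> subfield L Qbar \<and> K \<subseteq> L \<and>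
     fixed_field L (carrier (Gal L K)) = K"

text \<open>Meaningful when \<open>M\<close> has exactly one subfield of degree \<open>d\<close> over \<open>K\<close>, as in a
  \<open>\<int>\<^sub>p\<close>-extension for \<open>d\<close> a power of \<open>p\<close>.\<close>

definition layer :: "complex set \<Rightarrow> complex set \<Rightarrow> nat \<Rightarrow> complex set" where
  "layer K M d =
     (THE F. subfield F Qbar \<and> K \<subseteq> F \<and> F \<subseteq> M \<and> ring.dimension Qbar d K F)"


section \<open>The ring of p-adic integers\<close>

text \<open>The inverse limit of the rings of integers modulo \<open>p ^ n\<close>: the entry \<open>a n\<close> is the
  representative in \<open>{0..<p ^ n}\<close> of the residue class of \<open>a\<close>.\<close>

definition Zp :: "nat \<Rightarrow> (nat \<Rightarrow> int) ring" where
  "Zp p = \<lparr>carrier = {a. \<forall>n. a n \<in> {0..<int p ^ n} \<and> a (Suc n) mod int p ^ n = a n},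
     mult = (\<lambda>a b n. (a n * b n) mod int p ^ n),
     one = (\<lambda>n. 1 mod int p ^ n),
     ring.zero = (\<lambda>_. 0),
     add = (\<lambda>a b n. (a n + b n) mod int p ^ n)\<rparr>"

definition Zp_topology :: "nat \<Rightarrow> (nat \<Rightarrow> int) topology" where
  "Zp_topology p =
     subtopology (product_topology (\<lambda>_. discrete_topology UNIV) UNIV) (carrier (Zp p))"


section \<open>Z_p-extensions\<close>

definition Zp_extension :: "nat \<Rightarrow> complex set \<Rightarrow> complex set \<Rightarrow> bool" where
  "Zp_extension p K M \<longleftrightarrow> galois_extension M K \<and>
     (\<exists>\<phi>. \<phi> \<in> iso (Gal M K) (add_monoid (Zp p)) \<and>
          homeomorphic_map (krull_topology M K) (Zp_topology p) \<phi>)"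

definition Ktilde :: "nat \<Rightarrow> complex set \<Rightarrow> complex set" where
  "Ktilde p K = generate_field Qbar (K \<union> \<Union> {M. Zp_extension p K M})"

text \<open>The \<open>\<int>\<^sub>p\<close>-submodule generated by \<open>\<gamma>\<close>: its elements are the powers of \<open>\<gamma>\<close> with exponent
  \<open>a\<close> in \<open>\<int>\<^sub>p\<close>, that is, the limits of the powers with exponent \<open>a n\<close>.\<close>

definition Zp_span ::
  "nat \<Rightarrow> complex set \<Rightarrow> complex set \<Rightarrow> (complex \<Rightarrow> complex) \<Rightarrow> (complex \<Rightarrow> complex) set" where
  "Zp_span p L K \<gamma> = {\<sigma>. \<exists>a \<in> carrier (Zp p).
     limitin (krull_topology L K) (\<lambda>n. \<gamma> [^]\<^bsub>Gal L K\<^esub> nat (a n)) \<sigma> sequentially}"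

definition conj_act :: "complex set \<Rightarrow> (complex \<Rightarrow> complex) \<Rightarrow> complex \<Rightarrow> complex" where
  "conj_act L \<sigma> = (\<lambda>x\<in>L. cnj (\<sigma> (cnj x)))"

definition plus_eigenspace :: "complex set \<Rightarrow> complex set \<Rightarrow> (complex \<Rightarrow> complex) set" where
  "plus_eigenspace L K = {\<sigma> \<in> carrier (Gal L K). conj_act L \<sigma> = \<sigma>}"

definition minus_eigenspace :: "complex set \<Rightarrow> complex set \<Rightarrow> (complex \<Rightarrow> complex) set" where
  "minus_eigenspace L K = {\<sigma> \<in> carrier (Gal L K). conj_act L \<sigma> = inv\<^bsub>Gal L K\<^esub> \<sigma>}"

text \<open>That the two eigenspaces are free of rank one is not part of this predicate: it follows from
  class field theory.\<close>

definition eigen_generators ::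
  "nat \<Rightarrow> complex set \<Rightarrow> (complex \<Rightarrow> complex) \<Rightarrow> (complex \<Rightarrow> complex) \<Rightarrow> bool" where
  "eigen_generators p K \<gamma>c \<gamma>a \<longleftrightarrow>
     \<gamma>c \<in> plus_eigenspace (Ktilde p K) K \<and>
     \<gamma>a \<in> minus_eigenspace (Ktilde p K) K \<and>
     Zp_span p (Ktilde p K) K \<gamma>c = plus_eigenspace (Ktilde p K) K \<and>
     Zp_span p (Ktilde p K) K \<gamma>a = minus_eigenspace (Ktilde p K) K"

text \<open>The cyclotomic and the anticyclotomic extension are the fixed fields of the minus and of the
  plus part, respectively.\<close>

definition Kcyc :: "nat \<Rightarrow> complex set \<Rightarrow> (complex \<Rightarrow> complex) \<Rightarrow> complex set" where
  "Kcyc p K \<gamma>a = fixed_field (Ktilde p K) (Zp_span p (Ktilde p K) K \<gamma>a)"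

definition Kanti :: "nat \<Rightarrow> complex set \<Rightarrow> (complex \<Rightarrow> complex) \<Rightarrow> complex set" where
  "Kanti p K \<gamma>c = fixed_field (Ktilde p K) (Zp_span p (Ktilde p K) K \<gamma>c)"

definition slope :: "nat \<Rightarrow> (nat \<Rightarrow> int) \<Rightarrow> (nat \<Rightarrow> int) \<Rightarrow> bool" where
  "slope p \<alpha> \<beta> \<longleftrightarrow> \<alpha> \<in> carrier (Zp p) \<and> \<beta> \<in> carrier (Zp p) \<and>
     (\<alpha> \<in> Units (Zp p) \<or> \<beta> \<in> Units (Zp p))"

text \<open>A homomorphism into \<open>\<int>\<^sub>p\<close> is \<open>\<int>\<^sub>p\<close>-linear if and only if it is continuous, so this
  determines \<open>\<phi>\<close> on the Galois group from its values on the two generators.\<close>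

definition slope_hom ::
  "nat \<Rightarrow> complex set \<Rightarrow> (complex \<Rightarrow> complex) \<Rightarrow> (complex \<Rightarrow> complex) \<Rightarrow>
   (nat \<Rightarrow> int) \<Rightarrow> (nat \<Rightarrow> int) \<Rightarrow> ((complex \<Rightarrow> complex) \<Rightarrow> nat \<Rightarrow> int) \<Rightarrow> bool" where
  "slope_hom p K \<gamma>c \<gamma>a \<alpha> \<beta> \<phi> \<longleftrightarrow>
     \<phi> \<in> hom (Gal (Ktilde p K) K) (add_monoid (Zp p)) \<and>
     continuous_map (krull_topology (Ktilde p K) K) (Zp_topology p) \<phi> \<and>
     \<phi> \<gamma>c = \<alpha> \<and> \<phi> \<gamma>a = \<beta>"

definition slope_field ::
  "nat \<Rightarrow> complex set \<Rightarrow> ((complex \<Rightarrow> complex) \<Rightarrow> nat \<Rightarrow> int) \<Rightarrow> complex set" where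
  "slope_field p K \<phi> = fixed_field (Ktilde p K)
     (kernel (Gal (Ktilde p K) K) (add_monoid (Zp p)) \<phi>)"


section \<open>Elliptic curves over the rationals\<close>

text \<open>The equation \<open>y\<^sup>2 + a1 x y + a3 y = x\<^sup>3 + a2 x\<^sup>2 + a4 x + a6\<close>, with \<open>ai\<close> stored in
  the field \<open>wai\<close>.\<close>

record weierstrass =
  wa1 :: rat
  wa2 :: rat
  wa3 :: rat
  wa4 :: rat
  wa6 :: rat

definition discriminant :: "weierstrass \<Rightarrow> rat" where
  "discriminant E =
     (let b2 = (wa1 E)^2 + 4 * wa2 E;
          b4 = 2 * wa4 E + wa1 E * wa3 E;
          b6 = (wa3 E)^2 + 4 * wa6 E;
          b8 = (wa1 E)^2 * wa6 E + 4 * wa2 E * wa6 E - wa1 E * wa3 E * wa4 E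
               + wa2 E * (wa3 E)^2 - (wa4 E)^2
      in - (b2^2 * b8) - 8 * b4^3 - 27 * b6^2 + 9 * b2 * b4 * b6)"

definition elliptic_curve :: "weierstrass \<Rightarrow> bool" where
  "elliptic_curve E \<longleftrightarrow> discriminant E \<noteq> 0"

datatype point = Point_at_infinity | Affine complex complex

fun on_curve :: "weierstrass \<Rightarrow> point \<Rightarrow> bool" where
  "on_curve E Point_at_infinity = True"
| "on_curve E (Affine x y) =
     (y^2 + of_rat (wa1 E) * x * y + of_rat (wa3 E) * y =
      x^3 + of_rat (wa2 E) * x^2 + of_rat (wa4 E) * x + of_rat (wa6 E))"

fun coords :: "point \<Rightarrow> complex set" where
  "coords Point_at_infinity = {}"
| "coords (Affine x y) = {x, y}"

text \<open>Chord and tangent addition. The first case for affine points is that of a pair of inverse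
  points, where \<open>-(x, y) = (x, -y - a1 x - a3)\<close>; \<open>l\<close> is the slope of the chord or tangent.\<close>

fun point_add :: "weierstrass \<Rightarrow> point \<Rightarrow> point \<Rightarrow> point" where
  "point_add E Point_at_infinity Q = Q"
| "point_add E P Point_at_infinity = P"
| "point_add E (Affine x1 y1) (Affine x2 y2) =
     (if x1 = x2 \<and> y1 + y2 + of_rat (wa1 E) * x2 + of_rat (wa3 E) = 0 then Point_at_infinity
      else
        let l = (if x1 = x2
                 then (3 * x1^2 + 2 * of_rat (wa2 E) * x1 + of_rat (wa4 E) - of_rat (wa1 E) * y1)
                      / (2 * y1 + of_rat (wa1 E) * x1 + of_rat (wa3 E))
                 else (y2 - y1) / (x2 - x1));
            x3 = l^2 + of_rat (wa1 E) * l - of_rat (wa2 E) - x1 - x2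
        in Affine x3 (- (y1 + l * (x3 - x1)) - of_rat (wa1 E) * x3 - of_rat (wa3 E)))"

text \<open>The group \<open>E(F)\<close>, written multiplicatively as a record of the library: the multiple \<open>n P\<close>
  is the power \<open>P [^] n\<close>.\<close>

definition points :: "weierstrass \<Rightarrow> complex set \<Rightarrow> point monoid" where
  "points E F = \<lparr>carrier = {P. on_curve E P \<and> coords P \<subseteq> F},
     mult = point_add E, one = Point_at_infinity\<rparr>"

definition two_primary_torsion :: "weierstrass \<Rightarrow> complex set \<Rightarrow> point set" where
  "two_primary_torsion E F =
     {P \<in> carrier (points E F). \<exists>n::nat. P [^]\<^bsub>points E F\<^esub> ((2::nat) ^ n) = \<one>\<^bsub>points E F\<^esub>}"

definition two_torsion :: "weierstrass \<Rightarrow> point set" where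
  "two_torsion E = {P \<in> carrier (points E (carrier Qbar)).
     P [^]\<^bsub>points E (carrier Qbar)\<^esub> (2::nat) = \<one>\<^bsub>points E (carrier Qbar)\<^esub>}"

definition two_division_field :: "weierstrass \<Rightarrow> complex set \<Rightarrow> complex set" where
  "two_division_field E F = generate_field Qbar (F \<union> (\<Union>P\<in>two_torsion E. coords P))"

text \<open>The maximal real subfield of the field of \<open>n\<close>-th roots of unity.\<close>

definition cyclotomic_field_real :: "nat \<Rightarrow> complex set" where
  "cyclotomic_field_real n = generate_field Qbar (\<rat> \<union> {z. z ^ n = 1}) \<inter> \<real>"

end

theory Submission
  imports Defs "HOL-Algebra.Algebraic_Closure_Type"
begin

text \<open>A point of 2-power order is reached from the roots of the 2-division polynomial by successive
  halvings, each of which only adjoins square roots. Automorphisms act on \<open>Ktilde 3 K\<close> with orders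
  powers of 3, so an element of \<open>Ktilde 3 K\<close> that lies in a tower of quadratic extensions of
  \<open>K(E[2])\<close> lies in \<open>K(E[2])\<close> already. This gives the equalities of torsion groups.

  If \<open>L \<inter> K(E[2])\<close> is larger than \<open>K\<close>, then, as \<open>Ktilde 3 K\<close> is abelian over \<open>K\<close>, the group of
  \<open>K(E[2])\<close> is cyclic of order 3 and \<open>K(E[2]) \<subseteq> L\<close>. Complex conjugation permutes the three roots and
  normalises this group, so one of the two generators acts trivially and \<open>K(E[2])\<close> is the first layer
  of the cyclotomic or of the anticyclotomic extension. In the cyclotomic case the
  roots are real, and intersecting with \<open>\<real>\<close> descends \<open>K(E[2])\<close> to \<open>\<rat>(E[2])\<close>. Whether \<open>L\<close> contains a given
  first layer is read off from the slope modulo 3.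

  That the cyclotomic layer is generated by \<open>\<zeta>\<^sub>9 + \<zeta>\<^sub>9\<^sup>-\<^sup>1\<close> needs the cyclotomic
  extension inside \<open>Ktilde 3 K\<close>: it is the union of the fields \<open>K(\<zeta> + \<zeta>\<^sup>-\<^sup>1)\<close> for roots of unity
  \<open>\<zeta>\<close> of 3-power order.\<close>

text \<open>The Galois groups are infinite, so topological hypotheses are turned into statements
  about finitely many field elements: on a finite subset of \<open>T\<close> every automorphism
  agrees with a word, a power of \<open>\<gamma>a\<close> followed by a power of
  \<open>\<gamma>c\<close>. A word whose exponents satisfy the slope relation only modulo 3 need not
  lie in the kernel of \<open>\<phi>\<close>. It is corrected to a kernel element by a 3-adic
  exponent on the generator whose slope entry is a unit, and the correction is invisible on a cubic
  layer.

  Multiples of a point are left-nested sums, so halving a point of 2-power order needs the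
  associative law of the curve, which is proved from the chord and tangent formulas.

  The two cubic layers are reached differently. The cyclotomic one contains the explicit number
  \<open>xi 1 1\<close>, a zero of X^3 - 3 X + 1. For the anticyclotomic one, when 3 divides
  \<alpha>, a moved element is extracted from the open subgroup on which \<open>\<phi>\<close>
  vanishes modulo 3. As \<open>layer\<close> is a definite description, uniqueness of the cubic
  subfield has to be shown in both cases.\<close>

hide_const (open) up_ring.coeff up_ring.monom module.smult

section \<open>Algebraic numbers and subfields\<close>

abbreviation Qb :: "complex set" where "Qb \<equiv> {z. algebraic z}"

lemma ring_of_type_algebra_sel [simp]:
  "carrier ring_of_type_algebra = UNIV" "x \<otimes>\<^bsub>ring_of_type_algebra\<^esub> y = x * y"
  "\<one>\<^bsub>ring_of_type_algebra\<^esub> = 1" "\<zero>\<^bsub>ring_of_type_algebra\<^esub> = 0"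
  "x \<oplus>\<^bsub>ring_of_type_algebra\<^esub> y = x + y"
  by (simp_all add: ring_of_type_algebra_def)

text \<open>HOL-Algebra lists coefficients from the leading one down, \<open>Poly\<close> from the
  constant one up; hence the reversal.\<close>

lemma eval_ring_of_type_algebra:
  "ring.eval (ring_of_type_algebra :: complex ring) p x = poly (Poly (rev p)) x"
proof -
  interpret R: field "ring_of_type_algebra :: complex ring" by (rule field_from_type_algebra)
  have pow: "x [^]\<^bsub>(ring_of_type_algebra :: complex ring)\<^esub> (n::nat) = x ^ n" for n
    by (induction n) auto
  show ?thesis
    by (induction p) (simp_all add: pow Poly_append poly_monom)
qed

lemma subring_Rats: "subring \<rat> (ring_of_type_algebra :: complex ring)"
proof -
  interpret R: field "ring_of_type_algebra :: complex ring" by (rule field_from_type_algebra)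
  have "\<ominus>\<^bsub>ring_of_type_algebra\<^esub> x = - x" for x :: complex
    by (rule R.minus_equality) auto
  then show ?thesis by (intro R.subringI) auto
qed

lemma subfield_Rats: "subfield \<rat> (ring_of_type_algebra :: complex ring)"
proof -
  interpret R: field "ring_of_type_algebra :: complex ring" by (rule field_from_type_algebra)
  have "inv\<^bsub>ring_of_type_algebra\<^esub> x = inverse x" if "x \<noteq> 0" for x :: complex
    using that by (intro R.comm_inv_char) auto
  then show ?thesis by (intro R.subfieldI' subring_Rats) auto
qed

text \<open>Through this equivalence the closure of algebraic numbers under sums and products is
  taken over from HOL-Algebra.\<close>

lemma algebraic_over_Rats_iff:
  "(ring.algebraic (ring_of_type_algebra :: complex ring) over \<rat>) x \<longleftrightarrow> algebraic x"
proof -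
  let ?R = "ring_of_type_algebra :: complex ring"
  interpret R: field ?R by (rule field_from_type_algebra)
  show ?thesis
  proof
    assume "(R.algebraic over \<rat>) x"
    then obtain p where p: "p \<in> carrier (univ_poly ?R \<rat>)" "p \<noteq> []" "R.eval p x = 0"
      using R.algebraicE[OF subring_Rats, of x] by auto
    then have q: "set p \<subseteq> \<rat>" "hd p \<noteq> 0"
      unfolding univ_poly_def polynomial_def by auto
    have "Poly (rev p) \<noteq> 0"
    proof
      assume "Poly (rev p) = 0"
      then obtain n where "rev p = replicate n 0" by (auto simp: Poly_eq_0)
      then have "p = replicate n 0" by (metis rev_replicate rev_rev_ident)
      with p(2) q(2) show False by (cases n) auto
    qed
    moreover have "coeff (Poly (rev p)) i \<in> \<rat>" for i
      using q(1) nth_mem[of i "rev p"] by (auto simp: nth_default_def)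
    moreover have "poly (Poly (rev p)) x = 0"
      using p(3) by (simp add: eval_ring_of_type_algebra)
    ultimately show "algebraic x" by (rule_tac algebraicI') auto
  next
    assume "algebraic x"
    then obtain p where p: "\<And>i. coeff p i \<in> \<rat>" "p \<noteq> 0" "poly p x = 0"
      unfolding algebraic_altdef by blast
    have "rev (coeffs p) \<in> carrier (univ_poly ?R \<rat>)"
      using p(1,2) unfolding univ_poly_def polynomial_def
      by (auto simp: hd_rev last_coeffs_eq_coeff_degree coeffs_def)
    moreover have "rev (coeffs p) \<noteq> []" using p(2) by simp
    ultimately show "(R.algebraic over \<rat>) x"
      by (rule R.algebraicI) (use p in \<open>auto simp: eval_ring_of_type_algebra\<close>)
  qed
qed

lemma
  assumes "algebraic (x::complex)" "algebraic y"
  shows algebraic_add: "algebraic (x + y)" and algebraic_mult: "algebraic (x * y)"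
proof -
  let ?R = "ring_of_type_algebra :: complex ring"
  interpret R: field ?R by (rule field_from_type_algebra)
  have "subfield {x. algebraic x} ?R"
    using R.subfield_of_algebraics[OF subfield_Rats] by (simp add: algebraic_over_Rats_iff)
  from subringE(6,7)[OF subfieldE(1)[OF this]] assms
  show "algebraic (x + y)" "algebraic (x * y)" by auto
qed

lemma algebraic_Rats_poly:
  assumes "algebraic (x::complex)"
  obtains p where "p \<noteq> 0" "poly p x = 0" "\<And>i. coeff p i \<in> \<rat>"
  using assms unfolding algebraic_altdef by blast

lemma algebraic_power: "algebraic (x::complex) \<Longrightarrow> algebraic (x ^ n)"
  by (induction n) (auto intro: algebraic_mult)

lemma algebraic_root:
  assumes "algebraic ((x::complex) ^ n)" "n > 0" shows "algebraic x"
proof -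
  obtain p where p: "p \<noteq> 0" "poly p (x ^ n) = 0" "\<And>i. coeff p i \<in> \<rat>"
    using algebraic_Rats_poly[OF assms(1)] by blast
  have "pcompose p (monom 1 n) \<noteq> 0"
    using p(1) assms(2) by (auto simp: pcompose_eq_0_iff degree_monom_eq)
  moreover have "coeff (pcompose p (monom 1 n)) i \<in> \<rat>" for i
    using p(3) by (intro coeff_pcompose_semiring_closed) auto
  ultimately show ?thesis
    using p(2) by (intro algebraicI'[of "pcompose p (monom 1 n)"]) (auto simp: poly_pcompose poly_monom)
qed

text \<open>Negation and inversion are absent: negation is multiplication by -1, and the inverse of
  a nonzero algebraic number is a polynomial in it over \<rat>. Recognising a subfield thus reduces
  to sums and products.\<close>

definition alg_subfield :: "complex set \<Rightarrow> bool" where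
  "alg_subfield F \<longleftrightarrow> \<rat> \<subseteq> F \<and> F \<subseteq> Qb \<and> (\<forall>x\<in>F. \<forall>y\<in>F. x + y \<in> F \<and> x * y \<in> F)"

lemma
  assumes "alg_subfield F"
  shows alg_subfield_rat: "\<And>x. x \<in> \<rat> \<Longrightarrow> x \<in> F"
    and alg_subfield_algebraic: "\<And>x. x \<in> F \<Longrightarrow> algebraic x"
    and alg_subfield_add: "\<And>x y. x \<in> F \<Longrightarrow> y \<in> F \<Longrightarrow> x + y \<in> F"
    and alg_subfield_mult: "\<And>x y. x \<in> F \<Longrightarrow> y \<in> F \<Longrightarrow> x * y \<in> F"
  using assms unfolding alg_subfield_def by auto

lemma alg_subfield_numerals:
  assumes "alg_subfield F"
  shows "0 \<in> F" "1 \<in> F" "numeral n \<in> F" "of_nat k \<in> F" "of_int i \<in> F" "of_rat q \<in> F"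
  by (auto intro!: alg_subfield_rat[OF assms])

lemma alg_subfield_uminus: "alg_subfield F \<Longrightarrow> x \<in> F \<Longrightarrow> - x \<in> F"
  using alg_subfield_mult[of F "-1" x] alg_subfield_rat[of F "-1"] by simp

lemma alg_subfield_diff: "alg_subfield F \<Longrightarrow> x \<in> F \<Longrightarrow> y \<in> F \<Longrightarrow> x - y \<in> F"
  using alg_subfield_add[of F x "-y"] alg_subfield_uminus[of F y] by simp

lemma alg_subfield_power: "alg_subfield F \<Longrightarrow> x \<in> F \<Longrightarrow> x ^ n \<in> F"
  by (induction n) (auto intro: alg_subfield_add alg_subfield_mult alg_subfield_numerals)

lemma alg_subfield_sum:
  "alg_subfield F \<Longrightarrow> (\<And>i. i \<in> I \<Longrightarrow> f i \<in> F) \<Longrightarrow> sum f I \<in> F"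
  by (induction I rule: infinite_finite_induct) (auto intro: alg_subfield_add alg_subfield_mult alg_subfield_numerals)

lemma alg_subfield_prod:
  "alg_subfield F \<Longrightarrow> (\<And>i. i \<in> I \<Longrightarrow> f i \<in> F) \<Longrightarrow> prod f I \<in> F"
  by (induction I rule: infinite_finite_induct) (auto intro: alg_subfield_add alg_subfield_mult alg_subfield_numerals)

section \<open>Polynomials with coefficients in a subfield\<close>

definition polys_over :: "complex set \<Rightarrow> complex poly set" where
  "polys_over F = {p. \<forall>i. coeff p i \<in> F}"

lemma polys_overD: "p \<in> polys_over F \<Longrightarrow> coeff p i \<in> F"
  by (simp add: polys_over_def)

lemma polys_over_mono: "F \<subseteq> F' \<Longrightarrow> polys_over F \<subseteq> polys_over F'"
  by (auto simp: polys_over_def)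

lemma polys_over_pCons: 
  assumes "0 \<in> F" shows "pCons a p \<in> polys_over F \<longleftrightarrow> a \<in> F \<and> p \<in> polys_over F"
  unfolding polys_over_def mem_Collect_eq by (metis coeff_pCons_0 coeff_pCons_Suc not0_implies_Suc)

lemma polys_over_0: "0 \<in> F \<Longrightarrow> 0 \<in> polys_over F"
  by (simp add: polys_over_def)

lemma polys_over_add: "alg_subfield F \<Longrightarrow> p \<in> polys_over F \<Longrightarrow> q \<in> polys_over F \<Longrightarrow> p + q \<in> polys_over F"
  by (auto simp: polys_over_def intro: alg_subfield_add alg_subfield_mult)

lemma polys_over_diff: "alg_subfield F \<Longrightarrow> p \<in> polys_over F \<Longrightarrow> q \<in> polys_over F \<Longrightarrow> p - q \<in> polys_over F"
  by (auto simp: polys_over_def intro: alg_subfield_diff)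

lemma polys_over_smult: "alg_subfield F \<Longrightarrow> c \<in> F \<Longrightarrow> q \<in> polys_over F \<Longrightarrow> smult c q \<in> polys_over F"
  by (auto simp: polys_over_def intro: alg_subfield_add alg_subfield_mult)

lemma polys_over_mult: "alg_subfield F \<Longrightarrow> p \<in> polys_over F \<Longrightarrow> q \<in> polys_over F \<Longrightarrow> p * q \<in> polys_over F"
  by (auto simp: polys_over_def coeff_mult intro!: alg_subfield_sum alg_subfield_add alg_subfield_mult)

lemma polys_over_monom: "alg_subfield F \<Longrightarrow> c \<in> F \<Longrightarrow> monom c n \<in> polys_over F"
  by (auto simp: polys_over_def coeff_monom alg_subfield_numerals)

lemma polys_over_pderiv: "alg_subfield F \<Longrightarrow> p \<in> polys_over F \<Longrightarrow> pderiv p \<in> polys_over F"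
  unfolding polys_over_def mem_Collect_eq coeff_pderiv
  using alg_subfield_numerals(4) alg_subfield_mult by blast

lemma polys_over_poly:
  "alg_subfield F \<Longrightarrow> p \<in> polys_over F \<Longrightarrow> x \<in> F \<Longrightarrow> poly p x \<in> F"
  by (auto simp: poly_altdef intro!: alg_subfield_sum alg_subfield_mult alg_subfield_power dest: polys_overD)

text \<open>The minimal equation \<open>c\<^sub>0 + c\<^sub>1 a + \<dots> = 0\<close> of \<open>a \<noteq> 0\<close> has \<open>c\<^sub>0 \<noteq> 0\<close>, and
  dividing by \<open>c\<^sub>0 a\<close> expresses the inverse as a polynomial in \<open>a\<close>.\<close>

lemma alg_subfield_inverse:
  assumes F: "alg_subfield F" and "x \<in> F" shows "inverse x \<in> F"
proof (cases "x = 0")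
  case False
  obtain p where "p \<noteq> 0" "coeff p 0 \<noteq> 0" "poly (map_poly of_int p) x = 0"
    using algebraicE'_nonzero[OF alg_subfield_algebraic[OF F assms(2)] False] by blast
  then obtain q :: "complex poly" where q: "coeff q 0 \<noteq> 0" "poly q x = 0" "q \<in> polys_over \<rat>"
    by (intro that[of "map_poly of_int p"]) (auto simp: coeff_map_poly polys_over_def)
  obtain a r where r: "q = pCons a r" by (cases q) auto
  have ar: "a \<in> \<rat>" "r \<in> polys_over \<rat>" "a \<noteq> 0" using q by (auto simp: r polys_over_pCons)
  have e: "x * (- poly r x / a) = 1"
    using q(2) ar(3) by (simp add: r field_simps add_eq_0_iff)
  then have "inverse x = - poly r x * inverse a" by (metis inverse_unique divide_inverse)
  moreover have "poly r x \<in> F"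
    using F ar(2) assms(2) polys_over_mono[of \<rat> F] by (intro polys_over_poly) (auto simp: alg_subfield_def)
  moreover have "inverse a \<in> F" using ar(1) by (auto intro!: alg_subfield_rat[OF F])
  ultimately show ?thesis
    using F by (auto intro!: alg_subfield_mult alg_subfield_uminus)
qed (use assms in auto)

lemma alg_subfield_divide: "alg_subfield F \<Longrightarrow> x \<in> F \<Longrightarrow> y \<in> F \<Longrightarrow> x / y \<in> F"
  unfolding divide_inverse by (intro alg_subfield_mult alg_subfield_inverse)

lemmas alg_subfield_closed = alg_subfield_add alg_subfield_mult alg_subfield_numerals alg_subfield_uminus
  alg_subfield_diff alg_subfield_power alg_subfield_inverse alg_subfield_divide

lemma alg_subfield_Qb: "alg_subfield Qb"
  by (auto simp: alg_subfield_def intro: rat_imp_algebraic algebraic_add algebraic_mult)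

lemma alg_subfield_Rats: "alg_subfield \<rat>"
  by (auto simp: alg_subfield_def intro: rat_imp_algebraic)

lemma Qbar_sel [simp]: "carrier Qbar = Qb" "x \<otimes>\<^bsub>Qbar\<^esub> y = x * y" "\<one>\<^bsub>Qbar\<^esub> = 1"
  "\<zero>\<^bsub>Qbar\<^esub> = 0" "x \<oplus>\<^bsub>Qbar\<^esub> y = x + y"
  by (simp_all add: Qbar_def)

lemma cring_Qbar: "cring Qbar"
proof (intro cringI abelian_groupI comm_monoidI)
  fix x assume "x \<in> carrier Qbar"
  then show "\<exists>y\<in>carrier Qbar. y \<oplus>\<^bsub>Qbar\<^esub> x = \<zero>\<^bsub>Qbar\<^esub>" by (intro bexI[of _ "-x"]) auto
qed (auto simp: algebra_simps algebraic_add algebraic_mult)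

lemma field_Qbar: "field Qbar"
proof (rule cring.cring_fieldI2[OF cring_Qbar])
  fix a assume "a \<in> carrier Qbar" "a \<noteq> \<zero>\<^bsub>Qbar\<^esub>"
  then show "\<exists>b\<in>carrier Qbar. a \<otimes>\<^bsub>Qbar\<^esub> b = \<one>\<^bsub>Qbar\<^esub>"
    by (intro bexI[of _ "inverse a"]) auto
qed auto

lemma ring_Qbar: "ring Qbar"
  using cring_Qbar by (rule cring.axioms)

lemma Qbar_a_inv: "x \<in> Qb \<Longrightarrow> \<ominus>\<^bsub>Qbar\<^esub> x = - x"
  by (rule abelian_group.minus_equality[OF ring.is_abelian_group[OF ring_Qbar]]) auto

lemma Qbar_m_inv: "x \<in> Qb \<Longrightarrow> x \<noteq> 0 \<Longrightarrow> inv\<^bsub>Qbar\<^esub> x = inverse x"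
  by (rule comm_monoid.comm_inv_char[OF cring.axioms(2)[OF cring_Qbar]]) auto

lemma subfield_Qbar_iff: "subfield F Qbar \<longleftrightarrow> alg_subfield F"
proof
  assume F: "alg_subfield F"
  show "subfield F Qbar"
    using alg_subfield_closed[OF F] alg_subfield_algebraic[OF F]
    by (intro field.subfieldI'[OF field_Qbar] ring.subringI[OF ring_Qbar]) (auto simp: Qbar_a_inv Qbar_m_inv)
next
  assume F: "subfield F Qbar"
  note s = subringE[OF subfieldE(1)[OF F]]
  have alg: "F \<subseteq> Qb" using s(1) by simp
  have one: "1 \<in> F" and zero: "0 \<in> F" using s(2,3) by auto
  have um: "- x \<in> F" if "x \<in> F" for x using s(5)[OF that] that alg by (auto simp: Qbar_a_inv)
  have ad: "x + y \<in> F" and mu: "x * y \<in> F" if "x \<in> F" "y \<in> F" for x y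
    using s(6,7)[OF that] by auto
  have iv: "inverse x \<in> F" if "x \<in> F" "x \<noteq> 0" for x
    using ring.subfield_m_inv(1)[OF ring_Qbar F, of x] that alg by (auto simp: Qbar_m_inv)
  have nat: "of_nat n \<in> F" for n by (induction n) (auto intro: zero one ad)
  have int: "of_int i \<in> F" for i by (cases i rule: int_cases2) (use nat um in auto)
  have "x \<in> F" if "x \<in> \<rat>" for x
  proof -
    obtain a b :: int where "b > 0" "x = of_int a / of_int b" using Rats_cases'[OF \<open>x \<in> \<rat>\<close>] by metis
    then show ?thesis unfolding divide_inverse using int iv mu by auto
  qed
  then show "alg_subfield F" using alg ad mu unfolding alg_subfield_def by auto
qed

lemma generate_field_Qbar:
  assumes "H \<subseteq> Qb"
  shows alg_subfield_generate: "alg_subfield (generate_field Qbar H)"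
    and generate_superset: "H \<subseteq> generate_field Qbar H"
    and generate_least: "alg_subfield F \<Longrightarrow> H \<subseteq> F \<Longrightarrow> generate_field Qbar H \<subseteq> F"
  using field.generate_field_is_subfield[OF field_Qbar, of H]
    field.generate_field_min_subfield1[OF field_Qbar, of H] assms
  by (auto simp: subfield_Qbar_iff intro: generate_field.incl)

hide_const (open) Polynomials.lead_coeff Polynomials.degree

section \<open>Extension of field homomorphisms\<close>

text \<open>Values outside \<open>F\<close> are left free and no target is named, so the same
  function also serves on every smaller field.\<close>

definition alg_hom :: "complex set \<Rightarrow> complex set \<Rightarrow> (complex \<Rightarrow> complex) \<Rightarrow> bool" where
  "alg_hom K F \<sigma> \<longleftrightarrow> (\<forall>x\<in>F. \<forall>y\<in>F. \<sigma> (x + y) = \<sigma> x + \<sigma> y \<and> \<sigma> (x * y) = \<sigma> x * \<sigma> y) \<and>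
     (\<forall>x\<in>K. \<sigma> x = x)"

lemma
  assumes "alg_hom K F \<sigma>"
  shows alg_hom_add: "x \<in> F \<Longrightarrow> y \<in> F \<Longrightarrow> \<sigma> (x + y) = \<sigma> x + \<sigma> y"
    and alg_hom_mult: "x \<in> F \<Longrightarrow> y \<in> F \<Longrightarrow> \<sigma> (x * y) = \<sigma> x * \<sigma> y"
    and alg_hom_fix: "x \<in> K \<Longrightarrow> \<sigma> x = x"
  using assms by (auto simp: alg_hom_def)

lemma alg_hom_mono: "alg_hom K F \<sigma> \<Longrightarrow> K' \<subseteq> K \<Longrightarrow> F' \<subseteq> F \<Longrightarrow> alg_hom K' F' \<sigma>"
  unfolding alg_hom_def by blast

locale alg_homo =
  fixes K F \<sigma>
  assumes K: "alg_subfield K" and F: "alg_subfield F" and K_sub: "K \<subseteq> F" and hom: "alg_hom K F \<sigma>"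
begin

lemmas add = alg_hom_add[OF hom] and mult = alg_hom_mult[OF hom] and fix_K = alg_hom_fix[OF hom]

lemma numerals: "\<sigma> 0 = 0" "\<sigma> 1 = 1" "\<sigma> (-1) = -1"
  using alg_subfield_closed[OF K] by (auto intro!: fix_K)

lemma uminus: "x \<in> F \<Longrightarrow> \<sigma> (- x) = - \<sigma> x"
  using mult[of "-1" x] alg_subfield_rat[OF F, of "-1"] numerals by simp

lemma diff: "x \<in> F \<Longrightarrow> y \<in> F \<Longrightarrow> \<sigma> (x - y) = \<sigma> x - \<sigma> y"
  using add[of x "-y"] uminus[of y] alg_subfield_uminus[OF F, of y] by simp

lemma power: "x \<in> F \<Longrightarrow> \<sigma> (x ^ n) = \<sigma> x ^ n"
  by (induction n) (auto simp: numerals mult alg_subfield_power[OF F])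

lemma eq_0_iff: "x \<in> F \<Longrightarrow> \<sigma> x = 0 \<longleftrightarrow> x = 0"
  using mult[of x "inverse x"] alg_subfield_inverse[OF F, of x] numerals by (cases "x = 0") auto

lemma inj: "inj_on \<sigma> F"
  using diff eq_0_iff alg_subfield_diff[OF F] by (intro inj_onI) (metis eq_iff_diff_eq_0)

lemma poly_map: "p \<in> polys_over F \<Longrightarrow> x \<in> F \<Longrightarrow> \<sigma> (poly p x) = poly (map_poly \<sigma> p) (\<sigma> x)"
proof (induction p)
  case (pCons a p)
  then show ?case
    by (simp add: map_poly_pCons numerals add mult polys_over_pCons alg_subfield_numerals[OF F]
          polys_over_poly[OF F] alg_subfield_mult[OF F])
qed (simp add: numerals)

lemma map_poly_fixed: "p \<in> polys_over K \<Longrightarrow> map_poly \<sigma> p = p"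
  by (intro poly_eqI) (auto simp: coeff_map_poly numerals fix_K polys_overD)

lemma poly: "p \<in> polys_over K \<Longrightarrow> x \<in> F \<Longrightarrow> \<sigma> (poly p x) = poly p (\<sigma> x)"
  using poly_map[of p x] map_poly_fixed[of p] polys_over_mono[OF K_sub] by auto

lemma algebraic: "x \<in> F \<Longrightarrow> algebraic (\<sigma> x)"
proof -
  assume x: "x \<in> F"
  obtain p where p: "p \<noteq> 0" "poly p x = 0" "\<And>i. coeff p i \<in> \<rat>"
    using algebraic_Rats_poly[OF alg_subfield_algebraic[OF F x]] by blast
  have "p \<in> polys_over K" using p(3) K by (auto simp: polys_over_def alg_subfield_rat)
  from poly[OF this x] p show ?thesis by (auto intro!: algebraicI' simp: numerals)
qed

end

text \<open>A homomorphism on a subfield is stored as its graph, so that extension is inclusion and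
  Zorn's lemma applies to unions of chains.\<close>

definition hom_graph :: "(complex \<times> complex) set \<Rightarrow> bool" where
  "hom_graph R \<longleftrightarrow> (\<forall>q\<in>\<rat>. (q, q) \<in> R) \<and> single_valued R \<and> Domain R \<subseteq> Qb \<and>
     (\<forall>x x' y y'. (x, x') \<in> R \<longrightarrow> (y, y') \<in> R \<longrightarrow> (x + y, x' + y') \<in> R \<and> (x * y, x' * y') \<in> R)"

text \<open>The second polynomial is the image of the first under the homomorphism with graph
  \<open>R\<close>.\<close>

definition poly_rel :: "(complex \<times> complex) set \<Rightarrow> (complex poly \<times> complex poly) set" where
  "poly_rel R = {(f, g). \<forall>i. (coeff f i, coeff g i) \<in> R}"

lemma alg_subfield_Domain: "hom_graph R \<Longrightarrow> alg_subfield (Domain R)"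
  unfolding hom_graph_def alg_subfield_def by (auto simp: subset_iff) blast+

lemma
  assumes "hom_graph R"
  shows hom_graph_rat: "q \<in> \<rat> \<Longrightarrow> (q, q) \<in> R"
    and hom_graph_add: "(x, x') \<in> R \<Longrightarrow> (y, y') \<in> R \<Longrightarrow> (x + y, x' + y') \<in> R"
    and hom_graph_mult: "(x, x') \<in> R \<Longrightarrow> (y, y') \<in> R \<Longrightarrow> (x * y, x' * y') \<in> R"
    and hom_graph_unique: "(x, y) \<in> R \<Longrightarrow> (x, y') \<in> R \<Longrightarrow> y = y'"
    and hom_graph_alg: "(x, y) \<in> R \<Longrightarrow> algebraic x"
  using assms by (auto simp: hom_graph_def single_valued_def)

lemma hom_graph_sum:
  assumes "hom_graph R" "\<And>i. i \<in> I \<Longrightarrow> (f i, g i) \<in> R"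
  shows "(sum f I, sum g I) \<in> R"
  using assms(2)
  by (induction I rule: infinite_finite_induct)
     (auto intro: hom_graph_add[OF assms(1)] hom_graph_rat[OF assms(1)])

lemma hom_graph_diff:
  assumes "hom_graph R" "(x, x') \<in> R" "(y, y') \<in> R" shows "(x - y, x' - y') \<in> R"
  using hom_graph_add[OF assms(1,2) hom_graph_mult[OF assms(1) hom_graph_rat[OF assms(1), of "-1"] assms(3)]]
  by simp

lemma poly_rel_add: "hom_graph R \<Longrightarrow> (f, f') \<in> poly_rel R \<Longrightarrow> (g, g') \<in> poly_rel R \<Longrightarrow> (f + g, f' + g') \<in> poly_rel R"
  by (auto simp: poly_rel_def intro: hom_graph_add)

lemma poly_rel_diff: "hom_graph R \<Longrightarrow> (f, f') \<in> poly_rel R \<Longrightarrow> (g, g') \<in> poly_rel R \<Longrightarrow> (f - g, f' - g') \<in> poly_rel R"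
  by (auto simp: poly_rel_def intro: hom_graph_diff)

lemma poly_rel_mult: "hom_graph R \<Longrightarrow> (f, f') \<in> poly_rel R \<Longrightarrow> (g, g') \<in> poly_rel R \<Longrightarrow> (f * g, f' * g') \<in> poly_rel R"
  by (auto simp: poly_rel_def coeff_mult intro!: hom_graph_sum hom_graph_mult)

lemma poly_rel_monom: "hom_graph R \<Longrightarrow> (c, c') \<in> R \<Longrightarrow> (monom c n, monom c' n) \<in> poly_rel R"
  using hom_graph_rat[of R 0] by (auto simp: poly_rel_def coeff_monom)

lemma poly_rel_0: "hom_graph R \<Longrightarrow> (0, g) \<in> poly_rel R \<Longrightarrow> g = 0"
  using hom_graph_unique[of R 0 _ 0] hom_graph_rat[of R 0]
  by (intro poly_eqI) (auto simp: poly_rel_def)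

lemma poly_rel_exists:
  assumes "hom_graph R" "f \<in> polys_over (Domain R)"
  obtains g where "(f, g) \<in> poly_rel R"
  using assms(2)
proof (induction f arbitrary: thesis)
  case 0
  show ?case by (rule 0(1)[of 0]) (use hom_graph_rat[OF assms(1), of 0] in \<open>auto simp: poly_rel_def\<close>)
next
  case (pCons a f)
  have "0 \<in> Domain R" using hom_graph_rat[OF assms(1), of 0] by auto
  then have "a \<in> Domain R" "f \<in> polys_over (Domain R)"
    using pCons(4) by (simp_all add: polys_over_pCons)
  then obtain b g where "(a, b) \<in> R" "(f, g) \<in> poly_rel R"
    using pCons(2) by blast
  then have "(pCons a f, pCons b g) \<in> poly_rel R"
    by (auto simp: poly_rel_def coeff_pCons split: nat.split)
  with pCons(3) show ?case by blast
qed

lemma minimal_polynomial: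
  assumes F: "alg_subfield F" and x: "algebraic x"
  obtains p where "p \<in> polys_over F" "lead_coeff p = 1" "poly p x = 0"
    "\<And>f. f \<in> polys_over F \<Longrightarrow> f \<noteq> 0 \<Longrightarrow> poly f x = 0 \<Longrightarrow> degree p \<le> degree f"
proof -
  let ?P = "\<lambda>p. p \<in> polys_over F \<and> p \<noteq> 0 \<and> poly p x = 0"
  obtain p0 where "p0 \<noteq> 0" "poly p0 x = 0" "\<And>i. coeff p0 i \<in> \<rat>"
    using algebraic_Rats_poly[OF x] by blast
  then have "?P p0" using F by (auto simp: polys_over_def alg_subfield_rat)
  then obtain p where p: "?P p" "\<And>f. ?P f \<Longrightarrow> degree p \<le> degree f"
    using exists_least_iff[of "\<lambda>n. \<exists>p. ?P p \<and> degree p = n"] by (metis not_le)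
  let ?q = "smult (inverse (lead_coeff p)) p"
  show thesis
  proof (rule that[of ?q])
    show "?q \<in> polys_over F" using p(1) by (auto intro!: polys_over_smult[OF F] alg_subfield_inverse[OF F] polys_overD)
    show "lead_coeff ?q = 1" "poly ?q x = 0" using p(1) by auto
    show "degree ?q \<le> degree f" if "f \<in> polys_over F" "f \<noteq> 0" "poly f x = 0" for f
      using p(2)[of f] that p(1) by auto
  qed
qed

lemma poly_altdef_pos_degree:
  assumes "lead_coeff p = 1" "poly p (x::complex) = 0" shows "degree p > 0"
proof (rule ccontr)
  assume "\<not> degree p > 0"
  then have "degree p = 0" by simp
  then obtain c where "p = [:c:]" by (rule degree_eq_zeroE)
  with assms show False by auto
qed

text \<open>This makes the map from \<open>poly f x\<close> to \<open>poly g y\<close> well defined.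
  One step of division by the monic \<open>p\<close> is carried out on \<open>f\<close> and, with
  related coefficients, on \<open>g\<close>. It lowers the degree of \<open>f\<close>, and by
  minimality a nonzero polynomial that kills \<open>x\<close> never drops below
  \<open>degree p\<close>.\<close>

lemma poly_rel_kernel:
  assumes R: "hom_graph R" and pq: "(p, q) \<in> poly_rel R" and lc: "lead_coeff p = 1"
    and min: "\<And>f. f \<in> polys_over (Domain R) \<Longrightarrow> f \<noteq> 0 \<Longrightarrow> poly f x = 0 \<Longrightarrow> degree p \<le> degree f"
    and root: "poly p x = 0" "poly q y = 0" and fg: "(f, g) \<in> poly_rel R" "poly f x = 0"
  shows "poly g y = 0"
  using fg
proof (induction "degree f" arbitrary: f g rule: less_induct)
  case less
  show ?case
  proof (cases "f = 0")
    case True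
    then show ?thesis using poly_rel_0[OF R, of g] less by auto
  next
    case False
    have "f \<in> polys_over (Domain R)" using less(2) by (auto simp: poly_rel_def polys_over_def)
    then have le: "degree p \<le> degree f" using min False less(3) by blast
    define n where "n = degree f - degree p"
    let ?f = "f - monom (lead_coeff f) n * p" and ?g = "g - monom (coeff g (degree f)) n * q"
    have rel: "(?f, ?g) \<in> poly_rel R"
      using less(2) pq by (intro poly_rel_diff[OF R] poly_rel_mult[OF R] poly_rel_monom[OF R])
        (auto simp: poly_rel_def)
    have p0: "p \<noteq> 0" using lc by auto
    have deg: "degree (monom (lead_coeff f) n * p) = degree f"
      using False p0 le by (subst degree_mult_eq) (auto simp: degree_monom_eq n_def)
    have "lead_coeff (monom (lead_coeff f) n * p) = lead_coeff f"
      using lc unfolding lead_coeff_mult lead_coeff_monom by simp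
    then have c0: "coeff ?f (degree f) = 0" using deg by simp
    have "poly ?g y = 0"
    proof (cases "?f = 0")
      case True
      then show ?thesis using poly_rel_0[OF R, of ?g] rel by simp
    next
      case nz: False
      have "degree ?f \<le> degree f" using degree_diff_le_max[of f "monom (lead_coeff f) n * p"] deg by simp
      moreover have "degree ?f \<noteq> degree f" using c0 nz by (metis leading_coeff_0_iff)
      ultimately have "degree ?f < degree f" by simp
      from less(1)[OF this rel] show ?thesis using less(3) root by simp
    qed
    then show ?thesis using root by simp
  qed
qed

text \<open>The classical extension step: \<open>x\<close> goes to a root \<open>y\<close> of the
  transported minimal polynomial, and \<open>poly f x\<close> to \<open>poly g y\<close>.\<close>

lemma hom_graph_adjoin:
  assumes R: "hom_graph R" and pq: "(p, q) \<in> poly_rel R" and lc: "lead_coeff p = 1"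
    and min: "\<And>f. f \<in> polys_over (Domain R) \<Longrightarrow> f \<noteq> 0 \<Longrightarrow> poly f x = 0 \<Longrightarrow> degree p \<le> degree f"
    and root: "poly p x = 0" "poly q y = 0" and x: "algebraic x"
  obtains R' where "hom_graph R'" "R \<subseteq> R'" "(x, y) \<in> R'"
proof
  let ?R = "{(poly f x, poly g y) | f g. (f, g) \<in> poly_rel R}"
  have const: "([:a:], [:b:]) \<in> poly_rel R" if "(a, b) \<in> R" for a b
    using poly_rel_monom[OF R that, of 0] by (simp add: monom_0)
  show sub: "R \<subseteq> ?R" using const by force
  have "(monom 1 1, monom 1 1) \<in> poly_rel R" by (rule poly_rel_monom[OF R hom_graph_rat[OF R]]) simp
  then show "(x, y) \<in> ?R" by (force simp: poly_monom)
  have dom: "poly f x \<in> Qb" if "(f, g) \<in> poly_rel R" for f g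
    using that x by (intro polys_over_poly[OF alg_subfield_Qb])
      (auto simp: polys_over_def poly_rel_def intro: hom_graph_alg[OF R])
  have sv: "poly g y = poly g' y"
    if "(f, g) \<in> poly_rel R" "(f', g') \<in> poly_rel R" "poly f x = poly f' x" for f g f' g'
  proof -
    have "poly (g - g') y = 0"
    proof (rule poly_rel_kernel[OF R pq lc _ root poly_rel_diff[OF R that(1,2)]])
      show "degree p \<le> degree f" if "f \<in> polys_over (Domain R)" "f \<noteq> 0" "poly f x = 0" for f
        using that by (rule min)
    qed (simp add: that(3))
    then show ?thesis by simp
  qed
  show "hom_graph ?R"
    unfolding hom_graph_def
  proof (intro conjI ballI allI impI)
    show "single_valued ?R" unfolding single_valued_def using sv by (smt (verit) mem_Collect_eq prod.inject)
    show "Domain ?R \<subseteq> Qb" using dom by auto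
    show "(q, q) \<in> ?R" if "q \<in> \<rat>" for q using sub hom_graph_rat[OF R that] by blast
  next
    fix a a' b b' assume "(a, a') \<in> ?R" "(b, b') \<in> ?R"
    then obtain f f' g g' where *: "(f, f') \<in> poly_rel R" "(g, g') \<in> poly_rel R"
      "a = poly f x" "a' = poly f' y" "b = poly g x" "b' = poly g' y" by auto
    show "(a + b, a' + b') \<in> ?R"
      using * poly_rel_add[OF R *(1,2)] by (intro CollectI exI[of _ "f + g"] exI[of _ "f' + g'"]) auto
    show "(a * b, a' * b') \<in> ?R"
      using * poly_rel_mult[OF R *(1,2)] by (intro CollectI exI[of _ "f * g"] exI[of _ "f' * g'"]) auto
  qed
qed

lemma hom_graph_adjoin_exists:
  assumes R: "hom_graph R" and x: "algebraic x"
  obtains R' y where "hom_graph R'" "R \<subseteq> R'" "(x, y) \<in> R'"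
proof -
  obtain p where p: "p \<in> polys_over (Domain R)" "lead_coeff p = 1" "poly p x = 0"
    "\<And>f. f \<in> polys_over (Domain R) \<Longrightarrow> f \<noteq> 0 \<Longrightarrow> poly f x = 0 \<Longrightarrow> degree p \<le> degree f"
    using minimal_polynomial[OF alg_subfield_Domain[OF R] x] by blast
  obtain q where q: "(p, q) \<in> poly_rel R" using poly_rel_exists[OF R p(1)] by blast
  \<comment> \<open>The image polynomial keeps the leading coefficient 1, so it is not constant and
    has a complex root.\<close>
  have "(1, coeff q (degree p)) \<in> R" using q p(2) by (auto simp: poly_rel_def) (metis)
  then have "coeff q (degree p) = 1" using hom_graph_unique[OF R] hom_graph_rat[OF R, of 1] by auto
  then have "degree q > 0" using poly_altdef_pos_degree[OF p(2,3)] le_degree[of q "degree p"] by simp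
  then have "\<not> constant (poly q)" by (simp add: constant_degree)
  then obtain y where "poly q y = 0" using fundamental_theorem_of_algebra by blast
  with hom_graph_adjoin[OF R q p(2) p(4) p(3) _ x] that show thesis by blast
qed

text \<open>A maximal graph is total, because a missing algebraic number could still be
  adjoined.\<close>

lemma hom_graph_extend:
  assumes R: "hom_graph R"
  obtains \<sigma> where "alg_hom \<rat> Qb \<sigma>" "\<And>x y. (x, y) \<in> R \<Longrightarrow> \<sigma> x = y"
proof -
  let ?A = "{R'. hom_graph R' \<and> R \<subseteq> R'}"
  have "\<exists>M\<in>(?A). \<forall>U\<in>(?A). M \<subseteq> U \<longrightarrow> U = M"
  proof (rule subset_Zorn_nonempty)
    show "?A \<noteq> {}" using R by auto
    fix C assume C: "C \<noteq> {}" "subset.chain ?A C"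
    then have hg: "\<And>R'. R' \<in> C \<Longrightarrow> hom_graph R'" and sup: "\<And>R'. R' \<in> C \<Longrightarrow> R \<subseteq> R'"
      and ch: "\<And>U V. U \<in> C \<Longrightarrow> V \<in> C \<Longrightarrow> U \<subseteq> V \<or> V \<subseteq> U"
      by (auto simp: subset_chain_def)
    have common: "\<exists>U\<in>C. a \<in> U \<and> b \<in> U" if "a \<in> \<Union>C" "b \<in> \<Union>C" for a b
      using that ch by blast
    have "hom_graph (\<Union>C)"
      unfolding hom_graph_def
    proof (intro conjI ballI allI impI)
      show "(q, q) \<in> \<Union>C" if "q \<in> \<rat>" for q
        using C(1) hg hom_graph_rat that by blast
      show "single_valued (\<Union>C)"
        unfolding single_valued_def using common hg hom_graph_unique by metis
      show "Domain (\<Union>C) \<subseteq> Qb" using hg hom_graph_alg by (auto simp: Domain_iff)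
      show "(x + y, x' + y') \<in> \<Union>C" "(x * y, x' * y') \<in> \<Union>C" if "(x, x') \<in> \<Union>C" "(y, y') \<in> \<Union>C" for x x' y y'
        using common[OF that] hg hom_graph_add hom_graph_mult by blast+
    qed
    then show "\<Union>C \<in> ?A" using C(1) sup by auto
  qed
  then obtain M where M: "hom_graph M" "R \<subseteq> M" "\<And>U. hom_graph U \<Longrightarrow> M \<subseteq> U \<Longrightarrow> U = M" by auto
  have tot: "\<exists>y. (x, y) \<in> M" if "algebraic x" for x
    using hom_graph_adjoin_exists[OF M(1) that] M(3) by metis
  define \<sigma> where "\<sigma> x = (THE y. (x, y) \<in> M)" for x
  have sg: "\<sigma> x = y" if "(x, y) \<in> M" for x y
    unfolding \<sigma>_def using that hom_graph_unique[OF M(1)] by blast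
  have sg': "(x, \<sigma> x) \<in> M" if "algebraic x" for x using tot[OF that] sg by auto
  show thesis
  proof
    show "alg_hom \<rat> Qb \<sigma>"
      unfolding alg_hom_def
      by (auto intro!: sg hom_graph_add[OF M(1)] hom_graph_mult[OF M(1)] hom_graph_rat[OF M(1)] sg')
    show "\<And>x y. (x, y) \<in> R \<Longrightarrow> \<sigma> x = y" using sg M(2) by auto
  qed
qed

text \<open>The absolute Galois group of \<open>K\<close>, except that values at transcendental
  numbers are arbitrary. Identities between its members are therefore only asserted at algebraic
  numbers.\<close>

definition Aut :: "complex set \<Rightarrow> (complex \<Rightarrow> complex) set" where
  "Aut K = {\<sigma>. alg_hom K Qb \<sigma>}"

lemma extend_to_Aut:
  assumes "alg_homo K F \<sigma>"
  obtains \<tau> where "\<tau> \<in> Aut K" "\<And>x. x \<in> F \<Longrightarrow> \<tau> x = \<sigma> x"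
proof -
  interpret alg_homo K F \<sigma> by fact
  have "hom_graph {(x, \<sigma> x) | x. x \<in> F}"
    unfolding hom_graph_def
  proof (intro conjI)
    show "\<forall>q\<in>\<rat>. (q, q) \<in> {(x, \<sigma> x) |x. x \<in> F}"
      using K F fix_K alg_subfield_rat by fastforce
    show "\<forall>x x' y y'. (x, x') \<in> {(x, \<sigma> x) |x. x \<in> F} \<longrightarrow> (y, y') \<in> {(x, \<sigma> x) |x. x \<in> F} \<longrightarrow>
       (x + y, x' + y') \<in> {(x, \<sigma> x) |x. x \<in> F} \<and> (x * y, x' * y') \<in> {(x, \<sigma> x) |x. x \<in> F}"
      using add mult alg_subfield_add[OF F] alg_subfield_mult[OF F] by auto
  qed (auto simp: single_valued_def intro: alg_subfield_algebraic[OF F])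
  then obtain \<tau> where t: "alg_hom \<rat> Qb \<tau>" "\<And>x y. (x, y) \<in> {(x, \<sigma> x) | x. x \<in> F} \<Longrightarrow> \<tau> x = y"
    using hom_graph_extend by blast
  then have "\<tau> \<in> Aut K" using K_sub fix_K by (auto simp: Aut_def alg_hom_def)
  then show thesis using t that by blast
qed

lemma alg_homo_Aut: "alg_subfield K \<Longrightarrow> \<sigma> \<in> Aut K \<Longrightarrow> alg_homo K Qb \<sigma>"
  using alg_subfield_Qb by unfold_locales (auto simp: Aut_def intro: alg_subfield_algebraic)

lemma Aut_algebraic: "alg_subfield K \<Longrightarrow> \<sigma> \<in> Aut K \<Longrightarrow> algebraic x \<Longrightarrow> algebraic (\<sigma> x)"
  using alg_homo.algebraic[OF alg_homo_Aut] by auto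

lemma Aut_comp: "alg_subfield K \<Longrightarrow> \<sigma> \<in> Aut K \<Longrightarrow> \<tau> \<in> Aut K \<Longrightarrow> \<sigma> \<circ> \<tau> \<in> Aut K"
  using Aut_algebraic by (auto simp: Aut_def alg_hom_def)

lemma Aut_id: "id \<in> Aut K"
  by (auto simp: Aut_def alg_hom_def)

lemma Aut_funpow: "alg_subfield K \<Longrightarrow> \<sigma> \<in> Aut K \<Longrightarrow> \<sigma> ^^ n \<in> Aut K"
  by (induction n) (auto intro: Aut_id Aut_comp)

text \<open>An injection permutes the finite set of roots of a rational polynomial.\<close>

lemma alg_homo_surj:
  assumes "alg_homo K F \<sigma>" "\<sigma> ` F \<subseteq> F" shows "\<sigma> ` F = F"
proof -
  interpret alg_homo K F \<sigma> by fact
  have "x \<in> \<sigma> ` F" if x: "x \<in> F" for x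
  proof -
    obtain p where p: "p \<noteq> 0" "poly p x = 0" "\<And>i. coeff p i \<in> \<rat>"
      using algebraic_Rats_poly[OF alg_subfield_algebraic[OF F x]] by blast
    let ?S = "{z \<in> F. poly p z = 0}"
    have "p \<in> polys_over K" using p(3) K by (auto simp: polys_over_def alg_subfield_rat)
    then have "\<sigma> ` ?S \<subseteq> ?S" using assms(2) poly[of p] by (auto simp: numerals) (metis numerals(1))
    moreover have "finite ?S" using poly_roots_finite[OF p(1)] by simp
    moreover have "inj_on \<sigma> ?S" using inj by (rule inj_on_subset) auto
    ultimately have "\<sigma> ` ?S = ?S" by (simp add: endo_inj_surj)
    then show ?thesis using x p(2) by blast
  qed
  with assms(2) show ?thesis by blast
qed

lemma Aut_inverse:
  assumes K: "alg_subfield K" and s: "\<sigma> \<in> Aut K"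
  obtains \<tau> where "\<tau> \<in> Aut K" "\<And>x. algebraic x \<Longrightarrow> \<tau> (\<sigma> x) = x" "\<And>x. algebraic x \<Longrightarrow> \<sigma> (\<tau> x) = x"
proof -
  interpret alg_homo K Qb \<sigma> by (rule alg_homo_Aut[OF K s])
  have im: "\<sigma> ` Qb = Qb" by (rule alg_homo_surj[OF alg_homo_Aut[OF K s]]) (use algebraic in auto)
  define \<tau> where "\<tau> = inv_into Qb \<sigma>"
  have 1: "\<tau> (\<sigma> x) = x" if "algebraic x" for x
    unfolding \<tau>_def using that inj by (intro inv_into_f_f) auto
  have 2: "\<sigma> (\<tau> x) = x" "algebraic (\<tau> x)" if "algebraic x" for x
    using f_inv_into_f[of x \<sigma> Qb] inv_into_into[of x \<sigma> Qb] that im unfolding \<tau>_def by auto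
  have "\<tau> \<in> Aut K"
    unfolding Aut_def alg_hom_def
  proof (intro CollectI conjI ballI)
    show "\<tau> x = x" if "x \<in> K" for x using 1[of x] fix_K[OF that] alg_subfield_algebraic[OF K that] by simp
    show "\<tau> (x + y) = \<tau> x + \<tau> y" "\<tau> (x * y) = \<tau> x * \<tau> y" if "x \<in> Qb" "y \<in> Qb" for x y
      using 1[of "\<tau> x + \<tau> y"] 1[of "\<tau> x * \<tau> y"] 2 that add[of "\<tau> x" "\<tau> y"] mult[of "\<tau> x" "\<tau> y"]
      by (auto simp: algebraic_add algebraic_mult)
  qed
  with 1 2 that show thesis by blast
qed

text \<open>The minimal polynomial of an \<open>x\<close> outside \<open>K\<close> has degree at
  least 2 and, by separability, a second root \<open>y\<close>. The homomorphism over
  \<open>K\<close> sending \<open>x\<close> to \<open>y\<close> extends to all algebraic numbers and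
  moves \<open>x\<close>.\<close>

lemma Aut_fixed:
  assumes K: "alg_subfield K" and x: "algebraic x" and fixed: "\<And>\<sigma>. \<sigma> \<in> Aut K \<Longrightarrow> \<sigma> x = x"
  shows "x \<in> K"
proof (rule ccontr)
  assume nK: "x \<notin> K"
  obtain p where p: "p \<in> polys_over K" "lead_coeff p = 1" "poly p x = 0"
    "\<And>f. f \<in> polys_over K \<Longrightarrow> f \<noteq> 0 \<Longrightarrow> poly f x = 0 \<Longrightarrow> degree p \<le> degree f"
    using minimal_polynomial[OF K x] by blast
  have d0: "degree p > 0" using poly_altdef_pos_degree p(2,3) by blast
  obtain r where r: "p = [:-x, 1:] * r" using p(3) by (auto simp: poly_eq_0_iff_dvd elim: dvdE)
  have r0: "r \<noteq> 0" using p(2) r by auto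
  have "degree p = Suc (degree r)" using r0 by (simp only: r) (subst degree_mult_eq; simp)
  have "degree r \<noteq> 0"
  proof
    assume "degree r = 0"
    then obtain c where c: "r = [:c:]" by (rule degree_eq_zeroE)
    then have "p = [:- x * c, c:]" "c = 1" using p(2) r r0 by (auto simp: algebra_simps)
    then have "- x \<in> K" using polys_overD[OF p(1), of 0] by simp
    then show False using alg_subfield_uminus[OF K] nK by fastforce
  qed
  then obtain y where y: "poly r y = 0"
    using fundamental_theorem_of_algebra[of r] by (auto simp: constant_degree)
  \<comment> \<open>At a double root the derivative would be a nonzero polynomial of smaller degree
    that kills \<open>x\<close>.\<close>
  have neq: "y \<noteq> x"
  proof
    assume "y = x"
    have "pderiv p = [:-x, 1:] * pderiv r + r * pderiv [:-x, 1:]" unfolding r by (rule pderiv_mult)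
    then have "poly (pderiv p) x = 0" using y \<open>y = x\<close> by simp
    moreover have "pderiv p \<noteq> 0" using d0 by (simp add: pderiv_eq_0_iff)
    ultimately have "degree p \<le> degree (pderiv p)" using p(4) polys_over_pderiv[OF K p(1)] by blast
    then show False using d0 by (simp add: degree_pderiv)
  qed
  let ?R = "{(z, z) | z. z \<in> K}"
  have R: "hom_graph ?R"
    using K by (auto simp: hom_graph_def single_valued_def alg_subfield_def)
  have "(p, p) \<in> poly_rel ?R" using p(1) by (auto simp: poly_rel_def polys_over_def)
  have dom: "Domain ?R = K" by auto
  have "poly p y = 0" using y r by simp
  obtain R' where R': "hom_graph R'" "?R \<subseteq> R'" "(x, y) \<in> R'"
  proof (rule hom_graph_adjoin[OF R \<open>(p, p) \<in> poly_rel ?R\<close> p(2) _ p(3) \<open>poly p y = 0\<close> x])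
    show "degree p \<le> degree f" if "f \<in> polys_over (Domain ?R)" "f \<noteq> 0" "poly f x = 0" for f
      using that p(4) unfolding dom by blast
  qed
  obtain \<sigma> where s: "alg_hom \<rat> Qb \<sigma>" "\<And>x y. (x, y) \<in> R' \<Longrightarrow> \<sigma> x = y"
    using hom_graph_extend[OF R'(1)] by blast
  have "\<sigma> \<in> Aut K" using s R'(2) by (auto simp: Aut_def alg_hom_def)
  from fixed[OF this] s(2)[OF R'(3)] neq show False by simp
qed

section \<open>Galois theory\<close>

text \<open>Newton's form: a new node contributes a multiple of the product over the old nodes,
  which leaves the old values alone. The degree bound is put on coefficients so that it makes sense
  for empty \<open>S\<close>, where it forces the zero polynomial.\<close>

lemma lagrange_interpolation:
  assumes D: "alg_subfield D" and "finite S" "S \<subseteq> D" "\<And>u. u \<in> S \<Longrightarrow> v u \<in> D"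
  shows "\<exists>f\<in>polys_over D. (\<forall>i\<ge>card S. coeff f i = 0) \<and> (\<forall>u\<in>S. poly f u = v u)"
  using assms(2-)
proof (induction S rule: finite_induct)
  case empty
  then show ?case by (intro bexI[of _ 0]) (auto simp: polys_over_0 alg_subfield_numerals[OF D])
next
  case (insert u S)
  then obtain f where f: "f \<in> polys_over D" "\<forall>i\<ge>card S. coeff f i = 0" "\<forall>u\<in>S. poly f u = v u"
    by auto
  define q where "q = (\<Prod>w\<in>S. [:- w, 1:])"
  have q: "q \<in> polys_over D \<and> degree q = card S"
    using insert(1,4) unfolding q_def
  proof (induction S rule: finite_induct)
    case empty
    have "1 \<in> polys_over D" using polys_over_monom[OF D, of 1 0] alg_subfield_numerals(2)[OF D] by (simp add: monom_0 one_pCons)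
    then show ?case by simp
  next
    case (insert w S)
    have "[:- w, 1:] \<in> polys_over D"
      using insert(4) by (auto simp: polys_over_pCons alg_subfield_numerals[OF D] alg_subfield_uminus[OF D] polys_over_0)
    moreover have "(\<Prod>w\<in>S. [:- w, 1:]) \<noteq> 0" using insert(1) by auto
    ultimately show ?case
      using insert by (auto intro: polys_over_mult[OF D] simp: degree_mult_eq simp del: mult_pCons_left)
  qed
  have qr: "poly q w = 0 \<longleftrightarrow> w \<in> S" for w
    unfolding q_def poly_prod using insert(1) by auto
  define c where "c = (v u - poly f u) / poly q u"
  have "c \<in> D"
    unfolding c_def using insert(4,5) f(1) q
    by (auto intro!: alg_subfield_divide[OF D] alg_subfield_diff[OF D] polys_over_poly[OF D])
  then have "f + smult c q \<in> polys_over D"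
    using f(1) q by (auto intro!: polys_over_add[OF D] polys_over_smult[OF D])
  moreover have "\<forall>i\<ge>card (insert u S). coeff (f + smult c q) i = 0"
    using f(2) q insert(1,2) by (auto simp: coeff_eq_0)
  moreover have "\<forall>w\<in>insert u S. poly (f + smult c q) w = v w"
    using f(3) qr insert(2) by (auto simp: c_def)
  ultimately show ?case by blast
qed

lemma poly_eqI_card:
  assumes "finite S" "\<forall>i\<ge>card S. coeff (f :: complex poly) i = 0" "\<forall>i\<ge>card S. coeff g i = 0"
    "\<And>u. u \<in> S \<Longrightarrow> poly f u = poly g u"
  shows "f = g"
proof (rule ccontr)
  assume "f \<noteq> g"
  then have nz: "f - g \<noteq> 0" by simp
  have "coeff (f - g) (degree (f - g)) \<noteq> 0" using nz by (simp only: leading_coeff_0_iff) simp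
  then have "degree (f - g) < card S" using assms(2,3) by (metis coeff_diff diff_zero not_le)
  moreover have "card S \<le> card {x. poly (f - g) x = 0}"
    using assms(4) poly_roots_finite[OF nz] by (intro card_mono) auto
  ultimately show False using card_poly_roots_bound[OF nz] by simp
qed

text \<open>Common form of \<open>Aut K\<close> acting on \<open>Qb\<close> and of
  \<open>Gal L K\<close> acting on \<open>L\<close>. Identity, composites and inverses are required
  only up to equality on \<open>D\<close>, since members of \<open>Aut K\<close> are arbitrary
  elsewhere.\<close>

locale galois_action =
  fixes \<Gamma> :: "(complex \<Rightarrow> complex) set" and D K :: "complex set"
  assumes K: "alg_subfield K" and D: "alg_subfield D" and K_sub: "K \<subseteq> D"
    and hom: "\<And>g. g \<in> \<Gamma> \<Longrightarrow> alg_hom K D g"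
    and closed: "\<And>g x. g \<in> \<Gamma> \<Longrightarrow> x \<in> D \<Longrightarrow> g x \<in> D"
    and ident: "\<exists>e\<in>\<Gamma>. \<forall>x\<in>D. e x = x"
    and comp: "\<And>g h. g \<in> \<Gamma> \<Longrightarrow> h \<in> \<Gamma> \<Longrightarrow> \<exists>k\<in>\<Gamma>. \<forall>x\<in>D. k x = g (h x)"
    and inv: "\<And>g. g \<in> \<Gamma> \<Longrightarrow> \<exists>h\<in>\<Gamma>. \<forall>x\<in>D. h (g x) = x \<and> g (h x) = x"
    and fixed: "\<And>x. x \<in> D \<Longrightarrow> (\<And>g. g \<in> \<Gamma> \<Longrightarrow> g x = x) \<Longrightarrow> x \<in> K"
begin

lemma homo: "g \<in> \<Gamma> \<Longrightarrow> alg_homo K D g"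
  using K D K_sub hom by unfold_locales auto

definition orbit :: "complex \<Rightarrow> complex set" where
  "orbit x = (\<lambda>g. g x) ` \<Gamma>"

lemma orbit_sub: "x \<in> D \<Longrightarrow> orbit x \<subseteq> D"
  using closed by (auto simp: orbit_def)

lemma orbit_self: "x \<in> D \<Longrightarrow> x \<in> orbit x"
  using ident unfolding orbit_def by (metis image_eqI)

lemma finite_orbit:
  assumes "x \<in> D" shows "finite (orbit x)"
proof -
  obtain p where p: "p \<noteq> 0" "poly p x = 0" "\<And>i. coeff p i \<in> \<rat>"
    using algebraic_Rats_poly[OF alg_subfield_algebraic[OF D assms]] by blast
  have "p \<in> polys_over K" using p(3) K by (auto simp: polys_over_def alg_subfield_rat)
  then have "poly p (g x) = 0" if "g \<in> \<Gamma>" for g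
    using alg_homo.poly[OF homo[OF that] _ assms] alg_homo.numerals(1)[OF homo[OF that]] p(2) by metis
  then show ?thesis
    unfolding orbit_def by (intro finite_subset[OF _ poly_roots_finite[OF p(1)]]) auto
qed

text \<open>The interpolating polynomial with \<open>f (g x) = g y\<close> on the orbit of \<open>x\<close> is unique below the
  size of the orbit, hence its coefficients are invariant.\<close>

lemma interpolate:
  assumes x: "x \<in> D" and y: "y \<in> D" and stab: "\<And>g. g \<in> \<Gamma> \<Longrightarrow> g x = x \<Longrightarrow> g y = y"
  obtains f where "f \<in> polys_over K" "\<And>i. i \<ge> card (orbit x) \<Longrightarrow> coeff f i = 0"
    "\<And>g. g \<in> \<Gamma> \<Longrightarrow> poly f (g x) = g y"
proof -
  define v where "v u = (SOME w. \<exists>g\<in>\<Gamma>. u = g x \<and> w = g y)" for u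
  \<comment> \<open>The composite of the inverse of \<open>h\<close> with \<open>g\<close> fixes
    \<open>x\<close>, hence \<open>y\<close> by \<open>stab\<close>.\<close>
  have wd: "g y = h y" if "g \<in> \<Gamma>" "h \<in> \<Gamma>" "g x = h x" for g h
  proof -
    obtain h' where h': "h' \<in> \<Gamma>" "\<forall>x\<in>D. h' (h x) = x \<and> h (h' x) = x" using inv \<open>h \<in> \<Gamma>\<close> by blast
    obtain k where k: "k \<in> \<Gamma>" "\<forall>x\<in>D. k x = h' (g x)" using comp h' \<open>g \<in> \<Gamma>\<close> by blast
    have "k x = x" using k(2) x h'(2) that(3) by simp
    then have "h' (g y) = y" using stab k y by metis
    then show ?thesis using h'(2) closed[OF \<open>g \<in> \<Gamma>\<close> y] by metis
  qed
  have v: "v (g x) = g y" if "g \<in> \<Gamma>" for g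
  proof -
    have "\<exists>h\<in>\<Gamma>. g x = h x \<and> v (g x) = h y"
      unfolding v_def by (rule someI[of _ "g y"]) (use that in blast)
    then show ?thesis using wd[OF that] by metis
  qed
  have "v u \<in> D" if "u \<in> orbit x" for u
    using that v closed y by (auto simp: orbit_def)
  then obtain f where f: "f \<in> polys_over D" "\<forall>i\<ge>card (orbit x). coeff f i = 0"
    "\<forall>u\<in>orbit x. poly f u = v u"
    using lagrange_interpolation[OF D finite_orbit[OF x] orbit_sub[OF x]] by blast
  have f_val: "poly f (g x) = g y" if "g \<in> \<Gamma>" for g
    using f(3) v that by (auto simp: orbit_def)
  have inv_f: "map_poly h f = f" if h: "h \<in> \<Gamma>" for h
  proof (rule poly_eqI_card[OF finite_orbit[OF x] _ f(2)])
    note h0 = alg_homo.numerals(1)[OF homo[OF h]]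
    show "\<forall>i\<ge>card (orbit x). coeff (map_poly h f) i = 0"
      using f(2) by (simp add: coeff_map_poly h0)
    fix u assume "u \<in> orbit x"
    then obtain g where g: "g \<in> \<Gamma>" "u = g x" by (auto simp: orbit_def)
    \<comment> \<open>Every point \<open>u\<close> of the orbit is the image under \<open>h\<close>
      of another orbit point \<open>k x\<close>, where \<open>k\<close> is \<open>g\<close> followed
      by the inverse of \<open>h\<close>.\<close>
    obtain h' where h': "h' \<in> \<Gamma>" "\<forall>x\<in>D. h' (h x) = x \<and> h (h' x) = x" using inv h by blast
    obtain k where k: "k \<in> \<Gamma>" "\<forall>x\<in>D. k x = h' (g x)" using comp h' g by blast
    have u: "h (k x) = u" using k x h'(2) g closed[OF g(1) x] by simp
    have "poly (map_poly h f) (h (k x)) = h (poly f (k x))"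
      using alg_homo.poly_map[OF homo[OF h] f(1)] closed[OF k(1) x] by simp
    also have "\<dots> = h (k y)" using f_val[OF k(1)] by simp
    also have "\<dots> = g y" using k y h'(2) closed[OF g(1) y] by simp
    finally show "poly (map_poly h f) u = poly f u" using f_val[OF g(1)] g u by simp
  qed
  have "coeff f i \<in> K" for i
  proof (rule fixed)
    show "coeff f i \<in> D" using f(1) by (rule polys_overD)
    show "g (coeff f i) = coeff f i" if "g \<in> \<Gamma>" for g
      using arg_cong[OF inv_f[OF that], of "\<lambda>p. coeff p i"]
      by (simp add: coeff_map_poly alg_homo.numerals(1)[OF homo[OF that]])
  qed
  then have "f \<in> polys_over K" by (simp add: polys_over_def)
  then show thesis using that f(2) f_val by blast
qed

text \<open>Interpolation expresses \<open>x ^ n\<close>, for \<open>n\<close> the size of the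
  orbit, by lower powers of \<open>x\<close> over \<open>K\<close>. The resulting monic polynomial
  of degree \<open>n\<close> vanishes on the orbit, and a count leaves no room for further
  roots.\<close>

lemma orbit_poly:
  assumes x: "x \<in> D"
  obtains p where "p \<in> polys_over K" "{z. poly p z = 0} = orbit x" "degree p = card (orbit x)"
proof -
  let ?n = "card (orbit x)"
  have "g (x ^ ?n) = x ^ ?n" if "g \<in> \<Gamma>" "g x = x" for g
    using alg_homo.power[OF homo[OF that(1)] x] that(2) by simp
  then obtain f where f: "f \<in> polys_over K" "\<And>i. i \<ge> ?n \<Longrightarrow> coeff f i = 0"
    "\<And>g. g \<in> \<Gamma> \<Longrightarrow> poly f (g x) = g (x ^ ?n)"
    using interpolate[OF x alg_subfield_power[OF D x]] by metis
  let ?p = "monom 1 ?n - f"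
  have cn: "coeff ?p ?n = 1" using f(2) by simp
  then have nz: "?p \<noteq> 0" by (metis coeff_0 zero_neq_one)
  have deg: "degree ?p = ?n"
    by (rule antisym) (use f(2) cn in \<open>auto intro!: degree_le le_degree\<close>)
  have sub: "orbit x \<subseteq> {z. poly ?p z = 0}"
    using f(3) alg_homo.power[OF homo x] by (auto simp: orbit_def poly_monom)
  have "{z. poly ?p z = 0} = orbit x"
    using card_poly_roots_bound[OF nz] deg card_seteq[OF poly_roots_finite[OF nz] sub] by simp
  moreover have "?p \<in> polys_over K"
    using f(1) by (intro polys_over_diff[OF K] polys_over_monom[OF K] alg_subfield_numerals[OF K])
  ultimately show thesis using deg that by blast
qed

text \<open>This turns the fixed field condition into normality: a homomorphism over
  \<open>K\<close>, even one defined on a different field, permutes the roots of the orbit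
  polynomial.\<close>

lemma normal:
  assumes "alg_homo K F \<tau>" "x \<in> F" "x \<in> D"
  shows "\<tau> x \<in> orbit x"
proof -
  interpret t: alg_homo K F \<tau> by fact
  obtain p where p: "p \<in> polys_over K" "{z. poly p z = 0} = orbit x"
    using orbit_poly[OF assms(3)] by blast
  have "poly p x = 0" using p(2) orbit_self[OF assms(3)] by blast
  then have "poly p (\<tau> x) = 0" using t.poly[OF p(1) assms(2)] t.numerals by simp
  then show ?thesis using p(2) by blast
qed

end

lemma galois_action_Aut:
  assumes K: "alg_subfield K" shows "galois_action (Aut K) Qb K"
proof
  show "alg_subfield Qb" by (rule alg_subfield_Qb)
  show "\<exists>e\<in>Aut K. \<forall>x\<in>Qb. e x = x" by (rule bexI[OF _ Aut_id]) simp
  show "\<exists>k\<in>Aut K. \<forall>x\<in>Qb. k x = g (h x)" if "g \<in> Aut K" "h \<in> Aut K" for g h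
    by (rule bexI[OF _ Aut_comp[OF K that]]) simp
  show "\<exists>h\<in>Aut K. \<forall>x\<in>Qb. h (g x) = x \<and> g (h x) = x" if "g \<in> Aut K" for g
    using Aut_inverse[OF K that] by (metis mem_Collect_eq)
  show "alg_subfield K" by (rule K)
  show "K \<subseteq> Qb" using alg_subfield_algebraic[OF K] by blast
  show "alg_hom K Qb g" if "g \<in> Aut K" for g using that by (simp add: Aut_def)
  show "g x \<in> Qb" if "g \<in> Aut K" "x \<in> Qb" for g x using Aut_algebraic[OF K that(1)] that(2) by simp
  show "x \<in> K" if "x \<in> Qb" "\<And>g. g \<in> Aut K \<Longrightarrow> g x = x" for x
    using Aut_fixed[OF K] that by simp
qed

section \<open>The Galois group of one extension\<close>

locale field_extension =
  fixes L K :: "complex set"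
  assumes K: "alg_subfield K" and L: "alg_subfield L" and K_sub: "K \<subseteq> L"
begin

abbreviation "G \<equiv> Gal L K"

lemma carrier_Gal: "\<sigma> \<in> carrier G \<longleftrightarrow> \<sigma> \<in> extensional L \<and> bij_betw \<sigma> L L \<and> alg_hom K L \<sigma>"
  using alg_subfield_numerals(2)[OF K]
  by (auto simp: Gal_def ring_hom_def alg_hom_def Bij_def dest: bij_betwE)

lemma Gal_alg_homo: "\<sigma> \<in> carrier G \<Longrightarrow> alg_homo K L \<sigma>"
  using K L K_sub by unfold_locales (auto simp: carrier_Gal)

lemma Gal_closed: "\<sigma> \<in> carrier G \<Longrightarrow> x \<in> L \<Longrightarrow> \<sigma> x \<in> L"
  by (auto simp: carrier_Gal dest: bij_betwE)

lemma Gal_mult: "\<sigma> \<in> carrier G \<Longrightarrow> \<tau> \<in> carrier G \<Longrightarrow> \<sigma> \<otimes>\<^bsub>G\<^esub> \<tau> = compose L \<sigma> \<tau>"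
  by (auto simp: Gal_def BijGroup_def)

lemma Gal_one: "\<one>\<^bsub>G\<^esub> = (\<lambda>x\<in>L. x)"
  by (simp add: Gal_def BijGroup_def)

lemma Gal_one_closed: "(\<lambda>x\<in>L. x) \<in> carrier G"
  using K_sub alg_subfield_add[OF L] alg_subfield_mult[OF L]
  by (auto simp: carrier_Gal alg_hom_def bij_betw_def inj_on_def)

lemma Gal_eqI: "\<sigma> \<in> carrier G \<Longrightarrow> \<tau> \<in> carrier G \<Longrightarrow> (\<And>x. x \<in> L \<Longrightarrow> \<sigma> x = \<tau> x) \<Longrightarrow> \<sigma> = \<tau>"
  unfolding carrier_Gal by (blast intro: extensionalityI)

lemma restrict_Gal:
  assumes "alg_homo K F \<tau>" "L \<subseteq> F" "\<tau> ` L \<subseteq> L"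
  shows "restrict \<tau> L \<in> carrier G"
proof -
  interpret t: alg_homo K F \<tau> by fact
  have tl: "alg_homo K L \<tau>" using K L K_sub alg_hom_mono[OF t.hom _ assms(2)] by unfold_locales auto
  have "bij_betw \<tau> L L"
    using alg_homo_surj[OF tl assms(3)] alg_homo.inj[OF tl] by (simp add: bij_betw_def)
  then have "bij_betw (restrict \<tau> L) L L" by (simp cong: bij_betw_cong)
  moreover have "alg_hom K L (restrict \<tau> L)"
    using alg_homo.hom[OF tl] K_sub alg_subfield_add[OF L] alg_subfield_mult[OF L]
    by (auto simp: alg_hom_def)
  ultimately show ?thesis by (simp add: carrier_Gal)
qed

lemma group_Gal: "group G"
proof (rule groupI)
  show "\<one>\<^bsub>G\<^esub> \<in> carrier G" by (simp add: Gal_one Gal_one_closed)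
  have cl: "compose L \<sigma> \<tau> \<in> carrier G" if "\<sigma> \<in> carrier G" "\<tau> \<in> carrier G" for \<sigma> \<tau>
    using that K_sub alg_subfield_add[OF L] alg_subfield_mult[OF L] Gal_closed
    by (auto simp: carrier_Gal alg_hom_def compose_def cong: bij_betw_cong
        intro: bij_betw_trans[unfolded comp_def])
  then show "\<sigma> \<otimes>\<^bsub>G\<^esub> \<tau> \<in> carrier G" if "\<sigma> \<in> carrier G" "\<tau> \<in> carrier G" for \<sigma> \<tau>
    using that by (simp add: Gal_mult)
  show "\<one>\<^bsub>G\<^esub> \<otimes>\<^bsub>G\<^esub> \<sigma> = \<sigma>" if "\<sigma> \<in> carrier G" for \<sigma>
    using cl[OF Gal_one_closed that] Gal_closed[OF that] that
    by (intro Gal_eqI) (auto simp: Gal_mult Gal_one Gal_one_closed compose_def)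
  show "\<sigma> \<otimes>\<^bsub>G\<^esub> \<tau> \<otimes>\<^bsub>G\<^esub> \<rho> = \<sigma> \<otimes>\<^bsub>G\<^esub> (\<tau> \<otimes>\<^bsub>G\<^esub> \<rho>)"
    if "\<sigma> \<in> carrier G" "\<tau> \<in> carrier G" "\<rho> \<in> carrier G" for \<sigma> \<tau> \<rho>
    unfolding Gal_mult[OF that(1,2)] Gal_mult[OF that(2,3)] Gal_mult[OF cl[OF that(1,2)] that(3)]
      Gal_mult[OF that(1) cl[OF that(2,3)]]
    using Gal_closed[OF that(3)] by (auto simp: compose_def intro!: restrict_ext)
  fix \<sigma> assume s: "\<sigma> \<in> carrier G"
  \<comment> \<open>The inverse is formed in \<open>Aut K\<close> and restricted back to
    \<open>L\<close>.\<close>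
  then obtain \<tau> where t: "\<tau> \<in> Aut K" "\<And>x. x \<in> L \<Longrightarrow> \<tau> x = \<sigma> x"
    using extend_to_Aut[OF Gal_alg_homo] by blast
  obtain \<tau>' where t': "\<tau>' \<in> Aut K" "\<And>x. algebraic x \<Longrightarrow> \<tau>' (\<tau> x) = x" "\<And>x. algebraic x \<Longrightarrow> \<tau> (\<tau>' x) = x"
    using Aut_inverse[OF K t(1)] by blast
  have tt: "\<tau>' (\<sigma> x) = x" if "x \<in> L" for x
    using t(2)[OF that] t'(2)[of x] alg_subfield_algebraic[OF L that] by simp
  have "\<sigma> ` L = L" using s by (auto simp: carrier_Gal bij_betw_def)
  then have "\<tau>' x \<in> L" if "x \<in> L" for x using tt that by (metis imageE)
  then have "\<tau>' ` L \<subseteq> L" by blast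
  then have r: "restrict \<tau>' L \<in> carrier G"
    using restrict_Gal[OF alg_homo_Aut[OF K t'(1)]] alg_subfield_algebraic[OF L] by auto
  show "\<exists>\<rho>\<in>carrier G. \<rho> \<otimes>\<^bsub>G\<^esub> \<sigma> = \<one>\<^bsub>G\<^esub>"
    using r s tt Gal_closed[OF s]
    by (intro bexI[OF _ r]) (auto simp: Gal_mult Gal_one compose_def intro!: restrict_ext)
qed

lemma Gal_mult_apply: "\<sigma> \<in> carrier G \<Longrightarrow> \<tau> \<in> carrier G \<Longrightarrow> x \<in> L \<Longrightarrow> (\<sigma> \<otimes>\<^bsub>G\<^esub> \<tau>) x = \<sigma> (\<tau> x)"
  by (simp add: Gal_mult compose_def)

lemma Gal_one_apply: "x \<in> L \<Longrightarrow> \<one>\<^bsub>G\<^esub> x = x"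
  by (simp add: Gal_one)

lemma Gal_pow_apply:
  assumes "\<sigma> \<in> carrier G" "x \<in> L"
  shows "(\<sigma> [^]\<^bsub>G\<^esub> (n::nat)) x = (\<sigma> ^^ n) x"
proof -
  interpret group G by (rule group_Gal)
  show ?thesis
    using assms Gal_closed[OF assms(1)]
    by (induction n arbitrary: x) (auto simp: Gal_one_apply Gal_mult_apply funpow_Suc_right simp del: funpow.simps)
qed

lemma Gal_inv_apply:
  assumes "\<sigma> \<in> carrier G" "x \<in> L"
  shows "(inv\<^bsub>G\<^esub> \<sigma>) (\<sigma> x) = x" "\<sigma> ((inv\<^bsub>G\<^esub> \<sigma>) x) = x"
proof -
  interpret group G by (rule group_Gal)
  show "(inv\<^bsub>G\<^esub> \<sigma>) (\<sigma> x) = x" "\<sigma> ((inv\<^bsub>G\<^esub> \<sigma>) x) = x"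
    using Gal_mult_apply[OF inv_closed[OF assms(1)] assms(1,2)]
      Gal_mult_apply[OF assms(1) inv_closed[OF assms(1)] assms(2)] assms
    by (auto simp: Gal_one_apply)
qed

lemma galois_action_Gal:
  assumes "galois_extension L K" shows "galois_action (carrier G) L K"
proof -
  interpret group G by (rule group_Gal)
  show ?thesis
  proof
    show "\<exists>e\<in>carrier G. \<forall>x\<in>L. e x = x" using Gal_one_apply by blast
    show "\<exists>k\<in>carrier G. \<forall>x\<in>L. k x = g (h x)" if "g \<in> carrier G" "h \<in> carrier G" for g h
      using Gal_mult_apply[OF that] m_closed[OF that] by blast
    show "\<exists>h\<in>carrier G. \<forall>x\<in>L. h (g x) = x \<and> g (h x) = x" if "g \<in> carrier G" for g
      using Gal_inv_apply[OF that] inv_closed[OF that] by blast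
    show "x \<in> K" if "x \<in> L" "\<And>g. g \<in> carrier G \<Longrightarrow> g x = x" for x
      using assms that by (auto simp: galois_extension_def fixed_field_def)
  qed (use K L K_sub Gal_closed in \<open>auto simp: carrier_Gal\<close>)
qed

lemma galois_extension_normal:
  assumes "galois_extension L K" "\<tau> \<in> Aut K" shows "\<tau> ` L \<subseteq> L"
proof -
  interpret galois_action "carrier G" L K by (rule galois_action_Gal[OF assms(1)])
  show ?thesis
    using normal[OF alg_homo_Aut[OF K assms(2)]] orbit_sub alg_subfield_algebraic[OF L] by blast
qed

lemma normal_galois_extension:
  assumes "\<And>\<tau>. \<tau> \<in> Aut K \<Longrightarrow> \<tau> ` L \<subseteq> L" shows "galois_extension L K"
proof -
  have "x \<in> K" if x: "x \<in> L" and fixed: "\<forall>\<sigma>\<in>carrier G. \<sigma> x = x" for x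
  proof (rule Aut_fixed[OF K])
    show "algebraic x" using alg_subfield_algebraic[OF L x] .
    fix \<tau> assume t: "\<tau> \<in> Aut K"
    have "restrict \<tau> L \<in> carrier G"
      using restrict_Gal[OF alg_homo_Aut[OF K t] _ assms[OF t]] alg_subfield_algebraic[OF L] by auto
    with fixed x show "\<tau> x = x" by force
  qed
  moreover have "\<sigma> x = x" if "x \<in> K" "\<sigma> \<in> carrier G" for x \<sigma>
    using that by (auto simp: carrier_Gal alg_hom_def)
  ultimately show ?thesis
    using K L K_sub by (auto simp: galois_extension_def subfield_Qbar_iff fixed_field_def)
qed

end

section \<open>The Krull topology and the p-adic topology\<close>

abbreviation pointwise_topology :: "'b set \<Rightarrow> 'a set \<Rightarrow> ('a \<Rightarrow> 'b) set \<Rightarrow> ('a \<Rightarrow> 'b) topology" where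
  "pointwise_topology A I C \<equiv> subtopology (product_topology (\<lambda>_. discrete_topology A) I) C"

text \<open>A basic neighbourhood of \<open>f\<close> prescribes its values at finitely many points.
  From here on open sets, continuity and limits are statements about finite sets of
  arguments.\<close>

lemma openin_pointwise:
  assumes C: "C \<subseteq> I \<rightarrow>\<^sub>E A"
  shows "openin (pointwise_topology A I C) U \<longleftrightarrow>
    U \<subseteq> C \<and> (\<forall>f\<in>U. \<exists>S. finite S \<and> S \<subseteq> I \<and> (\<forall>g\<in>C. (\<forall>x\<in>S. g x = f x) \<longrightarrow> g \<in> U))"
proof
  assume "openin (pointwise_topology A I C) U"
  then obtain T where T: "openin (product_topology (\<lambda>_. discrete_topology A) I) T" "U = T \<inter> C"
    by (auto simp: openin_subtopology)
  show "U \<subseteq> C \<and> (\<forall>f\<in>U. \<exists>S. finite S \<and> S \<subseteq> I \<and> (\<forall>g\<in>C. (\<forall>x\<in>S. g x = f x) \<longrightarrow> g \<in> U))"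
  proof (intro conjI ballI)
    fix f assume f: "f \<in> U"
    then obtain W where W: "finite {i \<in> I. W i \<noteq> A}" "f \<in> Pi\<^sub>E I W" "Pi\<^sub>E I W \<subseteq> T"
      using T openin_product_topology_alt[of "\<lambda>_. discrete_topology A" I T] by auto
    have "g \<in> U" if g: "g \<in> C" "\<forall>x\<in>{i \<in> I. W i \<noteq> A}. g x = f x" for g
    proof -
      have "g \<in> Pi\<^sub>E I W"
      proof (rule PiE_I)
        show "g x \<in> W x" if "x \<in> I" for x
          using g C W(2) that by (cases "W x = A") auto
        show "g x = undefined" if "x \<notin> I" for x using g(1) C that by (auto simp: PiE_def extensional_def)
      qed
      then show ?thesis using W(3) T(2) g(1) by auto
    qed
    then show "\<exists>S. finite S \<and> S \<subseteq> I \<and> (\<forall>g\<in>C. (\<forall>x\<in>S. g x = f x) \<longrightarrow> g \<in> U)"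
      using W(1) by (intro exI[of _ "{i \<in> I. W i \<noteq> A}"]) auto
  qed (use T in auto)
next
  assume R: "U \<subseteq> C \<and> (\<forall>f\<in>U. \<exists>S. finite S \<and> S \<subseteq> I \<and> (\<forall>g\<in>C. (\<forall>x\<in>S. g x = f x) \<longrightarrow> g \<in> U))"
  then obtain S where S: "\<And>f. f \<in> U \<Longrightarrow> finite (S f) \<and> S f \<subseteq> I \<and> (\<forall>g\<in>C. (\<forall>x\<in>S f. g x = f x) \<longrightarrow> g \<in> U)"
    by metis
  define T where "T = (\<Union>f\<in>U. Pi\<^sub>E I (\<lambda>x. if x \<in> S f then {f x} else A))"
  have "openin (product_topology (\<lambda>_. discrete_topology A) I) T"
    unfolding T_def
  proof (intro openin_Union ballI; clarify)
    fix f assume f: "f \<in> U"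
    then have "f \<in> I \<rightarrow>\<^sub>E A" using C R by auto
    moreover have "finite {i \<in> I. (if i \<in> S f then {f i} else A) \<noteq> A}"
      by (rule finite_subset[of _ "S f"]) (use S[OF f] in auto)
    ultimately show "openin (product_topology (\<lambda>_. discrete_topology A) I)
        (Pi\<^sub>E I (\<lambda>x. if x \<in> S f then {f x} else A))"
      using S[OF f] by (intro product_topology_basis) (auto simp: PiE_def Pi_def)
  qed
  moreover have "U = T \<inter> C"
  proof (rule subset_antisym; intro subsetI)
    fix f assume f: "f \<in> U"
    then have fC: "f \<in> C" using R by auto
    then have "f \<in> I \<rightarrow>\<^sub>E A" using C by auto
    then have "f \<in> T" using f unfolding T_def by (auto simp: PiE_def Pi_def)
    with fC show "f \<in> T \<inter> C" by simp
  next
    fix g assume "g \<in> T \<inter> C"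
    then obtain f where f: "f \<in> U" "g \<in> Pi\<^sub>E I (\<lambda>x. if x \<in> S f then {f x} else A)" "g \<in> C"
      by (auto simp: T_def)
    have "\<forall>x\<in>S f. g x = f x"
    proof
      fix x assume x: "x \<in> S f"
      then have "x \<in> I" using S[OF f(1)] by auto
      then show "g x = f x" using PiE_mem[OF f(2)] x by fastforce
    qed
    then show "g \<in> U" using S[OF f(1)] f(3) by auto
  qed
  ultimately show "openin (pointwise_topology A I C) U" by (auto simp: openin_subtopology)
qed

lemma topspace_pointwise: "C \<subseteq> I \<rightarrow>\<^sub>E A \<Longrightarrow> topspace (pointwise_topology A I C) = C"
  by (auto simp: topspace_subtopology)

lemma continuous_map_pointwise:
  assumes C1: "C1 \<subseteq> I1 \<rightarrow>\<^sub>E A1" and C2: "C2 \<subseteq> I2 \<rightarrow>\<^sub>E A2"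
  shows "continuous_map (pointwise_topology A1 I1 C1) (pointwise_topology A2 I2 C2) \<phi> \<longleftrightarrow>
    \<phi> ` C1 \<subseteq> C2 \<and> (\<forall>f\<in>C1. \<forall>y\<in>I2. \<exists>S. finite S \<and> S \<subseteq> I1 \<and>
       (\<forall>g\<in>C1. (\<forall>x\<in>S. g x = f x) \<longrightarrow> \<phi> g y = \<phi> f y))"
    (is "?L \<longleftrightarrow> ?R")
proof
  assume L: ?L
  then have im: "\<phi> ` C1 \<subseteq> C2"
    using C1 C2 by (auto simp: continuous_map_def topspace_pointwise)
  have "\<exists>S. finite S \<and> S \<subseteq> I1 \<and> (\<forall>g\<in>C1. (\<forall>x\<in>S. g x = f x) \<longrightarrow> \<phi> g y = \<phi> f y)"
    if f: "f \<in> C1" and y: "y \<in> I2" for f y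
  proof -
    have "openin (pointwise_topology A2 I2 C2) {g \<in> C2. g y = \<phi> f y}"
      unfolding openin_pointwise[OF C2] using y by (intro conjI ballI exI[of _ "{y}"]) auto
    then have "openin (pointwise_topology A1 I1 C1) {g \<in> C1. \<phi> g \<in> {g \<in> C2. g y = \<phi> f y}}"
      using L unfolding continuous_map_def topspace_pointwise[OF C1] by blast
    moreover have "f \<in> {g \<in> C1. \<phi> g \<in> {g \<in> C2. g y = \<phi> f y}}" using f im by auto
    ultimately obtain S where "finite S" "S \<subseteq> I1"
      "\<forall>g\<in>C1. (\<forall>x\<in>S. g x = f x) \<longrightarrow> g \<in> {g \<in> C1. \<phi> g \<in> {g \<in> C2. g y = \<phi> f y}}"
      unfolding openin_pointwise[OF C1] by blast
    then show ?thesis by (intro exI[of _ S]) simp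
  qed
  with im show ?R by auto
next
  assume R: ?R
  have "openin (pointwise_topology A1 I1 C1) {g \<in> C1. \<phi> g \<in> V}"
    if V: "openin (pointwise_topology A2 I2 C2) V" for V
    unfolding openin_pointwise[OF C1]
  proof (intro conjI ballI)
    fix f assume "f \<in> {g \<in> C1. \<phi> g \<in> V}"
    then have f: "f \<in> C1" "\<phi> f \<in> V" by auto
    obtain S where S: "finite S" "S \<subseteq> I2" "\<forall>g\<in>C2. (\<forall>x\<in>S. g x = \<phi> f x) \<longrightarrow> g \<in> V"
      using V f(2) unfolding openin_pointwise[OF C2] by blast
    obtain R where R': "\<And>y. y \<in> I2 \<Longrightarrow> finite (R y) \<and> R y \<subseteq> I1 \<and> (\<forall>g\<in>C1. (\<forall>x\<in>R y. g x = f x) \<longrightarrow> \<phi> g y = \<phi> f y)"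
      using R f(1) by metis
    show "\<exists>S. finite S \<and> S \<subseteq> I1 \<and> (\<forall>g\<in>C1. (\<forall>x\<in>S. g x = f x) \<longrightarrow> g \<in> {g \<in> C1. \<phi> g \<in> V})"
    proof (intro exI[of _ "\<Union>(R ` S)"] conjI ballI impI)
      show "finite (\<Union>(R ` S))" "\<Union>(R ` S) \<subseteq> I1" using S R' by blast+
      show "g \<in> {g \<in> C1. \<phi> g \<in> V}" if g: "g \<in> C1" "\<forall>x\<in>\<Union>(R ` S). g x = f x" for g
      proof -
        have "\<phi> g y = \<phi> f y" if "y \<in> S" for y using R'[of y] S(2) g that by auto
        then show ?thesis using S(3) g(1) R by auto
      qed
    qed
  qed auto
  then show ?L
    using R unfolding continuous_map_def topspace_pointwise[OF C1] topspace_pointwise[OF C2] by auto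
qed

lemma limitin_pointwise:
  assumes C: "C \<subseteq> I \<rightarrow>\<^sub>E A"
  shows "limitin (pointwise_topology A I C) f l sequentially \<longleftrightarrow>
    l \<in> C \<and> (\<forall>\<^sub>F n in sequentially. f n \<in> C) \<and> (\<forall>x\<in>I. \<forall>\<^sub>F n in sequentially. f n x = l x)"
proof safe
  assume L: "limitin (pointwise_topology A I C) f l sequentially"
  then show l: "l \<in> C" using C by (auto simp: limitin_def topspace_pointwise)
  have ev: "\<forall>\<^sub>F n in sequentially. f n \<in> U" if "openin (pointwise_topology A I C) U" "l \<in> U" for U
    using L that by (auto simp: limitin_def)
  show "\<forall>\<^sub>F n in sequentially. f n \<in> C"
    by (rule ev) (use l in \<open>auto simp: openin_pointwise[OF C]\<close>)
  fix x assume x: "x \<in> I"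
  have "\<forall>\<^sub>F n in sequentially. f n \<in> {g \<in> C. g x = l x}"
  proof (rule ev)
    show "openin (pointwise_topology A I C) {g \<in> C. g x = l x}"
      unfolding openin_pointwise[OF C] using x by (intro conjI ballI exI[of _ "{x}"]) auto
  qed (use l in auto)
  then show "\<forall>\<^sub>F n in sequentially. f n x = l x" by (rule eventually_mono) auto
next
  assume R: "l \<in> C" "\<forall>\<^sub>F n in sequentially. f n \<in> C" "\<forall>x\<in>I. \<forall>\<^sub>F n in sequentially. f n x = l x"
  have "\<forall>\<^sub>F n in sequentially. f n \<in> U" if U: "openin (pointwise_topology A I C) U" "l \<in> U" for U
  proof -
    obtain S where S: "finite S" "S \<subseteq> I" "\<forall>g\<in>C. (\<forall>x\<in>S. g x = l x) \<longrightarrow> g \<in> U"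
      using U unfolding openin_pointwise[OF C] by blast
    have "\<forall>\<^sub>F n in sequentially. \<forall>x\<in>S. f n x = l x"
      using S R(3) by (intro eventually_ball_finite) auto
    then show ?thesis using R(2) by eventually_elim (use S(3) in auto)
  qed
  then show "limitin (pointwise_topology A I C) f l sequentially"
    using R(1) C by (auto simp: limitin_def topspace_pointwise)
qed

section \<open>Digits of p-adic integers and homomorphisms into them\<close>

lemma Zp_carrier_PiE: "carrier (Zp p) \<subseteq> UNIV \<rightarrow>\<^sub>E UNIV"
  by auto

lemma Zp_carrier: "a \<in> carrier (Zp p) \<longleftrightarrow> (\<forall>n. a n \<in> {0..<int p ^ n} \<and> a (Suc n) mod int p ^ n = a n)"
  by (simp add: Zp_def)

lemma Zp_mod: "a \<in> carrier (Zp p) \<Longrightarrow> a n mod int p ^ n = a n"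
  by (simp add: Zp_carrier)

lemma Zp_coherent:
  assumes "a \<in> carrier (Zp p)" "n \<le> m" shows "a m mod int p ^ n = a n"
  using assms(2)
proof (induction m rule: dec_induct)
  case base
  then show ?case using Zp_mod[OF assms(1)] .
next
  case (step m)
  have "a (Suc m) mod int p ^ n = a (Suc m) mod int p ^ m mod int p ^ n"
    using step(1) by (simp add: mod_mod_cancel le_imp_power_dvd)
  then show ?case using step assms(1) by (simp add: Zp_carrier)
qed

lemma Zp_add: "(a \<otimes>\<^bsub>add_monoid (Zp p)\<^esub> b) n = (a n + b n) mod int p ^ n"
  by (simp add: Zp_def)

lemma hom_Zp_one:
  assumes "group G" "\<phi> \<in> hom G (add_monoid (Zp p))" shows "\<phi> \<one>\<^bsub>G\<^esub> n = 0"
proof -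
  interpret group G by fact
  let ?a = "\<phi> \<one>\<^bsub>G\<^esub>"
  have "?a = ?a \<otimes>\<^bsub>add_monoid (Zp p)\<^esub> ?a" using hom_mult[OF assms(2) one_closed one_closed] by simp
  then have "?a n = (?a n + ?a n) mod int p ^ n" using Zp_add by metis
  moreover have "?a \<in> carrier (Zp p)" using hom_in_carrier[OF assms(2) one_closed] by simp
  then have "0 \<le> ?a n" "?a n < int p ^ n" by (auto simp: Zp_carrier)
  ultimately show ?thesis
    by (smt (verit) minus_mod_self2 mod_pos_pos_trivial)
qed

lemma hom_Zp_pow:
  assumes "group G" "\<phi> \<in> hom G (add_monoid (Zp p))" "g \<in> carrier G"
  shows "\<phi> (g [^]\<^bsub>G\<^esub> (k::nat)) n = (int k * \<phi> g n) mod int p ^ n"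
proof -
  interpret group G by fact
  show ?thesis
  proof (induction k)
    case 0
    then show ?case using hom_Zp_one[OF assms(1,2)] by simp
  next
    case (Suc k)
    have "\<phi> (g [^]\<^bsub>G\<^esub> Suc k) = \<phi> (g [^]\<^bsub>G\<^esub> k) \<otimes>\<^bsub>add_monoid (Zp p)\<^esub> \<phi> g"
      using assms(3) hom_mult[OF assms(2)] by simp
    then have "\<phi> (g [^]\<^bsub>G\<^esub> Suc k) n = (\<phi> (g [^]\<^bsub>G\<^esub> k) n + \<phi> g n) mod int p ^ n"
      by (simp only: Zp_add)
    then show ?case using Suc by (simp add: mod_simps algebra_simps)
  qed
qed

lemma (in field_extension) Gal_PiE: "carrier G \<subseteq> L \<rightarrow>\<^sub>E L"
  using Gal_closed by (auto simp: carrier_Gal PiE_def)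

lemmas (in field_extension) limitin_krull = limitin_pointwise[OF Gal_PiE, folded krull_topology_def]
lemmas (in field_extension) continuous_krull_Zp = continuous_map_pointwise[OF Gal_PiE Zp_carrier_PiE, folded krull_topology_def Zp_topology_def]
lemmas (in field_extension) continuous_Zp_krull = continuous_map_pointwise[OF Zp_carrier_PiE Gal_PiE, folded krull_topology_def Zp_topology_def]
lemmas (in field_extension) topspace_krull = topspace_pointwise[OF Gal_PiE, folded krull_topology_def]

lemma topspace_Zp: "topspace (Zp_topology p) = carrier (Zp p)"
  unfolding Zp_topology_def by (rule topspace_pointwise[OF Zp_carrier_PiE])

lemma Zp_extensionD:
  assumes "Zp_extension p K M"
  shows "galois_extension M K" "field_extension M K" "K \<subseteq> M" "alg_subfield M"
  using assms by (auto simp: Zp_extension_def galois_extension_def subfield_Qbar_iff field_extension_def)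

lemma Zp_extension_commute:
  assumes M: "Zp_extension p K M" and "\<sigma> \<in> carrier (Gal M K)" "\<tau> \<in> carrier (Gal M K)"
  shows "\<sigma> \<otimes>\<^bsub>Gal M K\<^esub> \<tau> = \<tau> \<otimes>\<^bsub>Gal M K\<^esub> \<sigma>"
proof -
  interpret field_extension M K using Zp_extensionD[OF M] by simp
  interpret group G by (rule group_Gal)
  obtain \<phi> where phi: "\<phi> \<in> iso G (add_monoid (Zp p))" using M by (auto simp: Zp_extension_def)
  have "\<phi> (\<sigma> \<otimes>\<^bsub>G\<^esub> \<tau>) = \<phi> (\<tau> \<otimes>\<^bsub>G\<^esub> \<sigma>)"
    using assms(2,3) hom_mult[of \<phi> G "add_monoid (Zp p)"] phi
    by (auto simp: iso_def Zp_def add.commute)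
  then show ?thesis
    using phi assms(2,3) by (auto simp: iso_def bij_betw_def dest!: inj_onD)
qed

text \<open>By continuity of the inverse of the isomorphism, \<open>\<sigma> x\<close> depends on
  finitely many digits of the image of \<open>\<sigma>\<close>. Multiplication by
  \<open>p ^ m\<close> kills all digits up to level \<open>m\<close>.\<close>

lemma Zp_extension_pow:
  assumes M: "Zp_extension p K M" and s: "\<sigma> \<in> carrier (Gal M K)" and x: "x \<in> M"
  shows "\<exists>m. (\<sigma> ^^ (p ^ m)) x = x"
proof -
  interpret field_extension M K using Zp_extensionD[OF M] by simp
  interpret group G by (rule group_Gal)
  obtain \<phi> where phi: "\<phi> \<in> iso G (add_monoid (Zp p))"
      "homeomorphic_map (krull_topology M K) (Zp_topology p) \<phi>"
    using M by (auto simp: Zp_extension_def)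
  then have hom: "\<phi> \<in> hom G (add_monoid (Zp p))" by (simp add: iso_def)
  obtain \<psi> where psi: "continuous_map (Zp_topology p) (krull_topology M K) \<psi>"
    "\<And>\<tau>. \<tau> \<in> carrier G \<Longrightarrow> \<psi> (\<phi> \<tau>) = \<tau>"
    using phi(2) unfolding homeomorphic_map_maps homeomorphic_maps_def topspace_krull by blast
  have ph: "\<phi> \<tau> \<in> carrier (Zp p)" if "\<tau> \<in> carrier G" for \<tau> using hom_in_carrier[OF hom that] by simp
  obtain S where S: "finite S" "\<And>b. b \<in> carrier (Zp p) \<Longrightarrow> (\<forall>i\<in>S. b i = \<phi> \<one>\<^bsub>G\<^esub> i) \<Longrightarrow> \<psi> b x = \<psi> (\<phi> \<one>\<^bsub>G\<^esub>) x"
    using psi(1) ph[OF one_closed] x unfolding continuous_Zp_krull by metis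
  define m where "m = Max (insert 0 S)"
  have m: "i \<le> m" if "i \<in> S" for i using that S(1) unfolding m_def by (intro Max_ge) auto
  let ?t = "\<sigma> [^]\<^bsub>G\<^esub> (p ^ m)"
  have t: "?t \<in> carrier G" using s by simp
  have "\<phi> ?t i = 0" if "i \<in> S" for i
  proof -
    have "int p ^ i dvd int p ^ m" using m[OF that] by (rule le_imp_power_dvd)
    then show ?thesis unfolding hom_Zp_pow[OF group_Gal hom s] by auto
  qed
  then have "\<psi> (\<phi> ?t) x = \<psi> (\<phi> \<one>\<^bsub>G\<^esub>) x"
    using S(2)[OF ph[OF t]] hom_Zp_one[OF group_Gal hom] by simp
  then have "?t x = x" using psi(2)[OF t] psi(2)[OF one_closed] Gal_one_apply[OF x] by simp
  then show ?thesis using Gal_pow_apply[OF s x] by auto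
qed

lemma funpow_fixed: "(f ^^ n) x = x \<Longrightarrow> (f ^^ (n * k)) x = x"
  by (induction k) (auto simp: funpow_add)

lemma funpow_fixed_le:
  assumes "(f ^^ (p ^ m)) x = x" "m \<le> n" shows "(f ^^ (p ^ n)) x = x"
proof -
  have "p ^ n = p ^ m * p ^ (n - m)" using assms(2) by (simp add: power_add[symmetric])
  then show ?thesis using funpow_fixed[OF assms(1)] by metis
qed

lemma funpow_odd_fixed:
  assumes "(f ^^ 2) x = x" "(f ^^ n) x = x" "odd n" shows "f x = x"
proof -
  obtain k where "n = Suc (2 * k)" using assms(3) by (elim oddE) auto
  then show ?thesis using assms(2) funpow_fixed[OF assms(1), of k] by simp
qed

section \<open>The compositum of all Z_p-extensions and its Galois group\<close>

locale base_field =
  fixes K :: "complex set" and p :: nat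
  assumes K: "alg_subfield K"
begin

definition T :: "complex set" where "T = Ktilde p K"

lemma gens_alg: "K \<union> \<Union> {M. Zp_extension p K M} \<subseteq> Qb"
  using Zp_extensionD(4)[of p K] alg_subfield_algebraic K by blast

lemma T_alg: "alg_subfield T"
  unfolding T_def Ktilde_def by (rule alg_subfield_generate[OF gens_alg])

lemma K_sub_T: "K \<subseteq> T" and M_sub_T: "Zp_extension p K M \<Longrightarrow> M \<subseteq> T"
  using generate_superset[OF gens_alg] unfolding T_def Ktilde_def by auto

text \<open>Serves as an induction principle: a property holds on all of \<open>T\<close> once the
  elements that have it form a field containing \<open>K\<close> and each Z_p-extension.\<close>

lemma T_least:
  assumes "alg_subfield F" "K \<subseteq> F" "\<And>M. Zp_extension p K M \<Longrightarrow> M \<subseteq> F" shows "T \<subseteq> F"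
  unfolding T_def Ktilde_def using assms by (intro generate_least[OF gens_alg]) auto

sublocale T: field_extension T K
  using K T_alg K_sub_T by unfold_locales

lemma Aut_add: "\<sigma> \<in> Aut K \<Longrightarrow> algebraic x \<Longrightarrow> algebraic y \<Longrightarrow> \<sigma> (x + y) = \<sigma> x + \<sigma> y"
  and Aut_mult: "\<sigma> \<in> Aut K \<Longrightarrow> algebraic x \<Longrightarrow> algebraic y \<Longrightarrow> \<sigma> (x * y) = \<sigma> x * \<sigma> y"
  and Aut_fix: "\<sigma> \<in> Aut K \<Longrightarrow> x \<in> K \<Longrightarrow> \<sigma> x = x"
  by (auto simp: Aut_def alg_hom_def)

lemma Aut_rat: "\<sigma> \<in> Aut K \<Longrightarrow> q \<in> \<rat> \<Longrightarrow> \<sigma> q = q"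
  using Aut_fix alg_subfield_rat[OF K] by blast

lemma restrict_Aut: "Zp_extension p K M \<Longrightarrow> \<tau> \<in> Aut K \<Longrightarrow> restrict \<tau> M \<in> carrier (Gal M K)"
  using field_extension.restrict_Gal[OF Zp_extensionD(2) alg_homo_Aut[OF K]]
    field_extension.galois_extension_normal[OF Zp_extensionD(2) Zp_extensionD(1)]
    alg_subfield_algebraic[OF Zp_extensionD(4)] by blast

lemma Aut_T: assumes t: "\<tau> \<in> Aut K" shows "\<tau> ` T \<subseteq> T"
proof -
  have "T \<subseteq> {x \<in> Qb. \<tau> x \<in> T}"
  proof (rule T_least)
    show "alg_subfield {x \<in> Qb. \<tau> x \<in> T}"
      using Aut_rat[OF t] Aut_add[OF t] Aut_mult[OF t] alg_subfield_rat[OF T_alg]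
        alg_subfield_add[OF T_alg] alg_subfield_mult[OF T_alg]
      by (auto simp: alg_subfield_def rat_imp_algebraic algebraic_add algebraic_mult)
    show "K \<subseteq> {x \<in> Qb. \<tau> x \<in> T}" using Aut_fix[OF t] K_sub_T alg_subfield_algebraic[OF K] by auto
    fix M assume M: "Zp_extension p K M"
    show "M \<subseteq> {x \<in> Qb. \<tau> x \<in> T}"
      using field_extension.galois_extension_normal[OF Zp_extensionD(2,1)[OF M] t] M_sub_T[OF M]
        alg_subfield_algebraic[OF Zp_extensionD(4)[OF M]] by blast
  qed
  then show ?thesis by auto
qed

lemma T_galois: "galois_extension T K"
  by (rule T.normal_galois_extension[OF Aut_T])

sublocale TA: galois_action "carrier (Gal T K)" T K
  by (rule T.galois_action_Gal[OF T_galois])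

lemma Aut_commute_T:
  assumes s: "\<sigma> \<in> Aut K" and t: "\<tau> \<in> Aut K" and "x \<in> T" shows "\<sigma> (\<tau> x) = \<tau> (\<sigma> x)"
proof -
  have "T \<subseteq> {x \<in> Qb. \<sigma> (\<tau> x) = \<tau> (\<sigma> x)}"
  proof (rule T_least)
    show "alg_subfield {x \<in> Qb. \<sigma> (\<tau> x) = \<tau> (\<sigma> x)}"
      by (auto simp: alg_subfield_def rat_imp_algebraic algebraic_add algebraic_mult
          Aut_rat[OF s] Aut_rat[OF t] Aut_add[OF s] Aut_add[OF t] Aut_mult[OF s] Aut_mult[OF t]
          Aut_algebraic[OF K s] Aut_algebraic[OF K t])
    show "K \<subseteq> {x \<in> Qb. \<sigma> (\<tau> x) = \<tau> (\<sigma> x)}"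
      using Aut_fix[OF s] Aut_fix[OF t] alg_subfield_algebraic[OF K] by auto
    fix M assume M: "Zp_extension p K M"
    interpret M: field_extension M K by (rule Zp_extensionD(2)[OF M])
    have "\<sigma> (\<tau> x) = \<tau> (\<sigma> x)" if "x \<in> M" for x
      using arg_cong[OF Zp_extension_commute[OF M restrict_Aut[OF M s] restrict_Aut[OF M t]], of "\<lambda>f. f x"]
        that M.Gal_closed[OF restrict_Aut[OF M s] that] M.Gal_closed[OF restrict_Aut[OF M t] that]
      by (simp add: M.Gal_mult_apply restrict_Aut[OF M] s t)
    then show "M \<subseteq> {x \<in> Qb. \<sigma> (\<tau> x) = \<tau> (\<sigma> x)}"
      using alg_subfield_algebraic[OF Zp_extensionD(4)[OF M]] by auto
  qed
  then show ?thesis using assms(3) by auto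
qed

lemma Aut_pow_T:
  assumes t: "\<tau> \<in> Aut K" and "x \<in> T" shows "\<exists>m. (\<tau> ^^ (p ^ m)) x = x"
proof -
  let ?F = "{x \<in> Qb. \<exists>m. (\<tau> ^^ (p ^ m)) x = x}"
  have "T \<subseteq> ?F"
  proof (rule T_least)
    show "alg_subfield ?F"
      unfolding alg_subfield_def
    proof (intro conjI ballI)
      show "\<rat> \<subseteq> ?F" using Aut_rat[OF Aut_funpow[OF K t]] by (auto simp: rat_imp_algebraic)
      fix x y assume "x \<in> ?F" "y \<in> ?F"
      then obtain m n where mn: "(\<tau> ^^ (p ^ m)) x = x" "(\<tau> ^^ (p ^ n)) y = y" and alg: "algebraic x" "algebraic y" by auto
      let ?k = "\<tau> ^^ (p ^ max m n)"
      have "?k x = x" "?k y = y" using funpow_fixed_le mn by (metis max.cobounded1 max.cobounded2)+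
      then have "?k (x + y) = x + y" "?k (x * y) = x * y"
        using Aut_add[OF Aut_funpow[OF K t] alg] Aut_mult[OF Aut_funpow[OF K t] alg] by simp_all
      then show "x + y \<in> ?F" "x * y \<in> ?F" using alg by (auto simp: algebraic_add algebraic_mult)
    qed auto
    show "K \<subseteq> ?F" using Aut_fix[OF Aut_funpow[OF K t]] alg_subfield_algebraic[OF K] by auto
    fix M assume M: "Zp_extension p K M"
    interpret M: field_extension M K by (rule Zp_extensionD(2)[OF M])
    have "\<exists>m. (\<tau> ^^ (p ^ m)) x = x" if x: "x \<in> M" for x
    proof -
      have "(restrict \<tau> M ^^ n) x = (\<tau> ^^ n) x \<and> (\<tau> ^^ n) x \<in> M" for n
        using x M.Gal_closed[OF restrict_Aut[OF M t]] by (induction n) auto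
      then show ?thesis using Zp_extension_pow[OF M restrict_Aut[OF M t] x] by simp
    qed
    then show "M \<subseteq> ?F" using alg_subfield_algebraic[OF Zp_extensionD(4)[OF M]] by auto
  qed
  then show ?thesis using assms(2) by auto
qed

lemma Gal_T_extend:
  assumes "\<sigma> \<in> carrier (Gal T K)"
  obtains \<tau> where "\<tau> \<in> Aut K" "\<And>x. x \<in> T \<Longrightarrow> \<tau> x = \<sigma> x"
  using extend_to_Aut[OF T.Gal_alg_homo[OF assms]] by blast

lemma Gal_T_commute:
  assumes s: "\<sigma> \<in> carrier (Gal T K)" and t: "\<tau> \<in> carrier (Gal T K)" and x: "x \<in> T"
  shows "\<sigma> (\<tau> x) = \<tau> (\<sigma> x)"
proof -
  obtain s' t' where st: "s' \<in> Aut K" "\<And>x. x \<in> T \<Longrightarrow> s' x = \<sigma> x" "t' \<in> Aut K" "\<And>x. x \<in> T \<Longrightarrow> t' x = \<tau> x"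
    using Gal_T_extend[OF s] Gal_T_extend[OF t] by metis
  show ?thesis
    using Aut_commute_T[OF st(1,3) x] st(2,4) T.Gal_closed[OF s x] T.Gal_closed[OF t x] x by simp
qed

lemma Gal_T_pow:
  assumes s: "\<sigma> \<in> carrier (Gal T K)" and x: "x \<in> T" shows "\<exists>m. (\<sigma> ^^ (p ^ m)) x = x"
proof -
  obtain s' where st: "s' \<in> Aut K" "\<And>x. x \<in> T \<Longrightarrow> s' x = \<sigma> x"
    using Gal_T_extend[OF s] by metis
  have "(s' ^^ n) x = (\<sigma> ^^ n) x \<and> (\<sigma> ^^ n) x \<in> T" for n
    using x T.Gal_closed[OF s] st(2) by (induction n) auto
  then show ?thesis using Aut_pow_T[OF st(1) x] by simp
qed

end

section \<open>Imaginary quadratic fields and complex conjugation\<close>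

lemma Rats_Reals_complex: "x \<in> \<rat> \<Longrightarrow> (x::complex) \<in> \<real>"
  by (elim Rats_cases') auto

text \<open>A non-real \<open>t\<close> in \<open>K\<close> spans \<open>K\<close> together with 1.
  Completing the square in the quadratic equation of \<open>t\<close> gives a generator
  \<open>s\<close> with rational square; it is not real, hence purely imaginary, and conjugation
  negates it.\<close>

lemma imaginary_quadraticE:
  assumes "imaginary_quadratic K"
  obtains s where "alg_subfield K" "s \<in> K" "s\<^sup>2 \<in> \<rat>" "cnj s = - s" "s \<noteq> 0"
    "K = {a + b * s | a b. a \<in> \<rat> \<and> b \<in> \<rat>}"
proof -
  have K: "alg_subfield K" and dim: "ring.dimension Qbar 2 \<rat> K" and "\<not> K \<subseteq> \<real>"
    using assms by (auto simp: imaginary_quadratic_def subfield_Qbar_iff)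
  then obtain t where t: "t \<in> K" "t \<notin> \<real>" by blast
  interpret Q: ring Qbar by (rule ring_Qbar)
  note sQ = subfield_Qbar_iff[THEN iffD2, OF alg_subfield_Rats]
  obtain v E where vE: "Q.dimension (Suc 0) \<rat> E" "K = Q.line_extension \<rat> v E"
    using Q.dimension_backwards[OF sQ dim[unfolded numeral_2_eq_2]] by auto
  obtain w E' where wE: "Q.dimension 0 \<rat> E'" "E = Q.line_extension \<rat> w E'"
    using Q.dimension_backwards[OF sQ vE(1)] by auto
  have E': "E' = {0}" using Q.dimension_zero[OF sQ wE(1)] by simp
  have span: "\<exists>a\<in>\<rat>. \<exists>b\<in>\<rat>. x = a * v + b * w" if "x \<in> K" for x
  proof -
    obtain a y where y: "a \<in> \<rat>" "y \<in> E" "x = a * v + y"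
      using \<open>x \<in> K\<close> Q.line_extension_mem_iff[of x \<rat> v E] vE(2) by auto
    then obtain b where "b \<in> \<rat>" "y = b * w"
      using Q.line_extension_mem_iff[of y \<rat> w E'] wE(2) E' by auto
    with y show ?thesis by blast
  qed
  obtain a b where ab: "a \<in> \<rat>" "b \<in> \<rat>" "1 = a * v + b * w" using span[OF alg_subfield_numerals(2)[OF K]] by blast
  obtain c d where cd: "c \<in> \<rat>" "d \<in> \<rat>" "t = c * v + d * w" using span[OF t(1)] by blast
  \<comment> \<open>The determinant of the coordinates of 1 and \<open>t\<close> with respect to
    \<open>v\<close> and \<open>w\<close>; if it vanished, \<open>t\<close> would be rational.
    Cramer's rule then replaces \<open>v\<close> and \<open>w\<close> by 1 and
    \<open>t\<close>.\<close>
  define \<Delta> where "\<Delta> = a * d - b * c"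
  have v: "d - b * t = \<Delta> * v" and w: "a * t - c = \<Delta> * w"
  proof -
    have "d - b * t = d * (a * v + b * w) - b * t" using ab(3) by simp
    then show "d - b * t = \<Delta> * v" unfolding cd(3) \<Delta>_def by (simp add: algebra_simps)
    have "a * t - c = a * t - c * (a * v + b * w)" using ab(3) by simp
    then show "a * t - c = \<Delta> * w" unfolding cd(3) \<Delta>_def by (simp add: algebra_simps)
  qed
  have Rt: "x \<in> \<real>" if "x \<in> \<rat>" for x :: complex using that by (rule Rats_Reals_complex)
  have nz: "\<Delta> \<noteq> 0"
  proof
    assume "\<Delta> = 0"
    then have e: "b * t = d" "a * t = c" using v w by auto
    have "a \<noteq> 0 \<or> b \<noteq> 0" using ab(3) by auto
    then have "t = c / a \<or> t = d / b" using e by (auto simp: field_simps)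
    then have "t \<in> \<rat>" using ab cd by auto
    then show False using Rt t(2) by blast
  qed
  have DQ: "\<Delta> \<in> \<rat>" using ab cd by (simp add: \<Delta>_def)
  have span_t: "\<exists>q\<in>\<rat>. \<exists>r\<in>\<rat>. x = q + r * t" if "x \<in> K" for x
  proof -
    obtain e f where ef: "e \<in> \<rat>" "f \<in> \<rat>" "x = e * v + f * w" using span \<open>x \<in> K\<close> by blast
    have "\<Delta> * x = e * (\<Delta> * v) + f * (\<Delta> * w)" by (simp add: ef(3) algebra_simps)
    also have "\<dots> = (e * d - f * c) + (f * a - e * b) * t" unfolding v[symmetric] w[symmetric] by (simp add: algebra_simps)
    finally have "x = ((e * d - f * c) + (f * a - e * b) * t) / \<Delta>" using nz by (simp add: eq_divide_eq mult.commute)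
    then have "x = (e * d - f * c) / \<Delta> + (f * a - e * b) / \<Delta> * t" by (simp add: add_divide_distrib)
    then show ?thesis using ef ab cd DQ by (intro bexI[of _ "(e * d - f * c) / \<Delta>"] bexI[of _ "(f * a - e * b) / \<Delta>"]) auto
  qed
  obtain q r where qr: "q \<in> \<rat>" "r \<in> \<rat>" "t\<^sup>2 = q + r * t"
    using span_t[of "t\<^sup>2"] alg_subfield_power[OF K t(1)] by blast
  define s where "s = t - r / 2"
  have "s\<^sup>2 = t\<^sup>2 - r * t + r\<^sup>2 / 4"
    unfolding s_def power2_diff by (simp add: power_divide)
  then have s2: "s\<^sup>2 = q + r\<^sup>2 / 4" unfolding qr(3) by simp
  then have s2Q: "s\<^sup>2 \<in> \<rat>" using qr by simp
  have rR: "r / 2 \<in> \<real>" using Rt qr(2) by simp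
  have "Im s \<noteq> 0"
  proof
    assume "Im s = 0"
    then have "s + r / 2 \<in> \<real>" using rR by (intro Reals_add) (simp_all add: complex_is_Real_iff)
    then show False using t(2) by (simp add: s_def)
  qed
  moreover have "Im (s\<^sup>2) = 0" using Rt[OF s2Q] by (simp add: complex_is_Real_iff)
  \<comment> \<open>The imaginary part of \<open>s\<^sup>2\<close> is
    \<open>2 * Re s * Im s\<close>.\<close>
  ultimately have "Re s = 0" by (simp add: power2_eq_square)
  then have cs: "cnj s = - s" by (simp add: complex_eq_iff)
  have sK: "s \<in> K"
    unfolding s_def by (rule alg_subfield_diff[OF K t(1) alg_subfield_rat[OF K]]) (use qr(2) in simp)
  have "K = {a + b * s | a b. a \<in> \<rat> \<and> b \<in> \<rat>}"
  proof (rule subset_antisym; intro subsetI)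
    fix x assume "x \<in> K"
    then obtain e f where ef: "e \<in> \<rat>" "f \<in> \<rat>" "x = e + f * t" using span_t by blast
    then have "x = (e + f * (r / 2)) + f * s" by (simp add: s_def algebra_simps)
    then show "x \<in> {a + b * s | a b. a \<in> \<rat> \<and> b \<in> \<rat>}"
      using ef qr by (intro CollectI exI[of _ "e + f * (r / 2)"] exI[of _ f]) auto
  next
    fix x assume "x \<in> {a + b * s | a b. a \<in> \<rat> \<and> b \<in> \<rat>}"
    then show "x \<in> K" using sK alg_subfield_rat[OF K] alg_subfield_add[OF K] alg_subfield_mult[OF K] by auto
  qed
  moreover have "s \<noteq> 0" using \<open>Im s \<noteq> 0\<close> by auto
  ultimately show thesis using that K sK s2Q cs by blast
qed

section \<open>Complex conjugation of fields and automorphisms\<close>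

lemma cnj_Rats: "x \<in> \<rat> \<Longrightarrow> cnj x = x"
  using Rats_Reals_complex Reals_cnj_iff by blast

lemma algebraic_cnj: "algebraic x \<Longrightarrow> algebraic (cnj x)"
proof -
  assume "algebraic x"
  then obtain p where p: "p \<noteq> 0" "poly p x = 0" "\<And>i. coeff p i \<in> \<rat>" using algebraic_Rats_poly by blast
  have "map_poly cnj p = p" using p(3) cnj_Rats by (intro poly_eqI) (simp add: coeff_map_poly)
  then have "poly p (cnj x) = cnj (poly p x)" by (metis poly_cnj)
  then show ?thesis using p by (auto intro!: algebraicI')
qed

lemma alg_subfield_cnj: "alg_subfield F \<Longrightarrow> alg_subfield (cnj ` F)"
  unfolding alg_subfield_def
proof safe
  fix x :: complex assume "\<rat> \<subseteq> F" "x \<in> \<rat>"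
  then show "x \<in> cnj ` F" using cnj_Rats[of x] by (metis image_eqI subsetD)
qed (auto simp: algebraic_cnj simp flip: complex_cnj_add complex_cnj_mult)

lemma alg_homo_cnj:
  assumes "alg_homo K F \<sigma>" "cnj ` K = K"
  shows "alg_homo K (cnj ` F) (\<lambda>x. cnj (\<sigma> (cnj x)))"
proof -
  interpret alg_homo K F \<sigma> by fact
  have "cnj k \<in> K" if "k \<in> K" for k using assms(2) that by blast
  moreover have "K \<subseteq> cnj ` F" using assms(2) K_sub by blast
  ultimately show ?thesis
    using K alg_subfield_cnj[OF F]
    by unfold_locales (auto simp: alg_hom_def add mult fix_K simp flip: complex_cnj_add complex_cnj_mult)
qed

lemma Aut_cnj:
  assumes "alg_subfield K" "cnj ` K = K" "\<tau> \<in> Aut K" shows "(\<lambda>x. cnj (\<tau> (cnj x))) \<in> Aut K"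
proof -
  have "cnj ` Qb = Qb" using algebraic_cnj by (auto simp: image_iff) (metis algebraic_cnj complex_cnj_cnj)
  then show ?thesis
    using alg_homo.hom[OF alg_homo_cnj[OF alg_homo_Aut[OF assms(1,3)] assms(2)]] by (simp add: Aut_def)
qed

lemma conj_act_apply: "x \<in> L \<Longrightarrow> conj_act L \<sigma> x = cnj (\<sigma> (cnj x))"
  by (simp add: conj_act_def)

context
  fixes K L L' :: "complex set"
  assumes ext: "field_extension L K" "field_extension L' K" and K_cnj: "cnj ` K = K" and L': "L' = cnj ` L"
begin

lemma cnj_mem: "x \<in> L \<Longrightarrow> cnj x \<in> L'" "x \<in> L' \<Longrightarrow> cnj x \<in> L"
  using L' by auto

text \<open>The fields \<open>L\<close> and \<open>L'\<close> are kept apart because a single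
  Z_p-extension need not be stable under conjugation; only their compositum is.\<close>

lemma conj_act_Gal:
  assumes "\<sigma> \<in> carrier (Gal L' K)" shows "conj_act L \<sigma> \<in> carrier (Gal L K)"
proof -
  have "alg_homo K L (\<lambda>x. cnj (\<sigma> (cnj x)))"
    using alg_homo_cnj[OF field_extension.Gal_alg_homo[OF ext(2) assms] K_cnj] by (simp add: L' image_image)
  then have "restrict (\<lambda>x. cnj (\<sigma> (cnj x))) L \<in> carrier (Gal L K)"
    by (rule field_extension.restrict_Gal[OF ext(1)]) (use field_extension.Gal_closed[OF ext(2) assms] cnj_mem in auto)
  then show ?thesis by (simp add: conj_act_def)
qed

lemma conj_act_mult:
  assumes s: "\<sigma> \<in> carrier (Gal L' K)" and t: "\<tau> \<in> carrier (Gal L' K)"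
  shows "conj_act L (\<sigma> \<otimes>\<^bsub>Gal L' K\<^esub> \<tau>) = conj_act L \<sigma> \<otimes>\<^bsub>Gal L K\<^esub> conj_act L \<tau>"
proof (rule field_extension.Gal_eqI[OF ext(1)])
  show "conj_act L (\<sigma> \<otimes>\<^bsub>Gal L' K\<^esub> \<tau>) \<in> carrier (Gal L K)"
    using conj_act_Gal group.is_monoid[OF field_extension.group_Gal[OF ext(2)]] s t by (simp add: monoid.m_closed)
  show "conj_act L \<sigma> \<otimes>\<^bsub>Gal L K\<^esub> conj_act L \<tau> \<in> carrier (Gal L K)"
    using conj_act_Gal[OF s] conj_act_Gal[OF t] group.is_monoid[OF field_extension.group_Gal[OF ext(1)]]
    by (simp add: monoid.m_closed)
  fix x assume x: "x \<in> L"
  then have "cnj (\<tau> (cnj x)) \<in> L" using cnj_mem field_extension.Gal_closed[OF ext(2) t] by blast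
  then show "conj_act L (\<sigma> \<otimes>\<^bsub>Gal L' K\<^esub> \<tau>) x = (conj_act L \<sigma> \<otimes>\<^bsub>Gal L K\<^esub> conj_act L \<tau>) x"
    using x cnj_mem by (simp add: conj_act_apply field_extension.Gal_mult_apply[OF ext(1)]
        field_extension.Gal_mult_apply[OF ext(2)] conj_act_Gal s t)
qed

lemma conj_act_conj_act:
  assumes s: "\<sigma> \<in> carrier (Gal L' K)" shows "conj_act L' (conj_act L \<sigma>) = \<sigma>"
proof -
  have "\<sigma> \<in> extensional L'" using s field_extension.carrier_Gal[OF ext(2)] by blast
  then show ?thesis
    by (intro extensionalityI[of _ L']) (auto simp: conj_act_def L')
qed

lemma continuous_conj_act: "continuous_map (krull_topology L' K) (krull_topology L K) (conj_act L)"
  unfolding krull_topology_def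
    continuous_map_pointwise[OF field_extension.Gal_PiE[OF ext(2)] field_extension.Gal_PiE[OF ext(1)]]
proof (intro conjI ballI)
  show "conj_act L ` carrier (Gal L' K) \<subseteq> carrier (Gal L K)" using conj_act_Gal by blast
  show "\<exists>S. finite S \<and> S \<subseteq> L' \<and> (\<forall>g\<in>carrier (Gal L' K). (\<forall>x\<in>S. g x = f x) \<longrightarrow> conj_act L g y = conj_act L f y)"
    if "y \<in> L" for f y
    using that cnj_mem by (intro exI[of _ "{cnj y}"]) (auto simp: conj_act_apply)
qed

end

lemma Zp_extension_cnj:
  assumes M: "Zp_extension p K M" and K_cnj: "cnj ` K = K" shows "Zp_extension p K (cnj ` M)"
proof -
  define M' where "M' = cnj ` M"
  have MM': "M = cnj ` M'" by (simp add: M'_def image_image)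
  interpret M: field_extension M K using Zp_extensionD[OF M] by simp
  have K_sub: "K \<subseteq> M'" using M.K_sub K_cnj unfolding M'_def by blast
  interpret M': field_extension M' K
    using M.K K_sub alg_subfield_cnj[OF M.L] by unfold_locales (auto simp: M'_def)
  note e = M.field_extension_axioms M'.field_extension_axioms K_cnj M'_def
  note e' = M'.field_extension_axioms M.field_extension_axioms K_cnj MM'
  have gal: "galois_extension M' K"
  proof (rule M'.normal_galois_extension)
    fix \<tau> assume "\<tau> \<in> Aut K"
    from M.galois_extension_normal[OF Zp_extensionD(1)[OF M] Aut_cnj[OF M.K K_cnj this]]
    have "cnj (\<tau> (cnj x)) \<in> M" if "x \<in> M" for x using that by auto
    then show "\<tau> ` M' \<subseteq> M'" unfolding M'_def by (auto simp: image_iff) (metis complex_cnj_cnj)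
  qed
  obtain \<phi> where phi: "\<phi> \<in> iso (Gal M K) (add_monoid (Zp p))"
    "homeomorphic_map (krull_topology M K) (Zp_topology p) \<phi>"
    using M by (auto simp: Zp_extension_def)
  have "conj_act M \<in> iso (Gal M' K) (Gal M K)"
  proof (rule isoI)
    show "conj_act M \<in> hom (Gal M' K) (Gal M K)"
      by (rule homI) (use conj_act_Gal[OF e] conj_act_mult[OF e] in auto)
    show "bij_betw (conj_act M) (carrier (Gal M' K)) (carrier (Gal M K))"
      by (rule bij_betw_byWitness[of _ "conj_act M'"])
         (use conj_act_Gal[OF e] conj_act_Gal[OF e'] conj_act_conj_act[OF e] conj_act_conj_act[OF e'] in auto)
  qed
  from iso_set_trans[OF this phi(1)]
  have iso: "\<phi> \<circ> conj_act M \<in> iso (Gal M' K) (add_monoid (Zp p))" .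
  have "homeomorphic_maps (krull_topology M' K) (krull_topology M K) (conj_act M) (conj_act M')"
    unfolding homeomorphic_maps_def M.topspace_krull M'.topspace_krull
    using continuous_conj_act[OF e] continuous_conj_act[OF e'] conj_act_conj_act[OF e] conj_act_conj_act[OF e']
    by auto
  then have "homeomorphic_map (krull_topology M' K) (krull_topology M K) (conj_act M)"
    by (auto simp: homeomorphic_map_maps)
  from homeomorphic_map_compose[OF this phi(2)] iso gal show ?thesis
    unfolding Zp_extension_def M'_def[symmetric] by blast
qed

lemma (in base_field) T_cnj:
  assumes "cnj ` K = K" shows "cnj ` T = T"
proof -
  have "T \<subseteq> cnj ` T"
  proof (rule T_least)
    show "alg_subfield (cnj ` T)" by (rule alg_subfield_cnj[OF T_alg])
    show "K \<subseteq> cnj ` T" using assms K_sub_T by blast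
    fix M assume "Zp_extension p K M"
    from M_sub_T[OF Zp_extension_cnj[OF this assms]] show "M \<subseteq> cnj ` T"
      by (metis (no_types, opaque_lifting) complex_cnj_cnj image_eqI image_subset_iff subsetI)
  qed
  moreover from this have "cnj ` T \<subseteq> cnj ` (cnj ` T)" by (rule image_mono)
  ultimately show ?thesis by (auto simp: image_image)
qed

section \<open>Powers in the units modulo powers of 3\<close>

lemma one_plus_power_mod_sq: "\<exists>r. (1 + a) ^ j = 1 + int j * a + a\<^sup>2 * r"
proof (induction j)
  case (Suc j)
  then obtain r where r: "(1 + a) ^ j = 1 + int j * a + a\<^sup>2 * r" by blast
  have "(1 + a) ^ Suc j = 1 + int (Suc j) * a + a\<^sup>2 * (int j + r + a * r)"
    unfolding power_Suc r by (simp add: algebra_simps power2_eq_square)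
  then show ?case by blast
qed (auto intro: exI[of _ 0])

text \<open>Cubing raises the 3-adic valuation of \<open>x - 1\<close> by exactly one when that
  valuation is positive: in the expansion of the cube the quadratic and cubic terms are divisible by
  a further factor 3.\<close>

lemma power_three_power:
  fixes s :: int
  assumes "\<not> 3 dvd s"
  shows "\<exists>t. (1 + 3 * s) ^ (3 ^ n) = 1 + 3 ^ Suc n * t \<and> \<not> 3 dvd t"
proof (induction n)
  case 0
  then show ?case using assms by auto
next
  case (Suc n)
  then obtain t where t: "(1 + 3 * s) ^ (3 ^ n) = 1 + 3 ^ Suc n * t" "\<not> 3 dvd t" by blast
  define m :: int where "m = 3 ^ n"
  have "(1 + 3 * s) ^ (3 ^ Suc n) = ((1 + 3 * s) ^ (3 ^ n)) ^ 3"
    by (simp add: power_mult[symmetric] mult.commute)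
  also have "\<dots> = 1 + 3 ^ Suc (Suc n) * (t + 3 * (m * t\<^sup>2 + m * m * t ^ 3))"
    unfolding t(1) by (simp add: m_def[symmetric]) (simp add: algebra_simps power2_eq_square power3_eq_cube)
  finally have "(1 + 3 * s) ^ (3 ^ Suc n) = 1 + 3 ^ Suc (Suc n) * (t + 3 * (m * t\<^sup>2 + m * m * t ^ 3))" .
  moreover have "\<not> 3 dvd t + 3 * (m * t\<^sup>2 + m * m * t ^ 3)"
    using t(2) by (simp add: dvd_add_left_iff)
  ultimately show ?case by blast
qed

text \<open>Equivalently, \<open>1 + 3 * s\<close> generates the group of residues modulo
  \<open>3 ^ Suc n\<close> that are 1 modulo 3, a group of order \<open>3 ^ n\<close>.\<close>

lemma power_cong_one_iff:
  fixes s :: int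
  assumes "\<not> 3 dvd s"
  shows "3 ^ Suc n dvd (1 + 3 * s) ^ k - 1 \<longleftrightarrow> 3 ^ n dvd k"
proof (induction n)
  case 0
  obtain r where "(1 + 3 * s) ^ k = 1 + int k * (3 * s) + (3 * s)\<^sup>2 * r"
    using one_plus_power_mod_sq by blast
  then have "(1 + 3 * s) ^ k - 1 = 3 * (int k * s + 3 * s\<^sup>2 * r)"
    by (simp add: power2_eq_square algebra_simps)
  then show ?case by simp
next
  case (Suc n)
  obtain t where t: "(1 + 3 * s) ^ (3 ^ n) = 1 + 3 ^ Suc n * t" "\<not> 3 dvd t"
    using power_three_power[OF assms] by blast
  have key: "3 ^ Suc (Suc n) dvd (1 + 3 * s) ^ (3 ^ n * j) - 1 \<longleftrightarrow> 3 dvd j" for j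
  proof -
    obtain r where r: "(1 + 3 ^ Suc n * t) ^ j = 1 + int j * (3 ^ Suc n * t) + (3 ^ Suc n * t)\<^sup>2 * r"
      using one_plus_power_mod_sq by blast
    have "(1 + 3 * s) ^ (3 ^ n * j) - 1 = 3 ^ Suc n * (int j * t + 3 * (3 ^ n * t\<^sup>2 * r))"
      unfolding power_mult t(1) r by (simp add: algebra_simps power2_eq_square)
    then have "3 ^ Suc (Suc n) dvd (1 + 3 * s) ^ (3 ^ n * j) - 1 \<longleftrightarrow>
        3 dvd int j * t + 3 * (3 ^ n * t\<^sup>2 * r)"
      by (simp only: power_Suc2[of 3 "Suc n"] dvd_mult_cancel_left) simp
    also have "\<dots> \<longleftrightarrow> 3 dvd int j * t" by (simp add: dvd_add_left_iff)
    also have "\<dots> \<longleftrightarrow> 3 dvd int j" using t(2) by (simp add: prime_dvd_mult_iff)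
    also have "\<dots> \<longleftrightarrow> 3 dvd j" by presburger
    finally show ?thesis .
  qed
  show ?case
  proof
    assume "3 ^ Suc (Suc n) dvd (1 + 3 * s) ^ k - 1"
    moreover from this have "3 ^ Suc n dvd (1 + 3 * s) ^ k - 1"
      by (rule dvd_trans[rotated]) (simp add: le_imp_power_dvd)
    then obtain j where "k = 3 ^ n * j" using Suc by (auto elim: dvdE)
    ultimately show "3 ^ Suc n dvd k" using key[of j] by auto
  next
    assume "3 ^ Suc n dvd k"
    then obtain j where "k = 3 ^ n * (3 * j)" by (auto elim!: dvdE)
    then show "3 ^ Suc (Suc n) dvd (1 + 3 * s) ^ k - 1" using key[of "3 * j"] by simp
  qed
qed

lemma square_mod_3: "\<not> 3 dvd (v::int) \<Longrightarrow> 3 dvd v\<^sup>2 - 1"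
proof -
  assume "\<not> 3 dvd v"
  then have "3 dvd v - 1 \<or> 3 dvd v + 1" by presburger
  moreover have "v\<^sup>2 - 1 = (v - 1) * (v + 1)" by (simp add: power2_eq_square algebra_simps)
  ultimately show ?thesis by auto
qed

text \<open>Successive approximation: raising the exponent by a multiple of \<open>3 ^ n\<close>
  alters the power first at \<open>3 ^ Suc n\<close>, where the remaining error sits.\<close>

lemma square_eq_power:
  fixes s v :: int
  assumes s: "\<not> 3 dvd s" and v: "\<not> 3 dvd v"
  shows "\<exists>k. 3 ^ Suc n dvd v\<^sup>2 - (1 + 3 * s) ^ k"
proof (induction n)
  case 0
  then show ?case using square_mod_3[OF v] by (intro exI[of _ 0]) simp
next
  case (Suc n)
  then obtain k d where d: "v\<^sup>2 - (1 + 3 * s) ^ k = 3 ^ Suc n * d" by (auto elim!: dvdE)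
  obtain t where t: "(1 + 3 * s) ^ (3 ^ n) = 1 + 3 ^ Suc n * t" "\<not> 3 dvd t"
    using power_three_power[OF s] by blast
  \<comment> \<open>The error digit \<open>d\<close> must equal \<open>i * t\<close> modulo 3. Since
    \<open>t\<^sup>2\<close> is 1 modulo 3, the solution is \<open>d * t\<close>.\<close>
  define i where "i = nat ((d * t) mod 3)"
  have i: "int i = (d * t) mod 3" by (simp add: i_def)
  obtain r where r: "(1 + 3 ^ Suc n * t) ^ i = 1 + int i * (3 ^ Suc n * t) + (3 ^ Suc n * t)\<^sup>2 * r"
    using one_plus_power_mod_sq by blast
  obtain z where z: "(1 + 3 * s) ^ k = 1 + 3 * z"
    using power_cong_one_iff[OF s, of 0 k] by (auto elim!: dvdE simp: algebra_simps)
  have e: "v\<^sup>2 - (1 + 3 * s) ^ (k + 3 ^ n * i) = 3 ^ Suc n * (d - int i * t - 3 * (z * int i * t + (1 + 3 * z) * 3 ^ n * t\<^sup>2 * r))"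
  proof -
    have "v\<^sup>2 = 1 + 3 * z + 3 ^ Suc n * d" using d z by simp
    then show ?thesis unfolding power_add power_mult t(1) r z
      by (simp add: algebra_simps power2_eq_square)
  qed
  have "3 dvd d - int i * t"
  proof -
    obtain q where q: "d * t = int i + 3 * q" using i by (metis mod_mult_div_eq add.commute)
    have "d - int i * t = 3 * (q * t) - d * (t\<^sup>2 - 1)"
    proof -
      have "int i = d * t - 3 * q" using q by simp
      then show ?thesis by (simp only: power2_eq_square) (simp add: algebra_simps)
    qed
    then show ?thesis using square_mod_3[OF t(2)] by simp
  qed
  then have "3 dvd d - int i * t - 3 * (z * int i * t + (1 + 3 * z) * 3 ^ n * t\<^sup>2 * r)" by simp
  then have "3 ^ Suc n * 3 dvd 3 ^ Suc n * (d - int i * t - 3 * (z * int i * t + (1 + 3 * z) * 3 ^ n * t\<^sup>2 * r))"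
    by (rule mult_dvd_mono[OF dvd_refl])
  then have "3 ^ Suc (Suc n) dvd v\<^sup>2 - (1 + 3 * s) ^ (k + 3 ^ n * i)"
    unfolding e by (simp add: mult.commute)
  then show ?case by blast
qed

text \<open>The factors \<open>a - b\<close> and \<open>a + b\<close> have sum \<open>2 * a\<close>,
  so 3 divides at most one of them and that one absorbs all of \<open>3 ^ m\<close>.\<close>

lemma square_eq_imp_pm:
  fixes a b :: int
  assumes "3 ^ m dvd a\<^sup>2 - b\<^sup>2" "\<not> 3 dvd a"
  shows "3 ^ m dvd a - b \<or> 3 ^ m dvd a + b"
proof -
  have *: "3 ^ m dvd (a - b) * (a + b)" using assms(1) by (simp add: power2_eq_square algebra_simps)
  have "\<not> 3 dvd a - b \<or> \<not> 3 dvd a + b" using assms(2) by presburger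
  then have "coprime (3 ^ m) (a - b) \<or> coprime (3 ^ m) (a + b)"
    using prime_imp_coprime[of "3::int"] by (auto intro!: coprime_power_left_iff[THEN iffD2])
  then show ?thesis using * coprime_dvd_mult_right_iff coprime_dvd_mult_left_iff by blast
qed

context
  fixes u :: int
  assumes u: "\<not> 3 dvd u" "\<not> 9 dvd u\<^sup>2 - 1"
begin

lemma unit_square_form: obtains s where "u\<^sup>2 = 1 + 3 * s" "\<not> 3 dvd s"
proof -
  obtain s where s: "u\<^sup>2 - 1 = 3 * s" using square_mod_3[OF u(1)] by (auto elim: dvdE)
  moreover have "\<not> 3 dvd s" using u(2) unfolding s by presburger
  ultimately show thesis by (intro that[of s]) auto
qed

text \<open>Up to sign the units modulo \<open>3 ^ Suc n\<close> form a cyclic group of order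
  \<open>3 ^ n\<close>, and the conditions on \<open>u\<close> make it a generator. Squaring removes
  the sign and leads back to powers of \<open>1 + 3 * s\<close>.\<close>

lemma unit_power_pm_one_iff:
  "3 ^ Suc n dvd u ^ k - 1 \<or> 3 ^ Suc n dvd u ^ k + 1 \<longleftrightarrow> 3 ^ n dvd k"
proof -
  obtain s where s: "u\<^sup>2 = 1 + 3 * s" "\<not> 3 dvd s" by (rule unit_square_form)
  have nd: "\<not> 3 dvd u ^ k" using u(1) prime_dvd_power[of 3 u k] by auto
  have eq: "(u ^ k)\<^sup>2 - 1\<^sup>2 = (1 + 3 * s) ^ k - 1"
    unfolding s(1)[symmetric] by (simp add: power_mult[symmetric] mult.commute)
  have "3 ^ Suc n dvd u ^ k - 1 \<or> 3 ^ Suc n dvd u ^ k + 1 \<longleftrightarrow> 3 ^ Suc n dvd (u ^ k)\<^sup>2 - 1\<^sup>2"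
  proof
    assume "3 ^ Suc n dvd u ^ k - 1 \<or> 3 ^ Suc n dvd u ^ k + 1"
    moreover have "(u ^ k)\<^sup>2 - 1\<^sup>2 = (u ^ k - 1) * (u ^ k + 1)" by (simp add: power2_eq_square algebra_simps)
    ultimately show "3 ^ Suc n dvd (u ^ k)\<^sup>2 - 1\<^sup>2" by auto
  qed (use square_eq_imp_pm[OF _ nd] in blast)
  then show ?thesis using power_cong_one_iff[OF s(2)] unfolding eq by blast
qed

lemma unit_power_surj:
  assumes "\<not> 3 dvd v" shows "\<exists>k. 3 ^ Suc n dvd v - u ^ k \<or> 3 ^ Suc n dvd v + u ^ k"
proof -
  obtain s where s: "u\<^sup>2 = 1 + 3 * s" "\<not> 3 dvd s" by (rule unit_square_form)
  obtain k where "3 ^ Suc n dvd v\<^sup>2 - (1 + 3 * s) ^ k" using square_eq_power[OF s(2) assms] by blast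
  then have "3 ^ Suc n dvd v\<^sup>2 - (u ^ k)\<^sup>2"
    unfolding s(1)[symmetric] by (simp add: power_mult[symmetric] mult.commute)
  then show ?thesis using square_eq_imp_pm[OF _ assms] by blast
qed

end

section \<open>A criterion for Z_p-extensions\<close>

lemma polys_over_pcompose:
  assumes "alg_subfield F" "p \<in> polys_over F" "q \<in> polys_over F" shows "pcompose p q \<in> polys_over F"
  unfolding polys_over_def using assms(2,3)
  by (auto intro!: coeff_pcompose_semiring_closed alg_subfield_closed[OF assms(1)] dest: polys_overD)

text \<open>The union of the fields \<open>K(x n)\<close> is the extension; \<open>\<tau>\<close>
  induces on the level \<open>n\<close> a generator of a cyclic group of order \<open>p ^ n\<close>.
  The isomorphism records, level by level, which power of \<open>\<tau>\<close> an automorphism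
  induces, and \<open>chain\<close> makes these exponents coherent.\<close>

lemma (in base_field) Zp_extension_chain:
  fixes x :: "nat \<Rightarrow> complex" and \<tau>
  assumes p: "p > 0" and alg: "\<And>n. algebraic (x n)" and t: "\<tau> \<in> Aut K"
    and chain: "\<And>n. \<exists>f\<in>polys_over K. x n = poly f (x (Suc n))"
    and step: "\<And>n. \<exists>f\<in>polys_over K. \<tau> (x n) = poly f (x n)"
    and gen: "\<And>\<sigma> n. \<sigma> \<in> Aut K \<Longrightarrow> \<exists>k. \<sigma> (x n) = (\<tau> ^^ k) (x n)"
    and ord: "\<And>n k. (\<tau> ^^ k) (x n) = x n \<longleftrightarrow> p ^ n dvd k"
  obtains M where "Zp_extension p K M" "\<And>n. x n \<in> M"
proof -
  \<comment> \<open>The ring \<open>K[x n]\<close>, which is already a field because its elements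
    are algebraic.\<close>
  define B where "B n = {poly f (x n) | f. f \<in> polys_over K}" for n
  define M where "M = (\<Union>n. B n)"
  have B_alg: "alg_subfield (B n)" for n
    unfolding alg_subfield_def
  proof (intro conjI ballI subsetI)
    fix q :: complex assume "q \<in> \<rat>"
    then show "q \<in> B n" unfolding B_def using polys_over_monom[OF K alg_subfield_rat[OF K], of q 0]
      by (intro CollectI exI[of _ "[:q:]"]) (auto simp: monom_0)
  next
    fix y assume "y \<in> B n"
    then show "y \<in> Qb" using polys_over_mono[of K Qb] alg_subfield_algebraic[OF K] alg[of n]
      by (auto simp: B_def intro!: polys_over_poly[OF alg_subfield_Qb, simplified])
  next
    fix y z assume "y \<in> B n" "z \<in> B n"
    then obtain f g where "y = poly f (x n)" "z = poly g (x n)" "f \<in> polys_over K" "g \<in> polys_over K"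
      by (auto simp: B_def)
    then have "y + z = poly (f + g) (x n)" "y * z = poly (f * g) (x n)"
      "f + g \<in> polys_over K" "f * g \<in> polys_over K"
      using polys_over_add[OF K, of f g] polys_over_mult[OF K, of f g] by auto
    then show "y + z \<in> B n" "y * z \<in> B n" unfolding B_def by blast+
  qed
  have x_B: "x n \<in> B n" for n
    unfolding B_def using polys_over_monom[OF K alg_subfield_numerals(2)[OF K], of 1]
    by (intro CollectI exI[of _ "monom 1 1"]) (auto simp: poly_monom)
  have K_B: "K \<subseteq> B n" for n
    unfolding B_def using polys_over_monom[OF K, of _ 0]
    by (auto simp: monom_0 intro!: exI[of _ "[:_:]"])
  have B_mono: "B n \<subseteq> B (Suc n)" for n
  proof
    fix y assume "y \<in> B n"
    then obtain f where f: "f \<in> polys_over K" "y = poly f (x n)" by (auto simp: B_def)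
    obtain g where g: "g \<in> polys_over K" "x n = poly g (x (Suc n))" using chain by blast
    show "y \<in> B (Suc n)" unfolding B_def
      using f g polys_over_pcompose[OF K f(1) g(1)] by (intro CollectI exI[of _ "pcompose f g"]) (auto simp: poly_pcompose)
  qed
  have B_le: "m \<le> n \<Longrightarrow> B m \<subseteq> B n" for m n using lift_Suc_mono_le[of B] B_mono by blast
  have M_alg: "alg_subfield M"
    unfolding alg_subfield_def
  proof (intro conjI ballI)
    show "\<rat> \<subseteq> M" using alg_subfield_rat[OF B_alg] by (auto simp: M_def)
    show "M \<subseteq> Qb" using alg_subfield_algebraic[OF B_alg] by (auto simp: M_def)
    fix y z assume "y \<in> M" "z \<in> M"
    then obtain m n where "y \<in> B m" "z \<in> B n" by (auto simp: M_def)
    then have yz: "y \<in> B (max m n)" "z \<in> B (max m n)" using B_le[of m "max m n"] B_le[of n "max m n"] by auto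
    show "y + z \<in> M" "y * z \<in> M"
      using alg_subfield_add[OF B_alg yz] alg_subfield_mult[OF B_alg yz] unfolding M_def by blast+
  qed
  interpret M: field_extension M K using K M_alg K_B by unfold_locales (auto simp: M_def)
  note M_Qb = alg_subfield_algebraic[OF M_alg]
  have x_M: "x n \<in> M" for n using x_B by (auto simp: M_def)
  have tk: "\<tau> ^^ k \<in> Aut K" for k by (rule Aut_funpow[OF K t])
  have agree: "\<sigma> y = \<rho> y"
    if "alg_homo K F \<sigma>" "alg_homo K F' \<rho>" "x n \<in> F" "x n \<in> F'" "\<sigma> (x n) = \<rho> (x n)" "y \<in> B n" for \<sigma> \<rho> F F' n y
    using that alg_homo.poly[OF that(1) _ that(3)] alg_homo.poly[OF that(2) _ that(4)] by (auto simp: B_def)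
  have agree_A: "\<sigma> y = \<rho> y"
    if "\<sigma> \<in> Aut K" "\<rho> \<in> Aut K" "\<sigma> (x n) = \<rho> (x n)" "y \<in> B n" for \<sigma> \<rho> n y
    by (rule agree[OF alg_homo_Aut[OF K that(1)] alg_homo_Aut[OF K that(2)] _ _ that(3,4)]) (use alg in auto)
  have t_B: "\<tau> y \<in> B n" if "y \<in> B n" for n y
  proof -
    obtain f where f: "f \<in> polys_over K" "y = poly f (x n)" using \<open>y \<in> B n\<close> by (auto simp: B_def)
    obtain g where g: "g \<in> polys_over K" "\<tau> (x n) = poly g (x n)" using step by blast
    have "\<tau> y = poly (pcompose f g) (x n)"
      using alg_homo.poly[OF alg_homo_Aut[OF K t] f(1), of "x n"] alg f(2) g(2) by (simp add: poly_pcompose)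
    then show ?thesis unfolding B_def using polys_over_pcompose[OF K f(1) g(1)] by blast
  qed
  have tk_B: "(\<tau> ^^ k) y \<in> B n" if "y \<in> B n" for n y k
    using that t_B by (induction k) auto
  have per: "(\<tau> ^^ a) y = (\<tau> ^^ b) y" if "y \<in> B n" "a mod p ^ n = b mod p ^ n" for y n a b
  proof -
    have fix_B: "(\<tau> ^^ (p ^ n * j)) y = y" for j
      using agree_A[OF tk Aut_id _ that(1)] ord[of "p ^ n * j" n] by simp
    have "(\<tau> ^^ a) y = (\<tau> ^^ (a mod p ^ n)) y" for a
    proof -
      have "(\<tau> ^^ (a mod p ^ n + p ^ n * (a div p ^ n))) y = (\<tau> ^^ (a mod p ^ n)) y"
        unfolding funpow_add comp_apply fix_B ..
      then show ?thesis by simp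
    qed
    then show ?thesis using that(2) by metis
  qed
  have per_x: "(\<tau> ^^ a) (x n) = (\<tau> ^^ b) (x n) \<longleftrightarrow> a mod p ^ n = b mod p ^ n" for n a b
  proof -
    have *: "a mod p ^ n = b mod p ^ n" if "(\<tau> ^^ a) (x n) = (\<tau> ^^ b) (x n)" "a \<le> b" for a b
    proof -
      obtain c where c: "b = a + c" using \<open>a \<le> b\<close> le_Suc_ex by blast
      have "(\<tau> ^^ a) (x n) = (\<tau> ^^ a) ((\<tau> ^^ c) (x n))" using that(1) by (simp add: c funpow_add)
      then have "x n = (\<tau> ^^ c) (x n)"
        using inj_onD[OF alg_homo.inj[OF alg_homo_Aut[OF K tk]]] alg Aut_algebraic[OF K tk] by blast
      then show ?thesis using ord[of c n] c by (auto elim!: dvdE)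
    qed
    show ?thesis using *[of a b] *[of b a] per[OF x_B] by (metis nat_le_linear)
  qed
  have gal: "galois_extension M K"
  proof (rule M.normal_galois_extension)
    fix \<sigma> assume s: "\<sigma> \<in> Aut K"
    have "\<sigma> y \<in> M" if "y \<in> M" for y
    proof -
      obtain n where n: "y \<in> B n" using \<open>y \<in> M\<close> by (auto simp: M_def)
      obtain k where "\<sigma> (x n) = (\<tau> ^^ k) (x n)" using gen[OF s] by blast
      then have "\<sigma> y = (\<tau> ^^ k) y" using agree_A[OF s tk _ n] by blast
      then show ?thesis using tk_B[OF n] by (auto simp: M_def)
    qed
    then show "\<sigma> ` M \<subseteq> M" by blast
  qed
  \<comment> \<open>The exponent is determined only modulo \<open>p ^ n\<close>, by
    \<open>per_x\<close>; reducing it makes the choice immaterial.\<close>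
  define \<phi> where "\<phi> \<sigma> n = int ((SOME k. \<sigma> (x n) = (\<tau> ^^ k) (x n)) mod p ^ n)" for \<sigma> n
  have gen_G: "\<exists>k. \<sigma> (x n) = (\<tau> ^^ k) (x n)" if "\<sigma> \<in> carrier (Gal M K)" for \<sigma> n
    using extend_to_Aut[OF M.Gal_alg_homo[OF that]] gen x_M by metis
  have phi: "\<sigma> (x n) = (\<tau> ^^ nat (\<phi> \<sigma> n)) (x n)" "\<phi> \<sigma> n \<in> {0..<int p ^ n}"
    if "\<sigma> \<in> carrier (Gal M K)" for \<sigma> n
  proof -
    have "\<sigma> (x n) = (\<tau> ^^ (SOME k. \<sigma> (x n) = (\<tau> ^^ k) (x n))) (x n)"
      using gen_G[OF that] by (rule someI_ex)
    also have "\<dots> = (\<tau> ^^ nat (\<phi> \<sigma> n)) (x n)" unfolding per_x \<phi>_def by simp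
    finally show "\<sigma> (x n) = (\<tau> ^^ nat (\<phi> \<sigma> n)) (x n)" .
    have "(SOME k. \<sigma> (x n) = (\<tau> ^^ k) (x n)) mod p ^ n < p ^ n" using p by simp
    then show "\<phi> \<sigma> n \<in> {0..<int p ^ n}" unfolding \<phi>_def by (simp flip: of_nat_power)
  qed
  have phi_eq: "\<phi> \<sigma> n = int (k mod p ^ n)"
    if "\<sigma> \<in> carrier (Gal M K)" "\<sigma> (x n) = (\<tau> ^^ k) (x n)" for \<sigma> n k
  proof -
    have "nat (\<phi> \<sigma> n) mod p ^ n = k mod p ^ n" using phi(1)[OF that(1)] that(2) per_x by metis
    moreover have "nat (\<phi> \<sigma> n) < p ^ n" using phi(2)[OF that(1), of n] by (auto simp: nat_less_iff)
    ultimately have "nat (\<phi> \<sigma> n) = k mod p ^ n" by simp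
    then show ?thesis using phi(2)[OF that(1), of n] by auto
  qed
  have phi_B: "\<sigma> y = (\<tau> ^^ nat (\<phi> \<sigma> n)) y" if "\<sigma> \<in> carrier (Gal M K)" "y \<in> B n" for \<sigma> n y
    by (rule agree[OF M.Gal_alg_homo[OF that(1)] alg_homo_Aut[OF K tk] x_M _ phi(1)[OF that(1)] that(2)])
       (use alg in auto)
  have phi_Zp: "\<phi> \<sigma> \<in> carrier (Zp p)" if s: "\<sigma> \<in> carrier (Gal M K)" for \<sigma>
    unfolding Zp_carrier
  proof (intro allI conjI)
    fix n
    show "\<phi> \<sigma> n \<in> {0..<int p ^ n}" by (rule phi(2)[OF s])
    have "\<sigma> (x n) = (\<tau> ^^ nat (\<phi> \<sigma> (Suc n))) (x n)"
      using phi_B[OF s] B_mono x_B by blast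
    from phi_eq[OF s this] show "\<phi> \<sigma> (Suc n) mod int p ^ n = \<phi> \<sigma> n"
      using phi(2)[OF s, of "Suc n"] by (simp add: zmod_int)
  qed
  have hom: "\<phi> \<in> hom (Gal M K) (add_monoid (Zp p))"
  proof (rule homI)
    fix \<sigma> \<rho> assume s: "\<sigma> \<in> carrier (Gal M K)" and r: "\<rho> \<in> carrier (Gal M K)"
    have sr: "\<sigma> \<otimes>\<^bsub>Gal M K\<^esub> \<rho> \<in> carrier (Gal M K)"
      using s r group.is_monoid[OF M.group_Gal] by (simp add: monoid.m_closed)
    show "\<phi> (\<sigma> \<otimes>\<^bsub>Gal M K\<^esub> \<rho>) = \<phi> \<sigma> \<otimes>\<^bsub>add_monoid (Zp p)\<^esub> \<phi> \<rho>"
    proof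
      fix n
      have "(\<sigma> \<otimes>\<^bsub>Gal M K\<^esub> \<rho>) (x n) = (\<tau> ^^ (nat (\<phi> \<sigma> n) + nat (\<phi> \<rho> n))) (x n)"
        unfolding M.Gal_mult_apply[OF s r x_M] phi(1)[OF r, of n]
        using phi_B[OF s tk_B[OF x_B]] by (simp add: funpow_add)
      from phi_eq[OF sr this] show "\<phi> (\<sigma> \<otimes>\<^bsub>Gal M K\<^esub> \<rho>) n = (\<phi> \<sigma> \<otimes>\<^bsub>add_monoid (Zp p)\<^esub> \<phi> \<rho>) n"
        unfolding Zp_add using phi(2)[OF s, of n] phi(2)[OF r, of n] by (simp add: zmod_int)
    qed
  qed (simp add: phi_Zp)
  have inj: "inj_on \<phi> (carrier (Gal M K))"
  proof (rule inj_onI)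
    fix \<sigma> \<rho> assume s: "\<sigma> \<in> carrier (Gal M K)" "\<rho> \<in> carrier (Gal M K)" "\<phi> \<sigma> = \<phi> \<rho>"
    show "\<sigma> = \<rho>"
    proof (rule M.Gal_eqI[OF s(1,2)])
      fix y assume "y \<in> M"
      then obtain n where "y \<in> B n" by (auto simp: M_def)
      then show "\<sigma> y = \<rho> y" using phi_B[OF s(1)] phi_B[OF s(2)] s(3) by simp
    qed
  qed
  have surj: "\<exists>\<sigma>\<in>carrier (Gal M K). \<phi> \<sigma> = a" if a: "a \<in> carrier (Zp p)" for a
  proof -
    have a_nn: "0 \<le> a n" for n using a by (simp add: Zp_carrier)
    \<comment> \<open>An element of the union is moved with the digit of the first level that
      contains it; \<open>rho\<close> shows that every later level gives the same value, so sums and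
      products can be treated in one common level.\<close>
    define N where "N y = (LEAST n. y \<in> B n)" for y
    define \<rho> where "\<rho> y = (\<tau> ^^ nat (a (N y))) y" for y
    have rho: "\<rho> y = (\<tau> ^^ nat (a n)) y" if "y \<in> B n" for y n
    proof -
      have N: "y \<in> B (N y)" "N y \<le> n" unfolding N_def using that by (auto intro: LeastI Least_le)
      have "a n mod int p ^ N y = a (N y)" by (rule Zp_coherent[OF a N(2)])
      then have "nat (a (N y)) mod p ^ N y = nat (a n) mod p ^ N y"
        using Zp_mod[OF a, of "N y"] a_nn
        by (metis nat_int nat_mod_distrib of_nat_0_le_iff of_nat_power)
      then show ?thesis unfolding \<rho>_def by (rule per[OF N(1)])
    qed
    have hom: "alg_hom K M \<rho>"
      unfolding alg_hom_def
    proof (intro conjI ballI)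
      fix y z assume "y \<in> M" "z \<in> M"
      then obtain m n where "y \<in> B m" "z \<in> B n" by (auto simp: M_def)
      then have yz: "y \<in> B (max m n)" "z \<in> B (max m n)" using B_le[of m "max m n"] B_le[of n "max m n"] by auto
      then have "y + z \<in> B (max m n)" "y * z \<in> B (max m n)"
        using alg_subfield_add[OF B_alg] alg_subfield_mult[OF B_alg] by auto
      then show "\<rho> (y + z) = \<rho> y + \<rho> z" "\<rho> (y * z) = \<rho> y * \<rho> z"
        using rho yz Aut_add[OF tk] Aut_mult[OF tk] alg_subfield_algebraic[OF B_alg] by metis+
    next
      show "\<rho> k = k" if "k \<in> K" for k using Aut_fix[OF tk that] by (simp add: \<rho>_def)
    qed
    have "\<rho> y \<in> M" if y: "y \<in> M" for y
    proof -
      obtain n where n: "y \<in> B n" using y by (auto simp: M_def)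
      show ?thesis unfolding rho[OF n] M_def using tk_B[OF n] by blast
    qed
    moreover have "alg_homo K M \<rho>" using K M_alg M.K_sub hom by unfold_locales
    ultimately have r: "restrict \<rho> M \<in> carrier (Gal M K)" by (intro M.restrict_Gal) auto
    have "\<phi> (restrict \<rho> M) n = a n" for n
    proof -
      have "restrict \<rho> M (x n) = (\<tau> ^^ nat (a n)) (x n)" using x_M rho[OF x_B] by simp
      from phi_eq[OF r this] have "\<phi> (restrict \<rho> M) n = int (nat (a n) mod p ^ n)" .
      also have "\<dots> = a n" using Zp_mod[OF a, of n] a_nn[of n] by (simp add: zmod_int)
      finally show ?thesis .
    qed
    then show ?thesis by (intro bexI[OF _ r] ext)
  qed
  have im: "\<phi> ` carrier (Gal M K) = carrier (Zp p)" using phi_Zp surj by (auto simp: image_iff)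
  have iso: "\<phi> \<in> iso (Gal M K) (add_monoid (Zp p))"
    using hom inj im by (auto simp: iso_def bij_betw_def)
  define \<psi> where "\<psi> = inv_into (carrier (Gal M K)) \<phi>"
  have psi: "\<psi> b \<in> carrier (Gal M K)" "\<phi> (\<psi> b) = b" if "b \<in> carrier (Zp p)" for b
    using f_inv_into_f[of b \<phi> "carrier (Gal M K)"] inv_into_into[of b \<phi> "carrier (Gal M K)"] that im
    unfolding \<psi>_def by auto
  have c1: "continuous_map (krull_topology M K) (Zp_topology p) \<phi>"
    unfolding M.continuous_krull_Zp
  proof (intro conjI ballI)
    show "\<exists>S. finite S \<and> S \<subseteq> M \<and> (\<forall>g\<in>carrier (Gal M K). (\<forall>x\<in>S. g x = f x) \<longrightarrow> \<phi> g n = \<phi> f n)" for f n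
      by (rule exI[of _ "{x n}"]) (use x_M in \<open>auto simp: \<phi>_def\<close>)
  qed (use phi_Zp in blast)
  have c2: "continuous_map (Zp_topology p) (krull_topology M K) \<psi>"
    unfolding M.continuous_Zp_krull
  proof (intro conjI ballI)
    fix f y assume f: "f \<in> carrier (Zp p)" and "y \<in> M"
    then obtain n where n: "y \<in> B n" by (auto simp: M_def)
    show "\<exists>S. finite S \<and> S \<subseteq> UNIV \<and> (\<forall>g\<in>carrier (Zp p). (\<forall>x\<in>S. g x = f x) \<longrightarrow> \<psi> g y = \<psi> f y)"
      using phi_B[OF psi(1) n] psi(2) f by (intro exI[of _ "{n}"]) auto
  qed (use psi in blast)
  have "homeomorphic_maps (krull_topology M K) (Zp_topology p) \<phi> \<psi>"
    unfolding homeomorphic_maps_def M.topspace_krull topspace_Zp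
    using c1 c2 psi(2) inj by (auto simp: \<psi>_def)
  then have "homeomorphic_map (krull_topology M K) (Zp_topology p) \<phi>"
    by (auto simp: homeomorphic_map_maps)
  with gal iso have "Zp_extension p K M" by (auto simp: Zp_extension_def)
  with x_M that show thesis by blast
qed

section \<open>The cyclotomic Z_3-extension\<close>

locale imquad =
  fixes K :: "complex set"
  assumes imaginary: "imaginary_quadratic K"
begin

lemma K_alg: "alg_subfield K"
  using imaginary_quadraticE[OF imaginary] by blast

lemma K_cnj: "cnj ` K = K"
proof -
  obtain s where "alg_subfield K" "s \<in> K" "s\<^sup>2 \<in> \<rat>" and s: "cnj s = - s" "s \<noteq> 0"
    "K = {a + b * s | a b. a \<in> \<rat> \<and> b \<in> \<rat>}"
    by (rule imaginary_quadraticE[OF imaginary])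
  have "cnj x \<in> K" if x: "x \<in> K" for x
  proof -
    obtain a b where ab: "x = a + b * s" "a \<in> \<rat>" "b \<in> \<rat>" using x s(3) by blast
    then have "cnj x = a + (- b) * s" using cnj_Rats s(1) by simp
    then show ?thesis unfolding s(3) using ab by (intro CollectI exI[of _ a] exI[of _ "- b"]) auto
  qed
  then show ?thesis by (auto simp: image_iff) (metis complex_cnj_cnj)
qed

lemma K_real:
  assumes "x \<in> K" "x \<in> \<real>" shows "x \<in> \<rat>"
proof -
  obtain s where "alg_subfield K" "s \<in> K" "s\<^sup>2 \<in> \<rat>" and s: "cnj s = - s" "s \<noteq> 0"
    "K = {a + b * s | a b. a \<in> \<rat> \<and> b \<in> \<rat>}"
    by (rule imaginary_quadraticE[OF imaginary])
  obtain a b where ab: "x = a + b * s" "a \<in> \<rat>" "b \<in> \<rat>" using assms(1) s(3) by blast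
  have "cnj x = x" using assms(2) Reals_cnj_iff by blast
  then have "b * s = 0" using ab cnj_Rats[of a] cnj_Rats[of b] s(1) by simp
  then show ?thesis using ab by auto
qed

end

sublocale imquad \<subseteq> base_field K 3
  by unfold_locales (rule K_alg)

text \<open>The order is \<open>3 ^ Suc n\<close>: \<open>zeta 0\<close> is a primitive cube root
  and \<open>zeta 1\<close> a primitive ninth root of unity, so that the index is the level in the
  cyclotomic tower.\<close>

definition zeta :: "nat \<Rightarrow> complex" where
  "zeta n = cis (2 * pi / 3 ^ Suc n)"

text \<open>This is 2 cos(2 pi v / 3^(n+1)); \<open>xi n 1\<close> generates the maximal real
  subfield at level \<open>n\<close>.\<close>

definition xi :: "nat \<Rightarrow> nat \<Rightarrow> complex" where
  "xi n v = zeta n ^ v + inverse (zeta n ^ v)"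

lemma zeta_power: "zeta n ^ j = cis (2 * pi * real j / real (3 ^ Suc n))"
  by (simp add: zeta_def Complex.DeMoivre mult_ac)

lemma zeta_nonzero [simp]: "zeta n \<noteq> 0"
  by (simp add: zeta_def)

lemma zeta_power_one: "zeta n ^ (3 ^ Suc n) = 1"
  unfolding zeta_power by simp

lemma zeta_roots:
  assumes "z ^ (3 ^ Suc n) = 1" obtains k where "k < 3 ^ Suc n" "z = zeta n ^ k"
proof -
  have "z \<in> (\<lambda>k. cis (2 * pi * real k / real (3 ^ Suc n))) ` {..<3 ^ Suc n}"
    using Complex.bij_betw_roots_unity[of "3 ^ Suc n"] assms by (simp add: bij_betw_def)
  then show thesis unfolding zeta_power[symmetric] using that by blast
qed

lemma zeta_power_mod: "zeta n ^ j = zeta n ^ (j mod 3 ^ Suc n)"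
proof -
  have "zeta n ^ j = zeta n ^ (3 ^ Suc n * (j div 3 ^ Suc n) + j mod 3 ^ Suc n)" by simp
  also have "\<dots> = zeta n ^ (j mod 3 ^ Suc n)"
    unfolding power_add power_mult zeta_power_one by simp
  finally show ?thesis .
qed

lemma zeta_power_eq_one: "zeta n ^ j = 1 \<longleftrightarrow> 3 ^ Suc n dvd j"
proof
  assume "zeta n ^ j = 1"
  then have "zeta n ^ (j mod 3 ^ Suc n) = zeta n ^ 0" using zeta_power_mod[of n j] by simp
  moreover have "inj_on (\<lambda>k. zeta n ^ k) {..<3 ^ Suc n}"
    unfolding zeta_power using Complex.bij_betw_roots_unity[of "3 ^ Suc n"] by (simp add: bij_betw_def)
  moreover have "j mod 3 ^ Suc n \<in> {..<3 ^ Suc n}" "0 \<in> {..<3 ^ Suc n :: nat}" by auto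
  ultimately have "j mod 3 ^ Suc n = 0" unfolding inj_on_def by blast
  then show "3 ^ Suc n dvd j" by auto
next
  assume "3 ^ Suc n dvd j"
  then show "zeta n ^ j = 1" using zeta_power_mod[of n j] by simp
qed

lemma zeta_power_eq: "zeta n ^ a = zeta n ^ b \<longleftrightarrow> 3 ^ Suc n dvd int a - int b"
proof -
  have *: "zeta n ^ a = zeta n ^ b \<longleftrightarrow> 3 ^ Suc n dvd int b - int a" if le: "a \<le> b" for a b
  proof -
    have "zeta n ^ b = zeta n ^ a * zeta n ^ (b - a)" using le by (simp add: power_add[symmetric])
    then have "zeta n ^ a = zeta n ^ b \<longleftrightarrow> zeta n ^ (b - a) = 1" by auto
    also have "\<dots> \<longleftrightarrow> 3 ^ Suc n dvd int (b - a)"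
      unfolding zeta_power_eq_one by (metis int_dvd_int_iff of_nat_numeral of_nat_power)
    finally show ?thesis using le by (simp add: of_nat_diff)
  qed
  show ?thesis
  proof (cases "a \<le> b")
    case True
    then show ?thesis using * dvd_minus_iff[of "3 ^ Suc n" "int b - int a"] by simp
  next
    case False
    then show ?thesis using *[of b a] by auto
  qed
qed

lemma plus_inverse_eq_iff:
  fixes a b :: complex
  assumes "a \<noteq> 0" "b \<noteq> 0"
  shows "a + inverse a = b + inverse b \<longleftrightarrow> (a - b) * (a * b - 1) = 0"
proof -
  have "(x - y) * (x * y - 1) = x * y * (x + p - (y + q))" if "x * p = 1" "y * q = 1" for x y p q :: complex
    using that by Groebner_Basis.algebra
  from this[of a "inverse a" b "inverse b"]
  have "(a - b) * (a * b - 1) = a * b * (a + inverse a - (b + inverse b))" using assms by simp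
  then show ?thesis using assms by simp
qed

lemma xi_eq: "xi n a = xi n b \<longleftrightarrow> 3 ^ Suc n dvd int a - int b \<or> 3 ^ Suc n dvd int a + int b"
proof -
  let ?z = "zeta n ^ a" and ?w = "zeta n ^ b"
  have "xi n a = xi n b \<longleftrightarrow> (?z - ?w) * (?z * ?w - 1) = 0"
    unfolding xi_def by (rule plus_inverse_eq_iff) simp_all
  also have "\<dots> \<longleftrightarrow> ?z = ?w \<or> zeta n ^ (a + b) = 1" by (simp add: power_add)
  also have "zeta n ^ (a + b) = 1 \<longleftrightarrow> 3 ^ Suc n dvd int (a + b)"
    unfolding zeta_power_eq_one by (metis int_dvd_int_iff of_nat_numeral of_nat_power)
  finally show ?thesis by (simp add: zeta_power_eq)
qed

lemma cnj_zeta: "cnj (zeta n) = inverse (zeta n)"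
  by (simp add: zeta_def cis_cnj cis_inverse)

lemma xi_real: "xi n v \<in> \<real>"
  by (simp add: Reals_cnj_iff xi_def cnj_zeta power_inverse add.commute)

lemma algebraic_zeta: "algebraic (zeta n)"
  using algebraic_root[of "zeta n" "3 ^ Suc n"] zeta_power_one by simp

lemma algebraic_xi: "algebraic (xi n v)"
  unfolding xi_def by (intro algebraic_add algebraic_inverse algebraic_power algebraic_zeta)

lemma zeta_Suc: "zeta (Suc n) ^ 3 = zeta n"
  by (simp add: zeta_def Complex.DeMoivre)

lemma cube_plus_inverse: "z \<noteq> 0 \<Longrightarrow> z ^ 3 + inverse (z ^ 3) = (z + inverse z) ^ 3 - 3 * (z + inverse z)" for z :: complex
proof -
  assume z: "z \<noteq> 0"
  have "x ^ 3 + y ^ 3 = (x + y) ^ 3 - 3 * (x + y)" if "x * y = 1" for x y :: complex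
    using that by Groebner_Basis.algebra
  from this[of z "inverse z"] z show ?thesis by (simp add: power_inverse)
qed

text \<open>The triple angle formula; it places each level inside the next.\<close>

lemma xi_Suc: "xi n 1 = xi (Suc n) 1 ^ 3 - 3 * xi (Suc n) 1"
  using cube_plus_inverse[of "zeta (Suc n)"] by (simp add: xi_def zeta_Suc)

text \<open>The bottom level is rational, in accordance with level \<open>n\<close> having degree
  \<open>3 ^ n\<close>.\<close>

lemma xi_0: "\<not> 3 dvd v \<Longrightarrow> xi 0 v = - 1"
proof -
  assume v: "\<not> 3 dvd v"
  have ne: "zeta 0 \<noteq> 1" using zeta_power_eq_one[of 0 1] by simp
  have z3: "zeta 0 ^ 3 = 1" using zeta_power_one[of 0] by simp
  then have "(zeta 0 - 1) * (zeta 0 ^ 2 + zeta 0 + 1) = 0"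
    by (simp add: algebra_simps power2_eq_square power3_eq_cube)
  then have "zeta 0 ^ 2 + zeta 0 + 1 = 0" using ne by simp
  moreover have "inverse (zeta 0) = zeta 0 ^ 2"
    using z3 by (intro inverse_unique) (simp add: power2_eq_square power3_eq_cube mult.assoc)
  ultimately have "xi 0 1 = -1" by (simp add: xi_def algebra_simps add_eq_0_iff)
  moreover have "xi 0 v = xi 0 1" unfolding xi_eq using v by simp presburger
  ultimately show ?thesis by simp
qed

lemma xi_1_root: "xi 1 1 ^ 3 - 3 * xi 1 1 + 1 = 0"
  using xi_Suc[of 0] xi_0[of 1] by simp

text \<open>Chebyshev recursion: twice the cosine of a multiple angle is a polynomial in twice the
  cosine.\<close>

lemma xi_poly: "\<exists>f\<in>polys_over \<rat>. xi n v = poly f (xi n 1)"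
proof (induction v rule: less_induct)
  case (less v)
  consider "v = 0" | "v = 1" | w where "v = Suc (Suc w)" by (metis One_nat_def not0_implies_Suc)
  then show ?case
  proof cases
    case 1
    then show ?thesis using polys_over_monom[OF alg_subfield_Rats, of 2 0]
      by (intro bexI[of _ "[:2:]"]) (auto simp: xi_def monom_0)
  next
    case 2
    then show ?thesis using polys_over_monom[OF alg_subfield_Rats, of 1 1]
      by (intro bexI[of _ "monom 1 1"]) (auto simp: poly_monom)
  next
    case 3
    then obtain f g where fg: "f \<in> polys_over \<rat>" "xi n (Suc w) = poly f (xi n 1)"
      "g \<in> polys_over \<rat>" "xi n w = poly g (xi n 1)" using less by (metis lessI less_SucI)
    have e: "xi n v = xi n 1 * xi n (Suc w) - xi n w"
    proof -
      let ?z = "zeta n" and ?p = "inverse (zeta n)"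
      have "x * (x * a) + y * (y * b) = (x + y) * (x * a + y * b) - (a + b)"
        if "x * y = 1" for x y a b :: complex using that by Groebner_Basis.algebra
      from this[of ?z ?p "?z ^ w" "?p ^ w"] show ?thesis unfolding 3 xi_def power_inverse[symmetric] by simp
    qed
    have "monom 1 1 * f - g \<in> polys_over \<rat>"
      using fg polys_over_monom[OF alg_subfield_Rats, of 1 1]
      by (intro polys_over_diff[OF alg_subfield_Rats] polys_over_mult[OF alg_subfield_Rats]) auto
    moreover have "xi n v = poly (monom 1 1 * f - g) (xi n 1)" unfolding e using fg by (simp add: poly_monom)
    ultimately show ?thesis by blast
  qed
qed

text \<open>A rational zero of the monic polynomial X^3 - 3 X + 1 is an integer dividing 1, and
  neither 1 nor -1 is a zero.\<close>

lemma xi_1_irrational: "xi 1 1 \<notin> \<rat>"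
proof
  assume r: "xi 1 1 \<in> \<rat>"
  have "algebraic_int (xi 1 1)"
  proof (rule algebraic_int.intros[of "[:1, -3, 0, 1:]"])
    show "poly [:1, -3, 0, 1:] (xi 1 1) = 0"
      using xi_1_root by (simp add: algebra_simps power3_eq_cube)
    show "\<forall>i. coeff [:1, -3, 0, 1:] i \<in> \<int>"
      by (auto simp: coeff_pCons split: nat.splits)
  qed simp
  then have "xi 1 1 \<in> \<int>" using r by (rule rational_algebraic_int_is_int)
  then obtain m where m: "xi 1 1 = of_int m" by (auto elim: Ints_cases)
  have "of_int (m ^ 3 - 3 * m + 1) = (0::complex)" using xi_1_root unfolding m by simp
  then have e: "m * (3 - m ^ 2) = 1" unfolding of_int_eq_0_iff by (simp add: algebra_simps power3_eq_cube power2_eq_square)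
  then have "m dvd 1" by (metis dvd_triv_left)
  then have "m = 1 \<or> m = -1" by auto
  with e show False by auto
qed

lemma (in base_field) Aut_inverse_val: "\<tau> \<in> Aut K \<Longrightarrow> algebraic x \<Longrightarrow> \<tau> (inverse x) = inverse (\<tau> x)"
proof (cases "x = 0")
  case True
  assume "\<tau> \<in> Aut K"
  from alg_homo.numerals(1)[OF alg_homo_Aut[OF K this]] show ?thesis using True by simp
next
  case False
  assume t: "\<tau> \<in> Aut K" and x: "algebraic x"
  have "\<tau> x * \<tau> (inverse x) = 1"
    using Aut_mult[OF t x algebraic_inverse[OF x]] False alg_homo.numerals(2)[OF alg_homo_Aut[OF K t]] by simp
  then show ?thesis by (metis inverse_unique)
qed

context base_field
begin

text \<open>If 3 divided the exponent, the \<open>3 ^ n\<close>-th power of \<open>zeta n\<close>,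
  which is not 1, would be sent to 1, against injectivity.\<close>

lemma Aut_zeta:
  assumes t: "\<tau> \<in> Aut K" obtains u where "\<not> 3 dvd u" "\<tau> (zeta n) = zeta n ^ u"
proof -
  note tp = alg_homo.power[OF alg_homo_Aut[OF K t], of "zeta n", simplified, OF algebraic_zeta]
  note t1 = alg_homo.numerals(2)[OF alg_homo_Aut[OF K t]]
  have "\<tau> (zeta n) ^ (3 ^ Suc n) = 1" using tp[of "3 ^ Suc n"] zeta_power_one t1 by simp
  then obtain u where u: "\<tau> (zeta n) = zeta n ^ u" by (rule zeta_roots)
  have "\<not> 3 dvd u"
  proof
    assume "3 dvd u"
    then obtain w where "u = 3 * w" by (elim dvdE)
    then have "\<tau> (zeta n ^ (3 ^ n)) = (zeta n ^ (3 ^ Suc n)) ^ w"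
      unfolding tp u by (simp add: power_mult[symmetric] mult_ac)
    then have "\<tau> (zeta n ^ (3 ^ n)) = \<tau> 1" unfolding zeta_power_one t1 by simp
    then have "zeta n ^ (3 ^ n) = 1"
      using inj_onD[OF alg_homo.inj[OF alg_homo_Aut[OF K t]]] algebraic_power[OF algebraic_zeta] by blast
    then show False unfolding zeta_power_eq_one by (auto dest: dvd_imp_le)
  qed
  with u that show thesis by blast
qed

lemma Aut_xi:
  assumes t: "\<tau> \<in> Aut K" and u: "\<tau> (zeta n) = zeta n ^ u"
  shows "\<tau> (xi n v) = xi n (u * v)"
proof -
  have "\<tau> (zeta n ^ v) = zeta n ^ (u * v)"
    using alg_homo.power[OF alg_homo_Aut[OF K t], of "zeta n" v] algebraic_zeta u by (simp add: power_mult)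
  then show ?thesis
    unfolding xi_def
    by (simp add: Aut_add[OF t] Aut_inverse_val[OF t] algebraic_power[OF algebraic_zeta]
        algebraic_inverse)
qed

lemma Aut_xi_funpow:
  assumes t: "\<tau> \<in> Aut K" and u: "\<tau> (zeta n) = zeta n ^ u"
  shows "(\<tau> ^^ k) (xi n 1) = xi n (u ^ k)"
  by (induction k) (simp_all add: Aut_xi[OF t u])

lemma Aut_xi_real: "\<tau> \<in> Aut K \<Longrightarrow> \<tau> (xi n v) \<in> \<real>"
  using Aut_zeta Aut_xi xi_real by metis

end

context imquad
begin

lemma xi_1_notin_K: "xi 1 1 \<notin> K"
  using K_real xi_real xi_1_irrational by blast

text \<open>As \<open>xi 1 1\<close> is not in \<open>K\<close>, some \<open>\<tau>\<close> moves
  it. That single fact makes \<open>\<tau>\<close> a generator at every level: its exponents are not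
  1 or -1 modulo 9, which is the condition of \<open>unit_power_pm_one_iff\<close> and
  \<open>unit_power_surj\<close>. Hence \<open>Zp_extension_chain\<close> applies to the sequence
  \<open>xi n 1\<close>.\<close>

lemma xi_1_in_T: "xi 1 1 \<in> T"
proof -
  obtain \<tau> where t: "\<tau> \<in> Aut K" "\<tau> (xi 1 1) \<noteq> xi 1 1"
    using Aut_fixed[OF K_alg algebraic_xi] xi_1_notin_K by blast
  have "\<exists>u. \<not> 3 dvd u \<and> \<tau> (zeta n) = zeta n ^ u" for n using Aut_zeta[OF t(1)] by metis
  then obtain u where u: "\<And>n. \<not> 3 dvd u n" "\<And>n. \<tau> (zeta n) = zeta n ^ u n" by metis
  have not3: "\<not> 3 dvd int (u n)" for n using u(1)[of n] by presburger
  have zeta_1: "zeta (Suc n) ^ (3 ^ n) = zeta 1" for n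
  proof (induction n)
    case (Suc n)
    have "zeta (Suc (Suc n)) ^ (3 ^ Suc n) = (zeta (Suc (Suc n)) ^ 3) ^ (3 ^ n)"
      by (simp add: power_mult)
    then show ?case using Suc zeta_Suc by simp
  qed simp
  \<comment> \<open>An exponent that is 1 or -1 modulo 9 fixes \<open>xi 1 1\<close>; the exponent
    at a higher level also acts on \<open>zeta 1\<close>, a power of
    \<open>zeta (Suc n)\<close>.\<close>
  have u9: "\<not> 9 dvd (int (u (Suc n)))\<^sup>2 - 1" for n
  proof
    assume *: "9 dvd (int (u (Suc n)))\<^sup>2 - 1"
    have "\<tau> (zeta 1) = zeta 1 ^ u (Suc n)"
      unfolding zeta_1[of n, symmetric]
      using alg_homo.power[OF alg_homo_Aut[OF K_alg t(1)], of "zeta (Suc n)"] u(2)[of "Suc n"] algebraic_zeta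
      by (simp add: power_mult[symmetric] mult.commute)
    then have "\<tau> (xi 1 1) = xi 1 (u (Suc n))" using Aut_xi[OF t(1), of 1 _ 1] by simp
    moreover have "3 ^ 2 dvd int (u (Suc n)) - 1 \<or> 3 ^ 2 dvd int (u (Suc n)) + 1"
      by (rule square_eq_imp_pm) (use * not3[of "Suc n"] in auto)
    then have "xi 1 (u (Suc n)) = xi 1 1" unfolding xi_eq by (simp add: numeral_2_eq_2)
    ultimately show False using t(2) by simp
  qed
  obtain M where M: "Zp_extension 3 K M" "\<And>n. xi n 1 \<in> M"
  proof (rule Zp_extension_chain[of "\<lambda>n. xi n 1" \<tau>])
    show "\<exists>f\<in>polys_over K. xi n 1 = poly f (xi (Suc n) 1)" for n
    proof (rule bexI[of _ "monom 1 3 - monom 3 1"])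
      show "xi n 1 = poly (monom 1 3 - monom 3 1) (xi (Suc n) 1)"
        unfolding xi_Suc[of n] by (simp add: poly_monom)
      show "monom 1 3 - monom 3 1 \<in> polys_over K"
        by (intro polys_over_diff[OF K_alg] polys_over_monom[OF K_alg] alg_subfield_numerals[OF K_alg])
    qed
    show "\<exists>f\<in>polys_over K. \<tau> (xi n 1) = poly f (xi n 1)" for n
    proof -
      have "polys_over \<rat> \<subseteq> polys_over K" using alg_subfield_rat[OF K_alg] by (intro polys_over_mono) blast
      then show ?thesis using Aut_xi[OF t(1) u(2), of n 1] xi_poly[of n "u n"] by auto
    qed
    show "(\<tau> ^^ k) (xi n 1) = xi n 1 \<longleftrightarrow> 3 ^ n dvd k" for n k
    proof (cases n)
      case 0
      have "\<not> 3 dvd u 0 ^ k" using u(1)[of 0] prime_dvd_power[of 3 "u 0" k] by auto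
      then show ?thesis
        unfolding 0 Aut_xi_funpow[OF t(1) u(2)] using xi_0[of "u 0 ^ k"] xi_0[of 1] by simp
    next
      case (Suc m)
      show ?thesis
        unfolding Suc Aut_xi_funpow[OF t(1) u(2)] xi_eq
        using unit_power_pm_one_iff[OF not3 u9[of m], of "Suc m" k] by simp
    qed
    show "\<exists>k. \<sigma> (xi n 1) = (\<tau> ^^ k) (xi n 1)" if s: "\<sigma> \<in> Aut K" for \<sigma> n
    proof -
      obtain v where v: "\<not> 3 dvd v" "\<sigma> (zeta n) = zeta n ^ v" by (rule Aut_zeta[OF s])
      show ?thesis
      proof (cases n)
        case 0
        have "xi n v = xi n 1" unfolding 0 using v(1) xi_0[of v] xi_0[of 1] by simp
        then show ?thesis using Aut_xi[OF s v(2), of 1] by (intro exI[of _ 0]) simp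
      next
        case (Suc m)
        have "\<not> 3 dvd int v" using v(1) by presburger
        then obtain k where "3 ^ Suc n dvd int v - int (u n) ^ k \<or> 3 ^ Suc n dvd int v + int (u n) ^ k"
          using unit_power_surj[OF not3 u9[of m]] unfolding Suc by blast
        then have "xi n v = xi n (u n ^ k)" unfolding xi_eq by simp
        then show ?thesis using Aut_xi[OF s v(2), of 1] Aut_xi_funpow[OF t(1) u(2)] by (intro exI[of _ k]) simp
      qed
    qed
  qed (use algebraic_xi t in auto)
  then show ?thesis using M_sub_T by blast
qed

end

text \<open>Over the real field generated by \<open>xi 1 1\<close> the number \<open>zeta 1\<close>
  satisfies z^2 = \<xi> z - 1, so the full cyclotomic field consists of the a + b z with a, b in
  that real field. Comparison with the conjugate shows that a real such element has b = 0.\<close>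

lemma cyclotomic_field_real_9: "cyclotomic_field_real 9 = generate_field Qbar (\<rat> \<union> {xi 1 1})"
proof -
  let ?\<xi> = "xi 1 1" and ?z = "zeta 1"
  let ?R = "generate_field Qbar (\<rat> \<union> {?\<xi>})"
  let ?C = "generate_field Qbar (\<rat> \<union> {z. z ^ 9 = 1})"
  have sub1: "\<rat> \<union> {?\<xi>} \<subseteq> Qb" using algebraic_xi rat_imp_algebraic by auto
  have sub2: "\<rat> \<union> {z. z ^ 9 = 1} \<subseteq> Qb" using algebraic_root[of _ 9] rat_imp_algebraic by auto
  note R = alg_subfield_generate[OF sub1] and C = alg_subfield_generate[OF sub2]
  have xiR: "?\<xi> \<in> ?R" using generate_superset[OF sub1] by auto
  have z9: "?z ^ 9 = 1" using zeta_power_one[of 1] by simp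
  then have zC: "?z \<in> ?C" using generate_superset[OF sub2] by auto
  then have "?\<xi> \<in> ?C" unfolding xi_def by (auto intro!: alg_subfield_closed[OF C])
  then have RC: "?R \<subseteq> ?C"
    using generate_superset[OF sub2] by (intro generate_least[OF sub1 C]) auto
  have Rreal: "?R \<subseteq> \<real>"
  proof -
    have "alg_subfield (Qb \<inter> \<real>)"
      using alg_subfield_Qb Rats_Reals_complex by (auto simp: alg_subfield_def)
    then have "?R \<subseteq> Qb \<inter> \<real>"
      using xi_real algebraic_xi Rats_Reals_complex rat_imp_algebraic by (intro generate_least[OF sub1]) auto
    then show ?thesis by blast
  qed
  let ?S = "{a + b * ?z | a b. a \<in> ?R \<and> b \<in> ?R}"
  have zsq: "?z * ?z = ?\<xi> * ?z - 1" by (simp add: xi_def distrib_right)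
  have S: "alg_subfield ?S"
    unfolding alg_subfield_def
  proof (intro conjI ballI subsetI)
    fix q :: complex assume "q \<in> \<rat>"
    then show "q \<in> ?S" using alg_subfield_rat[OF R, of q] alg_subfield_numerals(1)[OF R]
      by (intro CollectI exI[of _ q] exI[of _ 0]) auto
  next
    fix x assume "x \<in> ?S"
    then show "x \<in> Qb" using alg_subfield_algebraic[OF R] algebraic_zeta
      by (auto intro!: algebraic_add algebraic_mult)
  next
    fix x y assume "x \<in> ?S" "y \<in> ?S"
    then obtain a b c d where ab: "x = a + b * ?z" "y = c + d * ?z" "a \<in> ?R" "b \<in> ?R" "c \<in> ?R" "d \<in> ?R" by auto
    show "x + y \<in> ?S" using ab alg_subfield_add[OF R]
      by (intro CollectI exI[of _ "a + c"] exI[of _ "b + d"]) (auto simp: algebra_simps)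
    have "x * y = (a * c - b * d) + (a * d + b * c + b * d * ?\<xi>) * ?z"
    proof -
      have "x * y = a * c + (a * d + b * c) * ?z + b * d * (?z * ?z)" unfolding ab by (simp add: algebra_simps)
      then show ?thesis unfolding zsq by (simp add: algebra_simps)
    qed
    moreover have "a * c - b * d \<in> ?R" "a * d + b * c + b * d * ?\<xi> \<in> ?R"
      by (intro alg_subfield_diff[OF R] alg_subfield_add[OF R] alg_subfield_mult[OF R] ab xiR)+
    ultimately show "x * y \<in> ?S" by blast
  qed
  have "?C \<subseteq> ?S"
  proof (rule generate_least[OF sub2 S])
    have zS: "?z \<in> ?S" using alg_subfield_numerals(1,2)[OF R] by force
    have "z \<in> ?S" if z: "z ^ 9 = 1" for z
    proof -
      have "z ^ (3 ^ Suc 1) = 1" using z by simp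
      then obtain k where "z = ?z ^ k" by (rule zeta_roots)
      then show ?thesis using alg_subfield_power[OF S zS] by simp
    qed
    then show "\<rat> \<union> {z. z ^ 9 = 1} \<subseteq> ?S" using alg_subfield_rat[OF S] by blast
  qed
  moreover have "x \<in> ?R" if "x \<in> ?S" "x \<in> \<real>" for x
  proof -
    obtain a b where ab: "x = a + b * ?z" "a \<in> ?R" "b \<in> ?R" using \<open>x \<in> ?S\<close> by auto
    have cj: "cnj a = a" "cnj b = b" "cnj x = x"
      using ab(2,3) Rreal \<open>x \<in> \<real>\<close> Reals_cnj_iff by blast+
    then have "b * (?z - inverse ?z) = 0" unfolding ab(1) by (auto simp: cnj_zeta algebra_simps)
    moreover have "?z \<noteq> inverse ?z"
    proof
      assume "?z = inverse ?z"
      then have "?z ^ 2 = 1" by (metis power2_eq_square right_inverse zeta_nonzero)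
      then show False unfolding zeta_power_eq_one by (auto dest: dvd_imp_le)
    qed
    ultimately have "b = 0" by simp
    then show ?thesis using ab by simp
  qed
  ultimately show ?thesis unfolding cyclotomic_field_real_def using RC Rreal by blast
qed

section \<open>The group law on a cubic\<close>

locale cubic =
  fixes a b c :: complex
  assumes nonsingular: "\<And>x. x ^ 3 + a * x\<^sup>2 + b * x + c = 0 \<Longrightarrow> 3 * x\<^sup>2 + 2 * a * x + b \<noteq> 0"
begin

fun on :: "point \<Rightarrow> bool" where
  "on Point_at_infinity = True"
| "on (Affine x y) = (y\<^sup>2 = x ^ 3 + a * x\<^sup>2 + b * x + c)"

fun neg :: "point \<Rightarrow> point" where
  "neg Point_at_infinity = Point_at_infinity"
| "neg (Affine x y) = Affine x (- y)"

fun add :: "point \<Rightarrow> point \<Rightarrow> point" where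
  "add Point_at_infinity Q = Q"
| "add P Point_at_infinity = P"
| "add (Affine x1 y1) (Affine x2 y2) =
     (if x1 = x2 \<and> y1 + y2 = 0 then Point_at_infinity
      else
        let l = (if x1 = x2 then (3 * x1\<^sup>2 + 2 * a * x1 + b) / (2 * y1) else (y2 - y1) / (x2 - x1));
            x3 = l\<^sup>2 - a - x1 - x2
        in Affine x3 (- (y1 + l * (x3 - x1))))"

lemma add_infinity_right: "add P Point_at_infinity = P"
  by (cases P) auto

text \<open>The slope of the chord or tangent is characterised without case distinction: on the curve,
  either equation implies the other unless its linear coefficient vanishes.\<close>

definition line :: "complex \<Rightarrow> complex \<Rightarrow> complex \<Rightarrow> complex \<Rightarrow> complex \<Rightarrow> bool" where
  "line x1 y1 x2 y2 l \<longleftrightarrow> l * (x1 - x2) = y1 - y2 \<and>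
     l * (y1 + y2) = x1\<^sup>2 + x1 * x2 + x2\<^sup>2 + a * (x1 + x2) + b"

lemma line_sym: "line x1 y1 x2 y2 l \<longleftrightarrow> line x2 y2 x1 y1 l"
  unfolding line_def by (auto simp: algebra_simps)

lemma on_same_x: "on (Affine x y1) \<Longrightarrow> on (Affine x y2) \<Longrightarrow> y1 + y2 \<noteq> 0 \<Longrightarrow> y1 = y2"
  by (simp add: power2_eq_iff add_eq_0_iff2) (metis add.left_inverse power2_eq_iff)

lemma line_exists:
  assumes on: "on (Affine x1 y1)" "on (Affine x2 y2)" and ne: "\<not> (x1 = x2 \<and> y1 + y2 = 0)"
  obtains l where "line x1 y1 x2 y2 l"
proof (cases "x1 = x2")
  case True
  have y: "y1 = y2" using on_same_x on True ne by blast
  then have "y1 \<noteq> 0" using ne True by simp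
  then have "(3 * x1\<^sup>2 + 2 * a * x1 + b) / (2 * y1) * (y1 + y1) = 3 * x1\<^sup>2 + 2 * a * x1 + b"
    by (simp flip: mult_2)
  then have "line x1 y1 x2 y2 ((3 * x1\<^sup>2 + 2 * a * x1 + b) / (2 * y1))"
    unfolding line_def True[symmetric] y[symmetric] by (simp add: power2_eq_square)
  then show thesis by (rule that)
next
  case False
  define l where "l = (y1 - y2) / (x1 - x2)"
  have l: "l * (x1 - x2) = y1 - y2" using False by (simp add: l_def)
  have "(x1 - x2) * (l * (y1 + y2)) = (y1 - y2) * (y1 + y2)" using l by (simp add: mult_ac)
  also have "\<dots> = (x1 - x2) * (x1\<^sup>2 + x1 * x2 + x2\<^sup>2 + a * (x1 + x2) + b)"
    using on by simp Groebner_Basis.algebra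
  finally have "l * (y1 + y2) = x1\<^sup>2 + x1 * x2 + x2\<^sup>2 + a * (x1 + x2) + b" using False by simp
  with l have "line x1 y1 x2 y2 l" by (simp add: line_def)
  then show thesis by (rule that)
qed

lemma add_line:
  assumes on: "on (Affine x1 y1)" "on (Affine x2 y2)" and ne: "\<not> (x1 = x2 \<and> y1 + y2 = 0)"
    and l: "line x1 y1 x2 y2 l"
  shows "add (Affine x1 y1) (Affine x2 y2) =
    Affine (l\<^sup>2 - a - x1 - x2) (- (y1 + l * (l\<^sup>2 - a - x1 - x2 - x1)))"
proof (cases "x1 = x2")
  case True
  have y: "y1 = y2" using on_same_x on True ne by blast
  then have "y1 \<noteq> 0" using ne True by simp
  then have "l = (3 * x1\<^sup>2 + 2 * a * x1 + b) / (2 * y1)"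
    using l True y unfolding line_def by (simp add: power2_eq_square field_simps)
  then show ?thesis using ne True by (simp add: Let_def)
next
  case False
  then have "l = (y2 - y1) / (x2 - x1)" using l unfolding line_def by (simp add: field_simps)
  then show ?thesis using False by (simp add: Let_def)
qed

lemma third_point_on:
  assumes "on (Affine x1 y1)" "line x1 y1 x2 y2 l"
  shows "on (Affine (l\<^sup>2 - a - x1 - x2) (- (y1 + l * (l\<^sup>2 - a - x1 - x2 - x1))))"
  using assms unfolding line_def on.simps by Groebner_Basis.algebra

lemma third_point_sym:
  assumes "line x1 y1 x2 y2 l" shows "- (y1 + l * (x - x1)) = - (y2 + l * (x - x2))"
  using assms unfolding line_def by Groebner_Basis.algebra

lemma add_on: "on P \<Longrightarrow> on Q \<Longrightarrow> on (add P Q)"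
proof (cases P; cases Q)
  fix x1 y1 x2 y2 assume *: "on P" "on Q" "P = Affine x1 y1" "Q = Affine x2 y2"
  show "on (add P Q)"
  proof (cases "x1 = x2 \<and> y1 + y2 = 0")
    case True
    then show ?thesis using * by simp
  next
    case False
    then obtain l where "line x1 y1 x2 y2 l" using line_exists * by blast
    then show ?thesis using add_line[of x1 y1 x2 y2 l] third_point_on[of x1 y1 x2 y2 l] * False by metis
  qed
qed auto

lemma add_commute:
  assumes "on P" "on Q" shows "add P Q = add Q P"
proof (cases P; cases Q)
  fix x1 y1 x2 y2 assume *: "P = Affine x1 y1" "Q = Affine x2 y2"
  show ?thesis
  proof (cases "x1 = x2 \<and> y1 + y2 = 0")
    case True
    then show ?thesis using * by (simp add: add.commute)
  next
    case False
    then obtain l where l: "line x1 y1 x2 y2 l" using line_exists * assms by blast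
    have e: "l\<^sup>2 - a - x2 - x1 = l\<^sup>2 - a - x1 - x2" by simp
    have ne: "\<not> (x2 = x1 \<and> y2 + y1 = 0)" using False by (simp add: add.commute)
    have l': "line x2 y2 x1 y1 l" using l line_sym by blast
    show ?thesis
      unfolding * add_line[OF assms[unfolded *] False l] add_line[OF assms(2,1)[unfolded *] ne l'] e
        third_point_sym[OF l, of "l\<^sup>2 - a - x1 - x2"] ..
  qed
qed auto

lemma add_neg: "on P \<Longrightarrow> add (neg P) P = Point_at_infinity"
  by (cases P) auto

lemma neg_on: "on P \<Longrightarrow> on (neg P)"
  by (cases P) auto

text \<open>The chord through \<open>neg P\<close> and \<open>add P Q\<close> is the mirror image of
  the one through \<open>P\<close> and \<open>Q\<close>, so its slope is \<open>- l\<close>. The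
  exceptional position would force \<open>y1 = 0\<close> and a zero of the derivative at
  \<open>x1\<close>, against \<open>nonsingular\<close>.\<close>

lemma add_neg_cancel:
  assumes "on P" "on Q" shows "add (neg P) (add P Q) = Q"
proof (cases P; cases Q)
  fix x1 y1 x2 y2 assume PQ: "P = Affine x1 y1" "Q = Affine x2 y2"
  show ?thesis
  proof (cases "x1 = x2 \<and> y1 + y2 = 0")
    case True
    then show ?thesis using PQ by (simp add: add_eq_0_iff)
  next
    case False
    then obtain l where l: "line x1 y1 x2 y2 l" using line_exists PQ assms by blast
    define s where "s = l\<^sup>2 - a - x1 - x2"
    define t where "t = - (y1 + l * (s - x1))"
    have PQs: "add P Q = Affine s t"
      using add_line[OF _ _ False l] assms unfolding PQ s_def t_def by blast
    have "on (Affine s t)" using add_on[OF assms] PQs by simp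
    have l': "line x1 (- y1) s t (- l)"
      using l unfolding line_def s_def t_def by (intro conjI) (simp_all add: algebra_simps, Groebner_Basis.algebra)
    have ne: "\<not> (x1 = s \<and> - y1 + t = 0)"
    proof
      assume "x1 = s \<and> - y1 + t = 0"
      then have y0: "y1 = 0" and s: "x1 = s" unfolding t_def by auto
      have "3 * x1\<^sup>2 + 2 * a * x1 + b = 0"
        using l y0 s s_def unfolding line_def by Groebner_Basis.algebra
      moreover have "x1 ^ 3 + a * x1\<^sup>2 + b * x1 + c = 0" using assms(1) PQ y0 by simp
      ultimately show False using nonsingular by blast
    qed
    have "on (Affine x1 (- y1))" using neg_on[OF assms(1)] PQ by simp
    from add_line[OF this \<open>on (Affine s t)\<close> ne l']
    have "add (neg P) (add P Q) = Affine ((- l)\<^sup>2 - a - x1 - s) (- (- y1 + - l * ((- l)\<^sup>2 - a - x1 - s - x1)))"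
      unfolding PQs unfolding PQ(1) neg.simps .
    moreover have "(- l)\<^sup>2 - a - x1 - s = x2" by (simp add: s_def)
    moreover have "- (- y1 + - l * (x2 - x1)) = y2" using l unfolding line_def by Groebner_Basis.algebra
    ultimately show ?thesis unfolding PQ(2) by metis
  qed
qed (use add_neg assms in auto)

context
  fixes x1 y1 x2 y2 x3 y3 l m :: complex
  assumes l: "line x1 y1 x2 y2 l" and m: "line x2 y2 x3 y3 m"
begin

text \<open>Compares the chords through the first two and the last two of three points. For
  \<open>l = m\<close> it forces two abscissae to coincide, which isolates the collinear case of
  associativity.\<close>

lemma slope_relation:
  "2 * y2 * (l - m) = x1\<^sup>2 + x1 * x2 - x3\<^sup>2 - x2 * x3 + a * (x1 - x3) - l\<^sup>2 * (x1 - x2) + m\<^sup>2 * (x3 - x2)"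
  using l m unfolding line_def by Groebner_Basis.algebra

text \<open>The claimed identity is derived once multiplied by \<open>s - x3\<close> and once by
  \<open>t + y3\<close>, from the two equations of \<open>line\<close>; by \<open>ne\<close> one of
  these factors is nonzero.\<close>

lemma slope_of_sum:
  assumes s: "s = l\<^sup>2 - a - x1 - x2" and t: "t = - (y1 + l * (s - x1))"
    and u: "line s t x3 y3 u" and ne: "\<not> (s = x3 \<and> t + y3 = 0)"
  shows "u * (l - m) = l * m - x2 - x3 - s - a"
proof -
  have y: "y1 = y2 + l * (x1 - x2)" "y3 = y2 + m * (x3 - x2)"
    using l m unfolding line_def by Groebner_Basis.algebra+
  have b: "b = l * (y1 + y2) - (x1\<^sup>2 + x1 * x2 + x2\<^sup>2 + a * (x1 + x2))"
    using l unfolding line_def by simp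
  have "(s - x3) * (u * (l - m) - (l * m - x2 - x3 - s - a)) = 0"
  proof -
    have "u * (s - x3) = t - y3" using u unfolding line_def by simp
    then show ?thesis using slope_relation s t y by Groebner_Basis.algebra
  qed
  moreover have "(t + y3) * (u * (l - m) - (l * m - x2 - x3 - s - a)) = 0"
  proof -
    have "u * (t + y3) = s\<^sup>2 + s * x3 + x3\<^sup>2 + a * (s + x3) + b" using u unfolding line_def by simp
    then show ?thesis using slope_relation s t y b by Groebner_Basis.algebra
  qed
  ultimately show ?thesis using ne by auto
qed

end

text \<open>In the generic case the slopes \<open>u\<close> and \<open>v\<close> of the two final
  chords satisfy \<open>v = u + l - m\<close>, and both coordinates follow. If \<open>l = m\<close>,
  either \<open>P = R\<close> and commutativity suffices, or the points are collinear and both sides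
  are the point at infinity.\<close>

lemma add_assoc:
  assumes "on P" "on Q" "on R" shows "add (add P Q) R = add P (add Q R)"
proof -
  consider "P = Point_at_infinity \<or> Q = Point_at_infinity \<or> R = Point_at_infinity"
    | x1 y1 x2 y2 x3 y3 where "P = Affine x1 y1" "Q = Affine x2 y2" "R = Affine x3 y3"
    by (cases P; cases Q; cases R) auto
  then show ?thesis
  proof cases
    case 1
    then show ?thesis by (auto simp: add_infinity_right)
  next
    case 2
    note on1 = assms(1)[unfolded 2(1)] and on2 = assms(2)[unfolded 2(2)] and on3 = assms(3)[unfolded 2(3)]
    consider "x1 = x2 \<and> y1 + y2 = 0" | "x2 = x3 \<and> y2 + y3 = 0"
      | "\<not> (x1 = x2 \<and> y1 + y2 = 0)" "\<not> (x2 = x3 \<and> y2 + y3 = 0)" by blast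
    then show ?thesis
    proof cases
      case 1: 1
      then have "P = neg Q" using 2 by (simp add: add_eq_0_iff2)
      then show ?thesis using add_neg_cancel[of Q R] add_neg[of Q] assms by simp
    next
      case 3: 2
      then have "R = neg Q" using 2 by (simp add: add_eq_0_iff)
      then show ?thesis
        using add_neg_cancel[of Q P] add_neg[of Q] add_commute assms neg_on add_on
        by (metis add.simps(1))
    next
      case ne: 3
      obtain l where l: "line x1 y1 x2 y2 l" using line_exists[OF on1 on2 ne(1)] .
      obtain m where m: "line x2 y2 x3 y3 m" using line_exists[OF on2 on3 ne(2)] .
      have l_rev: "line x2 y2 x1 y1 l" and m_rev: "line x3 y3 x2 y2 m" using l m line_sym by blast+
      define s t s' t' where "s = l\<^sup>2 - a - x1 - x2" and "t = - (y1 + l * (s - x1))"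
        and "s' = m\<^sup>2 - a - x3 - x2" and "t' = - (y3 + m * (s' - x3))"
      note st = s_def t_def s'_def t'_def
      have PQ: "add P Q = Affine s t"
        using add_line[OF on1 on2 ne(1) l] unfolding 2 st by simp
      have ne2': "\<not> (x3 = x2 \<and> y3 + y2 = 0)" using ne(2) by (simp add: add.commute)
      have QR: "add Q R = Affine s' t'"
        using add_line[OF on3 on2 ne2' m_rev] add_commute[OF assms(2,3)] unfolding 2 st by simp
      have ons: "on (Affine s t)" "on (Affine s' t')"
        using add_on[OF assms(1,2)] add_on[OF assms(2,3)] PQ QR by simp_all
      note rel = slope_relation[OF l m]
      show ?thesis
      proof (cases "l = m")
        case True
        then have "(x1 - x3) * (x3 - s) = 0"
          using rel unfolding s_def True by (simp add: power2_eq_square algebra_simps)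
        then consider "x1 = x3" | "x1 \<noteq> x3" "x3 = s" by auto
        then show ?thesis
        proof cases
          case 1
          then have "y1 - y2 = - (y2 - y3)"
            using l m True unfolding line_def by (metis minus_diff_eq mult_minus_right)
          then have "y1 = y3" by simp
          then have "P = R" using 1 2 by simp
          then show ?thesis using add_commute assms add_on by metis
        next
          case col: 2
          have "x1 = s'" using col True unfolding s_def s'_def by simp
          have "m * (x3 - x2) = y3 - y2" using m unfolding line_def by (metis minus_diff_eq mult_minus_right)
          then have t: "t + y3 = 0"
            using third_point_sym[OF l, of s] col True unfolding t_def by simp
          have t': "y1 + t' = 0"
            using third_point_sym[OF m_rev, of s'] \<open>x1 = s'\<close> True l unfolding t'_def line_def by simp
          show ?thesis using PQ QR 2 col t t' \<open>x1 = s'\<close> by simp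
        qed
      next
        case lm: False
        \<comment> \<open>If the third point were the negative of the sum of the first two, it would
          lie on their line, and that line would have slope \<open>m\<close>. The claim is stated
          for arbitrary points because it is applied a second time with the order reversed.\<close>
        have excl: "\<not> (s = x3 \<and> t + y3 = 0)"
          if l: "line x1 y1 x2 y2 l" and m: "line x2 y2 x3 y3 m" and lm: "l \<noteq> m"
            and ne: "\<not> (x2 = x3 \<and> y2 + y3 = 0)"
            and s: "s = l\<^sup>2 - a - x1 - x2" and t: "t = - (y1 + l * (s - x1))"
          for x1 y1 x2 y2 x3 y3 l m s t
        proof
          assume *: "s = x3 \<and> t + y3 = 0"
          have "m * (x3 - x2) = y3 - y2" using m unfolding line_def by (metis minus_diff_eq mult_minus_right)
          moreover have "l * (x3 - x2) = y3 - y2"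
          proof -
            have "t = - y3" using * by (simp add: add_eq_0_iff2)
            then have "- (y2 + l * (x3 - x2)) = - y3"
              using third_point_sym[OF l, of s] * unfolding t by simp
            then have "y2 + l * (x3 - x2) = y3" by (simp only: neg_equal_iff_equal)
            then show ?thesis by (simp add: eq_diff_eq add.commute)
          qed
          ultimately have "(l - m) * (x3 - x2) = 0" by (simp add: left_diff_distrib)
          then have x: "x3 = x2" using lm by simp
          then have y: "y3 = y2" using m unfolding line_def by simp
          have "(l - m) * (2 * y2) = 0"
          proof -
            have "m * (y2 + y2) = x2\<^sup>2 + x2 * x2 + x2\<^sup>2 + a * (x2 + x2) + b"
              using m unfolding line_def x y by blast
            moreover have "x2 = l\<^sup>2 - a - x1 - x2" using * s x by simp
            ultimately show ?thesis using l unfolding line_def by Groebner_Basis.algebra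
          qed
          then show False using lm ne x y by simp
        qed
        have ne_u: "\<not> (s = x3 \<and> t + y3 = 0)" by (rule excl[OF l m lm ne(2) s_def t_def])
        have ne_v: "\<not> (s' = x1 \<and> t' + y1 = 0)"
          using excl[OF m_rev l_rev _ _ s'_def t'_def] lm ne(1) by (auto simp: add.commute)
        obtain u where u: "line s t x3 y3 u" using line_exists[OF ons(1) on3 ne_u] .
        obtain v where v: "line s' t' x1 y1 v" using line_exists[OF ons(2) on1 ne_v] .
        have U: "u * (l - m) = l * m - x2 - x3 - s - a" by (rule slope_of_sum[OF l m s_def t_def u ne_u])
        have V: "v * (m - l) = m * l - x2 - x1 - s' - a" by (rule slope_of_sum[OF m_rev l_rev s'_def t'_def v ne_v])
        define z z' where "z = u\<^sup>2 - a - s - x3" and "z' = v\<^sup>2 - a - s' - x1"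
        have sum: "add (add P Q) R = Affine z (- (y3 + u * (z - x3)))"
          unfolding PQ unfolding 2(3) z_def add_line[OF ons(1) on3 ne_u u] third_point_sym[OF u] ..
        have sum': "add P (add Q R) = Affine z' (- (y1 + v * (z' - x1)))"
        proof -
          have "add P (add Q R) = add (Affine s' t') (Affine x1 y1)"
            using add_commute[OF on1 ons(2)] unfolding QR 2(1) .
          then show ?thesis unfolding z'_def add_line[OF ons(2) on1 ne_v v] third_point_sym[OF v] .
        qed
        \<comment> \<open>Adding \<open>U\<close> and \<open>V\<close> and inserting
          \<open>s\<close> and \<open>s'\<close> gives
          \<open>(l - m) * (u - v) = - (l - m)\<^sup>2\<close>.\<close>
        have "(l - m) * (u - v + (l - m)) = 0"
          using U V unfolding s_def s'_def by Groebner_Basis.algebra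
        then have "u - v + (l - m) = 0" using lm by (simp only: mult_eq_0_iff) simp
        then have vu: "v = u + l - m" by (simp add: algebra_simps)
        have "z = z'"
          using U V vu unfolding z_def z'_def by Groebner_Basis.algebra
        moreover have "y3 + u * (z - x3) = y1 + v * (z - x1)"
          using U vu l m unfolding z_def s_def line_def by Groebner_Basis.algebra
        ultimately show ?thesis using sum sum' by simp
      qed
    qed
  qed
qed

fun multiple :: "nat \<Rightarrow> point \<Rightarrow> point" where
  "multiple 0 P = Point_at_infinity"
| "multiple (Suc n) P = add (multiple n P) P"

lemma multiple_on: "on P \<Longrightarrow> on (multiple n P)"
  by (induction n) (auto intro: add_on)

lemma multiple_add: "on P \<Longrightarrow> multiple (m + n) P = add (multiple m P) (multiple n P)"
proof (induction n)
  case (Suc n)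
  then show ?case using add_assoc[of "multiple m P" "multiple n P" P] by (simp add: multiple_on)
qed (simp add: add_infinity_right)

lemma multiple_double: "on P \<Longrightarrow> multiple (2 * n) P = multiple n (add P P)"
proof (induction n)
  case (Suc n)
  have "multiple (2 * Suc n) P = multiple (2 * n + 2) P" by simp
  also have "\<dots> = add (multiple (2 * n) P) (multiple 2 P)" by (rule multiple_add[OF Suc(2)])
  also have "multiple 2 P = add P P" by (simp add: numeral_2_eq_2)
  finally show ?case using Suc by simp
qed simp

end

section \<open>Quadratic towers\<close>

definition adjoin :: "complex set \<Rightarrow> complex \<Rightarrow> complex set" where
  "adjoin M s = {u + v * s | u v. u \<in> M \<and> v \<in> M}"

text \<open>The root \<open>s\<close> may already lie in \<open>M\<close>: a step has degree 1 or 2,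
  and no irreducibility is tracked.\<close>

inductive quadratic_tower :: "complex set \<Rightarrow> complex set \<Rightarrow> bool" for F where
  base: "quadratic_tower F F"
| step: "quadratic_tower F M \<Longrightarrow> s\<^sup>2 \<in> M \<Longrightarrow> quadratic_tower F (adjoin M s)"

lemma adjoin_superset: "alg_subfield M \<Longrightarrow> M \<subseteq> adjoin M s"
  unfolding adjoin_def using alg_subfield_numerals(1) by force

lemma adjoin_mem: "alg_subfield M \<Longrightarrow> s \<in> adjoin M s"
  unfolding adjoin_def using alg_subfield_numerals(1,2) by force

lemma adjoin_alg_subfield:
  assumes M: "alg_subfield M" and s: "s\<^sup>2 \<in> M" shows "alg_subfield (adjoin M s)"
  unfolding alg_subfield_def
proof (intro conjI ballI)
  show "\<rat> \<subseteq> adjoin M s" using adjoin_superset[OF M] alg_subfield_rat[OF M] by blast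
  have "algebraic s" using algebraic_root[of s 2] alg_subfield_algebraic[OF M s] by simp
  then show "adjoin M s \<subseteq> Qb"
    using alg_subfield_algebraic[OF M] by (auto simp: adjoin_def intro!: algebraic_add algebraic_mult)
  fix x y assume "x \<in> adjoin M s" "y \<in> adjoin M s"
  then obtain u v w z where *: "x = u + v * s" "y = w + z * s" "u \<in> M" "v \<in> M" "w \<in> M" "z \<in> M"
    by (auto simp: adjoin_def)
  have "x + y = (u + w) + (v + z) * s" "x * y = (u * w + v * z * s\<^sup>2) + (u * z + v * w) * s"
    unfolding *(1,2) by (simp_all add: algebra_simps power2_eq_square)
  moreover have "u + w \<in> M" "v + z \<in> M" "u * w + v * z * s\<^sup>2 \<in> M" "u * z + v * w \<in> M"
    by (intro alg_subfield_add[OF M] alg_subfield_mult[OF M] * s)+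
  ultimately show "x + y \<in> adjoin M s" "x * y \<in> adjoin M s" unfolding adjoin_def by blast+
qed

lemma quadratic_tower_alg:
  assumes "quadratic_tower F M" "alg_subfield F" shows "alg_subfield M \<and> F \<subseteq> M"
  using assms by induction (use adjoin_alg_subfield adjoin_superset in blast)+

text \<open>The automorphism \<open>u + v s \<mapsto> u - v s\<close> is an involution, whereas every automorphism acts on
  \<open>T\<close> with odd order.\<close>

lemma (in base_field) quadratic_step:
  assumes p: "odd p" and M: "alg_subfield M" "K \<subseteq> M" and s: "s\<^sup>2 \<in> M"
    and x: "x \<in> T" "x \<in> adjoin M s"
  shows "x \<in> M"
proof (cases "s \<in> M")
  case True
  then show ?thesis using x(2) alg_subfield_add[OF M(1)] alg_subfield_mult[OF M(1)] by (auto simp: adjoin_def)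
next
  case sM: False
  let ?R = "{(u + v * s, u - v * s) | u v. u \<in> M \<and> v \<in> M}"
  have uniq: "u = u' \<and> v = v'"
    if "u + v * s = u' + v' * s" "u \<in> M" "v \<in> M" "u' \<in> M" "v' \<in> M" for u v u' v'
  proof -
    have e: "(v - v') * s = u' - u" using that(1) by (simp add: algebra_simps)
    have "v = v'"
    proof (rule ccontr)
      assume "v \<noteq> v'"
      then have "s = (u' - u) / (v - v')" using e by (simp add: eq_divide_eq mult.commute)
      then show False using sM that alg_subfield_divide[OF M(1)] alg_subfield_diff[OF M(1)] by metis
    qed
    with that(1) show ?thesis by simp
  qed
  have "hom_graph ?R"
    unfolding hom_graph_def
  proof (intro conjI ballI allI impI)
    show "(q, q) \<in> ?R" if "q \<in> \<rat>" for q
      using alg_subfield_rat[OF M(1) that] alg_subfield_numerals(1)[OF M(1)]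
      by (intro CollectI exI[of _ q] exI[of _ 0]) auto
    show "single_valued ?R"
    proof (rule single_valuedI)
      fix z z' z'' assume "(z, z') \<in> ?R" "(z, z'') \<in> ?R"
      then obtain u v u' v' where *: "z = u + v * s" "z' = u - v * s" "z = u' + v' * s" "z'' = u' - v' * s"
        "u \<in> M" "v \<in> M" "u' \<in> M" "v' \<in> M" by blast
      have "u = u' \<and> v = v'" by (rule uniq) (use * in auto)
      then show "z' = z''" using * by simp
    qed
    show "Domain ?R \<subseteq> Qb"
      using alg_subfield_algebraic[OF adjoin_alg_subfield[OF M(1) s]] by (auto simp: adjoin_def)
    fix a a' b b' assume "(a, a') \<in> ?R" "(b, b') \<in> ?R"
    then obtain u v w z where *: "a = u + v * s" "a' = u - v * s" "b = w + z * s" "b' = w - z * s"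
      "u \<in> M" "v \<in> M" "w \<in> M" "z \<in> M" by auto
    have "a + b = (u + w) + (v + z) * s" "a' + b' = (u + w) - (v + z) * s"
      "a * b = (u * w + v * z * s\<^sup>2) + (u * z + v * w) * s"
      "a' * b' = (u * w + v * z * s\<^sup>2) - (u * z + v * w) * s"
      unfolding *(1-4) by (simp_all add: algebra_simps power2_eq_square)
    moreover have "u + w \<in> M" "v + z \<in> M" "u * w + v * z * s\<^sup>2 \<in> M" "u * z + v * w \<in> M"
      by (intro alg_subfield_add[OF M(1)] alg_subfield_mult[OF M(1)] * s)+
    ultimately show "(a + b, a' + b') \<in> ?R" "(a * b, a' * b') \<in> ?R" by blast+
  qed
  then obtain \<tau> where t: "alg_hom \<rat> Qb \<tau>" "\<And>x y. (x, y) \<in> ?R \<Longrightarrow> \<tau> x = y"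
    using hom_graph_extend by blast
  have tval: "\<tau> (u + v * s) = u - v * s" if "u \<in> M" "v \<in> M" for u v using t(2) that by blast
  have "\<tau> k = k" if "k \<in> K" for k
    using tval[of k 0] M that alg_subfield_numerals(1)[OF M(1)] by auto
  then have tA: "\<tau> \<in> Aut K" using t(1) by (auto simp: Aut_def alg_hom_def)
  obtain u v where uv: "x = u + v * s" "u \<in> M" "v \<in> M" using x(2) by (auto simp: adjoin_def)
  have "\<tau> (\<tau> x) = x"
    using tval[of u v] tval[of u "- v"] uv alg_subfield_uminus[OF M(1)] by simp
  then have "(\<tau> ^^ 2) x = x" by (simp add: numeral_2_eq_2)
  moreover obtain m where "(\<tau> ^^ (p ^ m)) x = x" using Aut_pow_T[OF tA x(1)] by blast
  ultimately have "\<tau> x = x" using funpow_odd_fixed p by fastforce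
  then have "v * s = 0" using tval[of u v] uv by auto
  then show ?thesis using uv by auto
qed

lemma (in base_field) quadratic_tower_T:
  assumes "quadratic_tower F M" "odd p" "alg_subfield F" "K \<subseteq> F" "x \<in> T" "x \<in> M"
  shows "x \<in> F"
  using assms(1,6)
proof induction
  case (step M s)
  then show ?case
    using quadratic_step[OF assms(2) _ _ step(2) assms(5) step(4)] quadratic_tower_alg[OF step(1) assms(3)] assms(4)
    by blast
qed

section \<open>Halving points\<close>

lemma cubic_split:
  fixes a b c :: complex
  obtains e1 e2 e3 where "a = - (e1 + e2 + e3)" "b = e1 * e2 + e1 * e3 + e2 * e3" "c = - (e1 * e2 * e3)"
proof -
  have "\<not> constant (poly [:c, b, a, 1:])" by (simp add: constant_degree)
  then obtain e1 where "poly [:c, b, a, 1:] e1 = 0" using fundamental_theorem_of_algebra by blast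
  then have e1: "c + e1 * (b + e1 * (a + e1)) = 0" by simp
  define B C where "B = a + e1" and "C = b + B * e1"
  define d where "d = csqrt (B\<^sup>2 - 4 * C)"
  have d: "d\<^sup>2 = B\<^sup>2 - 4 * C" by (simp add: d_def)
  have h: "e1 * ((- B + d) / 2) + e1 * ((- B - d) / 2) + (- B + d) / 2 * ((- B - d) / 2) = - (e1 * B) + C"
  proof -
    have "(- B + d) / 2 * ((- B - d) / 2) = (B\<^sup>2 - d\<^sup>2) / 4" by (simp add: algebra_simps power2_eq_square)
    then have "(- B + d) / 2 * ((- B - d) / 2) = C" unfolding d by simp
    moreover have "e1 * ((- B + d) / 2) + e1 * ((- B - d) / 2) = - (e1 * B)" by (simp add: field_simps)
    ultimately show ?thesis by simp
  qed
  have h2: "(- B + d) / 2 * ((- B - d) / 2) = C"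
  proof -
    have "(- B + d) / 2 * ((- B - d) / 2) = (B\<^sup>2 - d\<^sup>2) / 4" by (simp add: algebra_simps power2_eq_square)
    then show ?thesis unfolding d by simp
  qed
  show thesis
  proof (rule that[of e1 "(- B + d) / 2" "(- B - d) / 2"])
    show "a = - (e1 + (- B + d) / 2 + (- B - d) / 2)" by (simp add: B_def field_simps)
    show "b = e1 * ((- B + d) / 2) + e1 * ((- B - d) / 2) + (- B + d) / 2 * ((- B - d) / 2)"
      unfolding h by (simp add: C_def)
    show "c = - (e1 * ((- B + d) / 2) * ((- B - d) / 2))"
      unfolding mult.assoc h2 using e1 by (simp add: C_def B_def add_eq_0_iff2 algebra_simps)
  qed
qed

locale split_cubic =
  fixes e1 e2 e3 :: complex
  assumes distinct: "e1 \<noteq> e2" "e1 \<noteq> e3" "e2 \<noteq> e3"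
begin

definition "ca = - (e1 + e2 + e3)"
definition "cb = e1 * e2 + e1 * e3 + e2 * e3"
definition "cc = - (e1 * e2 * e3)"

lemma factor: "x ^ 3 + ca * x\<^sup>2 + cb * x + cc = (x - e1) * (x - e2) * (x - e3)"
  unfolding ca_def cb_def cc_def by Groebner_Basis.algebra

sublocale cubic ca cb cc
proof
  fix x assume "x ^ 3 + ca * x\<^sup>2 + cb * x + cc = 0"
  then consider "x = e1" | "x = e2" | "x = e3" unfolding factor by auto
  then show "3 * x\<^sup>2 + 2 * ca * x + cb \<noteq> 0"
  proof cases
    case 1
    have "3 * x\<^sup>2 + 2 * ca * x + cb = (e1 - e2) * (e1 - e3)"
      unfolding 1 ca_def cb_def by Groebner_Basis.algebra
    then show ?thesis using distinct by simp
  next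
    case 2
    have "3 * x\<^sup>2 + 2 * ca * x + cb = (e2 - e1) * (e2 - e3)"
      unfolding 2 ca_def cb_def by Groebner_Basis.algebra
    then show ?thesis using distinct by simp
  next
    case 3
    have "3 * x\<^sup>2 + 2 * ca * x + cb = (e3 - e1) * (e3 - e2)"
      unfolding 3 ca_def cb_def by Groebner_Basis.algebra
    then show ?thesis using distinct by simp
  qed
qed

text \<open>If \<open>(X, Y)\<close> is the double of \<open>(x, y)\<close>, then \<open>X - e\<^sub>i\<close> is the square of
  \<open>s\<^sub>i = ((x - e\<^sub>i)\<^sup>2 - (e\<^sub>i - e\<^sub>j) (e\<^sub>i - e\<^sub>k)) / (2 y)\<close>, and
  \<open>(s\<^sub>i + s\<^sub>j) y = (x - e\<^sub>i) (x - e\<^sub>j)\<close>.\<close>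

lemma halving:
  assumes F: "alg_subfield F" "e1 \<in> F" "e2 \<in> F" "e3 \<in> F" and M: "quadratic_tower F M"
    and on: "on (Affine x y)" and dbl: "coords (add (Affine x y) (Affine x y)) \<subseteq> M"
  obtains M' where "quadratic_tower F M'" "x \<in> M'" "y \<in> M'"
proof (cases "y = 0")
  case True
  then have "x = e1 \<or> x = e2 \<or> x = e3" using on unfolding on.simps factor by auto
  then have "x \<in> F" "y \<in> F" using F True alg_subfield_numerals(1) by auto
  then show thesis using that[OF quadratic_tower.base] by blast
next
  case y: False
  define l where "l = (3 * x\<^sup>2 + 2 * ca * x + cb) / (2 * y)"
  define z where "z = l\<^sup>2 - ca - x - x"
  have "add (Affine x y) (Affine x y) = Affine z (- (y + l * (z - x)))"
    using y by (simp add: Let_def l_def z_def)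
  then have zM: "z \<in> M" using dbl by auto
  note Malg = quadratic_tower_alg[OF M F(1)]
  define s1 where "s1 = ((x - e1)\<^sup>2 - (e1 - e2) * (e1 - e3)) / (2 * y)"
  define s2 where "s2 = ((x - e2)\<^sup>2 - (e2 - e1) * (e2 - e3)) / (2 * y)"
  define s3 where "s3 = ((x - e3)\<^sup>2 - (e3 - e1) * (e3 - e2)) / (2 * y)"
  have y2: "y\<^sup>2 = (x - e1) * (x - e2) * (x - e3)" using on unfolding on.simps factor .
  have sq: "(r / (2 * y))\<^sup>2 = z - e"
    if "r\<^sup>2 = (3 * x\<^sup>2 + 2 * ca * x + cb)\<^sup>2 - 4 * ((x - e1) * (x - e2) * (x - e3)) * (ca + x + x + e)" for r e
  proof -
    have "(r / (2 * y))\<^sup>2 = r\<^sup>2 / (4 * y\<^sup>2)" by (simp add: power_divide power_mult_distrib)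
    also have "\<dots> = (3 * x\<^sup>2 + 2 * ca * x + cb)\<^sup>2 / (4 * y\<^sup>2) - (ca + x + x + e)"
      unfolding that y2[symmetric] using y by (simp add: diff_divide_distrib)
    also have "(3 * x\<^sup>2 + 2 * ca * x + cb)\<^sup>2 / (4 * y\<^sup>2) = l\<^sup>2"
      by (simp add: l_def power_divide power_mult_distrib)
    finally show ?thesis by (simp add: z_def)
  qed
  have s: "s1\<^sup>2 = z - e1" "s2\<^sup>2 = z - e2" "s3\<^sup>2 = z - e3"
    unfolding s1_def s2_def s3_def by (rule sq; unfold ca_def cb_def; Groebner_Basis.algebra)+
  have ss: "s1 + s2 = (x - e1) * (x - e2) / y" "s1 + s3 = (x - e1) * (x - e3) / y" "s2 + s3 = (x - e2) * (x - e3) / y"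
  proof -
    have half: "r / (2 * y) + r' / (2 * y) = q / y" if "r + r' = 2 * q" for r r' q
      using that y by (simp add: add_divide_distrib[symmetric])
    show "s1 + s2 = (x - e1) * (x - e2) / y" "s1 + s3 = (x - e1) * (x - e3) / y" "s2 + s3 = (x - e2) * (x - e3) / y"
      unfolding s1_def s2_def s3_def by (rule half; Groebner_Basis.algebra)+
  qed
  \<comment> \<open>Expanding this product and using \<open>s1\<^sup>2 = z - e1\<close> expresses
    \<open>x\<close> by the three square roots; the product of all three pair sums then gives
    \<open>y\<close>.\<close>
  have "(s1 + s2) * (s1 + s3) = (x - e1) * y\<^sup>2 / y\<^sup>2"
    unfolding ss y2 by (simp add: power2_eq_square mult_ac y2[symmetric, unfolded power2_eq_square])
      (simp add: y2[unfolded power2_eq_square] mult_ac)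
  then have "(s1 + s2) * (s1 + s3) = x - e1" using y by simp
  then have x: "x = z + s1 * s2 + s1 * s3 + s2 * s3"
    using s(1) by Groebner_Basis.algebra
  have "(s1 + s2) * (s1 + s3) * (s2 + s3) = y\<^sup>2 * y\<^sup>2 / (y * y * y)"
    unfolding ss y2 by (simp add: power2_eq_square mult_ac)
  then have y': "y = (s1 + s2) * (s1 + s3) * (s2 + s3)"
    using y by (simp add: power2_eq_square)
  define M1 M2 M3 where "M1 = adjoin M s1" and "M2 = adjoin M1 s2" and "M3 = adjoin M2 s3"
  have eM: "z - e1 \<in> M" "z - e2 \<in> M" "z - e3 \<in> M"
    using zM F Malg by (auto intro!: alg_subfield_diff)
  have M1: "quadratic_tower F M1" "M \<subseteq> M1" "s1 \<in> M1"
    unfolding M1_def using Malg eM M by (auto intro!: quadratic_tower.step adjoin_mem dest: adjoin_superset simp: s)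
  note M1alg = quadratic_tower_alg[OF M1(1) F(1)]
  have M2: "quadratic_tower F M2" "M1 \<subseteq> M2" "s2 \<in> M2"
    unfolding M2_def using M1alg eM M1 by (auto intro!: quadratic_tower.step adjoin_mem dest: adjoin_superset simp: s)
  note M2alg = quadratic_tower_alg[OF M2(1) F(1)]
  have M3: "quadratic_tower F M3" "M2 \<subseteq> M3" "s3 \<in> M3"
    unfolding M3_def using M2alg eM M1 M2 by (auto intro!: quadratic_tower.step adjoin_mem dest: adjoin_superset simp: s)
  have M3alg: "alg_subfield M3" using quadratic_tower_alg[OF M3(1) F(1)] by blast
  have in3: "s1 \<in> M3" "s2 \<in> M3" "s3 \<in> M3" "z \<in> M3" using M1 M2 M3 zM by auto
  show thesis
  proof (rule that[OF M3(1)])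
    show "x \<in> M3" unfolding x by (intro alg_subfield_add[OF M3alg] alg_subfield_mult[OF M3alg] in3)
    show "y \<in> M3" unfolding y' by (intro alg_subfield_add[OF M3alg] alg_subfield_mult[OF M3alg] in3)
  qed
qed

text \<open>By \<open>multiple_double\<close> the induction hypothesis applies to
  \<open>add P P\<close>, and halving enlarges its tower by three square roots.\<close>

lemma two_power_torsion_tower:
  assumes F: "alg_subfield F" "e1 \<in> F" "e2 \<in> F" "e3 \<in> F"
  shows "on P \<Longrightarrow> multiple (2 ^ n) P = Point_at_infinity \<Longrightarrow> \<exists>M. quadratic_tower F M \<and> coords P \<subseteq> M"
proof (induction n arbitrary: P)
  case 0
  then show ?case using quadratic_tower.base by auto
next
  case (Suc n)
  have "multiple (2 ^ n) (add P P) = Point_at_infinity"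
    using Suc.prems multiple_double[OF Suc.prems(1), of "2 ^ n"] by simp
  then obtain M where M: "quadratic_tower F M" "coords (add P P) \<subseteq> M"
    using Suc.IH add_on Suc.prems(1) by blast
  show ?case
  proof (cases P)
    case (Affine x y)
    then show ?thesis using halving[OF F M(1), of x y] M(2) Suc.prems(1) by auto
  qed (use quadratic_tower.base in auto)
qed

end

section \<open>Two-power torsion of elliptic curves\<close>

locale elliptic = split_cubic e1 e2 e3 for e1 e2 e3 +
  fixes E :: weierstrass
  assumes coeffs: "of_rat (wa2 E) + (of_rat (wa1 E) / 2)\<^sup>2 = ca"
    "of_rat (wa4 E) + 2 * (of_rat (wa1 E) / 2) * (of_rat (wa3 E) / 2) = cb"
    "of_rat (wa6 E) + (of_rat (wa3 E) / 2)\<^sup>2 = cc"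
begin

definition "\<mu> = of_rat (wa1 E) / (2::complex)"
definition "\<nu> = of_rat (wa3 E) / (2::complex)"

lemma coeff_eqs: "of_rat (wa1 E) = 2 * \<mu>" "of_rat (wa3 E) = 2 * \<nu>" "of_rat (wa2 E) = ca - \<mu>\<^sup>2"
  "of_rat (wa4 E) = cb - 2 * \<mu> * \<nu>" "of_rat (wa6 E) = cc - \<nu>\<^sup>2"
  unfolding \<mu>_def \<nu>_def coeffs[symmetric] by simp_all

text \<open>Completing the square carries the Weierstrass equation to \<open>y\<^sup>2 = (x - e1) (x - e2) (x - e3)\<close>.\<close>

fun shift :: "point \<Rightarrow> point" where
  "shift Point_at_infinity = Point_at_infinity"
| "shift (Affine x y) = Affine x (y + \<mu> * x + \<nu>)"

lemma shift_on: "on (shift P) \<longleftrightarrow> on_curve E P"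
proof (cases P)
  case (Affine x y)
  have "(y + \<mu> * x + \<nu>)\<^sup>2 - (x ^ 3 + ca * x\<^sup>2 + cb * x + cc) =
     y\<^sup>2 + 2 * \<mu> * x * y + 2 * \<nu> * y - (x ^ 3 + (ca - \<mu>\<^sup>2) * x\<^sup>2 + (cb - 2 * \<mu> * \<nu>) * x + (cc - \<nu>\<^sup>2))"
    by Groebner_Basis.algebra
  then show ?thesis
    unfolding Affine shift.simps on.simps on_curve.simps coeff_eqs by (rule diff_eq_diff_eq)
qed auto

lemma shift_infinity: "shift P = Point_at_infinity \<longleftrightarrow> P = Point_at_infinity"
  by (cases P) auto

text \<open>The change of coordinates is linear, so chords go to chords and tangents to tangents,
  with slopes increased by the constant \<open>\<mu>\<close>.\<close>

lemma shift_add: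
  assumes "on_curve E P" "on_curve E Q" shows "shift (point_add E P Q) = add (shift P) (shift Q)"
proof (cases P; cases Q)
  fix x1 y1 x2 y2 assume PQ: "P = Affine x1 y1" "Q = Affine x2 y2"
  define \<eta>1 \<eta>2 where "\<eta>1 = y1 + \<mu> * x1 + \<nu>" and "\<eta>2 = y2 + \<mu> * x2 + \<nu>"
  have sh: "shift P = Affine x1 \<eta>1" "shift Q = Affine x2 \<eta>2" by (simp_all add: PQ \<eta>1_def \<eta>2_def)
  have on: "on (Affine x1 \<eta>1)" "on (Affine x2 \<eta>2)" using assms shift_on sh by metis+
  have inv: "(x1 = x2 \<and> y1 + y2 + 2 * \<mu> * x2 + 2 * \<nu> = 0) \<longleftrightarrow> (x1 = x2 \<and> \<eta>1 + \<eta>2 = 0)"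
    unfolding \<eta>1_def \<eta>2_def by (auto simp: algebra_simps)
  show ?thesis
  proof (cases "x1 = x2 \<and> \<eta>1 + \<eta>2 = 0")
    case True
    then show ?thesis unfolding sh using inv by (simp add: PQ coeff_eqs)
  next
    case ne: False
    define k where "k = (if x1 = x2
       then (3 * x1\<^sup>2 + 2 * (ca - \<mu>\<^sup>2) * x1 + (cb - 2 * \<mu> * \<nu>) - 2 * \<mu> * y1) / (2 * y1 + 2 * \<mu> * x1 + 2 * \<nu>)
       else (y2 - y1) / (x2 - x1))"
    define l where "l = (if x1 = x2 then (3 * x1\<^sup>2 + 2 * ca * x1 + cb) / (2 * \<eta>1) else (\<eta>2 - \<eta>1) / (x2 - x1))"
    have kl: "l = k + \<mu>"
    proof (cases "x1 = x2")
      case True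
      then have "\<eta>1 = \<eta>2" using on_same_x on ne by blast
      then have nz: "\<eta>1 \<noteq> 0" using ne True by simp
      have d: "2 * y1 + 2 * \<mu> * x1 + 2 * \<nu> = 2 * \<eta>1" by (simp add: \<eta>1_def)
      have n: "3 * x1\<^sup>2 + 2 * ca * x1 + cb =
         (3 * x1\<^sup>2 + 2 * (ca - \<mu>\<^sup>2) * x1 + (cb - 2 * \<mu> * \<nu>) - 2 * \<mu> * y1) + \<mu> * (2 * \<eta>1)"
        unfolding \<eta>1_def by Groebner_Basis.algebra
      show ?thesis unfolding l_def k_def d n using True nz by (simp add: add_divide_distrib)
    next
      case False
      then have "x2 - x1 \<noteq> 0" by simp
      moreover have "\<eta>2 - \<eta>1 = (y2 - y1) + \<mu> * (x2 - x1)" by (simp add: \<eta>1_def \<eta>2_def algebra_simps)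
      ultimately show ?thesis unfolding l_def k_def using False by (simp add: add_divide_distrib)
    qed
    define z where "z = l\<^sup>2 - ca - x1 - x2"
    have z: "k\<^sup>2 + 2 * \<mu> * k - (ca - \<mu>\<^sup>2) - x1 - x2 = z"
      unfolding z_def kl by (simp add: power2_eq_square algebra_simps)
    have "point_add E P Q = Affine z (- (y1 + k * (z - x1)) - 2 * \<mu> * z - 2 * \<nu>)"
      unfolding PQ point_add.simps coeff_eqs inv k_def[symmetric] Let_def z using ne by (simp only: if_False)
    then have "shift (point_add E P Q) = Affine z (- (y1 + k * (z - x1)) - 2 * \<mu> * z - 2 * \<nu> + \<mu> * z + \<nu>)"
      by simp
    also have "- (y1 + k * (z - x1)) - 2 * \<mu> * z - 2 * \<nu> + \<mu> * z + \<nu> = - (\<eta>1 + l * (z - x1))"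
      unfolding kl \<eta>1_def by (simp add: algebra_simps)
    also have "Affine z (- (\<eta>1 + l * (z - x1))) = add (shift P) (shift Q)"
      unfolding sh add.simps l_def[symmetric] Let_def z_def[symmetric] using ne by (simp only: if_False)
    finally show ?thesis .
  qed
qed (simp_all add: add_infinity_right)

lemma on_curve_add: "on_curve E P \<Longrightarrow> on_curve E Q \<Longrightarrow> on_curve E (point_add E P Q)"
  using add_on shift_add shift_on by metis

lemma points_pow:
  assumes "on_curve E P"
  shows "on_curve E (P [^]\<^bsub>points E F\<^esub> (n::nat)) \<and> shift (P [^]\<^bsub>points E F\<^esub> n) = multiple n (shift P)"
proof (induction n)
  case 0
  then show ?case by (simp add: points_def)
next
  case (Suc n)
  have "P [^]\<^bsub>points E F\<^esub> Suc n = point_add E (P [^]\<^bsub>points E F\<^esub> n) P"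
    by (simp add: nat_pow_Suc) (simp add: points_def)
  then show ?case using Suc assms on_curve_add shift_add by simp
qed

lemma two_primary_torsion_iff:
  "P \<in> two_primary_torsion E F \<longleftrightarrow>
     on_curve E P \<and> coords P \<subseteq> F \<and> (\<exists>n. multiple (2 ^ n) (shift P) = Point_at_infinity)"
proof -
  have one: "\<one>\<^bsub>points E F\<^esub> = Point_at_infinity" and car: "P \<in> carrier (points E F) \<longleftrightarrow> on_curve E P \<and> coords P \<subseteq> F"
    by (simp_all add: points_def)
  have "P [^]\<^bsub>points E F\<^esub> ((2::nat) ^ n) = Point_at_infinity \<longleftrightarrow> multiple (2 ^ n) (shift P) = Point_at_infinity"
    if "on_curve E P" for n
    using points_pow[OF that, of F "2 ^ n"] shift_infinity by metis
  then show ?thesis unfolding two_primary_torsion_def one mem_Collect_eq car by blast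
qed

lemma roots_algebraic: "algebraic e1" "algebraic e2" "algebraic e3"
proof -
  have r: "ca \<in> \<rat>" "cb \<in> \<rat>" "cc \<in> \<rat>" unfolding coeffs[symmetric] by auto
  have "algebraic x" if "(x - e1) * (x - e2) * (x - e3) = 0" for x
  proof (rule algebraicI'[of "[:cc, cb, ca, 1:]"])
    show "coeff [:cc, cb, ca, 1:] i \<in> \<rat>" for i using r by (auto simp: coeff_pCons split: nat.splits)
    show "poly [:cc, cb, ca, 1:] x = 0"
      using that unfolding factor[symmetric] by (simp add: algebra_simps power2_eq_square power3_eq_cube)
  qed simp
  then show "algebraic e1" "algebraic e2" "algebraic e3" by auto
qed

lemma mu_nu_rat: "\<mu> \<in> \<rat>" "\<nu> \<in> \<rat>"
  unfolding \<mu>_def \<nu>_def by auto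

lemma two_torsion_iff:
  "P \<in> two_torsion E \<longleftrightarrow> P = Point_at_infinity \<or> (\<exists>e\<in>{e1, e2, e3}. P = Affine e (- (\<mu> * e + \<nu>)))"
proof -
  let ?Q = "carrier Qbar"
  have "P \<in> two_torsion E \<longleftrightarrow> on_curve E P \<and> coords P \<subseteq> Qb \<and> add (shift P) (shift P) = Point_at_infinity"
  proof (cases "on_curve E P")
    case True
    have "P [^]\<^bsub>points E ?Q\<^esub> (2::nat) = \<one>\<^bsub>points E ?Q\<^esub> \<longleftrightarrow> shift (P [^]\<^bsub>points E ?Q\<^esub> (2::nat)) = Point_at_infinity"
      unfolding shift_infinity by (simp add: points_def)
    also have "\<dots> \<longleftrightarrow> add (shift P) (shift P) = Point_at_infinity"
      using points_pow[OF True, of ?Q 2] by (simp add: numeral_2_eq_2)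
    finally show ?thesis using True by (simp add: two_torsion_def points_def)
  qed (simp add: two_torsion_def points_def)
  also have "\<dots> \<longleftrightarrow> P = Point_at_infinity \<or> (\<exists>e\<in>{e1, e2, e3}. P = Affine e (- (\<mu> * e + \<nu>)))"
  proof (cases P)
    case (Affine x y)
    have "add (Affine x t) (Affine x t) = Point_at_infinity \<longleftrightarrow> t = 0" for t
      by (simp add: Let_def flip: mult_2)
    then have dbl: "add (shift P) (shift P) = Point_at_infinity \<longleftrightarrow> y + \<mu> * x + \<nu> = 0"
      unfolding Affine shift.simps .
    have on: "on_curve E P \<longleftrightarrow> (y + \<mu> * x + \<nu>)\<^sup>2 = (x - e1) * (x - e2) * (x - e3)"
      unfolding shift_on[symmetric] Affine shift.simps on.simps factor ..
    have y: "y + \<mu> * x + \<nu> = 0 \<longleftrightarrow> y = - (\<mu> * x + \<nu>)" by (simp add: add_eq_0_iff2 add.assoc)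
    have alg: "algebraic (- (\<mu> * e + \<nu>))" if "algebraic e" for e
      by (intro algebraic_minus algebraic_add algebraic_mult rat_imp_algebraic mu_nu_rat that)
    have "on_curve E P \<and> y + \<mu> * x + \<nu> = 0 \<longleftrightarrow> x \<in> {e1, e2, e3} \<and> y + \<mu> * x + \<nu> = 0"
      unfolding on by auto
    then show ?thesis
      unfolding dbl y using alg roots_algebraic unfolding Affine by auto
  qed auto
  finally show ?thesis .
qed

text \<open>The ordinates of the points of order 2 are rational linear expressions in the roots and
  generate nothing new.\<close>

lemma two_division_field:
  assumes "alg_subfield F"
  shows "two_division_field E F = generate_field Qbar (F \<union> {e1, e2, e3})"
proof -
  let ?H = "F \<union> (\<Union>P\<in>two_torsion E. coords P)" and ?H' = "F \<union> {e1, e2, e3}"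
  have H': "?H' \<subseteq> Qb" using roots_algebraic alg_subfield_algebraic[OF assms] by auto
  note G' = alg_subfield_generate[OF H'] and s' = generate_superset[OF H']
  have coord: "(\<Union>P\<in>two_torsion E. coords P) = {e1, e2, e3} \<union> (\<lambda>e. - (\<mu> * e + \<nu>)) ` {e1, e2, e3}"
    by (auto simp: two_torsion_iff)
  have "- (\<mu> * e + \<nu>) \<in> generate_field Qbar ?H'" if "e \<in> generate_field Qbar ?H'" for e
    by (intro alg_subfield_uminus[OF G'] alg_subfield_add[OF G'] alg_subfield_mult[OF G']
        alg_subfield_rat[OF G'] mu_nu_rat that)
  then have sub: "?H \<subseteq> generate_field Qbar ?H'"
    unfolding coord using s' by blast
  then have H: "?H \<subseteq> Qb" using alg_subfield_algebraic[OF G'] by blast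
  show ?thesis
    unfolding two_division_field_def
  proof (rule subset_antisym)
    show "generate_field Qbar ?H \<subseteq> generate_field Qbar ?H'" by (rule generate_least[OF H G' sub])
    show "generate_field Qbar ?H' \<subseteq> generate_field Qbar ?H"
      using generate_superset[OF H] by (intro generate_least[OF H' alg_subfield_generate[OF H]]) (auto simp: coord)
  qed
qed

end

text \<open>The discriminant equals 16 times the square of the product of the root differences, so
  its nonvanishing keeps the three roots apart.\<close>

lemma elliptic_exists:
  assumes "elliptic_curve E" obtains e1 e2 e3 where "elliptic e1 e2 e3 E"
proof -
  define p q A2 A4 A6 :: complex where "p = of_rat (wa1 E) / 2" and "q = of_rat (wa3 E) / 2"
    and "A2 = of_rat (wa2 E)" and "A4 = of_rat (wa4 E)" and "A6 = of_rat (wa6 E)"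
  obtain e1 e2 e3 where e: "A2 + p\<^sup>2 = - (e1 + e2 + e3)" "A4 + 2 * p * q = e1 * e2 + e1 * e3 + e2 * e3"
    "A6 + q\<^sup>2 = - (e1 * e2 * e3)"
    by (rule cubic_split)
  have pq: "of_rat (wa1 E) = 2 * p" "of_rat (wa3 E) = 2 * q" by (simp_all add: p_def q_def)
  have "of_rat (discriminant E) =
     (let b2 = (2 * p)\<^sup>2 + 4 * A2; b4 = 2 * A4 + 2 * p * (2 * q); b6 = (2 * q)\<^sup>2 + 4 * A6;
          b8 = (2 * p)\<^sup>2 * A6 + 4 * A2 * A6 - 2 * p * (2 * q) * A4 + A2 * (2 * q)\<^sup>2 - A4\<^sup>2
      in - (b2\<^sup>2 * b8) - 8 * b4 ^ 3 - 27 * b6\<^sup>2 + 9 * b2 * b4 * b6)"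
    unfolding discriminant_def Let_def pq[symmetric] A2_def A4_def A6_def
    by (simp add: of_rat_add of_rat_diff of_rat_minus of_rat_mult of_rat_power)
  also have "\<dots> = 16 * ((e1 - e2) * (e1 - e3) * (e2 - e3))\<^sup>2"
  proof -
    have s: "A2 = - (e1 + e2 + e3) - p\<^sup>2" "A4 = e1 * e2 + e1 * e3 + e2 * e3 - 2 * p * q" "A6 = - (e1 * e2 * e3) - q\<^sup>2"
      using e by (simp_all add: algebra_simps)
    show ?thesis unfolding s Let_def by Groebner_Basis.algebra
  qed
  finally have "16 * ((e1 - e2) * (e1 - e3) * (e2 - e3))\<^sup>2 \<noteq> (0::complex)"
    using assms unfolding elliptic_curve_def by (metis of_rat_eq_0_iff)
  then have d: "e1 \<noteq> e2" "e1 \<noteq> e3" "e2 \<noteq> e3" by auto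
  interpret split_cubic e1 e2 e3 using d by unfold_locales
  have "elliptic e1 e2 e3 E"
    using e unfolding p_def q_def A2_def A4_def A6_def by unfold_locales (auto simp: ca_def cb_def cc_def)
  then show thesis by (rule that)
qed

text \<open>Only \<open>F \<subseteq> T\<close> is asked of \<open>F\<close>, so the lemma covers
  the slope field and \<open>Ktilde 3 K\<close> alike. The tower is built for the shifted point, and
  the shift is undone with rational coefficients.\<close>

lemma (in base_field) two_primary_torsion_T:
  assumes "elliptic_curve E" "odd p" "F \<subseteq> T"
  shows "two_primary_torsion E F = two_primary_torsion E (F \<inter> two_division_field E K)"
proof -
  obtain e1 e2 e3 where "elliptic e1 e2 e3 E" using elliptic_exists[OF assms(1)] .
  then interpret elliptic e1 e2 e3 E .
  let ?F = "two_division_field E K"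
  have H: "K \<union> {e1, e2, e3} \<subseteq> Qb" using roots_algebraic alg_subfield_algebraic[OF K] by auto
  have F_alg: "alg_subfield ?F" and F_sup: "K \<subseteq> ?F" "e1 \<in> ?F" "e2 \<in> ?F" "e3 \<in> ?F"
    unfolding two_division_field[OF K] using alg_subfield_generate[OF H] generate_superset[OF H] by auto
  have "coords P \<subseteq> ?F" if P: "P \<in> two_primary_torsion E F" for P
  proof (cases P)
    case (Affine x y)
    obtain n where n: "on_curve E P" "coords P \<subseteq> F" "multiple (2 ^ n) (shift P) = Point_at_infinity"
      using P unfolding two_primary_torsion_iff by blast
    obtain M where M: "quadratic_tower ?F M" "coords (shift P) \<subseteq> M"
      using two_power_torsion_tower[OF F_alg F_sup(2-4) _ n(3)] shift_on n(1) by blast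
    have xy: "x \<in> T" "y \<in> T" using n(2) assms(3) Affine by auto
    have "y + \<mu> * x + \<nu> \<in> T"
      using xy mu_nu_rat alg_subfield_rat[OF T_alg]
      by (intro alg_subfield_add[OF T_alg] alg_subfield_mult[OF T_alg]) auto
    then have 1: "y + \<mu> * x + \<nu> \<in> ?F" and 2: "x \<in> ?F"
      using quadratic_tower_T[OF M(1) assms(2) F_alg F_sup(1)] M(2) xy Affine by auto
    have "y = (y + \<mu> * x + \<nu>) - \<mu> * x - \<nu>" by simp
    also have "\<dots> \<in> ?F"
      using 1 2 mu_nu_rat alg_subfield_rat[OF F_alg]
      by (intro alg_subfield_diff[OF F_alg] alg_subfield_mult[OF F_alg]) auto
    finally show ?thesis using 2 Affine by simp
  qed auto
  then show ?thesis unfolding set_eq_iff two_primary_torsion_iff by blast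
qed

section \<open>Elements of order 3 and cubic layers\<close>

text \<open>Two of the first four iterates coincide, which gives a period 1, 2 or 3; a period 2
  collapses to 1 because a power of 3 is also a period.\<close>

lemma funpow_in_small_set:
  assumes fin: "finite S" "card S \<le> 3" and orb: "\<And>k. (f ^^ k) x \<in> S" and per: "(f ^^ (3 ^ m)) x = x"
  shows "(f ^^ 3) x = x"
proof -
  have "\<not> inj_on (\<lambda>k. (f ^^ k) x) {0..3}"
  proof
    assume "inj_on (\<lambda>k. (f ^^ k) x) {0..3}"
    then have "card {0..3::nat} \<le> card S" using fin(1) orb by (intro card_inj_on_le) auto
    then show False using fin(2) by simp
  qed
  then obtain i j where ij: "i < j" "j \<le> 3" "(f ^^ i) x = (f ^^ j) x"
    unfolding inj_on_def by (metis atLeastAtMost_iff nat_neq_iff)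
  have red: "(f ^^ (j - i)) x = x"
  proof -
    \<comment> \<open>The iterate \<open>f ^^ i\<close> is undone by going on to the multiple
      \<open>3 ^ m * i\<close> of the known period.\<close>
    have a: "i \<le> 3 ^ m * i" by simp
    have pm: "(f ^^ (3 ^ m * i)) x = x" by (rule funpow_fixed[OF per])
    have "(f ^^ (3 ^ m * i - i)) ((f ^^ i) x) = (f ^^ (3 ^ m * i - i + i)) x"
      unfolding funpow_add comp_apply ..
    then have "(f ^^ (3 ^ m * i - i)) ((f ^^ i) x) = x" using a pm by simp
    moreover have "(f ^^ (3 ^ m * i - i)) ((f ^^ j) x) = (f ^^ (j - i)) x"
    proof -
      have "3 ^ m * i - i + j = (j - i) + 3 ^ m * i" using a ij by simp
      then have "(f ^^ (3 ^ m * i - i)) ((f ^^ j) x) = (f ^^ (j - i)) ((f ^^ (3 ^ m * i)) x)"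
        by (metis comp_apply funpow_add)
      then show ?thesis using pm by simp
    qed
    ultimately show ?thesis using ij(3) by simp
  qed
  consider "j - i = 1" | "j - i = 2" | "j - i = 3" using ij by linarith
  then show ?thesis
  proof cases
    case 1
    then show ?thesis using red funpow_fixed[of 1 f x 3] by simp
  next
    case 2
    have "f x = x" by (rule funpow_odd_fixed[OF _ per]) (use red 2 in auto)
    then show ?thesis using funpow_fixed[of 1 f x 3] by simp
  qed (use red in simp)
qed

lemma funpow_3_fixed_iff:
  assumes "(f ^^ 3) x = x" "f x \<noteq> x" shows "(f ^^ u) x = x \<longleftrightarrow> 3 dvd u"
proof -
  have "(f ^^ (u mod 3 + 3 * (u div 3))) x = (f ^^ (u mod 3)) x"
    unfolding funpow_add comp_apply funpow_fixed[OF assms(1)] ..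
  then have *: "(f ^^ u) x = (f ^^ (u mod 3)) x" by simp
  have n2: "(f ^^ 2) x \<noteq> x" using funpow_odd_fixed[of f x 3] assms by auto
  consider "u mod 3 = 0" | "u mod 3 = 1" | "u mod 3 = 2" by linarith
  then show ?thesis
  proof cases
    case 1
    then show ?thesis unfolding * by (simp add: dvd_eq_mod_eq_0)
  next
    case 2
    then show ?thesis unfolding * using assms(2) by (simp add: dvd_eq_mod_eq_0)
  next
    case 3
    then show ?thesis unfolding * using n2 by (simp add: dvd_eq_mod_eq_0)
  qed
qed

text \<open>The four powers from \<open>1\<close> to \<open>x ^ 3\<close> are dependent in dimension
  3, and the first relation met along the list yields a monic polynomial.\<close>

lemma dimension_3_degree:
  assumes K: "alg_subfield K" and F: "alg_subfield F"
    and dim: "ring.dimension Qbar 3 K F" and x: "x \<in> F"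
  obtains p where "p \<in> polys_over K" "p \<noteq> 0" "degree p \<le> 3" "poly p x = 0"
proof -
  interpret Q: ring Qbar by (rule ring_Qbar)
  note sK = subfield_Qbar_iff[THEN iffD2, OF K]
  have "\<not> Q.independent K [x ^ 3, x ^ 2, x, 1]"
  proof
    assume "Q.independent K [x ^ 3, x ^ 2, x, 1]"
    then have "length [x ^ 3, x ^ 2, x, 1] \<le> 3"
      using x alg_subfield_power[OF F x] alg_subfield_numerals(2)[OF F]
      by (intro Q.independent_length_le_dimension[OF sK dim]) auto
    then show False by simp
  qed
  moreover have "algebraic x" using alg_subfield_algebraic[OF F x] .
  then have "z \<in> carrier Qbar" if "z \<in> {x ^ 3, x ^ 2, x, 1}" for z
    using that by (auto simp: algebraic_power)
  ultimately have "1 \<in> Q.Span K [] \<or> x \<in> Q.Span K [1] \<or> x ^ 2 \<in> Q.Span K [x, 1] \<or> x ^ 3 \<in> Q.Span K [x ^ 2, x, 1]"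
    using Q.li_Cons Q.li_Nil by (metis insertCI)
  moreover have mem: "z \<in> Q.Span K (u # us) \<longleftrightarrow> (\<exists>k\<in>K. \<exists>w\<in>Q.Span K us. z = k * u + w)" for z u us
    by (simp add: Q.line_extension_mem_iff)
  have nil: "Q.Span K [] = {0}" by simp
  have s1: "z \<in> Q.Span K [1] \<longleftrightarrow> z \<in> K" for z unfolding mem nil by simp
  have s2: "z \<in> Q.Span K [x, 1] \<longleftrightarrow> (\<exists>k\<in>K. \<exists>l\<in>K. z = k * x + l)" for z
    unfolding mem[of z x] by (simp only: Bex_def s1)
  have s3: "z \<in> Q.Span K [x ^ 2, x, 1] \<longleftrightarrow> (\<exists>k\<in>K. \<exists>l\<in>K. \<exists>m\<in>K. z = k * x ^ 2 + (l * x + m))" for z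
    unfolding mem[of z "x ^ 2"] by (simp only: Bex_def s2) blast
  from calculation consider k where "k \<in> K" "x = k" | k l where "k \<in> K" "l \<in> K" "x ^ 2 = k * x + l"
    | k l m where "k \<in> K" "l \<in> K" "m \<in> K" "x ^ 3 = k * x ^ 2 + l * x + m"
    unfolding nil s1 s2 s3 add.assoc by auto
  then show thesis
  proof cases
    case 1
    show thesis
      by (rule that[of "[:-k, 1:]"])
        (use 1 in \<open>auto simp: polys_over_pCons polys_over_0 alg_subfield_numerals[OF K] alg_subfield_uminus[OF K]\<close>)
  next
    case 2
    show thesis
      by (rule that[of "[:-l, -k, 1:]"])
        (use 2 in \<open>auto simp: polys_over_pCons polys_over_0 alg_subfield_numerals[OF K] alg_subfield_uminus[OF K]
          power2_eq_square algebra_simps\<close>)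
  next
    case 3
    show thesis
      by (rule that[of "[:-m, -l, -k, 1:]"])
        (use 3 in \<open>auto simp: polys_over_pCons polys_over_0 alg_subfield_numerals[OF K] alg_subfield_uminus[OF K]
          power2_eq_square power3_eq_cube algebra_simps\<close>)
  qed
qed

context base_field
begin

abbreviation "G \<equiv> Gal T K"

lemma comm_group_G: "comm_group G"
proof -
  interpret group G by (rule T.group_Gal)
  show ?thesis
  proof (rule group_comm_groupI)
    fix \<sigma> \<tau> assume "\<sigma> \<in> carrier G" "\<tau> \<in> carrier G"
    then show "\<sigma> \<otimes>\<^bsub>G\<^esub> \<tau> = \<tau> \<otimes>\<^bsub>G\<^esub> \<sigma>"
      by (intro T.Gal_eqI) (auto simp: T.Gal_mult_apply Gal_T_commute)
  qed
qed

lemma G_pow_closed: "\<sigma> \<in> carrier G \<Longrightarrow> \<sigma> [^]\<^bsub>G\<^esub> (n::nat) \<in> carrier G"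
  using monoid.nat_pow_closed[OF group.is_monoid[OF T.group_Gal]] by blast

lemma G_funpow_closed: "\<sigma> \<in> carrier G \<Longrightarrow> x \<in> T \<Longrightarrow> (\<sigma> ^^ n) x \<in> T"
  using T.Gal_closed by (induction n) auto

lemma G_funpow_commute:
  assumes "\<sigma> \<in> carrier G" "\<tau> \<in> carrier G" "x \<in> T" shows "\<sigma> ((\<tau> ^^ n) x) = (\<tau> ^^ n) (\<sigma> x)"
  using Gal_T_commute[OF assms(1) G_pow_closed[OF assms(2)] assms(3), of n] T.Gal_closed[OF assms(1,3)]
  by (simp add: T.Gal_pow_apply assms)

text \<open>Agreement at a single point passes to iterates because \<open>\<sigma>\<close> can be
  moved past powers of \<open>\<tau>\<close> in the abelian group.\<close>

lemma agree_funpow: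
  assumes "\<sigma> \<in> carrier G" "\<tau> \<in> carrier G" "x \<in> T" "\<sigma> x = \<tau> x"
  shows "(\<sigma> ^^ n) x = (\<tau> ^^ n) x"
proof (induction n)
  case (Suc n)
  then show ?case
    using G_funpow_commute[OF assms(1-3), of n] assms(4) by (simp add: funpow_swap1)
qed simp

lemma G_inj: "\<sigma> \<in> carrier G \<Longrightarrow> x \<in> T \<Longrightarrow> y \<in> T \<Longrightarrow> \<sigma> x = \<sigma> y \<Longrightarrow> x = y"
  using inj_onD[OF alg_homo.inj[OF T.Gal_alg_homo]] by blast

lemma fixed_alg_subfield:
  assumes "H \<subseteq> carrier G" shows "alg_subfield {x \<in> T. \<forall>\<sigma>\<in>H. \<sigma> x = x}"
proof -
  have hom: "alg_hom K T \<sigma>" if "\<sigma> \<in> H" for \<sigma> using that assms T.carrier_Gal by blast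
  show ?thesis
    unfolding alg_subfield_def
  proof (intro conjI ballI)
    show "\<rat> \<subseteq> {x \<in> T. \<forall>\<sigma>\<in>H. \<sigma> x = x}"
      using alg_subfield_rat[OF K] alg_subfield_rat[OF T_alg] alg_hom_fix[OF hom] by blast
    show "{x \<in> T. \<forall>\<sigma>\<in>H. \<sigma> x = x} \<subseteq> Qb" using alg_subfield_algebraic[OF T_alg] by blast
    fix x y assume xy: "x \<in> {x \<in> T. \<forall>\<sigma>\<in>H. \<sigma> x = x}" "y \<in> {x \<in> T. \<forall>\<sigma>\<in>H. \<sigma> x = x}"
    have "\<sigma> (x + y) = x + y \<and> \<sigma> (x * y) = x * y" if s: "\<sigma> \<in> H" for \<sigma>
    proof -
      have "\<sigma> x = x" "\<sigma> y = y" "x \<in> T" "y \<in> T" using xy s by auto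
      then show ?thesis using alg_hom_add[OF hom[OF s], of x y] alg_hom_mult[OF hom[OF s], of x y] by simp
    qed
    then show "x + y \<in> {x \<in> T. \<forall>\<sigma>\<in>H. \<sigma> x = x}" "x * y \<in> {x \<in> T. \<forall>\<sigma>\<in>H. \<sigma> x = x}"
      using xy alg_subfield_add[OF T_alg] alg_subfield_mult[OF T_alg] by auto
  qed
qed

end

text \<open>Topological generation by two elements, phrased on finite sets. Here
  \<open>\<gamma>'\<close> cuts out a subextension and \<open>\<gamma>\<close> acts on it; the
  locale is instantiated twice, with \<open>\<gamma>c\<close> and \<open>\<gamma>a\<close> in either
  role.\<close>

locale gen_pair = base_field K 3 for K +
  fixes \<gamma> \<gamma>'
  assumes gen_closed: "\<gamma> \<in> carrier (Gal (base_field.T K 3) K)" "\<gamma>' \<in> carrier (Gal (base_field.T K 3) K)"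
    and span: "\<And>\<sigma> S. \<sigma> \<in> carrier (Gal (base_field.T K 3) K) \<Longrightarrow> finite S \<Longrightarrow> S \<subseteq> base_field.T K 3 \<Longrightarrow>
      \<exists>u v. \<forall>x\<in>S. \<sigma> x = (\<gamma> ^^ u) ((\<gamma>' ^^ v) x)"
begin

text \<open>The candidate for the cubic layer of the fixed field of \<open>\<gamma>'\<close>. That
  \<open>\<gamma>\<close> acts on it nontrivially has to be supplied by some
  \<open>\<theta>\<close>.\<close>

definition N :: "complex set" where "N = {x \<in> T. \<gamma>' x = x \<and> (\<gamma> ^^ 3) x = x}"

lemma N_alg: "alg_subfield N"
proof -
  have "N = {x \<in> T. \<forall>\<sigma>\<in>{\<gamma>', \<gamma> [^]\<^bsub>G\<^esub> (3::nat)}. \<sigma> x = x}"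
    using T.Gal_pow_apply[OF gen_closed(1)] by (auto simp: N_def)
  then show ?thesis
    using fixed_alg_subfield[of "{\<gamma>', \<gamma> [^]\<^bsub>G\<^esub> (3::nat)}"] gen_closed G_pow_closed by simp
qed

lemma funpow_fix: "f x = x \<Longrightarrow> (f ^^ n) x = x"
  by (induction n) auto

lemma K_sub_N: "K \<subseteq> N"
  using K_sub_T T.carrier_Gal gen_closed by (auto simp: N_def alg_hom_def funpow_fix)

lemma fixed_in_K: "x \<in> T \<Longrightarrow> \<gamma> x = x \<Longrightarrow> \<gamma>' x = x \<Longrightarrow> x \<in> K"
proof (rule TA.fixed)
  fix g assume x: "x \<in> T" "\<gamma> x = x" "\<gamma>' x = x" and "g \<in> carrier G"
  then obtain u v where "g x = (\<gamma> ^^ u) ((\<gamma>' ^^ v) x)" using span[of g "{x}"] by auto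
  then show "g x = x" using funpow_fix[of \<gamma>' x v] funpow_fix[of \<gamma> x u] x by simp
qed

text \<open>On \<open>N\<close> every automorphism is a power of \<open>\<gamma>\<close>, and one
  that fixes \<open>\<theta>\<close> has exponent divisible by 3, so it fixes \<open>N\<close>.
  Interpolation on the orbit of \<open>\<theta>\<close>, which has at most three points, gives a
  polynomial of degree at most 2.\<close>

lemma N_span:
  assumes \<theta>: "\<theta> \<in> N" "\<gamma> \<theta> \<noteq> \<theta>" and y: "y \<in> N"
  obtains k0 k1 k2 where "k0 \<in> K" "k1 \<in> K" "k2 \<in> K" "y = k2 * \<theta> ^ 2 + (k1 * \<theta> + k0)"
proof -
  have T: "\<theta> \<in> T" "y \<in> T" using \<theta> y by (auto simp: N_def)
  have on_N: "(\<gamma> ^^ u) ((\<gamma>' ^^ v) x) = (\<gamma> ^^ u) x" if "x \<in> N" for x u v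
    using that by (simp add: N_def funpow_fix)
  have stab: "g y = y" if g: "g \<in> carrier G" "g \<theta> = \<theta>" for g
  proof -
    obtain u v where uv: "\<forall>x\<in>{\<theta>, y}. g x = (\<gamma> ^^ u) ((\<gamma>' ^^ v) x)"
      using span[OF g(1), of "{\<theta>, y}"] T by auto
    then have "(\<gamma> ^^ u) \<theta> = \<theta>" using on_N[OF \<theta>(1)] g(2) by simp
    then have "3 dvd u" using funpow_3_fixed_iff[of \<gamma> \<theta> u] \<theta> by (simp add: N_def)
    then obtain w where "u = 3 * w" by (elim dvdE)
    then have "(\<gamma> ^^ u) y = y" using y funpow_fixed by (auto simp: N_def)
    then show ?thesis using uv on_N[OF y] by simp
  qed
  obtain f where f: "f \<in> polys_over K" "\<And>i. i \<ge> card (TA.orbit \<theta>) \<Longrightarrow> coeff f i = 0"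
    "\<And>g. g \<in> carrier G \<Longrightarrow> poly f (g \<theta>) = g y"
    by (rule TA.interpolate[OF T]) (use stab in auto)
  have "TA.orbit \<theta> \<subseteq> {\<theta>, \<gamma> \<theta>, (\<gamma> ^^ 2) \<theta>}"
  proof
    fix z assume "z \<in> TA.orbit \<theta>"
    then obtain g where g: "g \<in> carrier G" "z = g \<theta>" by (auto simp: TA.orbit_def)
    obtain u v where "g \<theta> = (\<gamma> ^^ u) ((\<gamma>' ^^ v) \<theta>)" using span[OF g(1), of "{\<theta>}"] T by auto
    then have "z = (\<gamma> ^^ u) \<theta>" using on_N[OF \<theta>(1)] g(2) by simp
    also have "(\<gamma> ^^ u) \<theta> = (\<gamma> ^^ (u mod 3)) \<theta>"
    proof -
      have "(\<gamma> ^^ (u mod 3 + 3 * (u div 3))) \<theta> = (\<gamma> ^^ (u mod 3)) \<theta>"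
        unfolding funpow_add comp_apply using funpow_fixed[of 3 \<gamma> \<theta>] \<theta>(1) by (simp add: N_def)
      then show ?thesis by simp
    qed
    finally show "z \<in> {\<theta>, \<gamma> \<theta>, (\<gamma> ^^ 2) \<theta>}"
    proof -
      assume z: "z = (\<gamma> ^^ (u mod 3)) \<theta>"
      have "u mod 3 = 0 \<or> u mod 3 = 1 \<or> u mod 3 = 2" by linarith
      then show ?thesis using z by auto
    qed
  qed
  then have "card (TA.orbit \<theta>) \<le> card {\<theta>, \<gamma> \<theta>, (\<gamma> ^^ 2) \<theta>}" by (intro card_mono) auto
  also have "\<dots> \<le> 3" by (simp add: card_insert_if)
  finally have "coeff f i = 0" if "i \<ge> 3" for i using f(2) that by auto
  then have "f = [:coeff f 0, coeff f 1, coeff f 2:]"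
    by (intro poly_eqI) (auto simp: coeff_pCons numeral_2_eq_2 split: nat.splits)
  then have "poly f \<theta> = poly [:coeff f 0, coeff f 1, coeff f 2:] \<theta>" by (rule arg_cong)
  then have "poly f \<theta> = coeff f 2 * \<theta> ^ 2 + (coeff f 1 * \<theta> + coeff f 0)"
    by (simp add: power2_eq_square algebra_simps)
  moreover have "poly f \<theta> = y"
    using f(3)[OF group.is_monoid[OF T.group_Gal, THEN monoid.one_closed]] T by (simp add: T.Gal_one_apply)
  ultimately have "y = coeff f 2 * \<theta> ^ 2 + (coeff f 1 * \<theta> + coeff f 0)"
    by simp
  then show thesis using that f(1) polys_overD by blast
qed

text \<open>A quadratic relation for \<open>\<theta>\<close> over \<open>K\<close> is impossible,
  since its three iterates under \<open>\<gamma>\<close> are distinct roots of the same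
  polynomial.\<close>

lemma N_dimension:
  assumes \<theta>: "\<theta> \<in> N" "\<gamma> \<theta> \<noteq> \<theta>" shows "ring.dimension Qbar 3 K N"
proof -
  interpret Q: ring Qbar by (rule ring_Qbar)
  have T: "\<theta> \<in> T" and g3: "(\<gamma> ^^ 3) \<theta> = \<theta>" using \<theta> by (auto simp: N_def)
  have alg: "algebraic \<theta>" using alg_subfield_algebraic[OF T_alg T] .
  define E0 where "E0 = Q.line_extension K 1 {0}"
  define E1 where "E1 = Q.line_extension K \<theta> E0"
  define E2 where "E2 = Q.line_extension K (\<theta> ^ 2) E1"
  have E0: "E0 = K" unfolding E0_def by (auto simp: Q.line_extension_mem_iff)
  have E1: "z \<in> E1 \<longleftrightarrow> (\<exists>k\<in>K. \<exists>l\<in>K. z = k * \<theta> + l)" for z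
    unfolding E1_def E0 by (simp add: Q.line_extension_mem_iff)
  have E2: "z \<in> E2 \<longleftrightarrow> (\<exists>k\<in>K. \<exists>l\<in>K. \<exists>m\<in>K. z = k * \<theta> ^ 2 + (l * \<theta> + m))" for z
  proof -
    have "z \<in> E2 \<longleftrightarrow> (\<exists>k\<in>K. \<exists>w\<in>E1. z = k * \<theta> ^ 2 + w)"
      unfolding E2_def by (simp add: Q.line_extension_mem_iff)
    then show ?thesis by (simp add: E1 bex_simps Bex_def) blast
  qed
  note gK = T.carrier_Gal[THEN iffD1, OF gen_closed(1), THEN conjunct2, THEN conjunct2]
  have "\<theta> \<notin> K" using \<theta>(2) alg_hom_fix[OF gK] by blast
  have "\<theta> ^ 2 \<notin> E1"
  proof
    assume "\<theta> ^ 2 \<in> E1"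
    then obtain k l where kl: "k \<in> K" "l \<in> K" "\<theta> ^ 2 = k * \<theta> + l" unfolding E1 by blast
    have p: "[:-l, -k, 1:] \<in> polys_over K"
      using kl by (auto simp: polys_over_pCons polys_over_0 alg_subfield_numerals[OF K] alg_subfield_uminus[OF K])
    have root: "poly [:-l, -k, 1:] \<theta> = 0" using kl(3) by (simp add: power2_eq_square algebra_simps)
    have roots: "poly [:-l, -k, 1:] ((\<gamma> ^^ n) \<theta>) = 0" for n
    proof (induction n)
      case (Suc n)
      have "poly [:-l, -k, 1:] (\<gamma> ((\<gamma> ^^ n) \<theta>)) = \<gamma> (poly [:-l, -k, 1:] ((\<gamma> ^^ n) \<theta>))"
        using alg_homo.poly[OF T.Gal_alg_homo[OF gen_closed(1)] p G_funpow_closed[OF gen_closed(1) T]] by simp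
      then show ?case using Suc alg_homo.numerals(1)[OF T.Gal_alg_homo[OF gen_closed(1)]] by simp
    qed (use root in simp)
    have "(\<gamma> ^^ 2) \<theta> \<noteq> \<theta>" "(\<gamma> ^^ 2) \<theta> \<noteq> \<gamma> \<theta>"
    proof -
      show n2: "(\<gamma> ^^ 2) \<theta> \<noteq> \<theta>" using funpow_3_fixed_iff[OF g3 \<theta>(2), of 2] by simp
      show "(\<gamma> ^^ 2) \<theta> \<noteq> \<gamma> \<theta>"
        using G_inj[OF gen_closed(1) T.Gal_closed[OF gen_closed(1) T] T] \<theta>(2) by (auto simp: numeral_2_eq_2)
    qed
    then have "card {\<theta>, \<gamma> \<theta>, (\<gamma> ^^ 2) \<theta>} = 3" using \<theta>(2) by (auto simp: card_insert_if)
    moreover have "{\<theta>, \<gamma> \<theta>, (\<gamma> ^^ 2) \<theta>} \<subseteq> {z. poly [:-l, -k, 1:] z = 0}"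
      using roots[of 0] roots[of 1] roots[of 2] by simp
    then have "card {\<theta>, \<gamma> \<theta>, (\<gamma> ^^ 2) \<theta>} \<le> card {z. poly [:-l, -k, 1:] z = 0}"
      by (intro card_mono poly_roots_finite) auto
    moreover have "card {z. poly [:-l, -k, 1:] z = 0} \<le> degree [:-l, -k, 1:]"
      by (rule card_poly_roots_bound) simp
    ultimately show False by simp
  qed
  have "Q.dimension (Suc 0) K E0"
    unfolding E0_def by (rule Q.Suc_dim) (use Q.zero_dim in auto)
  then have "Q.dimension (Suc (Suc 0)) K E1"
    unfolding E1_def by (intro Q.Suc_dim) (use alg \<open>\<theta> \<notin> K\<close> E0 in auto)
  then have "Q.dimension (Suc (Suc (Suc 0))) K E2"
    unfolding E2_def by (intro Q.Suc_dim) (use algebraic_power[OF alg] \<open>\<theta> ^ 2 \<notin> E1\<close> in auto)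
  moreover have "E2 = N"
  proof (rule subset_antisym; rule subsetI)
    show "z \<in> N" if "z \<in> E2" for z
      using that \<theta>(1) K_sub_N unfolding E2
      by (auto intro!: alg_subfield_add[OF N_alg] alg_subfield_mult[OF N_alg] alg_subfield_power[OF N_alg])
    show "z \<in> E2" if "z \<in> N" for z
      unfolding E2 using N_span[OF \<theta> that] by metis
  qed
  ultimately show ?thesis by (simp add: numeral_3_eq_3)
qed

text \<open>For uniqueness, an element of a cubic \<open>F\<close> has at most three iterates under
  \<open>\<gamma>\<close> and a period that is a power of 3, so \<open>F \<subseteq> N\<close>.
  Conversely any element of \<open>F\<close> moved by \<open>\<gamma>\<close> spans
  \<open>N\<close>.\<close>

lemma layer_eq_N:
  assumes \<theta>: "\<theta> \<in> N" "\<gamma> \<theta> \<noteq> \<theta>" shows "layer K {x \<in> T. \<gamma>' x = x} 3 = N"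
  unfolding layer_def
proof (rule the_equality)
  show "subfield N Qbar \<and> K \<subseteq> N \<and> N \<subseteq> {x \<in> T. \<gamma>' x = x} \<and> ring.dimension Qbar 3 K N"
    using N_alg K_sub_N N_dimension[OF \<theta>] by (auto simp: subfield_Qbar_iff N_def)
  fix F assume "subfield F Qbar \<and> K \<subseteq> F \<and> F \<subseteq> {x \<in> T. \<gamma>' x = x} \<and> ring.dimension Qbar 3 K F"
  then have F: "alg_subfield F" "K \<subseteq> F" "F \<subseteq> {x \<in> T. \<gamma>' x = x}" "ring.dimension Qbar 3 K F"
    by (auto simp: subfield_Qbar_iff)
  have FN: "F \<subseteq> N"
  proof
    fix x assume x: "x \<in> F"
    then have xT: "x \<in> T" "\<gamma>' x = x" using F(3) by auto
    obtain p where p: "p \<in> polys_over K" "p \<noteq> 0" "degree p \<le> 3" "poly p x = 0"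
      by (rule dimension_3_degree[OF K F(1,4) x])
    have roots: "poly p ((\<gamma> ^^ n) x) = 0" for n
    proof (induction n)
      case (Suc n)
      have "poly p (\<gamma> ((\<gamma> ^^ n) x)) = \<gamma> (poly p ((\<gamma> ^^ n) x))"
        using alg_homo.poly[OF T.Gal_alg_homo[OF gen_closed(1)] p(1) G_funpow_closed[OF gen_closed(1) xT(1)]] by simp
      then show ?case using Suc alg_homo.numerals(1)[OF T.Gal_alg_homo[OF gen_closed(1)]] by simp
    qed (use p in simp)
    obtain m where "(\<gamma> ^^ (3 ^ m)) x = x" using Gal_T_pow[OF gen_closed(1) xT(1)] by blast
    then have "(\<gamma> ^^ 3) x = x"
      using funpow_in_small_set[of "{z. poly p z = 0}" \<gamma> x m] poly_roots_finite[OF p(2)]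
        card_poly_roots_bound[OF p(2)] p(3) roots by simp
    then show "x \<in> N" using xT by (simp add: N_def)
  qed
  \<comment> \<open>If \<open>\<gamma>\<close> fixed all of \<open>F\<close>, then \<open>F\<close>
    would be \<open>K\<close>, of dimension 1.\<close>
  obtain \<theta>' where t': "\<theta>' \<in> F" "\<gamma> \<theta>' \<noteq> \<theta>'"
  proof (rule ccontr)
    assume "\<not> thesis"
    then have "F \<subseteq> K" using that fixed_in_K F(3) by blast
    then have "ring.dimension Qbar 3 K K" using F(2,4) by (metis subset_antisym)
    moreover have "ring.dimension Qbar 1 K K"
      by (rule ring.dimension_one[OF ring_Qbar subfield_Qbar_iff[THEN iffD2, OF K]])
    ultimately have "3 = (1::nat)"
      using ring.dimension_is_inj[OF ring_Qbar subfield_Qbar_iff[THEN iffD2, OF K]] by blast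
    then show False by simp
  qed
  have "y \<in> F" if "y \<in> N" for y
  proof -
    obtain k0 k1 k2 where "k0 \<in> K" "k1 \<in> K" "k2 \<in> K" "y = k2 * \<theta>' ^ 2 + (k1 * \<theta>' + k0)"
      using N_span[OF _ t'(2) \<open>y \<in> N\<close>] FN t'(1) by blast
    then show ?thesis
      using t'(1) F(2) by (auto intro!: alg_subfield_add[OF F(1)] alg_subfield_mult[OF F(1)] alg_subfield_power[OF F(1)])
  qed
  with FN show "F = N" by blast
qed

lemma N_sub:
  assumes \<theta>: "\<theta> \<in> N" "\<gamma> \<theta> \<noteq> \<theta>" and F: "alg_subfield F" "K \<subseteq> F" "\<theta> \<in> F" shows "N \<subseteq> F"
proof
  fix y assume "y \<in> N"
  then obtain k0 k1 k2 where "k0 \<in> K" "k1 \<in> K" "k2 \<in> K" "y = k2 * \<theta> ^ 2 + (k1 * \<theta> + k0)"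
    using N_span[OF \<theta>] by blast
  then show "y \<in> F"
    using F by (auto intro!: alg_subfield_add[OF F(1)] alg_subfield_mult[OF F(1)] alg_subfield_power[OF F(1)])
qed

end

section \<open>Powers with p-adic exponents and kernels of slope homomorphisms\<close>

lemma Zp_mult: "(a \<otimes>\<^bsub>Zp p\<^esub> b) n = (a n * b n) mod int p ^ n"
  by (simp add: Zp_def)

lemma Zp_unit_inverse:
  assumes "\<alpha> \<in> Units (Zp p)"
  obtains \<alpha>' where "\<alpha>' \<in> carrier (Zp p)" "\<And>n. (\<alpha>' n * \<alpha> n) mod int p ^ n = 1 mod int p ^ n"
proof -
  obtain \<alpha>' where a: "\<alpha>' \<in> carrier (Zp p)" "\<alpha>' \<otimes>\<^bsub>Zp p\<^esub> \<alpha> = \<one>\<^bsub>Zp p\<^esub>"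
    using assms by (auto simp: Units_def)
  have "(\<alpha>' n * \<alpha> n) mod int p ^ n = 1 mod int p ^ n" for n
    using fun_cong[OF a(2), of n] unfolding Zp_mult by (simp add: Zp_def)
  with a(1) show thesis by (rule that)
qed

lemma Zp_add_pow: "([k] \<cdot>\<^bsub>Zp p\<^esub> b) n = (int k * b n) mod int p ^ n"
proof (induction k)
  case (Suc k)
  have "([Suc k] \<cdot>\<^bsub>Zp p\<^esub> b) n = (([k] \<cdot>\<^bsub>Zp p\<^esub> b) n + b n) mod int p ^ n"
    by (simp add: add_pow_def Zp_def)
  then show ?case using Suc by (simp add: mod_simps algebra_simps)
qed (simp add: add_pow_def Zp_def)

lemma Zp_3_divides_iff:
  assumes \<beta>: "\<beta> \<in> carrier (Zp 3)" shows "(\<exists>b\<in>carrier (Zp 3). \<beta> = [(3::nat)] \<cdot>\<^bsub>Zp 3\<^esub> b) \<longleftrightarrow> \<beta> 1 = 0"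
proof
  assume "\<exists>b\<in>carrier (Zp 3). \<beta> = [(3::nat)] \<cdot>\<^bsub>Zp 3\<^esub> b"
  then obtain b where "\<beta> = [(3::nat)] \<cdot>\<^bsub>Zp 3\<^esub> b" by blast
  then have "\<beta> 1 = ([(3::nat)] \<cdot>\<^bsub>Zp 3\<^esub> b) 1" by simp
  then show "\<beta> 1 = 0" unfolding Zp_add_pow by simp
next
  assume b1: "\<beta> 1 = 0"
  \<comment> \<open>Division by 3 costs one digit, so level \<open>n\<close> of the quotient is read
    off from level \<open>Suc n\<close>.\<close>
  define b where "b n = \<beta> (Suc n) div 3" for n
  have b3: "\<beta> (Suc n) = 3 * b n" for n
  proof -
    have "\<beta> (Suc n) mod 3 = 0" using Zp_coherent[OF \<beta>, of 1 "Suc n"] b1 by simp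
    then show ?thesis unfolding b_def by (simp add: mod_0_imp_dvd)
  qed
  have "b \<in> carrier (Zp 3)"
    unfolding Zp_carrier
  proof (intro allI conjI)
    fix n
    have "\<beta> (Suc n) \<in> {0..<3 ^ Suc n}" "\<beta> (Suc (Suc n)) mod 3 ^ Suc n = \<beta> (Suc n)"
      using \<beta>[unfolded Zp_carrier, THEN spec, of "Suc n"] by auto
    then show "b n \<in> {0..<int 3 ^ n}" "b (Suc n) mod int 3 ^ n = b n"
      unfolding b3 by (auto simp: mult_mod_right[symmetric])
  qed
  moreover have "\<beta> = [(3::nat)] \<cdot>\<^bsub>Zp 3\<^esub> b"
  proof
    fix n
    show "\<beta> n = ([(3::nat)] \<cdot>\<^bsub>Zp 3\<^esub> b) n"
      unfolding Zp_add_pow using b3[of n] Zp_coherent[OF \<beta>, of n "Suc n"] by simp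
  qed
  ultimately show "\<exists>b\<in>carrier (Zp 3). \<beta> = [(3::nat)] \<cdot>\<^bsub>Zp 3\<^esub> b" by blast
qed

context base_field
begin

text \<open>This forms a power of \<open>\<gamma>\<close> with p-adic exponent. Each
  \<open>x\<close> has a period \<open>p ^ m\<close>, so the iterates at \<open>x\<close> no longer
  change once the exponents agree modulo \<open>p ^ m\<close>.\<close>

lemma power_limit:
  assumes g: "\<gamma> \<in> carrier G" and w: "\<And>n. w (Suc n) mod p ^ n = w n mod p ^ n"
  obtains \<omega> where "\<omega> \<in> carrier G" "\<And>x. x \<in> T \<Longrightarrow> \<forall>\<^sub>F n in sequentially. \<omega> x = (\<gamma> ^^ w n) x"
proof -
  have w': "w n mod p ^ m = w m mod p ^ m" if "m \<le> n" for m n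
    using that
  proof (induction n rule: dec_induct)
    case (step n)
    have "w (Suc n) mod p ^ m = w (Suc n) mod p ^ n mod p ^ m"
      using step(1) by (simp add: mod_mod_cancel le_imp_power_dvd)
    also have "\<dots> = w n mod p ^ m" unfolding w using step(1) by (simp add: mod_mod_cancel le_imp_power_dvd)
    finally show ?case using step(3) by simp
  qed simp
  define m where "m x = (SOME m. (\<gamma> ^^ (p ^ m)) x = x)" for x
  define \<omega> where "\<omega> x = (\<gamma> ^^ w (m x)) x" for x
  have om: "\<omega> x = (\<gamma> ^^ w n) x" if x: "x \<in> T" and n: "n \<ge> m x" for x n
  proof -
    have per: "(\<gamma> ^^ (p ^ m x)) x = x" unfolding m_def by (rule someI_ex) (rule Gal_T_pow[OF g x])
    have red: "(\<gamma> ^^ k) x = (\<gamma> ^^ (k mod p ^ m x)) x" for k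
    proof -
      have "(\<gamma> ^^ (k mod p ^ m x + p ^ m x * (k div p ^ m x))) x = (\<gamma> ^^ (k mod p ^ m x)) x"
        unfolding funpow_add comp_apply funpow_fixed[OF per] ..
      then show ?thesis by simp
    qed
    show ?thesis unfolding \<omega>_def using red[of "w n"] red[of "w (m x)"] w'[OF n] by simp
  qed
  have "alg_hom K T \<omega>"
    unfolding alg_hom_def
  proof (intro conjI ballI)
    fix x y assume xy: "x \<in> T" "y \<in> T"
    define n where "n = max (max (m x) (m y)) (max (m (x + y)) (m (x * y)))"
    have n: "n \<ge> m x" "n \<ge> m y" "n \<ge> m (x + y)" "n \<ge> m (x * y)" by (auto simp: n_def)
    have cl: "x + y \<in> T" "x * y \<in> T" using xy alg_subfield_add[OF T_alg] alg_subfield_mult[OF T_alg] by auto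
    note h = alg_homo.hom[OF T.Gal_alg_homo[OF G_pow_closed[OF g, of "w n"]]]
    show "\<omega> (x + y) = \<omega> x + \<omega> y" "\<omega> (x * y) = \<omega> x * \<omega> y"
      using alg_hom_add[OF h xy] alg_hom_mult[OF h xy] om[OF _ n(1)] om[OF _ n(2)] om[OF _ n(3)] om[OF _ n(4)] xy cl
      by (simp_all add: T.Gal_pow_apply[OF g])
  next
    fix x assume x: "x \<in> K"
    then have "x \<in> T" using K_sub_T by blast
    then show "\<omega> x = x" unfolding \<omega>_def
      using alg_hom_fix[OF alg_homo.hom[OF T.Gal_alg_homo[OF G_pow_closed[OF g, of "w (m x)"]]] x]
        T.Gal_pow_apply[OF g, of x "w (m x)"] by simp
  qed
  then have "alg_homo K T \<omega>" using K T_alg K_sub_T by unfold_locales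
  moreover have "\<omega> ` T \<subseteq> T" using G_funpow_closed[OF g] by (auto simp: \<omega>_def)
  ultimately have "restrict \<omega> T \<in> carrier G" by (intro T.restrict_Gal) auto
  moreover have "\<forall>\<^sub>F n in sequentially. restrict \<omega> T x = (\<gamma> ^^ w n) x" if "x \<in> T" for x
    using om[OF that] that by (intro eventually_sequentiallyI[of "m x"]) auto
  ultimately show thesis by (rule that)
qed

text \<open>The relation \<open>uv\<close> holds only modulo \<open>p\<close>, so the word itself
  need not lie in the kernel. Solving the relation exactly for the exponent of
  \<open>\<gamma>\<close>, possible because \<open>\<phi> \<gamma>\<close> is a unit, gives an
  element of the kernel. The exact exponent agrees with \<open>u\<close> modulo \<open>p\<close>, a
  period of \<open>\<theta>\<close> under \<open>\<gamma>\<close>, so on \<open>\<theta>\<close>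
  nothing has changed.\<close>

lemma kernel_word_fixes:
  assumes g: "\<gamma> \<in> carrier G" "\<gamma>' \<in> carrier G" and hom: "\<phi> \<in> hom G (add_monoid (Zp p))"
    and cont: "continuous_map (krull_topology T K) (Zp_topology p) \<phi>"
    and unit: "\<phi> \<gamma> \<in> Units (Zp p)"
    and \<theta>: "\<theta> \<in> T" "(\<gamma> ^^ p) \<theta> = \<theta>" and ker: "\<forall>\<kappa>\<in>carrier G. \<phi> \<kappa> = (\<lambda>_. 0) \<longrightarrow> \<kappa> \<theta> = \<theta>"
    and uv: "(int u * \<phi> \<gamma> 1 + int v * \<phi> \<gamma>' 1) mod int p = 0"
  shows "(\<gamma> ^^ u) ((\<gamma>' ^^ v) \<theta>) = \<theta>"
\<comment> \<open>For \<open>p = 0\<close> the carrier is empty: the digit at level 1 would lie in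
  an empty interval.\<close>
proof (cases "p = 0")
  case True
  have "(0::int) \<le> \<phi> \<gamma> 1 \<and> \<phi> \<gamma> 1 < int p ^ 1"
    using hom_in_carrier[OF hom g(1)] by (simp add: Zp_carrier) (metis One_nat_def power_one_right)
  then show ?thesis using True by auto
next
  case p: False
  interpret comm_group G by (rule comm_group_G)
  let ?\<alpha> = "\<phi> \<gamma>" and ?\<beta> = "\<phi> \<gamma>'"
  have \<alpha>: "?\<alpha> \<in> carrier (Zp p)" and \<beta>: "?\<beta> \<in> carrier (Zp p)" using hom_in_carrier[OF hom] g by auto
  obtain \<alpha>' where a': "\<alpha>' \<in> carrier (Zp p)" "\<And>n. (\<alpha>' n * ?\<alpha> n) mod int p ^ n = 1 mod int p ^ n"
    by (rule Zp_unit_inverse[OF unit]) blast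
  \<comment> \<open>The digits of minus \<open>v\<close> times the quotient of
    \<open>?\<beta>\<close> by \<open>?\<alpha>\<close>.\<close>
  define W where "W n = (- (int v * ?\<beta> n * \<alpha>' n)) mod int p ^ n" for n
  define w where "w n = nat (W n)" for n
  have W0: "0 \<le> W n" for n using p by (simp add: W_def)
  have W_mod: "W (Suc n) mod int p ^ n = W n" for n
  proof -
    have "W (Suc n) mod int p ^ n = (- (int v * ?\<beta> (Suc n) * \<alpha>' (Suc n))) mod int p ^ n"
      unfolding W_def by (rule mod_mod_cancel) simp
    also have "\<dots> = (- (int v * (?\<beta> (Suc n) mod int p ^ n) * (\<alpha>' (Suc n) mod int p ^ n))) mod int p ^ n"
      by (rule mod_minus_cong) (metis mod_mult_eq mod_mult_right_eq)
    also have "\<dots> = W n" unfolding W_def using Zp_coherent[OF \<beta>, of n "Suc n"] Zp_coherent[OF a'(1), of n "Suc n"] by simp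
    finally show ?thesis .
  qed
  have w_mod: "w (Suc n) mod p ^ n = w n mod p ^ n" for n
  proof -
    have "int (w (Suc n) mod p ^ n) = W (Suc n) mod int p ^ n" "int (w n mod p ^ n) = W n mod int p ^ n"
      unfolding w_def using W0 by (simp_all add: zmod_int)
    then have "int (w (Suc n) mod p ^ n) = int (w n mod p ^ n)" using W_mod[of n] by (metis mod_mod_trivial)
    then show ?thesis by simp
  qed
  have w_le: "w k mod p ^ n = w n mod p ^ n" if "n \<le> k" for n k
    using that
  proof (induction k rule: dec_induct)
    case (step k)
    have "w (Suc k) mod p ^ n = w (Suc k) mod p ^ k mod p ^ n"
      using step(1) by (simp add: mod_mod_cancel le_imp_power_dvd)
    also have "\<dots> = w k mod p ^ n" unfolding w_mod using step(1) by (simp add: mod_mod_cancel le_imp_power_dvd)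
    finally show ?case using step(3) by simp
  qed simp
  have red: "(a mod m * b + c) mod m = (a * b + c) mod m" for a b c m :: int
    by (metis mod_add_left_eq mod_mult_left_eq)
  have rel: "(int (w n) * ?\<alpha> n + int v * ?\<beta> n) mod int p ^ n = 0" for n
  proof -
    have wW: "int (w n) = W n" using W0 by (simp add: w_def)
    have "(int (w n) * ?\<alpha> n + int v * ?\<beta> n) mod int p ^ n
        = (- (int v * ?\<beta> n * \<alpha>' n) * ?\<alpha> n + int v * ?\<beta> n) mod int p ^ n"
      unfolding wW W_def by (rule red)
    also have "\<dots> = (int v * ?\<beta> n * (1 - \<alpha>' n * ?\<alpha> n)) mod int p ^ n" by (simp add: algebra_simps)
    also have "\<dots> = 0"
    proof -
      have "int p ^ n dvd 1 - \<alpha>' n * ?\<alpha> n" using a'(2)[of n] by (metis mod_eq_dvd_iff)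
      then show ?thesis by simp
    qed
    finally show ?thesis .
  qed
  obtain \<omega> where om: "\<omega> \<in> carrier G" "\<And>x. x \<in> T \<Longrightarrow> \<forall>\<^sub>F n in sequentially. \<omega> x = (\<gamma> ^^ w n) x"
    by (rule power_limit[OF g(1), of w]) (use w_mod in auto)
  let ?\<kappa> = "\<omega> \<otimes>\<^bsub>G\<^esub> \<gamma>' [^]\<^bsub>G\<^esub> v" and ?\<kappa>n = "\<lambda>n. \<gamma> [^]\<^bsub>G\<^esub> w n \<otimes>\<^bsub>G\<^esub> \<gamma>' [^]\<^bsub>G\<^esub> v"
  have cl: "?\<kappa> \<in> carrier G" "?\<kappa>n n \<in> carrier G" for n using om(1) g by auto
  \<comment> \<open>By continuity digit \<open>k\<close> of the value at the limit is that of a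
    finite word agreeing with it on a finite set, and there \<open>rel\<close> applies.\<close>
  have "\<phi> ?\<kappa> k = 0" for k
  proof -
    obtain S where S: "finite S" "S \<subseteq> T" "\<forall>h\<in>carrier G. (\<forall>x\<in>S. h x = ?\<kappa> x) \<longrightarrow> \<phi> h k = \<phi> ?\<kappa> k"
      using cont cl(1) unfolding T.continuous_krull_Zp by blast
    have "\<forall>\<^sub>F n in sequentially. \<forall>x\<in>S. ?\<kappa>n n x = ?\<kappa> x"
    proof (intro eventually_ball_finite[OF S(1)] ballI)
      fix x assume "x \<in> S"
      then have x: "x \<in> T" using S(2) by blast
      then have x': "(\<gamma>' [^]\<^bsub>G\<^esub> v) x \<in> T" using T.Gal_closed g by simp
      have e: "?\<kappa>n n x = (\<gamma> ^^ w n) ((\<gamma>' [^]\<^bsub>G\<^esub> v) x)" for n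
        using T.Gal_mult_apply[OF nat_pow_closed[OF g(1)] nat_pow_closed[OF g(2)] x]
          T.Gal_pow_apply[OF g(1) x'] by simp
      show "\<forall>\<^sub>F n in sequentially. ?\<kappa>n n x = ?\<kappa> x"
        using om(2)[OF x']
      proof eventually_elim
        case (elim n)
        then show ?case unfolding e using T.Gal_mult_apply[OF om(1) nat_pow_closed[OF g(2)] x] by simp
      qed
    qed
    moreover have "\<forall>\<^sub>F n in sequentially. n \<ge> k" by (rule eventually_ge_at_top)
    ultimately have "\<forall>\<^sub>F n in sequentially. (\<forall>x\<in>S. ?\<kappa>n n x = ?\<kappa> x) \<and> n \<ge> k" by (rule eventually_conj)
    then obtain n where n: "\<forall>x\<in>S. ?\<kappa>n n x = ?\<kappa> x" "n \<ge> k"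
      using eventually_happens'[OF sequentially_bot] by blast
    have "\<phi> ?\<kappa> k = \<phi> (?\<kappa>n n) k" using S(3) cl(2) n(1) by metis
    also have "\<dots> = (int (w n) * ?\<alpha> k + int v * ?\<beta> k) mod int p ^ k"
      using hom_mult[OF hom nat_pow_closed[OF g(1)] nat_pow_closed[OF g(2)], of "w n" v]
        hom_Zp_pow[OF is_group hom g(1), of "w n" k] hom_Zp_pow[OF is_group hom g(2), of v k]
      by (simp only: Zp_add) (simp add: mod_simps)
    also have "\<dots> = (int (w n mod p ^ k) * ?\<alpha> k + int v * ?\<beta> k) mod int p ^ k"
      unfolding zmod_int of_nat_power by (rule red[symmetric])
    also have "\<dots> = (int (w k mod p ^ k) * ?\<alpha> k + int v * ?\<beta> k) mod int p ^ k" using w_le[OF n(2)] by simp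
    also have "\<dots> = 0" using rel[of k] unfolding zmod_int of_nat_power red .
    finally show ?thesis .
  qed
  then have fix_th: "?\<kappa> \<theta> = \<theta>" using ker[rule_format, OF cl(1)] by blast
  have x': "(\<gamma>' ^^ v) \<theta> \<in> T" using G_funpow_closed[OF g(2) \<theta>(1)] .
  have "\<forall>\<^sub>F n in sequentially. \<omega> ((\<gamma>' ^^ v) \<theta>) = (\<gamma> ^^ w n) ((\<gamma>' ^^ v) \<theta>) \<and> n \<ge> 1"
    using om(2)[OF x'] eventually_ge_at_top by (rule eventually_conj)
  then obtain n where n: "\<omega> ((\<gamma>' ^^ v) \<theta>) = (\<gamma> ^^ w n) ((\<gamma>' ^^ v) \<theta>)" "n \<ge> 1"
    using eventually_happens'[OF sequentially_bot] by blast
  have per: "(\<gamma> ^^ k) ((\<gamma>' ^^ v) \<theta>) = (\<gamma> ^^ (k mod p)) ((\<gamma>' ^^ v) \<theta>)" for k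
  proof -
    have "(\<gamma> ^^ p) ((\<gamma>' ^^ v) \<theta>) = (\<gamma>' ^^ v) \<theta>"
      using G_funpow_commute[OF G_pow_closed[OF g(1), of p] g(2) \<theta>(1), of v] \<theta> T.Gal_pow_apply[OF g(1), of _ p] x' by simp
    from funpow_fixed[OF this] have "(\<gamma> ^^ (k mod p + p * (k div p))) ((\<gamma>' ^^ v) \<theta>) = (\<gamma> ^^ (k mod p)) ((\<gamma>' ^^ v) \<theta>)"
      unfolding funpow_add comp_apply by simp
    then show ?thesis by simp
  qed
  have "w n mod p = u mod p"
  proof -
    have "w n mod p = w 1 mod p" using w_le[OF n(2)] by simp
    moreover have "int p dvd int (w 1) - int u"
    proof -
      have "int p dvd (int (w 1) * ?\<alpha> 1 + int v * ?\<beta> 1) - (int u * ?\<alpha> 1 + int v * ?\<beta> 1)"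
        using rel[of 1] uv by (intro dvd_diff) auto
      then have "int p dvd (int (w 1) - int u) * ?\<alpha> 1" by (simp add: left_diff_distrib)
      then have "int p dvd \<alpha>' 1 * ((int (w 1) - int u) * ?\<alpha> 1)" by (rule dvd_mult)
      moreover have "int p dvd (1 - \<alpha>' 1 * ?\<alpha> 1) * (int (w 1) - int u)"
        using a'(2)[of 1] by (intro dvd_mult2) (metis mod_eq_dvd_iff power_one_right)
      ultimately have "int p dvd \<alpha>' 1 * ((int (w 1) - int u) * ?\<alpha> 1) + (1 - \<alpha>' 1 * ?\<alpha> 1) * (int (w 1) - int u)"
        by (rule dvd_add)
      then show ?thesis by (simp add: algebra_simps)
    qed
    then have "int (w 1) mod int p = int u mod int p" by (simp add: mod_eq_dvd_iff)
    ultimately show ?thesis by (metis of_nat_eq_iff of_nat_mod)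
  qed
  then have "\<omega> ((\<gamma>' ^^ v) \<theta>) = (\<gamma> ^^ u) ((\<gamma>' ^^ v) \<theta>)" using n(1) per[of "w n"] per[of u] by simp
  moreover have "\<omega> ((\<gamma>' ^^ v) \<theta>) = \<theta>"
    using fix_th T.Gal_mult_apply[OF om(1) nat_pow_closed[OF g(2)] \<theta>(1), of v] T.Gal_pow_apply[OF g(2) \<theta>(1)] by simp
  ultimately show ?thesis by simp
qed

text \<open>The usual combination \<open>x + c * z\<close>: only finitely many \<open>c\<close> let
  an automorphism move \<open>x\<close> and \<open>z\<close> without moving the sum, and these are
  the quotients collected in \<open>bad\<close>.\<close>

lemma primitive_element:
  assumes "finite S" "S \<subseteq> T" shows "\<exists>z\<in>T. \<forall>g\<in>carrier G. g z = z \<longrightarrow> (\<forall>x\<in>S. g x = x)"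
  using assms
proof (induction S rule: finite_induct)
  case empty
  then show ?case using alg_subfield_numerals(1)[OF T_alg] by blast
next
  case (insert x S)
  then obtain z where z: "z \<in> T" "\<forall>g\<in>carrier G. g z = z \<longrightarrow> (\<forall>x\<in>S. g x = x)" by auto
  have x: "x \<in> T" using insert by simp
  define bad where "bad = (\<lambda>(a, b). (a - x) / (z - b)) ` (TA.orbit x \<times> TA.orbit z)"
  have "finite bad" unfolding bad_def using TA.finite_orbit x z by auto
  moreover have "infinite (range (of_nat :: nat \<Rightarrow> complex))" by (simp add: range_inj_infinite inj_of_nat)
  ultimately have "\<not> range (of_nat :: nat \<Rightarrow> complex) \<subseteq> bad" using finite_subset by blast
  then obtain c :: nat where c: "of_nat c \<notin> bad" by blast
  let ?z = "x + of_nat c * z"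
  have key: "g x = x \<and> g z = z" if g: "g \<in> carrier G" "g ?z = ?z" for g
  proof -
    note h = alg_homo.hom[OF T.Gal_alg_homo[OF g(1)]]
    have cT: "of_nat c \<in> T" "of_nat c \<in> K" using alg_subfield_numerals(4)[OF T_alg] alg_subfield_numerals(4)[OF K] by auto
    have "g ?z = g x + of_nat c * g z"
      using alg_hom_add[OF h x alg_subfield_mult[OF T_alg cT(1) z(1)]] alg_hom_mult[OF h cT(1) z(1)] alg_hom_fix[OF h cT(2)] by simp
    then have e: "of_nat c * (z - g z) = g x - x" using g(2) by (simp add: algebra_simps)
    have "g z = z"
    proof (rule ccontr)
      assume "g z \<noteq> z"
      then have "of_nat c = (g x - x) / (z - g z)" using e by (simp add: eq_divide_eq)
      then have "of_nat c \<in> bad" unfolding bad_def TA.orbit_def using g(1) by force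
      then show False using c by simp
    qed
    then show ?thesis using e by simp
  qed
  have zT: "?z \<in> T"
    using x z by (intro alg_subfield_add[OF T_alg] alg_subfield_mult[OF T_alg] alg_subfield_numerals(4)[OF T_alg]) auto
  show ?case
  proof (rule bexI[OF _ zT]; intro ballI impI)
    fix g y assume g: "g \<in> carrier G" "g ?z = ?z" and y: "y \<in> insert x S"
    show "g y = y"
    proof (cases "y = x")
      case False
      then have "y \<in> S" using y by simp
      with key[OF g] z(2) g(1) show ?thesis by blast
    qed (use key[OF g] in simp)
  qed
qed

text \<open>If every product \<open>\<Prod>h\<in>H. (t - h z)\<close> with rational \<open>t\<close> were fixed by \<open>\<gamma>\<close>, then \<open>\<gamma> z\<close> would
  be one of the roots \<open>h z\<close>, contrary to the choice of \<open>z\<close>.\<close>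

lemma fixed_by_subgroup_moved:
  assumes z: "z \<in> T" and H: "subgroup H G" and stab: "\<And>g. g \<in> carrier G \<Longrightarrow> g z = z \<Longrightarrow> g \<in> H"
    and g: "\<gamma> \<in> carrier G" "\<gamma> \<notin> H"
  obtains \<theta> where "\<theta> \<in> T" "\<And>h. h \<in> H \<Longrightarrow> h \<theta> = \<theta>" "\<gamma> \<theta> \<noteq> \<theta>"
proof -
  interpret group G by (rule T.group_Gal)
  interpret H: subgroup H G by (rule H)
  define B where "B = (\<lambda>h. h z) ` H"
  have "B \<subseteq> TA.orbit z" using H.mem_carrier by (auto simp: B_def TA.orbit_def)
  then have B: "finite B" "B \<subseteq> T"
    using finite_subset[OF _ TA.finite_orbit[OF z]] TA.orbit_sub[OF z] by auto
  define P where "P t = (\<Prod>w\<in>B. (of_nat t - w))" for t :: nat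
  have PT: "P t \<in> T" for t
    unfolding P_def using B(2) by (intro alg_subfield_prod[OF T_alg] alg_subfield_diff[OF T_alg] alg_subfield_numerals(4)[OF T_alg]) auto
  have gP: "\<sigma> (P t) = (\<Prod>w\<in>\<sigma> ` B. (of_nat t - w))" if s: "\<sigma> \<in> carrier G" for \<sigma> t
  proof -
    interpret s: alg_homo K T \<sigma> by (rule T.Gal_alg_homo[OF s])
    have ofn: "\<sigma> (of_nat t) = of_nat t" by (rule s.fix_K[OF alg_subfield_numerals(4)[OF K]])
    have "\<sigma> (\<Prod>w\<in>B. (of_nat t - w)) = (\<Prod>w\<in>B. (of_nat t - \<sigma> w))"
      using B
    proof (induction B rule: finite_induct)
      case (insert w B)
      have "(\<Prod>w\<in>B. (of_nat t - w)) \<in> T" "of_nat t - w \<in> T"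
        using insert by (auto intro!: alg_subfield_prod[OF T_alg] alg_subfield_diff[OF T_alg] alg_subfield_numerals(4)[OF T_alg])
      then show ?case using insert ofn alg_subfield_numerals(4)[OF T_alg] by (simp add: s.mult s.diff)
    qed (simp add: s.numerals)
    also have "\<dots> = (\<Prod>w\<in>\<sigma> ` B. (of_nat t - w))"
      using inj_on_subset[OF s.inj B(2)] by (simp add: prod.reindex)
    finally show ?thesis unfolding P_def .
  qed
  have "h (P t) = P t" if h: "h \<in> H" for h t
  proof -
    have sub: "h ` B \<subseteq> B"
    proof
      fix w assume "w \<in> h ` B"
      then obtain h' where "h' \<in> H" "w = h (h' z)" by (auto simp: B_def)
      then have "w = (h \<otimes>\<^bsub>G\<^esub> h') z" "h \<otimes>\<^bsub>G\<^esub> h' \<in> H"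
        using T.Gal_mult_apply[OF H.mem_carrier H.mem_carrier z] h by auto
      then show "w \<in> B" by (auto simp: B_def)
    qed
    have "inj_on h B" using alg_homo.inj[OF T.Gal_alg_homo[OF H.mem_carrier[OF h]]] B(2) by (rule inj_on_subset)
    then have "h ` B = B" using endo_inj_surj[OF B(1) sub] by simp
    then show ?thesis using gP[OF H.mem_carrier[OF h]] by (simp add: P_def)
  qed
  moreover have "\<exists>t. \<gamma> (P t) \<noteq> P t"
  proof (rule ccontr)
    assume "\<not> (\<exists>t. \<gamma> (P t) \<noteq> P t)"
    then have eq: "(\<Prod>w\<in>\<gamma> ` B. (of_nat t - w)) = (\<Prod>w\<in>B. (of_nat t - w))" for t :: nat
      using gP[OF g(1), of t] unfolding P_def by simp
    have poly_eq: "poly (\<Prod>w\<in>\<gamma> ` B. [:- w, 1:]) (of_nat t) = poly (\<Prod>w\<in>B. [:- w, 1:]) (of_nat t)" for t :: nat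
      using eq[of t] by (simp add: poly_prod)
    have "(\<Prod>w\<in>\<gamma> ` B. [:- w, 1:]) = (\<Prod>w\<in>B. [:- w, 1:])"
    proof (rule ccontr)
      assume "(\<Prod>w\<in>\<gamma> ` B. [:- w, 1:]) \<noteq> (\<Prod>w\<in>B. [:- w, 1:])"
      then have "finite {x. poly ((\<Prod>w\<in>\<gamma> ` B. [:- w, 1:]) - (\<Prod>w\<in>B. [:- w, 1:])) x = 0}"
        by (intro poly_roots_finite) simp
      moreover have "range (of_nat :: nat \<Rightarrow> complex) \<subseteq> {x. poly ((\<Prod>w\<in>\<gamma> ` B. [:- w, 1:]) - (\<Prod>w\<in>B. [:- w, 1:])) x = 0}"
        using poly_eq by auto
      ultimately have "finite (range (of_nat :: nat \<Rightarrow> complex))" by (rule finite_subset[rotated])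
      then show False by (simp add: range_inj_infinite inj_of_nat)
    qed
    moreover have "z \<in> B" unfolding B_def using T.Gal_one_apply[OF z] H.one_closed by (metis image_eqI)
    then have "poly (\<Prod>w\<in>\<gamma> ` B. [:- w, 1:]) (\<gamma> z) = 0" using B(1) by (auto simp: poly_prod)
    ultimately have "poly (\<Prod>w\<in>B. [:- w, 1:]) (\<gamma> z) = 0" by simp
    then have "\<gamma> z \<in> B" using B(1) by (auto simp: poly_prod)
    then obtain h where h: "h \<in> H" "\<gamma> z = h z" by (auto simp: B_def)
    have "(inv\<^bsub>G\<^esub> h \<otimes>\<^bsub>G\<^esub> \<gamma>) z = z"
      using T.Gal_mult_apply[OF inv_closed[OF H.mem_carrier[OF h(1)]] g(1) z] T.Gal_inv_apply(1)[OF H.mem_carrier[OF h(1)] z] h(2) by simp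
    then have "inv\<^bsub>G\<^esub> h \<otimes>\<^bsub>G\<^esub> \<gamma> \<in> H" using stab H.mem_carrier h(1) g(1) by simp
    then have "h \<otimes>\<^bsub>G\<^esub> (inv\<^bsub>G\<^esub> h \<otimes>\<^bsub>G\<^esub> \<gamma>) \<in> H" using h(1) by simp
    then show False using g H.mem_carrier[OF h(1)] by (simp add: m_assoc[symmetric])
  qed
  ultimately show thesis using PT that by blast
qed

end

section \<open>Cubic abelian subextensions of the 2-division field\<close>

context base_field
begin

lemma Aut_agree_generate:
  assumes H: "H \<subseteq> Qb" and s: "\<sigma> \<in> Aut K" and t: "\<tau> \<in> Aut K" and agree: "\<And>x. x \<in> H \<Longrightarrow> \<sigma> x = \<tau> x"
    and x: "x \<in> generate_field Qbar (K \<union> H)"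
  shows "\<sigma> x = \<tau> x"
proof -
  have KH: "K \<union> H \<subseteq> Qb" using H alg_subfield_algebraic[OF K] by blast
  have "generate_field Qbar (K \<union> H) \<subseteq> {x \<in> Qb. \<sigma> x = \<tau> x}"
  proof (rule generate_least[OF KH])
    show "alg_subfield {x \<in> Qb. \<sigma> x = \<tau> x}"
      by (auto simp: alg_subfield_def rat_imp_algebraic algebraic_add algebraic_mult
          Aut_rat[OF s] Aut_rat[OF t] Aut_add[OF s] Aut_add[OF t] Aut_mult[OF s] Aut_mult[OF t])
    show "K \<union> H \<subseteq> {x \<in> Qb. \<sigma> x = \<tau> x}" using KH agree Aut_fix[OF s] Aut_fix[OF t] by auto
  qed
  with x show ?thesis by blast
qed

lemma Aut_inj: "\<sigma> \<in> Aut K \<Longrightarrow> algebraic x \<Longrightarrow> algebraic y \<Longrightarrow> \<sigma> x = \<sigma> y \<longleftrightarrow> x = y"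
  using inj_onD[OF alg_homo.inj[OF alg_homo_Aut[OF K]]] by blast

text \<open>Some \<open>\<tau>\<close> moves \<open>\<theta>\<close>. Its order on
  \<open>\<theta>\<close> is odd, so its square moves \<open>\<theta>\<close> and therefore a root;
  a permutation of at most three roots with nontrivial square is a 3-cycle. Commutativity on
  \<open>T\<close> excludes transpositions, so \<open>Aut K\<close> acts on \<open>F\<close> through
  the powers of this cycle, and the nontrivial ones move \<open>\<theta>\<close>.\<close>

lemma cubic_action:
  assumes p: "odd p" and R: "finite R" "card R \<le> 3" "R \<subseteq> Qb" and R_stable: "\<forall>\<rho>\<in>Aut K. \<rho> ` R \<subseteq> R"
    and F: "F = generate_field Qbar (K \<union> R)" and \<theta>: "\<theta> \<in> T" "\<theta> \<in> F" "\<theta> \<notin> K"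
  obtains \<tau> f where "\<tau> \<in> Aut K" "f \<noteq> \<tau> f" "f \<noteq> \<tau> (\<tau> f)" "\<tau> f \<noteq> \<tau> (\<tau> f)" "R = {f, \<tau> f, \<tau> (\<tau> f)}"
    "\<forall>x\<in>F. (\<tau> ^^ 3) x = x" "\<forall>\<rho>\<in>Aut K. \<exists>k. \<forall>x\<in>F. \<rho> x = (\<tau> ^^ k) x"
    "\<forall>\<rho>\<in>Aut K. \<rho> \<theta> = \<theta> \<longrightarrow> (\<forall>x\<in>F. \<rho> x = x)"
proof -
  have perm: "\<rho> e \<in> R" if "\<rho> \<in> Aut K" "e \<in> R" for \<rho> e using R_stable that by blast
  have \<theta>alg: "algebraic \<theta>" using alg_subfield_algebraic[OF T_alg \<theta>(1)] .
  obtain \<tau> where t: "\<tau> \<in> Aut K" "\<tau> \<theta> \<noteq> \<theta>" using Aut_fixed[OF K \<theta>alg] \<theta>(3) by blast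
  note comp = Aut_comp[OF K]
  have agree: "\<sigma> x = \<rho> x" if "\<sigma> \<in> Aut K" "\<rho> \<in> Aut K" "\<And>e. e \<in> R \<Longrightarrow> \<sigma> e = \<rho> e" "x \<in> F" for \<sigma> \<rho> x
    using Aut_agree_generate[OF R(3) that(1-3)] that(4) F by blast
  obtain m where "(\<tau> ^^ (p ^ m)) \<theta> = \<theta>" using Aut_pow_T[OF t(1) \<theta>(1)] by blast
  moreover have "odd (p ^ m)" using p by simp
  ultimately have "(\<tau> ^^ 2) \<theta> \<noteq> \<theta>" using funpow_odd_fixed[of \<tau> \<theta> "p ^ m"] t(2) by metis
  then have t2: "\<tau> (\<tau> \<theta>) \<noteq> \<theta>" by (simp add: numeral_2_eq_2)
  obtain f where f: "f \<in> R" "\<tau> (\<tau> f) \<noteq> f"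
  proof (rule ccontr)
    assume "\<not> thesis"
    then have "(\<tau> \<circ> \<tau>) e = id e" if "e \<in> R" for e using that \<open>\<not> thesis\<close> \<open>\<And>f. \<lbrakk>f \<in> R; \<tau> (\<tau> f) \<noteq> f\<rbrakk> \<Longrightarrow> thesis\<close> by auto
    then have "(\<tau> \<circ> \<tau>) \<theta> = id \<theta>" using agree[OF comp[OF t(1) t(1)] Aut_id] \<theta>(2) by blast
    then show False using t2 by simp
  qed
  define f1 f2 where "f1 = \<tau> f" and "f2 = \<tau> f1"
  have fR: "f \<in> R" "f1 \<in> R" "f2 \<in> R" using f perm[OF t(1)] by (auto simp: f1_def f2_def)
  then have falg: "algebraic f" "algebraic f1" "algebraic f2" using R(3) by auto
  have ne: "f \<noteq> f2" "f \<noteq> f1" using f(2) by (auto simp: f1_def f2_def)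
  have ne12: "f1 \<noteq> f2"
  proof
    assume "f1 = f2"
    then have "\<tau> f = \<tau> f1" using f1_def f2_def by metis
    then show False using Aut_inj[OF t(1) falg(1,2)] ne by simp
  qed
  have R_eq: "R = {f, f1, f2}"
    using card_seteq[OF R(1), of "{f, f1, f2}"] fR R(2) ne ne12 by simp
  have tf: "\<tau> f = f1" "\<tau> f1 = f2" by (simp_all add: f1_def f2_def)
  have tf2: "\<tau> f2 = f"
  proof -
    have "\<tau> f2 \<in> {f, f1, f2}" using perm[OF t(1) fR(3)] R_eq by simp
    moreover have "\<tau> f2 \<noteq> f1" using Aut_inj[OF t(1) falg(3,1)] ne tf by simp
    moreover have "\<tau> f2 \<noteq> f2" using Aut_inj[OF t(1) falg(3,2)] ne12 tf by simp
    ultimately show ?thesis by blast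
  qed
  text \<open>A transposition would invert the 3-cycle \<open>\<tau>\<close>, but commutes with it on \<open>\<theta>\<close>.\<close>
  have fixes_all: "\<rho> f1 = f1 \<and> \<rho> f2 = f2" if r: "\<rho> \<in> Aut K" and rf: "\<rho> f = f" for \<rho>
  proof -
    have "\<rho> f1 \<in> {f, f1, f2}" "\<rho> f2 \<in> {f, f1, f2}" using perm[OF r] fR R_eq by auto
    moreover have "\<rho> f1 \<noteq> f" "\<rho> f2 \<noteq> f" "\<rho> f1 \<noteq> \<rho> f2"
      using Aut_inj[OF r falg(2,1)] Aut_inj[OF r falg(3,1)] Aut_inj[OF r falg(2,3)] ne ne12 rf by auto
    ultimately consider "\<rho> f1 = f1 \<and> \<rho> f2 = f2" | "\<rho> f1 = f2" "\<rho> f2 = f1" by (metis empty_iff insert_iff)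
    then show ?thesis
    proof cases
      case 2
      have "(\<rho> \<circ> \<tau>) \<theta> = (\<tau> \<circ> (\<tau> \<circ> \<rho>)) \<theta>"
        by (rule agree[OF comp[OF r t(1)] comp[OF t(1) comp[OF t(1) r]] _ \<theta>(2)])
           (auto simp: R_eq tf tf2 rf 2)
      then have "\<tau> (\<rho> \<theta>) = \<tau> (\<tau> (\<rho> \<theta>))" using Aut_commute_T[OF r t(1) \<theta>(1)] by simp
      then have "\<rho> \<theta> = \<tau> (\<rho> \<theta>)"
        using Aut_inj[OF t(1)] Aut_algebraic[OF K r \<theta>alg] Aut_algebraic[OF K t(1)] by blast
      then have "\<rho> \<theta> = \<rho> (\<tau> \<theta>)" using Aut_commute_T[OF r t(1) \<theta>(1)] by simp
      then have "\<theta> = \<tau> \<theta>" using Aut_inj[OF r \<theta>alg Aut_algebraic[OF K t(1) \<theta>alg]] by simp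
      then show ?thesis using t(2) by simp
    qed
  qed
  have cyc: "\<exists>k. \<forall>x\<in>F. \<rho> x = (\<tau> ^^ k) x" if r: "\<rho> \<in> Aut K" for \<rho>
  proof -
    have ralg: "algebraic (\<rho> f1)" "algebraic (\<rho> f2)" "algebraic (\<tau> (\<rho> f1))" "algebraic (\<tau> (\<rho> f2))"
      using Aut_algebraic[OF K r] Aut_algebraic[OF K t(1)] falg by auto
    have "\<exists>k. \<forall>e\<in>R. \<rho> e = (\<tau> ^^ k) e"
    proof -
      consider "\<rho> f = f" | "\<rho> f = f1" | "\<rho> f = f2" using perm[OF r fR(1)] R_eq by blast
      then show ?thesis
      proof cases
        case 1
        then show ?thesis using fixes_all[OF r 1] by (intro exI[of _ 0]) (auto simp: R_eq)
      next
        case 2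
        then have "(\<tau> \<circ> (\<tau> \<circ> \<rho>)) f = f" by (simp add: tf tf2)
        from fixes_all[OF comp[OF t(1) comp[OF t(1) r]] this]
        have "\<tau> (\<tau> (\<rho> f1)) = \<tau> (\<tau> f2)" "\<tau> (\<tau> (\<rho> f2)) = \<tau> (\<tau> f)" by (simp_all add: tf tf2)
        then have "\<rho> f1 = f2" "\<rho> f2 = f"
          using Aut_inj[OF t(1)] ralg falg Aut_algebraic[OF K t(1)] by metis+
        then show ?thesis using 2 by (intro exI[of _ 1]) (auto simp: R_eq tf tf2)
      next
        case 3
        then have "(\<tau> \<circ> \<rho>) f = f" by (simp add: tf tf2)
        from fixes_all[OF comp[OF t(1) r] this]
        have "\<tau> (\<rho> f1) = \<tau> f" "\<tau> (\<rho> f2) = \<tau> f1" by (simp_all add: tf tf2)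
        then have "\<rho> f1 = f" "\<rho> f2 = f1"
          using Aut_inj[OF t(1)] ralg falg by metis+
        then show ?thesis using 3 by (intro exI[of _ 2]) (auto simp: R_eq tf tf2 numeral_2_eq_2)
      qed
    qed
    then obtain k where "\<forall>e\<in>R. \<rho> e = (\<tau> ^^ k) e" by blast
    then have "\<rho> x = (\<tau> ^^ k) x" if "x \<in> F" for x using agree[OF r Aut_funpow[OF K t(1)] _ that] by blast
    then show ?thesis by blast
  qed
  have t3: "(\<tau> ^^ 3) x = x" if "x \<in> F" for x
  proof -
    have "(\<tau> ^^ 3) x = id x"
      by (rule agree[OF Aut_funpow[OF K t(1)] Aut_id _ that]) (auto simp: R_eq numeral_3_eq_3 tf tf2)
    then show ?thesis by simp
  qed
  have "\<rho> x = x" if r: "\<rho> \<in> Aut K" "\<rho> \<theta> = \<theta>" and x: "x \<in> F" for \<rho> x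
  proof -
    obtain k where k: "\<forall>x\<in>F. \<rho> x = (\<tau> ^^ k) x" using cyc[OF r(1)] by blast
    then have "(\<tau> ^^ k) \<theta> = \<theta>" using r(2) \<theta>(2) by simp
    then have "3 dvd k" using funpow_3_fixed_iff[OF t3[OF \<theta>(2)] t(2)] by blast
    then obtain j where "k = 3 * j" by (elim dvdE)
    then show ?thesis using k x funpow_fixed[OF t3[OF x]] by simp
  qed
  with t(1) ne ne12 R_eq t3 cyc show thesis using that[of \<tau> f] unfolding tf by blast
qed

end

section \<open>Generators of the eigenspaces\<close>

lemma (in imquad) T_cnj': "T = cnj ` T"
  using T_cnj[OF K_cnj] by simp

locale eigen = imquad K for K +
  fixes \<gamma>c \<gamma>a
  assumes gens: "eigen_generators 3 K \<gamma>c \<gamma>a"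
begin

lemma T_eq: "Ktilde 3 K = T"
  by (simp add: T_def)

lemma gens_T:
  "\<gamma>c \<in> plus_eigenspace T K" "\<gamma>a \<in> minus_eigenspace T K"
  "Zp_span 3 T K \<gamma>c = plus_eigenspace T K" "Zp_span 3 T K \<gamma>a = minus_eigenspace T K"
  using gens unfolding eigen_generators_def T_eq by auto

lemma gens_G: "\<gamma>c \<in> carrier G" "\<gamma>a \<in> carrier G"
  and gens_conj: "conj_act T \<gamma>c = \<gamma>c" "conj_act T \<gamma>a = inv\<^bsub>G\<^esub> \<gamma>a"
  using gens_T by (auto simp: plus_eigenspace_def minus_eigenspace_def)

lemma Zp_span_limit:
  assumes "\<sigma> \<in> Zp_span 3 T K \<gamma>" "\<gamma> \<in> carrier G"
  obtains a where "\<And>x. x \<in> T \<Longrightarrow> \<forall>\<^sub>F n in sequentially. (\<gamma> ^^ a n) x = \<sigma> x"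
proof -
  obtain a where "limitin (krull_topology T K) (\<lambda>n. \<gamma> [^]\<^bsub>G\<^esub> nat (a n)) \<sigma> sequentially"
    using assms(1) by (auto simp: Zp_span_def)
  then have "\<forall>\<^sub>F n in sequentially. (\<gamma> [^]\<^bsub>G\<^esub> nat (a n)) x = \<sigma> x" if "x \<in> T" for x
    using that unfolding T.limitin_krull by blast
  then show thesis using that[of "\<lambda>n. nat (a n)"] by (simp add: T.Gal_pow_apply[OF assms(2)])
qed

text \<open>\<open>\<sigma>\<^sup>2\<close> is the product of a plus and a minus element, and squaring is invertible: the exponent
  \<open>(3 ^ n + 1) / 2\<close> takes square roots in the limit.\<close>

lemma decomposition:
  assumes s: "\<sigma> \<in> carrier G"
  obtains u v where "\<And>x. x \<in> T \<Longrightarrow> \<forall>\<^sub>F n in sequentially. (\<gamma>c ^^ u n) ((\<gamma>a ^^ v n) x) = \<sigma> x"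
proof -
  interpret comm_group G by (rule comm_group_G)
  note e = T.field_extension_axioms T.field_extension_axioms K_cnj T_cnj'
  interpret h: group_hom G G "conj_act T"
    by (intro group_hom.intro group_hom_axioms.intro is_group homI)
       (use conj_act_Gal[OF e] conj_act_mult[OF e] in auto)
  define \<sigma>' where "\<sigma>' = conj_act T \<sigma>"
  have s': "\<sigma>' \<in> carrier G" "conj_act T \<sigma>' = \<sigma>"
    unfolding \<sigma>'_def using conj_act_Gal[OF e s] conj_act_conj_act[OF e s] by auto
  define \<pi> \<mu> where "\<pi> = \<sigma> \<otimes>\<^bsub>G\<^esub> \<sigma>'" and "\<mu> = \<sigma> \<otimes>\<^bsub>G\<^esub> inv\<^bsub>G\<^esub> \<sigma>'"
  have cl: "\<pi> \<in> carrier G" "\<mu> \<in> carrier G" using s s' by (auto simp: \<pi>_def \<mu>_def)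
  have "\<pi> \<in> plus_eigenspace T K"
    unfolding plus_eigenspace_def using cl s s' by (simp add: \<pi>_def \<sigma>'_def[symmetric] m_comm)
  then obtain a where a: "\<And>x. x \<in> T \<Longrightarrow> \<forall>\<^sub>F n in sequentially. (\<gamma>c ^^ a n) x = \<pi> x"
    using Zp_span_limit[OF _ gens_G(1)] gens_T(3) by blast
  have "conj_act T \<mu> = \<sigma>' \<otimes>\<^bsub>G\<^esub> inv\<^bsub>G\<^esub> \<sigma>" using s s' by (simp add: \<mu>_def \<sigma>'_def[symmetric])
  also have "\<dots> = inv\<^bsub>G\<^esub> \<mu>" using s s' by (simp add: \<mu>_def inv_mult_group)
  finally have "\<mu> \<in> minus_eigenspace T K"
    unfolding minus_eigenspace_def using cl by simp
  then obtain b where b: "\<And>x. x \<in> T \<Longrightarrow> \<forall>\<^sub>F n in sequentially. (\<gamma>a ^^ b n) x = \<mu> x"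
    using Zp_span_limit[OF _ gens_G(2)] gens_T(4) by blast
  define k :: "nat \<Rightarrow> nat" where "k n = (3 ^ n + 1) div 2" for n
  have k: "2 * k n = 3 ^ n + 1" for n
  proof -
    have "even (3 ^ n + 1 :: nat)" by simp
    then show ?thesis unfolding k_def by simp
  qed
  show thesis
  proof (rule that[of "\<lambda>n. a n * k n" "\<lambda>n. b n * k n"])
    fix x assume x: "x \<in> T"
    obtain m where m: "(\<sigma> ^^ (3 ^ m)) x = x" using Gal_T_pow[OF s x] by blast
    have "\<forall>\<^sub>F n in sequentially. n \<ge> m" by (rule eventually_ge_at_top)
    then show "\<forall>\<^sub>F n in sequentially. (\<gamma>c ^^ (a n * k n)) ((\<gamma>a ^^ (b n * k n)) x) = \<sigma> x"
      using a[OF x] b[OF x]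
    proof eventually_elim
      case (elim n)
      have pa: "(\<gamma>c ^^ (a n * k n)) x = (\<pi> [^]\<^bsub>G\<^esub> k n) x"
      proof -
        have "((\<gamma>c [^]\<^bsub>G\<^esub> a n) ^^ k n) x = (\<pi> ^^ k n) x"
          using elim(2) x by (intro agree_funpow nat_pow_closed gens_G cl) (simp_all add: T.Gal_pow_apply[OF gens_G(1)])
        then have "(\<gamma>c [^]\<^bsub>G\<^esub> (a n * k n)) x = (\<pi> [^]\<^bsub>G\<^esub> k n) x"
          using x gens_G(1) cl(1) by (simp add: nat_pow_pow[symmetric] T.Gal_pow_apply)
        then show ?thesis by (simp add: T.Gal_pow_apply[OF gens_G(1) x])
      qed
      have pb: "(\<gamma>a ^^ (b n * k n)) x = (\<mu> [^]\<^bsub>G\<^esub> k n) x"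
      proof -
        have "((\<gamma>a [^]\<^bsub>G\<^esub> b n) ^^ k n) x = (\<mu> ^^ k n) x"
          using elim(3) x by (intro agree_funpow nat_pow_closed gens_G cl) (simp_all add: T.Gal_pow_apply[OF gens_G(2)])
        then have "(\<gamma>a [^]\<^bsub>G\<^esub> (b n * k n)) x = (\<mu> [^]\<^bsub>G\<^esub> k n) x"
          using x gens_G(2) cl(2) by (simp add: nat_pow_pow[symmetric] T.Gal_pow_apply)
        then show ?thesis by (simp add: T.Gal_pow_apply[OF gens_G(2) x])
      qed
      have "(\<gamma>c ^^ (a n * k n)) ((\<gamma>a ^^ (b n * k n)) x) = (\<gamma>c ^^ (a n * k n)) ((\<mu> [^]\<^bsub>G\<^esub> k n) x)"
        unfolding pb ..
      also have "\<dots> = (\<mu> [^]\<^bsub>G\<^esub> k n) ((\<gamma>c ^^ (a n * k n)) x)"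
        using G_funpow_commute[OF nat_pow_closed[OF cl(2)] gens_G(1) x, of "k n" "a n * k n"] by simp
      also have "\<dots> = (\<mu> [^]\<^bsub>G\<^esub> k n) ((\<pi> [^]\<^bsub>G\<^esub> k n) x)" unfolding pa ..
      also have "\<dots> = (\<mu> [^]\<^bsub>G\<^esub> k n \<otimes>\<^bsub>G\<^esub> \<pi> [^]\<^bsub>G\<^esub> k n) x"
        using T.Gal_mult_apply[OF nat_pow_closed[OF cl(2)] nat_pow_closed[OF cl(1)] x] by simp
      also have "\<mu> [^]\<^bsub>G\<^esub> k n \<otimes>\<^bsub>G\<^esub> \<pi> [^]\<^bsub>G\<^esub> k n = (\<mu> \<otimes>\<^bsub>G\<^esub> \<pi>) [^]\<^bsub>G\<^esub> k n"
        using cl by (simp add: nat_pow_distrib)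
      also have "\<mu> \<otimes>\<^bsub>G\<^esub> \<pi> = \<sigma> [^]\<^bsub>G\<^esub> (2::nat)"
      proof -
        have "\<mu> \<otimes>\<^bsub>G\<^esub> \<pi> = \<sigma> \<otimes>\<^bsub>G\<^esub> (inv\<^bsub>G\<^esub> \<sigma>' \<otimes>\<^bsub>G\<^esub> (\<sigma>' \<otimes>\<^bsub>G\<^esub> \<sigma>))"
          unfolding \<mu>_def \<pi>_def using s s'(1) by (simp add: m_assoc m_comm[of \<sigma> \<sigma>'])
        also have "\<dots> = \<sigma> \<otimes>\<^bsub>G\<^esub> \<sigma>" using s s'(1) by (simp add: m_assoc[symmetric])
        finally show ?thesis using s by (simp add: numeral_2_eq_2)
      qed
      also have "(\<sigma> [^]\<^bsub>G\<^esub> (2::nat)) [^]\<^bsub>G\<^esub> k n = \<sigma> [^]\<^bsub>G\<^esub> (3 ^ n + 1 :: nat)"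
        using s by (simp only: nat_pow_pow k)
      also have "(\<sigma> [^]\<^bsub>G\<^esub> (3 ^ n + 1 :: nat)) x = \<sigma> ((\<sigma> ^^ (3 ^ n)) x)"
        unfolding T.Gal_pow_apply[OF s x] by simp
      also have "\<dots> = \<sigma> x" using funpow_fixed_le[OF m elim(1)] by simp
      finally show ?case .
    qed
  qed
qed

text \<open>At each point the words of \<open>decomposition\<close> are eventually constant, and one
  index serves finitely many points.\<close>

lemma word_span:
  assumes s: "\<sigma> \<in> carrier G" and S: "finite S" "S \<subseteq> T"
  shows "\<exists>u v. \<forall>x\<in>S. \<sigma> x = (\<gamma>c ^^ u) ((\<gamma>a ^^ v) x)"
proof -
  obtain u v where uv: "\<And>x. x \<in> T \<Longrightarrow> \<forall>\<^sub>F n in sequentially. (\<gamma>c ^^ u n) ((\<gamma>a ^^ v n) x) = \<sigma> x"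
    using decomposition[OF s] by blast
  have "\<forall>\<^sub>F n in sequentially. \<forall>x\<in>S. (\<gamma>c ^^ u n) ((\<gamma>a ^^ v n) x) = \<sigma> x"
    using uv S by (intro eventually_ball_finite) auto
  then obtain n where "\<forall>x\<in>S. (\<gamma>c ^^ u n) ((\<gamma>a ^^ v n) x) = \<sigma> x"
    using eventually_happens'[OF sequentially_bot] by blast
  then show ?thesis by metis
qed

lemma words_commute: "x \<in> T \<Longrightarrow> (\<gamma>c ^^ u) ((\<gamma>a ^^ v) x) = (\<gamma>a ^^ v) ((\<gamma>c ^^ u) x)"
  using G_funpow_commute[OF G_pow_closed[OF gens_G(1)] gens_G(2), of x u v]
  by (simp add: T.Gal_pow_apply[OF gens_G(1)] G_funpow_closed[OF gens_G(2)])

sublocale C: gen_pair K \<gamma>c \<gamma>a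
  using gens_G word_span by unfold_locales

sublocale A: gen_pair K \<gamma>a \<gamma>c
proof unfold_locales
  fix \<sigma> S assume *: "\<sigma> \<in> carrier G" "finite S" "S \<subseteq> T"
  then obtain u v where "\<forall>x\<in>S. \<sigma> x = (\<gamma>c ^^ u) ((\<gamma>a ^^ v) x)" using word_span by blast
  then show "\<exists>u v. \<forall>x\<in>S. \<sigma> x = (\<gamma>a ^^ u) ((\<gamma>c ^^ v) x)"
    using words_commute *(3) by (metis subsetD)
qed (use gens_G in auto)

lemma fixed_field_Zp_span:
  assumes g: "\<gamma> \<in> carrier G" shows "fixed_field T (Zp_span 3 T K \<gamma>) = {x \<in> T. \<gamma> x = x}"
proof -
  have "\<gamma> \<in> Zp_span 3 T K \<gamma>"
  proof -
    have "(\<lambda>n. 1 mod int 3 ^ n) \<in> carrier (Zp 3)"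
      unfolding Zp_carrier by (auto simp: mod_mod_cancel le_imp_power_dvd)
    moreover have "limitin (krull_topology T K) (\<lambda>n. \<gamma> [^]\<^bsub>G\<^esub> nat (1 mod int 3 ^ n)) \<gamma> sequentially"
      unfolding T.limitin_krull
    proof (intro conjI ballI)
      have *: "\<forall>\<^sub>F n in sequentially. \<gamma> [^]\<^bsub>G\<^esub> nat (1 mod int 3 ^ n) = \<gamma>"
      \<comment> \<open>At \<open>n = 0\<close> the exponent is 1 modulo 1, that is 0, so the
        sequence is constant only from index 1 on.\<close>
      proof (rule eventually_sequentiallyI[of 1])
        fix n :: nat assume "1 \<le> n"
        then have "1 < (3::int) ^ n" by simp
        then have "nat (1 mod int 3 ^ n) = 1" by simp
        then show "\<gamma> [^]\<^bsub>G\<^esub> nat (1 mod int 3 ^ n) = \<gamma>"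
          using monoid.nat_pow_eone[OF group.is_monoid[OF T.group_Gal] g] by simp
      qed
      then show "\<forall>\<^sub>F n in sequentially. \<gamma> [^]\<^bsub>G\<^esub> nat (1 mod int 3 ^ n) \<in> carrier G"
        by eventually_elim (use g in simp)
      show "\<forall>\<^sub>F n in sequentially. (\<gamma> [^]\<^bsub>G\<^esub> nat (1 mod int 3 ^ n)) x = \<gamma> x" for x
        using * by eventually_elim simp
    qed (rule g)
    ultimately show ?thesis
      unfolding Zp_span_def by (intro CollectI bexI[of _ "\<lambda>n. 1 mod int 3 ^ n"])
  qed
  moreover have "\<sigma> x = x" if "\<sigma> \<in> Zp_span 3 T K \<gamma>" "x \<in> T" "\<gamma> x = x" for \<sigma> x
  proof -
    obtain a where "\<And>x. x \<in> T \<Longrightarrow> \<forall>\<^sub>F n in sequentially. (\<gamma> ^^ a n) x = \<sigma> x"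
      using Zp_span_limit[OF \<open>\<sigma> \<in> Zp_span 3 T K \<gamma>\<close> g] by blast
    then obtain n where "(\<gamma> ^^ a n) x = \<sigma> x"
      using eventually_happens'[OF sequentially_bot] \<open>x \<in> T\<close> by blast
    then show ?thesis using C.funpow_fix[of \<gamma> x "a n"] that(3) by simp
  qed
  ultimately show ?thesis unfolding fixed_field_def by blast
qed

lemma Kcyc_eq: "Kcyc 3 K \<gamma>a = {x \<in> T. \<gamma>a x = x}" and Kanti_eq: "Kanti 3 K \<gamma>c = {x \<in> T. \<gamma>c x = x}"
  unfolding Kcyc_def Kanti_def T_eq using fixed_field_Zp_span gens_G by auto

text \<open>Conjugation inverts \<open>\<gamma>a\<close>. Where it also leaves the value unchanged,
  \<open>\<gamma>a\<close> acts as an involution, and its odd period makes it trivial.\<close>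

lemma \<gamma>a_fixes:
  assumes x: "x \<in> T" and conj: "cnj (\<gamma>a (cnj x)) = \<gamma>a x" shows "\<gamma>a x = x"
proof -
  have "(inv\<^bsub>G\<^esub> \<gamma>a) x = \<gamma>a x"
    using gens_conj(2) conj conj_act_apply[OF x, of \<gamma>a] by simp
  then have "(\<gamma>a ^^ 2) x = x" using T.Gal_inv_apply(2)[OF gens_G(2) x] by (simp add: numeral_2_eq_2)
  moreover obtain m where "(\<gamma>a ^^ (3 ^ m)) x = x" using Gal_T_pow[OF gens_G(2) x] by blast
  ultimately show ?thesis by (rule funpow_odd_fixed) simp
qed

lemma Gal_xi_real: "\<sigma> \<in> carrier G \<Longrightarrow> \<sigma> (xi 1 1) \<in> \<real>"
  using Gal_T_extend Aut_xi_real xi_1_in_T by metis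

text \<open>All conjugates of \<open>xi 1 1\<close> over \<open>K\<close> are real, so
  \<open>\<gamma>a\<close> fixes it; \<open>\<gamma>c ^^ 3\<close> fixes it because
  \<open>\<gamma>c\<close> permutes the at most three zeros of the cubic.\<close>

lemma xi_in_N: "xi 1 1 \<in> C.N"
proof -
  have "cnj (\<gamma>a (cnj (xi 1 1))) = \<gamma>a (xi 1 1)"
    using Gal_xi_real[OF gens_G(2)] xi_real[of 1 1] by (simp add: Reals_cnj_iff)
  then have ga: "\<gamma>a (xi 1 1) = xi 1 1" by (rule \<gamma>a_fixes[OF xi_1_in_T])
  have p: "[:1, -3, 0, 1:] \<in> polys_over K"
    using alg_subfield_numerals[OF K_alg] alg_subfield_uminus[OF K_alg]
    by (auto simp: polys_over_pCons polys_over_0)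
  have roots: "poly [:1, -3, 0, 1:] ((\<gamma>c ^^ n) (xi 1 1)) = 0" for n
  proof (induction n)
    case 0
    show ?case using xi_1_root by (simp add: algebra_simps power3_eq_cube)
  next
    case (Suc n)
    have "poly [:1, -3, 0, 1:] (\<gamma>c ((\<gamma>c ^^ n) (xi 1 1))) = \<gamma>c (poly [:1, -3, 0, 1:] ((\<gamma>c ^^ n) (xi 1 1)))"
      using alg_homo.poly[OF T.Gal_alg_homo[OF gens_G(1)] p G_funpow_closed[OF gens_G(1) xi_1_in_T]] by simp
    then show ?case using Suc alg_homo.numerals(1)[OF T.Gal_alg_homo[OF gens_G(1)]] by simp
  qed
  obtain m where "(\<gamma>c ^^ (3 ^ m)) (xi 1 1) = xi 1 1" using Gal_T_pow[OF gens_G(1) xi_1_in_T] by blast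
  moreover have "card {z. poly [:1, -3, 0, 1::complex:] z = 0} \<le> degree [:1, -3, 0, 1::complex:]"
    by (rule card_poly_roots_bound) simp
  moreover have "finite {z. poly [:1, -3, 0, 1::complex:] z = 0}" by (rule poly_roots_finite) simp
  ultimately have "(\<gamma>c ^^ 3) (xi 1 1) = xi 1 1"
    using roots by (intro funpow_in_small_set[of "{z. poly [:1, -3, 0, 1::complex:] z = 0}" \<gamma>c _ m]) simp_all
  then show ?thesis using ga xi_1_in_T by (simp add: C.N_def)
qed

lemma xi_moved: "\<gamma>c (xi 1 1) \<noteq> xi 1 1"
  using C.fixed_in_K[OF xi_1_in_T] xi_in_N xi_1_notin_K by (auto simp: C.N_def)

lemma N_cyc_eq: "C.N = generate_field Qbar (K \<union> {xi 1 1})"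
proof -
  have H: "K \<union> {xi 1 1} \<subseteq> Qb" using algebraic_xi alg_subfield_algebraic[OF K_alg] by auto
  show ?thesis
    using C.N_sub[OF xi_in_N xi_moved alg_subfield_generate[OF H]] generate_superset[OF H]
      generate_least[OF H C.N_alg] C.K_sub_N xi_in_N by blast
qed

end

context imquad
begin

lemma alg_subfield_real: "alg_subfield {x \<in> Qb. x \<in> \<real>}"
  unfolding alg_subfield_def
  by (auto intro: Rats_Reals_complex rat_imp_algebraic algebraic_add algebraic_mult Reals_add Reals_mult)

text \<open>Adjoining \<open>K\<close> amounts to adjoining a purely imaginary \<open>s\<close> with
  rational square. A real element \<open>u + v * s\<close> with real \<open>u\<close> and
  \<open>v\<close> has \<open>v = 0\<close>.\<close>

lemma generate_real_part:
  assumes H: "H \<subseteq> Qb" "H \<subseteq> \<real>"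
  shows "generate_field Qbar (K \<union> H) \<inter> \<real> = generate_field Qbar (\<rat> \<union> H)"
proof -
  obtain s where "alg_subfield K" "s \<in> K" and s: "s\<^sup>2 \<in> \<rat>" "cnj s = - s" "s \<noteq> 0"
    "K = {a + b * s | a b. a \<in> \<rat> \<and> b \<in> \<rat>}"
    by (rule imaginary_quadraticE[OF imaginary])
  let ?R = "generate_field Qbar (\<rat> \<union> H)"
  have RH: "\<rat> \<union> H \<subseteq> Qb" and KH: "K \<union> H \<subseteq> Qb"
    using H rat_imp_algebraic alg_subfield_algebraic[OF K_alg] by auto
  note R = alg_subfield_generate[OF RH]
  have real: "?R \<subseteq> \<real>"
    using generate_least[OF RH alg_subfield_real] RH H(2) Rats_Reals_complex by blast
  have sR: "s\<^sup>2 \<in> ?R" by (rule alg_subfield_rat[OF R s(1)])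
  have "K \<union> H \<subseteq> adjoin ?R s"
    using generate_superset[OF RH] alg_subfield_rat[OF R] adjoin_superset[OF R, of s]
    unfolding s(4) by (auto simp: adjoin_def[of _ s])
  then have sub: "generate_field Qbar (K \<union> H) \<subseteq> adjoin ?R s"
    using generate_least[OF KH adjoin_alg_subfield[OF R sR]] by blast
  have "x \<in> ?R" if x: "x \<in> generate_field Qbar (K \<union> H)" "x \<in> \<real>" for x
  proof -
    obtain u v where uv: "x = u + v * s" "u \<in> ?R" "v \<in> ?R" using x(1) sub by (auto simp: adjoin_def)
    then have r: "cnj x = x" "cnj u = u" "cnj v = v" using x(2) real by (auto simp: Reals_cnj_iff)
    have "cnj x = cnj u + cnj v * cnj s" unfolding uv(1) by simp
    then have "u + v * s = u - v * s" using uv(1) unfolding r s(2) by simp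
    then have "2 * (v * s) = 0" by (simp add: algebra_simps)
    then have "v = 0" using s(3) by simp
    then show ?thesis using uv by simp
  qed
  moreover have "?R \<subseteq> generate_field Qbar (K \<union> H)"
    using generate_superset[OF KH] alg_subfield_rat[OF alg_subfield_generate[OF KH]]
    by (intro generate_least[OF RH alg_subfield_generate[OF KH]]) auto
  ultimately show ?thesis using real by blast
qed

end

context base_field
begin

lemma Aut_stable_generate:
  assumes H: "H \<subseteq> Qb" and r: "\<rho> \<in> Aut K" "\<rho> ` H \<subseteq> H" and x: "x \<in> generate_field Qbar (K \<union> H)"
  shows "\<rho> x \<in> generate_field Qbar (K \<union> H)"
proof -
  have KH: "K \<union> H \<subseteq> Qb" using H alg_subfield_algebraic[OF K] by blast
  let ?F = "generate_field Qbar (K \<union> H)"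
  note F = alg_subfield_generate[OF KH] and sup = generate_superset[OF KH]
  have "?F \<subseteq> {x \<in> Qb. \<rho> x \<in> ?F}"
  proof (rule generate_least[OF KH])
    show "alg_subfield {x \<in> Qb. \<rho> x \<in> ?F}"
      by (auto simp: alg_subfield_def rat_imp_algebraic algebraic_add algebraic_mult
          Aut_rat[OF r(1)] Aut_add[OF r(1)] Aut_mult[OF r(1)] alg_subfield_rat[OF F] alg_subfield_add[OF F] alg_subfield_mult[OF F])
    show "K \<union> H \<subseteq> {x \<in> Qb. \<rho> x \<in> ?F}" using KH sup r Aut_fix[OF r(1)] by auto
  qed
  with x show ?thesis by blast
qed

lemma cnj_stable_generate:
  assumes H: "H \<subseteq> Qb" and K_cnj: "cnj ` K = K" and H_cnj: "cnj ` H \<subseteq> H" and x: "x \<in> generate_field Qbar (K \<union> H)"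
  shows "cnj x \<in> generate_field Qbar (K \<union> H)"
proof -
  have KH: "K \<union> H \<subseteq> Qb" using H alg_subfield_algebraic[OF K] by blast
  let ?F = "generate_field Qbar (K \<union> H)"
  note F = alg_subfield_generate[OF KH] and sup = generate_superset[OF KH]
  have "?F \<subseteq> {x \<in> Qb. cnj x \<in> ?F}"
  proof (rule generate_least[OF KH])
    show "alg_subfield {x \<in> Qb. cnj x \<in> ?F}"
      by (auto simp: alg_subfield_def rat_imp_algebraic algebraic_add algebraic_mult cnj_Rats
          alg_subfield_rat[OF F] alg_subfield_add[OF F] alg_subfield_mult[OF F])
    show "K \<union> H \<subseteq> {x \<in> Qb. cnj x \<in> ?F}" using KH sup K_cnj H_cnj by blast
  qed
  with x show ?thesis by blast
qed

end

context eigen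
begin

text \<open>On \<open>F\<close> the generators act through powers of one 3-cycle. If \<open>\<gamma>c\<close> moves \<open>\<theta>\<close>, then \<open>\<gamma>a\<close> is a
  power of \<open>\<gamma>c\<close> on \<open>F\<close>, hence in both eigenspaces, hence trivial.\<close>

lemma cubic_subfield:
  assumes R: "finite R" "card R \<le> 3" "R \<subseteq> Qb" "cnj ` R \<subseteq> R" and R_stable: "\<forall>\<rho>\<in>Aut K. \<rho> ` R \<subseteq> R"
    and F: "F = generate_field Qbar (K \<union> R)" and \<theta>: "\<theta> \<in> T" "\<theta> \<in> F" "\<theta> \<notin> K"
  shows "F = C.N \<and> \<theta> \<in> C.N \<and> \<gamma>c \<theta> \<noteq> \<theta> \<and> R \<subseteq> \<real> \<or> F = A.N \<and> \<theta> \<in> A.N \<and> \<gamma>a \<theta> \<noteq> \<theta>"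
proof -
  have perm: "\<rho> e \<in> R" if "\<rho> \<in> Aut K" "e \<in> R" for \<rho> e using R_stable that by blast
  have KR: "K \<union> R \<subseteq> Qb" using R(3) alg_subfield_algebraic[OF K_alg] by auto
  have F_alg: "alg_subfield F" and F_sup: "K \<subseteq> F" "R \<subseteq> F"
    unfolding F using alg_subfield_generate[OF KR] generate_superset[OF KR] by auto
  have FQ: "algebraic x" if "x \<in> F" for x by (rule alg_subfield_algebraic[OF F_alg that])
  obtain \<tau> f where t: "\<tau> \<in> Aut K" "f \<noteq> \<tau> f" "f \<noteq> \<tau> (\<tau> f)" "\<tau> f \<noteq> \<tau> (\<tau> f)" "R = {f, \<tau> f, \<tau> (\<tau> f)}"
    and t3': "\<forall>x\<in>F. (\<tau> ^^ 3) x = x" and cyc: "\<forall>\<rho>\<in>Aut K. \<exists>k. \<forall>x\<in>F. \<rho> x = (\<tau> ^^ k) x"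
    and stab': "\<forall>\<rho>\<in>Aut K. \<rho> \<theta> = \<theta> \<longrightarrow> (\<forall>x\<in>F. \<rho> x = x)"
    by (rule cubic_action[OF odd_numeral R(1-3) R_stable F \<theta>])
  have t3: "(\<tau> ^^ 3) x = x" if "x \<in> F" for x using t3' that by blast
  have stab: "\<rho> x = x" if "\<rho> \<in> Aut K" "\<rho> \<theta> = \<theta>" "x \<in> F" for \<rho> x using stab' that by blast
  interpret Q: galois_action "Aut K" Qb K by (rule galois_action_Aut[OF K_alg])
  \<comment> \<open>An automorphism fixing \<open>\<theta>\<close> fixes all of \<open>F\<close>, so
    interpolation makes every element of \<open>F\<close> a polynomial in \<open>\<theta>\<close>
    over \<open>K\<close>.\<close>
  have FT: "F \<subseteq> T"
  proof
    fix x assume x: "x \<in> F"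
    obtain h where h: "h \<in> polys_over K" "\<And>g. g \<in> Aut K \<Longrightarrow> poly h (g \<theta>) = g x"
      using Q.interpolate[of \<theta> x] FQ[OF \<theta>(2)] FQ[OF x] stab[OF _ _ x] by (metis mem_Collect_eq)
    from h(2)[OF Aut_id] have "x = poly h \<theta>" by simp
    then show "x \<in> T" using polys_over_poly[OF T_alg _ \<theta>(1)] h(1) polys_over_mono[OF K_sub_T] by blast
  qed
  have tF: "\<tau> x \<in> F" if "x \<in> F" for x
    using Aut_stable_generate[OF R(3) t(1)] perm[OF t(1)] that unfolding F by blast
  have tnF: "(\<tau> ^^ n) x \<in> F" if "x \<in> F" for n x
    using that tF by (induction n) auto
  have cF: "cnj x \<in> F" if "x \<in> F" for x
    using cnj_stable_generate[OF R(3) K_cnj R(4)] that unfolding F by blast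
  have gen: "\<exists>i. \<forall>x\<in>F. \<forall>n. (\<gamma> ^^ n) x = (\<tau> ^^ (i * n)) x" and gen_stab: "\<gamma> \<theta> = \<theta> \<Longrightarrow> \<forall>x\<in>F. \<gamma> x = x"
    if g: "\<gamma> \<in> carrier G" for \<gamma>
  proof -
    obtain \<rho> where r: "\<rho> \<in> Aut K" "\<And>x. x \<in> T \<Longrightarrow> \<rho> x = \<gamma> x" using Gal_T_extend[OF g] by blast
    then obtain i where i: "\<forall>x\<in>F. \<rho> x = (\<tau> ^^ i) x" using cyc by blast
    have "(\<gamma> ^^ n) x = (\<tau> ^^ (i * n)) x" if x: "x \<in> F" for n x
    proof (induction n)
      case (Suc n)
      have "\<gamma> ((\<tau> ^^ (i * n)) x) = (\<tau> ^^ i) ((\<tau> ^^ (i * n)) x)" using r(2) i tnF[OF x] FT by (metis subsetD)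
      then show ?case using Suc by (simp add: funpow_add)
    qed simp
    then show "\<exists>i. \<forall>x\<in>F. \<forall>n. (\<gamma> ^^ n) x = (\<tau> ^^ (i * n)) x" by blast
    show "\<forall>x\<in>F. \<gamma> x = x" if "\<gamma> \<theta> = \<theta>" using stab[OF r(1)] r(2) \<theta>(1) that FT by (metis subsetD)
  qed
  obtain i where i: "\<forall>x\<in>F. \<forall>n. (\<gamma>c ^^ n) x = (\<tau> ^^ (i * n)) x" using gen[OF gens_G(1)] by blast
  obtain j where j: "\<forall>x\<in>F. \<forall>n. (\<gamma>a ^^ n) x = (\<tau> ^^ (j * n)) x" using gen[OF gens_G(2)] by blast
  have cube: "(\<gamma>c ^^ 3) x = x" "(\<gamma>a ^^ 3) x = x" if "x \<in> F" for x
    using i j that funpow_fixed[OF t3[OF that], of i] funpow_fixed[OF t3[OF that], of j] by (simp_all add: mult.commute)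
  show ?thesis
  proof (cases "\<gamma>c \<theta> = \<theta>")
    case True
    then have ga: "\<gamma>a \<theta> \<noteq> \<theta>" using C.fixed_in_K[OF \<theta>(1)] \<theta>(3) by blast
    have FN: "F \<subseteq> A.N" using gen_stab[OF gens_G(1) True] cube FT by (auto simp: A.N_def)
    then have "\<theta> \<in> A.N" using \<theta>(2) by blast
    then show ?thesis using A.N_sub[OF _ ga F_alg F_sup(1) \<theta>(2)] ga FN by blast
  next
    case gc: False
    have not3: "\<not> 3 dvd i"
    proof
      assume "3 dvd i"
      then obtain k where "i = 3 * k" by (elim dvdE)
      moreover have "(\<gamma>c ^^ 1) \<theta> = (\<tau> ^^ (i * 1)) \<theta>" using i \<theta>(2) by blast
      ultimately have "(\<gamma>c ^^ 1) \<theta> = \<theta>" using funpow_fixed[OF t3[OF \<theta>(2)], of k] by simp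
      then show False using gc by simp
    qed
    \<comment> \<open>On \<open>F\<close> the element \<open>\<gamma>c\<close> is
      \<open>\<tau> ^^ i\<close>, and \<open>i * i\<close> is 1 modulo 3; so \<open>\<tau>\<close>
      inherits from \<open>\<gamma>c\<close> that it commutes with conjugation.\<close>
    have tau: "\<tau> x = (\<gamma>c ^^ i) x" if x: "x \<in> F" for x
    proof -
      have "i mod 3 = 1 \<or> i mod 3 = 2" using not3 by presburger
      then have "(i * i) mod 3 = 1" by (auto simp: mod_mult_eq[of i 3 i, symmetric])
      then obtain k where k: "i * i = 1 + 3 * k" by (metis mod_mult_div_eq)
      have "(\<gamma>c ^^ i) x = (\<tau> ^^ (1 + 3 * k)) x" using i x k by metis
      also have "\<dots> = \<tau> x" unfolding funpow_add comp_apply funpow_fixed[OF t3[OF x]] by simp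
      finally show ?thesis by simp
    qed
    have c_cnj: "cnj (\<gamma>c x) = \<gamma>c (cnj x)" if "x \<in> T" for x
    proof -
      have "cnj (\<gamma>c (cnj (cnj x))) = \<gamma>c (cnj x)"
        using gens_conj(1) conj_act_apply[of "cnj x" T \<gamma>c] T_cnj' that by (metis imageI)
      then show ?thesis by simp
    qed
    have cn_cnj: "cnj ((\<gamma>c ^^ n) x) = (\<gamma>c ^^ n) (cnj x)" if "x \<in> T" for n x
      by (induction n) (simp_all add: c_cnj G_funpow_closed[OF gens_G(1) that])
    have t_cnj: "cnj (\<tau> x) = \<tau> (cnj x)" if "x \<in> F" for x
      using tau[OF that] tau[OF cF[OF that]] cn_cnj that FT by (metis subsetD)
    have tn_cnj: "cnj ((\<tau> ^^ n) x) = (\<tau> ^^ n) (cnj x)" if "x \<in> F" for n x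
      by (induction n) (simp_all add: t_cnj tnF[OF that])
    have "\<gamma>a \<theta> = \<theta>"
    proof (rule \<gamma>a_fixes[OF \<theta>(1)])
      have j1: "\<gamma>a x = (\<tau> ^^ j) x" if "x \<in> F" for x
        using j[rule_format, OF that, of 1] by simp
      show "cnj (\<gamma>a (cnj \<theta>)) = \<gamma>a \<theta>"
        using tn_cnj[OF cF[OF \<theta>(2)], of j] j1[OF \<theta>(2)] j1[OF cF[OF \<theta>(2)]] by simp
    qed
    then have FN: "F \<subseteq> C.N" using gen_stab[OF gens_G(2)] cube FT by (auto simp: C.N_def)
    then have \<theta>N: "\<theta> \<in> C.N" using \<theta>(2) by blast
    \<comment> \<open>Conjugation commutes with the 3-cycle on the roots, so it acts on them as a
      power of it. Being an involution, it is trivial there, and the roots are real.\<close>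
    have f: "f \<in> F" using t(5) F_sup(2) by auto
    have "cnj f \<in> R" using R(4) t(5) by auto
    then have "\<exists>k. cnj f = (\<tau> ^^ k) f"
    proof -
      assume "cnj f \<in> R"
      then consider "cnj f = (\<tau> ^^ 0) f" | "cnj f = (\<tau> ^^ 1) f" | "cnj f = (\<tau> ^^ 2) f"
        unfolding t(5) by (auto simp: numeral_2_eq_2)
      then show ?thesis by blast
    qed
    then obtain k where k: "cnj f = (\<tau> ^^ k) f" by blast
    have "f = cnj (cnj f)" by simp
    also have "\<dots> = (\<tau> ^^ k) ((\<tau> ^^ k) f)" using tn_cnj[OF f, of k] k by simp
    also have "\<dots> = (\<tau> ^^ (k + k)) f" by (simp add: funpow_add)
    finally have "3 dvd k + k" using funpow_3_fixed_iff[OF t3[OF f]] t(2) by metis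
    then have "3 dvd k" by presburger
    then have cf: "cnj f = f" using funpow_3_fixed_iff[OF t3[OF f]] t(2) k by metis
    have "R \<subseteq> \<real>"
      using t_cnj[OF f] t_cnj[OF tF[OF f]] cf unfolding t(5) by (simp add: Reals_cnj_iff)
    then show ?thesis using C.N_sub[OF \<theta>N gc F_alg F_sup(1) \<theta>(2)] gc FN \<theta>N by blast
  qed
qed

end

section \<open>Fields of given slope\<close>

lemma Zp_unit_nonzero:
  assumes "\<alpha> \<in> Units (Zp 3)" shows "\<alpha> 1 \<noteq> 0"
proof
  assume "\<alpha> 1 = 0"
  obtain \<alpha>' where "\<alpha>' \<in> carrier (Zp 3)" and \<alpha>': "\<And>n. (\<alpha>' n * \<alpha> n) mod int 3 ^ n = 1 mod int 3 ^ n"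
    using Zp_unit_inverse[OF assms] by blast
  from \<alpha>'[of 1] \<open>\<alpha> 1 = 0\<close> show False by simp
qed

lemma Zp_first_digit:
  assumes "\<alpha> \<in> carrier (Zp 3)" shows "\<alpha> 1 \<in> {0, 1, 2}"
proof -
  have "\<alpha> 1 \<in> {0..<int 3 ^ 1}" using assms unfolding Zp_carrier by blast
  then show ?thesis by auto
qed

locale slope_data = eigen +
  fixes \<alpha> \<beta> \<phi>
  assumes slope: "slope 3 \<alpha> \<beta>" and slope_hom: "slope_hom 3 K \<gamma>c \<gamma>a \<alpha> \<beta> \<phi>"
begin

definition L :: "complex set" where "L = slope_field 3 K \<phi>"

lemma phi: "\<phi> \<in> hom G (add_monoid (Zp 3))" "continuous_map (krull_topology T K) (Zp_topology 3) \<phi>"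
    "\<phi> \<gamma>c = \<alpha>" "\<phi> \<gamma>a = \<beta>"
  using slope_hom unfolding slope_hom_def T_eq by auto

lemma slope_carrier: "\<alpha> \<in> carrier (Zp 3)" "\<beta> \<in> carrier (Zp 3)"
  and slope_unit: "\<alpha> \<in> Units (Zp 3) \<or> \<beta> \<in> Units (Zp 3)"
  using slope by (auto simp: slope_def)

lemma L_iff: "x \<in> L \<longleftrightarrow> x \<in> T \<and> (\<forall>\<kappa>\<in>carrier G. \<phi> \<kappa> = (\<lambda>_. 0) \<longrightarrow> \<kappa> x = x)"
proof -
  have "\<one>\<^bsub>add_monoid (Zp 3)\<^esub> = (\<lambda>_. 0)" by (simp add: Zp_def)
  then show ?thesis unfolding L_def slope_field_def T_eq fixed_field_def kernel_def by auto
qed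

lemma L_sub: "L \<subseteq> T" "K \<subseteq> L"
  using L_iff K_sub_T alg_homo.fix_K[OF T.Gal_alg_homo] by blast+

text \<open>Continuity provides a finite set that controls the first digit of \<open>\<phi>\<close>;
  enlarging \<open>S\<close> by it makes one word compute both \<open>\<sigma>\<close> on
  \<open>S\<close> and \<open>\<phi> \<sigma>\<close> modulo 3.\<close>

lemma word_phi:
  assumes s: "\<sigma> \<in> carrier G" and S: "finite S" "S \<subseteq> T"
  obtains u v where "\<And>x. x \<in> S \<Longrightarrow> \<sigma> x = (\<gamma>c ^^ u) ((\<gamma>a ^^ v) x)"
    "\<phi> \<sigma> 1 = (int u * \<alpha> 1 + int v * \<beta> 1) mod 3"
proof -
  interpret group G by (rule T.group_Gal)
  obtain S' where S': "finite S'" "S' \<subseteq> T" "\<forall>h\<in>carrier G. (\<forall>x\<in>S'. h x = \<sigma> x) \<longrightarrow> \<phi> h 1 = \<phi> \<sigma> 1"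
    using phi(2) s unfolding T.continuous_krull_Zp by blast
  obtain u v where uv: "\<forall>x\<in>S \<union> S'. \<sigma> x = (\<gamma>c ^^ u) ((\<gamma>a ^^ v) x)"
    using word_span[OF s, of "S \<union> S'"] S S' by blast
  let ?h = "\<gamma>c [^]\<^bsub>G\<^esub> u \<otimes>\<^bsub>G\<^esub> \<gamma>a [^]\<^bsub>G\<^esub> v"
  have cl: "\<gamma>c [^]\<^bsub>G\<^esub> u \<in> carrier G" "\<gamma>a [^]\<^bsub>G\<^esub> v \<in> carrier G" using gens_G by auto
  have "?h x = \<sigma> x" if "x \<in> S'" for x
  proof -
    have x: "x \<in> T" using that S' by blast
    have "?h x = (\<gamma>c ^^ u) ((\<gamma>a ^^ v) x)"
      using T.Gal_mult_apply[OF cl x] T.Gal_pow_apply[OF gens_G(2) x]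
        T.Gal_pow_apply[OF gens_G(1) G_funpow_closed[OF gens_G(2) x]] by simp
    then show ?thesis using uv that by simp
  qed
  then have "\<phi> \<sigma> 1 = \<phi> ?h 1" using S'(3) cl by (metis m_closed)
  also have "\<dots> = (\<phi> (\<gamma>c [^]\<^bsub>G\<^esub> u) 1 + \<phi> (\<gamma>a [^]\<^bsub>G\<^esub> v) 1) mod 3"
    unfolding hom_mult[OF phi(1) cl] Zp_add by simp
  also have "\<phi> (\<gamma>c [^]\<^bsub>G\<^esub> u) 1 = (int u * \<alpha> 1) mod 3"
    using hom_Zp_pow[OF is_group phi(1) gens_G(1), of u 1] phi(3) by simp
  also have "\<phi> (\<gamma>a [^]\<^bsub>G\<^esub> v) 1 = (int v * \<beta> 1) mod 3"
    using hom_Zp_pow[OF is_group phi(1) gens_G(2), of v 1] phi(4) by simp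
  finally have "\<phi> \<sigma> 1 = (int u * \<alpha> 1 + int v * \<beta> 1) mod 3" by (simp add: mod_add_eq)
  then show thesis using that[of u v] uv by blast
qed

text \<open>The exact exponent is solved for on whichever of the two generators has a unit slope
  entry.\<close>

lemma kernel_word:
  assumes \<theta>: "\<theta> \<in> L" "(\<gamma>c ^^ 3) \<theta> = \<theta>" "(\<gamma>a ^^ 3) \<theta> = \<theta>" and uv: "(int u * \<alpha> 1 + int v * \<beta> 1) mod 3 = 0"
  shows "(\<gamma>c ^^ u) ((\<gamma>a ^^ v) \<theta>) = \<theta>"
proof -
  have T: "\<theta> \<in> T" and ker: "\<forall>\<kappa>\<in>carrier G. \<phi> \<kappa> = (\<lambda>_. 0) \<longrightarrow> \<kappa> \<theta> = \<theta>" using \<theta>(1) L_iff by auto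
  from slope_unit show ?thesis
  proof
    assume "\<alpha> \<in> Units (Zp 3)"
    then show ?thesis
      using kernel_word_fixes[OF gens_G phi(1,2) _ T \<theta>(2) ker, of u v] uv unfolding phi by simp
  next
    assume "\<beta> \<in> Units (Zp 3)"
    then have "(\<gamma>a ^^ v) ((\<gamma>c ^^ u) \<theta>) = \<theta>"
      using kernel_word_fixes[OF gens_G(2,1) phi(1,2) _ T \<theta>(3) ker, of v u] uv unfolding phi by (simp add: add.commute)
    then show ?thesis using words_commute[OF T] by simp
  qed
qed

text \<open>If one slope entry vanishes modulo 3, the other is a unit. An element of the kernel then
  acts as a word whose exponent at the generator moving the layer is divisible by 3.\<close>

lemma N_sub_L: "\<beta> 1 = 0 \<Longrightarrow> C.N \<subseteq> L" "\<alpha> 1 = 0 \<Longrightarrow> A.N \<subseteq> L"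
proof -
  have three: "3 dvd u" if "a \<in> Units (Zp 3)" "a \<in> carrier (Zp 3)" "0 = (int u * a 1) mod 3" for u a
    using Zp_unit_nonzero[OF that(1)] Zp_first_digit[OF that(2)] that(3) by auto presburger+
  {
    assume b: "\<beta> 1 = 0"
    then have unit: "\<alpha> \<in> Units (Zp 3)" using slope_unit Zp_unit_nonzero by blast
    show "C.N \<subseteq> L"
    proof
      fix x assume x: "x \<in> C.N"
      have "\<kappa> x = x" if k: "\<kappa> \<in> carrier G" "\<phi> \<kappa> = (\<lambda>_. 0)" for \<kappa>
      proof -
        obtain u v where uv: "\<kappa> x = (\<gamma>c ^^ u) ((\<gamma>a ^^ v) x)" "\<phi> \<kappa> 1 = (int u * \<alpha> 1 + int v * \<beta> 1) mod 3"
          using word_phi[OF k(1), of "{x}"] x by (auto simp: C.N_def)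
        then have "3 dvd u" using three[OF unit slope_carrier(1)] b k(2) by simp
        then obtain w where "u = 3 * w" by (elim dvdE)
        then show ?thesis using uv(1) x funpow_fixed[of 3 \<gamma>c x w] C.funpow_fix[of \<gamma>a x v] by (simp add: C.N_def)
      qed
      then show "x \<in> L" using L_iff x by (simp add: C.N_def)
    qed
  }
  {
    assume a: "\<alpha> 1 = 0"
    then have unit: "\<beta> \<in> Units (Zp 3)" using slope_unit Zp_unit_nonzero by blast
    show "A.N \<subseteq> L"
    proof
      fix x assume x: "x \<in> A.N"
      have "\<kappa> x = x" if k: "\<kappa> \<in> carrier G" "\<phi> \<kappa> = (\<lambda>_. 0)" for \<kappa>
      proof -
        obtain u v where uv: "\<kappa> x = (\<gamma>c ^^ u) ((\<gamma>a ^^ v) x)" "\<phi> \<kappa> 1 = (int u * \<alpha> 1 + int v * \<beta> 1) mod 3"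
          using word_phi[OF k(1), of "{x}"] x by (auto simp: A.N_def)
        then have "3 dvd v" using three[OF unit slope_carrier(2)] a k(2) by simp
        then obtain w where "v = 3 * w" by (elim dvdE)
        then show ?thesis using uv(1) x funpow_fixed[of 3 \<gamma>a x w] C.funpow_fix[of \<gamma>c x u] by (simp add: A.N_def)
      qed
      then show "x \<in> L" using L_iff x by (simp add: A.N_def)
    qed
  }
qed

text \<open>If \<beta> were nonzero modulo 3, some word \<open>\<gamma>c\<close> after
  \<open>\<gamma>a ^^ w\<close> would have slope value 0 modulo 3 and fix \<theta>. Since
  \<open>\<gamma>a\<close> fixes \<theta>, so would \<open>\<gamma>c\<close>, and \<theta> would lie
  in \<open>K\<close>. The other claim is symmetric.\<close>

lemma slope_zero:
  assumes \<theta>: "\<theta> \<in> L" "\<theta> \<notin> K"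
  shows "\<theta> \<in> C.N \<Longrightarrow> \<beta> 1 = 0" "\<theta> \<in> A.N \<Longrightarrow> \<alpha> 1 = 0"
proof -
  have T: "\<theta> \<in> T" using \<theta>(1) L_sub by blast
  \<comment> \<open>A nonzero residue modulo 3 is its own inverse, hence the choice of
    \<open>- a * b\<close>.\<close>
  have sol: "\<exists>w. (a + int w * b) mod 3 = 0" if "b \<noteq> 0" "b \<in> {0, 1, 2}" for a b :: int
  proof (intro exI)
    have "int (nat ((- a * b) mod 3)) = (- a * b) mod 3" by simp
    moreover have "(a + (- a * b) mod 3 * b) mod 3 = 0" using that by auto presburger+
    ultimately show "(a + int (nat ((- a * b) mod 3)) * b) mod 3 = 0" by simp
  qed
  show "\<beta> 1 = 0" if N: "\<theta> \<in> C.N"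
  proof (rule ccontr)
    assume "\<beta> 1 \<noteq> 0"
    then obtain w where w: "(\<alpha> 1 + int w * \<beta> 1) mod 3 = 0"
      using sol[OF _ Zp_first_digit[OF slope_carrier(2)], of "\<alpha> 1"] by metis
    have ga: "(\<gamma>a ^^ n) \<theta> = \<theta>" for n using N C.funpow_fix[of \<gamma>a \<theta> n] by (simp add: C.N_def)
    have "(\<gamma>c ^^ 1) ((\<gamma>a ^^ w) \<theta>) = \<theta>"
      using N w by (intro kernel_word[OF \<theta>(1)] ga) (auto simp: C.N_def)
    then have "\<gamma>c \<theta> = \<theta>" using ga by simp
    then show False using C.fixed_in_K[OF T] N \<theta>(2) by (simp add: C.N_def)
  qed
  show "\<alpha> 1 = 0" if N: "\<theta> \<in> A.N"
  proof (rule ccontr)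
    assume "\<alpha> 1 \<noteq> 0"
    then obtain w where w: "(\<beta> 1 + int w * \<alpha> 1) mod 3 = 0"
      using sol[OF _ Zp_first_digit[OF slope_carrier(1)], of "\<beta> 1"] by metis
    have gc: "(\<gamma>c ^^ n) \<theta> = \<theta>" for n using N C.funpow_fix[of \<gamma>c \<theta> n] by (simp add: A.N_def)
    have "(\<gamma>c ^^ w) ((\<gamma>a ^^ 1) \<theta>) = \<theta>"
      using N w by (intro kernel_word[OF \<theta>(1)] gc) (auto simp: A.N_def add.commute)
    then have "\<gamma>a \<theta> = \<theta>" using words_commute[OF T, of w 1] gc by simp
    then show False using A.fixed_in_K[OF T] N \<theta>(2) by (simp add: A.N_def)
  qed
qed

text \<open>The automorphisms with \<open>\<phi>\<close> vanishing modulo 3 form a subgroup that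
  contains \<open>\<gamma>c\<close> and the cube of \<open>\<gamma>a\<close> but not
  \<open>\<gamma>a\<close>. By continuity and a primitive element it contains the stabiliser of a
  single \<open>z\<close>, which is what \<open>fixed_by_subgroup_moved\<close> asks for.\<close>

lemma A_N_moved:
  assumes a: "\<alpha> 1 = 0" obtains \<theta> where "\<theta> \<in> A.N" "\<gamma>a \<theta> \<noteq> \<theta>"
proof -
  interpret group G by (rule T.group_Gal)
  have b: "\<beta> 1 \<noteq> 0" using a slope_unit Zp_unit_nonzero by blast
  define H where "H = {g \<in> carrier G. \<phi> g 1 = 0}"
  have one: "\<phi> \<one>\<^bsub>G\<^esub> 1 = 0" by (rule hom_Zp_one[OF is_group phi(1)])
  have mult: "\<phi> (g \<otimes>\<^bsub>G\<^esub> h) 1 = (\<phi> g 1 + \<phi> h 1) mod 3" if "g \<in> carrier G" "h \<in> carrier G" for g h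
    unfolding hom_mult[OF phi(1) that] Zp_add by simp
  have digit: "\<phi> g 1 \<in> {0, 1, 2}" if "g \<in> carrier G" for g
    using Zp_first_digit hom_in_carrier[OF phi(1) that] by simp
  have H: "subgroup H G"
  proof (rule subgroupI)
    fix g assume g: "g \<in> H"
    then have "0 = (\<phi> (inv\<^bsub>G\<^esub> g) 1 + \<phi> g 1) mod 3"
      using mult[of "inv\<^bsub>G\<^esub> g" g] one by (simp add: H_def)
    then show "inv\<^bsub>G\<^esub> g \<in> H" using digit[of "inv\<^bsub>G\<^esub> g"] g by (auto simp: H_def)
  qed (use one mult in \<open>auto simp: H_def\<close>)
  obtain S where S: "finite S" "S \<subseteq> T" "\<forall>h\<in>carrier G. (\<forall>x\<in>S. h x = \<one>\<^bsub>G\<^esub> x) \<longrightarrow> \<phi> h 1 = \<phi> \<one>\<^bsub>G\<^esub> 1"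
    using phi(2) one_closed unfolding T.continuous_krull_Zp by blast
  obtain z where z: "z \<in> T" "\<forall>g\<in>carrier G. g z = z \<longrightarrow> (\<forall>x\<in>S. g x = x)"
    using primitive_element[OF S(1,2)] by blast
  have stab: "g \<in> H" if g: "g \<in> carrier G" "g z = z" for g
  proof -
    have "g x = \<one>\<^bsub>G\<^esub> x" if "x \<in> S" for x
      using z(2)[rule_format, OF g that] T.Gal_one_apply[of x] S(2) that by auto
    then have "\<phi> g 1 = \<phi> \<one>\<^bsub>G\<^esub> 1" using S(3) g(1) by blast
    then show ?thesis using g(1) one by (simp add: H_def)
  qed
  have "\<gamma>a \<notin> H" using b phi(4) by (simp add: H_def)
  then obtain \<theta> where \<theta>: "\<theta> \<in> T" "\<And>h. h \<in> H \<Longrightarrow> h \<theta> = \<theta>" "\<gamma>a \<theta> \<noteq> \<theta>"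
    using fixed_by_subgroup_moved[OF z(1) H stab gens_G(2)] by blast
  have "\<gamma>c \<in> H" using a phi(3) gens_G by (simp add: H_def)
  moreover have "\<gamma>a [^]\<^bsub>G\<^esub> (3::nat) \<in> H"
    using hom_Zp_pow[OF is_group phi(1) gens_G(2), of 3 1] gens_G by (simp add: H_def)
  ultimately have "\<theta> \<in> A.N"
    using \<theta>(1,2) T.Gal_pow_apply[OF gens_G(2) \<theta>(1)] by (metis (mono_tags, lifting) A.N_def mem_Collect_eq)
  with \<theta>(3) show thesis by (rule that[rotated])
qed

lemma cyc_layer: "layer K (Kcyc 3 K \<gamma>a) 3 = C.N"
  unfolding Kcyc_eq using C.layer_eq_N[OF xi_in_N xi_moved] .

lemma anti_layer: "\<alpha> 1 = 0 \<Longrightarrow> layer K (Kanti 3 K \<gamma>c) 3 = A.N"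
  unfolding Kanti_eq using A.layer_eq_N A_N_moved by metis

text \<open>The conclusions supply case (i), case (ii) and, by contraposition, the generic case;
  divisibility by 3 appears as a vanishing first digit, as in
  \<open>Zp_3_divides_iff\<close>.\<close>

lemma intersection_two_division_field:
  fixes E :: weierstrass
  assumes ell: "elliptic_curve E"
  defines "F \<equiv> two_division_field E K"
  shows "two_division_field E \<rat> = cyclotomic_field_real 9 \<Longrightarrow> \<beta> 1 = 0 \<Longrightarrow> L \<inter> F = C.N"
    and "F = layer K (Kanti 3 K \<gamma>c) 3 \<Longrightarrow> \<alpha> 1 = 0 \<Longrightarrow> L \<inter> F = F"
    and "L \<inter> F \<noteq> K \<Longrightarrow> two_division_field E \<rat> = cyclotomic_field_real 9 \<and> \<beta> 1 = 0 \<or>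
           F = layer K (Kanti 3 K \<gamma>c) 3 \<and> \<alpha> 1 = 0"
proof -
  obtain e1 e2 e3 where "elliptic e1 e2 e3 E" using elliptic_exists[OF ell] .
  then interpret ell: elliptic e1 e2 e3 E .
  define R where "R = {e1, e2, e3}"
  have RQ: "R \<subseteq> Qb" using ell.roots_algebraic by (auto simp: R_def)
  have F: "F = generate_field Qbar (K \<union> R)" and FQ: "two_division_field E \<rat> = generate_field Qbar (\<rat> \<union> R)"
    unfolding F_def R_def using ell.two_division_field[OF K_alg] ell.two_division_field[OF alg_subfield_Rats] .
  have KR: "K \<union> R \<subseteq> Qb" using RQ alg_subfield_algebraic[OF K_alg] by auto
  \<comment> \<open>Equality of two fields generated over \<rat> passes to the fields generated over
    \<open>K\<close>; symmetry of the hypothesis gives both inclusions.\<close>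
  have gen_mono: "generate_field Qbar (K \<union> H) \<subseteq> generate_field Qbar (K \<union> H')"
    if H: "H \<subseteq> Qb" "H' \<subseteq> Qb" "generate_field Qbar (\<rat> \<union> H) = generate_field Qbar (\<rat> \<union> H')" for H H'
  proof -
    have Q: "K \<union> H \<subseteq> Qb" "K \<union> H' \<subseteq> Qb" "\<rat> \<union> H \<subseteq> Qb" "\<rat> \<union> H' \<subseteq> Qb"
      using H rat_imp_algebraic alg_subfield_algebraic[OF K_alg] by auto
    note a = alg_subfield_generate[OF Q(2)]
    have "H \<subseteq> generate_field Qbar (\<rat> \<union> H')" using generate_superset[OF Q(3)] H(3) by blast
    also have "\<dots> \<subseteq> generate_field Qbar (K \<union> H')"
      using generate_superset[OF Q(2)] alg_subfield_rat[OF a] by (intro generate_least[OF Q(4) a]) auto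
    finally show ?thesis using generate_superset[OF Q(2)] by (intro generate_least[OF Q(1) a]) auto
  qed
  show "L \<inter> F = C.N" if "two_division_field E \<rat> = cyclotomic_field_real 9" "\<beta> 1 = 0"
  proof -
    have "generate_field Qbar (\<rat> \<union> R) = generate_field Qbar (\<rat> \<union> {xi 1 1})"
      using that(1) FQ cyclotomic_field_real_9 by simp
    then have "F = C.N" unfolding F N_cyc_eq using RQ algebraic_xi by (intro subset_antisym gen_mono) auto
    then show ?thesis using N_sub_L(1)[OF that(2)] by blast
  qed
  show "L \<inter> F = F" if "F = layer K (Kanti 3 K \<gamma>c) 3" "\<alpha> 1 = 0"
    using N_sub_L(2)[OF that(2)] anti_layer[OF that(2)] that(1) by blast
  assume "L \<inter> F \<noteq> K"
  moreover have "K \<subseteq> L \<inter> F" using L_sub generate_superset[OF KR] unfolding F by blast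
  ultimately obtain \<theta> where \<theta>: "\<theta> \<in> L" "\<theta> \<in> F" "\<theta> \<notin> K" by blast
  have roots: "x \<in> R \<longleftrightarrow> poly [:ell.cc, ell.cb, ell.ca, 1:] x = 0" for x
  proof -
    have "poly [:ell.cc, ell.cb, ell.ca, 1:] x = (x - e1) * (x - e2) * (x - e3)"
      unfolding ell.factor[symmetric] by (simp add: algebra_simps power2_eq_square power3_eq_cube)
    then show ?thesis by (simp add: R_def)
  qed
  have coeffs: "ell.ca \<in> \<rat>" "ell.cb \<in> \<rat>" "ell.cc \<in> \<rat>" unfolding ell.coeffs[symmetric] by auto
  have perm: "\<rho> e \<in> R" if r: "\<rho> \<in> Aut K" and e: "e \<in> R" for \<rho> e
  proof -
    interpret r: alg_homo K Qb \<rho> by (rule alg_homo_Aut[OF K_alg r])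
    have "[:ell.cc, ell.cb, ell.ca, 1:] \<in> polys_over K"
      using coeffs alg_subfield_rat[OF K_alg] alg_subfield_numerals[OF K_alg] by (auto simp: polys_over_pCons polys_over_0)
    then have "\<rho> (poly [:ell.cc, ell.cb, ell.ca, 1:] e) = poly [:ell.cc, ell.cb, ell.ca, 1:] (\<rho> e)"
      using r.poly[of _ e] e RQ by blast
    then have "poly [:ell.cc, ell.cb, ell.ca, 1:] (\<rho> e) = \<rho> (poly [:ell.cc, ell.cb, ell.ca, 1:] e)" by (rule sym)
    also have "\<dots> = 0" using e r.numerals unfolding roots by simp
    finally show ?thesis unfolding roots .
  qed
  have R_cnj: "cnj ` R \<subseteq> R"
  proof
    fix y assume "y \<in> cnj ` R"
    then obtain e where e: "e \<in> R" "y = cnj e" by blast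
    have "poly [:ell.cc, ell.cb, ell.ca, 1:] (cnj e) = cnj (poly [:ell.cc, ell.cb, ell.ca, 1:] e)"
      using coeffs by (simp add: cnj_Rats)
    also have "\<dots> = 0" using e(1) unfolding roots by simp
    finally show "y \<in> R" unfolding e(2) roots .
  qed
  have stable: "\<forall>\<rho>\<in>Aut K. \<rho> ` R \<subseteq> R" using perm by blast
  have R3: "finite R" "card R \<le> 3" by (auto simp: R_def card_insert_if)
  consider (cyc) "F = C.N" "\<theta> \<in> C.N" "R \<subseteq> \<real>" | (anti) "F = A.N" "\<theta> \<in> A.N"
    using cubic_subfield[OF R3 RQ R_cnj stable F _ \<theta>(2,3)] \<theta>(1) L_sub(1) by blast
  then show "two_division_field E \<rat> = cyclotomic_field_real 9 \<and> \<beta> 1 = 0 \<or>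
      F = layer K (Kanti 3 K \<gamma>c) 3 \<and> \<alpha> 1 = 0"
  proof cases
    case cyc
    have "generate_field Qbar (\<rat> \<union> R) = generate_field Qbar (\<rat> \<union> {xi 1 1})"
      using generate_real_part[OF RQ cyc(3)] generate_real_part[of "{xi 1 1}"] algebraic_xi xi_real cyc(1) F N_cyc_eq by simp
    then show ?thesis using FQ cyclotomic_field_real_9 slope_zero(1)[OF \<theta>(1,3) cyc(2)] by simp
  next
    case anti
    then show ?thesis using slope_zero(2)[OF \<theta>(1,3)] anti_layer by simp
  qed
qed

end

theorem theorem3p3:
  fixes E :: weierstrass and K :: "complex set"
  assumes "elliptic_curve E" and "imaginary_quadratic K"
  shows "(\<forall>\<gamma>c \<gamma>a \<alpha> \<beta> \<phi> L.
            eigen_generators 3 K \<gamma>c \<gamma>a \<and> slope 3 \<alpha> \<beta> \<and> slope_hom 3 K \<gamma>c \<gamma>a \<alpha> \<beta> \<phi> \<and>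
            L = slope_field 3 K \<phi> \<longrightarrow>
            (let I = L \<inter> two_division_field E K;
                 Kcyc1 = layer K (Kcyc 3 K \<gamma>a) 3;
                 Kanti1 = layer K (Kanti 3 K \<gamma>c) 3;
                 case_i = (two_division_field E \<rat> = cyclotomic_field_real 9 \<and>
                           (\<exists>b \<in> carrier (Zp 3). \<beta> = [(3::nat)] \<cdot>\<^bsub>Zp 3\<^esub> b));
                 case_ii = (two_division_field E K = Kanti1 \<and>
                           (\<exists>a \<in> carrier (Zp 3). \<alpha> = [(3::nat)] \<cdot>\<^bsub>Zp 3\<^esub> a))
             in two_primary_torsion E L = two_primary_torsion E I \<and>
                (\<not> case_i \<and> \<not> case_ii \<longrightarrow> I = K) \<and>
                (case_i \<longrightarrow> I = Kcyc1) \<and>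
                (case_ii \<longrightarrow> I = Kanti1)))
         \<and> two_primary_torsion E (Ktilde 3 K) =
             two_primary_torsion E (Ktilde 3 K \<inter> two_division_field E K)"
proof -
  interpret imquad K using assms(2) by unfold_locales
  have odd3: "odd (3::nat)" by simp
  show ?thesis
  proof (intro conjI allI impI; (elim conjE)?)
    show "two_primary_torsion E (Ktilde 3 K) = two_primary_torsion E (Ktilde 3 K \<inter> two_division_field E K)"
      using two_primary_torsion_T[OF assms(1) odd3, of T] unfolding T_def by simp
    fix \<gamma>c \<gamma>a \<alpha> \<beta> \<phi> L
    assume "eigen_generators 3 K \<gamma>c \<gamma>a" "slope 3 \<alpha> \<beta>" "slope_hom 3 K \<gamma>c \<gamma>a \<alpha> \<beta> \<phi>" and L: "L = slope_field 3 K \<phi>"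
    then interpret s: slope_data K \<gamma>c \<gamma>a \<alpha> \<beta> \<phi> by unfold_locales
    have Ls: "L = s.L" unfolding L s.L_def ..
    note I = s.intersection_two_division_field[OF assms(1)]
    show "let I = L \<inter> two_division_field E K;
                 Kcyc1 = layer K (Kcyc 3 K \<gamma>a) 3;
                 Kanti1 = layer K (Kanti 3 K \<gamma>c) 3;
                 case_i = (two_division_field E \<rat> = cyclotomic_field_real 9 \<and>
                           (\<exists>b \<in> carrier (Zp 3). \<beta> = [(3::nat)] \<cdot>\<^bsub>Zp 3\<^esub> b));
                 case_ii = (two_division_field E K = Kanti1 \<and>
                           (\<exists>a \<in> carrier (Zp 3). \<alpha> = [(3::nat)] \<cdot>\<^bsub>Zp 3\<^esub> a))
             in two_primary_torsion E L = two_primary_torsion E I \<and>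
                (\<not> case_i \<and> \<not> case_ii \<longrightarrow> I = K) \<and>
                (case_i \<longrightarrow> I = Kcyc1) \<and>
                (case_ii \<longrightarrow> I = Kanti1)"
      unfolding Let_def Ls s.cyc_layer Zp_3_divides_iff[OF s.slope_carrier(1)] Zp_3_divides_iff[OF s.slope_carrier(2)]
      apply (intro conjI impI)
      subgoal by (rule two_primary_torsion_T[OF assms(1) odd3 s.L_sub(1)])
      subgoal using I(3) by argo
      subgoal using I(1) by argo
      subgoal using I(2) by argo
      done
  qed
qed

end
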